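(* Let $R$ be a commutative ring with category of modules $\mathscr V$, and let $\mathscr F$ be a category with a proper factorization system $(\mathscr E,\mathscr M)$ and groupoid $\mathscr G=\mathscr E\cap\mathscr M$, such that the Idempotent Axiom holds and each object $A$ of $\mathscr F$ has only finitely many $\mathscr M$-subobjects (each slice category $\mathscr M/A$ has only finitely many isomorphism classes of objects). Then the functor $\widehat M:[\mathscr G,\mathscr V]\to[\mathscr F,\mathscr V]$ is an equivalence with inverse equivalence $\widehat E:[\mathscr F,\mathscr V]\to[\mathscr G,\mathscr V]$.
   Context: $RX$ is the free $R$-module on a set $X$; for a category $\mathscr C$, $R\mathscr C$ is the $R$-linear category with the same objects and homs $R(\mathscr C(A,B))$; $[\mathscr C,\mathscr V]$ is the category of functors $\mathscr C\to\mathscr V$ (equivalently $R$-linear functors $R\mathscr C\to\mathscr V$), with pointwise $R$-linear structure. Factorization system: $\mathscr E,\mathscr M$ are sets of morphisms of $\mathscr F$ with: (FS0) $mw\in\mathscr M$ if $m\in\mathscr M$ and $w$ is invertible, $we\in\mathscr E$ if $e\in\mathscr E$ and $w$ is invertible; (FS1) if $mh=ke$ with $e\in\mathscr E$, $m\in\mathscr M$, there is a unique $\ell$ with $\ell e=h$, $m\ell=k$; (FS2) every $f$ factors as $f=me$ with $m\in\mathscr M$, $e\in\mathscr E$. It is proper when every member of $\mathscr E$ is an epimorphism and every member of $\mathscr M$ is a monomorphism. Then $\mathscr G=\mathscr E\cap\mathscr M$ is the set of invertible morphisms, regarded as a groupoid with all objects of $\mathscr F$. $\mathscr M',\mathscr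 E'$ denote the sets of morphisms of $\mathscr F$ not in $\mathscr M,\mathscr E$ respectively; $\mathscr M(A,B)$ etc. denotes the set of morphisms $A\to B$ in $\mathscr M$ etc. Idempotent Axiom: for each object $A\in\mathscr F$ there is a morphism $p_A:A\to A$ in $R\mathscr F$ such that (p0) $p_Ap_A=p_A$; (p1) if $f\in\mathscr F(A,B)$ and $f\in\mathscr M'$ then $fp_A=0$; (p2) if $f\in\mathscr F(A,B)$ and $f\in\mathscr E'$ then $p_Bf=0$; (p3) if $g\in\mathscr G(A,B)$ then $gp_A=p_Bg$; (p4) $1_A-p_A\in R(\mathscr E'(A,A)\cap\mathscr M'(A,A))$. $M(A,B)=R\mathscr M(A,B)$ for $A\in\mathscr G$, $B\in\mathscr F$, contravariant in $A$ and covariant in $B$ with $M(g,f)(m)=fmg$ if $fmg\in\mathscr M$ and $0$ otherwise. $E(B,A)=R\mathscr E(B,A)$ for $B\in\mathscr F$, $A\in\mathscr G$, contravariant in $B$ and covariant in $A$ with $E(f,g)(e)=gef$ if $gef\in\mathscr E$ and $0$ otherwise. The functors are $$\widehat M(T)B=\int^{A\in\mathscr G}M(A,B)\otimes TA,\qquad \widehat E(F)A=\int^{B\in\mathscr F}E(B,A)\otimes FB .$$ *)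

theory Defs
  imports "HOL-Algebra.Module" "HOL-Library.Equipollence"
begin

section \<open>Categories\<close>

record ('o, 'a) cat =
  Obj :: "'o set"
  Arr :: "'a set"
  Dom :: "'a \<Rightarrow> 'o"
  Cod :: "'a \<Rightarrow> 'o"
  Idn :: "'o \<Rightarrow> 'a"
  Cmp :: "'a \<Rightarrow> 'a \<Rightarrow> 'a"  (infixr \<open>\<cdot>\<index>\<close> 75)

definition Hom :: "('o, 'a) cat \<Rightarrow> 'o \<Rightarrow> 'o \<Rightarrow> 'a set" where
  "Hom C A B = {f \<in> Arr C. Dom C f = A \<and> Cod C f = B}"

text \<open>Composition is written in the usual order: \<open>g \<cdot> f\<close> is \<open>f\<close> followed by \<open>g\<close>.\<close>

locale category =
  fixes C :: "('o, 'a) cat" (structure)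
  assumes Dom_in_Obj: "f \<in> Arr C \<Longrightarrow> Dom C f \<in> Obj C"
    and Cod_in_Obj: "f \<in> Arr C \<Longrightarrow> Cod C f \<in> Obj C"
    and Idn_in_Hom: "A \<in> Obj C \<Longrightarrow> Idn C A \<in> Hom C A A"
    and Cmp_in_Hom: "f \<in> Hom C A B \<Longrightarrow> g \<in> Hom C B D \<Longrightarrow> g \<cdot> f \<in> Hom C A D"
    and Cmp_Idn_left: "f \<in> Hom C A B \<Longrightarrow> Idn C B \<cdot> f = f"
    and Cmp_Idn_right: "f \<in> Hom C A B \<Longrightarrow> f \<cdot> Idn C A = f"
    and Cmp_assoc: "f \<in> Hom C A B \<Longrightarrow> g \<in> Hom C B D \<Longrightarrow> h \<in> Hom C D E \<Longrightarrow>
      (h \<cdot> g) \<cdot> f = h \<cdot> (g \<cdot> f)"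

definition invertible :: "('o, 'a) cat \<Rightarrow> 'a \<Rightarrow> bool" where
  "invertible C f \<longleftrightarrow> f \<in> Arr C \<and>
     (\<exists>g \<in> Hom C (Cod C f) (Dom C f).
        g \<cdot>\<^bsub>C\<^esub> f = Idn C (Dom C f) \<and> f \<cdot>\<^bsub>C\<^esub> g = Idn C (Cod C f))"

definition isomorphic :: "('o, 'a) cat \<Rightarrow> 'o \<Rightarrow> 'o \<Rightarrow> bool" where
  "isomorphic C A B \<longleftrightarrow> (\<exists>f \<in> Hom C A B. invertible C f)"

definition monomorphism :: "('o, 'a) cat \<Rightarrow> 'a \<Rightarrow> bool" where
  "monomorphism C m \<longleftrightarrow> m \<in> Arr C \<and>
     (\<forall>A. \<forall>f \<in> Hom C A (Dom C m). \<forall>g \<in> Hom C A (Dom C m).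
        m \<cdot>\<^bsub>C\<^esub> f = m \<cdot>\<^bsub>C\<^esub> g \<longrightarrow> f = g)"

definition epimorphism :: "('o, 'a) cat \<Rightarrow> 'a \<Rightarrow> bool" where
  "epimorphism C e \<longleftrightarrow> e \<in> Arr C \<and>
     (\<forall>B. \<forall>f \<in> Hom C (Cod C e) B. \<forall>g \<in> Hom C (Cod C e) B.
        f \<cdot>\<^bsub>C\<^esub> e = g \<cdot>\<^bsub>C\<^esub> e \<longrightarrow> f = g)"

text \<open>The subcategory containing all objects and the arrows in \<open>S\<close> (a category whenever \<open>S\<close>
  contains the identities and is closed under composition).\<close>

definition wide_subcat :: "('o, 'a) cat \<Rightarrow> 'a set \<Rightarrow> ('o, 'a) cat" where
  "wide_subcat C S = C\<lparr>Arr := S\<rparr>"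

text \<open>The slice \<open>C/A\<close>; an arrow \<open>w\<close> from \<open>m\<close> to \<open>m'\<close> over \<open>A\<close> is the triple \<open>(m, w, m')\<close>.\<close>

definition slice_cat :: "('o, 'a) cat \<Rightarrow> 'o \<Rightarrow> ('a, 'a \<times> 'a \<times> 'a) cat" where
  "slice_cat C A = \<lparr>
     Obj = {m \<in> Arr C. Cod C m = A},
     Arr = {(m, w, m'). m \<in> Arr C \<and> Cod C m = A \<and> m' \<in> Arr C \<and> Cod C m' = A \<and>
              w \<in> Hom C (Dom C m) (Dom C m') \<and> m' \<cdot>\<^bsub>C\<^esub> w = m},
     Dom = (\<lambda>(m, w, m'). m),
     Cod = (\<lambda>(m, w, m'). m'),
     Idn = (\<lambda>m. (m, Idn C (Dom C m), m)),
     Cmp = (\<lambda>(n, v, n') (m, w, m'). (m, v \<cdot>\<^bsub>C\<^esub> w, n'))\<rparr>"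

definition iso_classes :: "('o, 'a) cat \<Rightarrow> 'o set set" where
  "iso_classes C = Obj C // {(A, B). A \<in> Obj C \<and> B \<in> Obj C \<and> isomorphic C A B}"


section \<open>Functors and natural transformations\<close>

record ('o, 'a, 'p, 'b) fctr =
  fobj :: "'o \<Rightarrow> 'p"
  farr :: "'a \<Rightarrow> 'b"

text \<open>Functors are extensional (\<open>undefined\<close> off the source category), so that equality of
  functors is HOL equality.\<close>

definition is_functor ::
    "('o, 'a) cat \<Rightarrow> ('p, 'b) cat \<Rightarrow> ('o, 'a, 'p, 'b) fctr \<Rightarrow> bool" where
  "is_functor C D T \<longleftrightarrow>
     fobj T \<in> Obj C \<rightarrow>\<^sub>E Obj D \<and>
     farr T \<in> Arr C \<rightarrow>\<^sub>E Arr D \<and>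
     (\<forall>f \<in> Arr C. Dom D (farr T f) = fobj T (Dom C f) \<and> Cod D (farr T f) = fobj T (Cod C f)) \<and>
     (\<forall>A \<in> Obj C. farr T (Idn C A) = Idn D (fobj T A)) \<and>
     (\<forall>f \<in> Arr C. \<forall>g \<in> Arr C. Cod C f = Dom C g \<longrightarrow>
        farr T (g \<cdot>\<^bsub>C\<^esub> f) = farr T g \<cdot>\<^bsub>D\<^esub> farr T f)"

definition functor_id :: "('o, 'a) cat \<Rightarrow> ('o, 'a, 'o, 'a) fctr" where
  "functor_id C = \<lparr>fobj = (\<lambda>A \<in> Obj C. A), farr = (\<lambda>f \<in> Arr C. f)\<rparr>"

definition functor_comp ::
    "('o, 'a) cat \<Rightarrow> ('p, 'b, 'q, 'c) fctr \<Rightarrow> ('o, 'a, 'p, 'b) fctr \<Rightarrow> ('o, 'a, 'q, 'c) fctr" where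
  "functor_comp C S T =
     \<lparr>fobj = (\<lambda>A \<in> Obj C. fobj S (fobj T A)), farr = (\<lambda>f \<in> Arr C. farr S (farr T f))\<rparr>"

type_synonym ('o, 'a, 'p, 'b) nat_tr =
  "('o, 'a, 'p, 'b) fctr \<times> ('o \<Rightarrow> 'b) \<times> ('o, 'a, 'p, 'b) fctr"

definition is_nat_tr ::
    "('o, 'a) cat \<Rightarrow> ('p, 'b) cat \<Rightarrow> ('o, 'a, 'p, 'b) fctr \<Rightarrow> ('o \<Rightarrow> 'b) \<Rightarrow>
     ('o, 'a, 'p, 'b) fctr \<Rightarrow> bool" where
  "is_nat_tr C D S \<alpha> T \<longleftrightarrow>
     is_functor C D S \<and> is_functor C D T \<and> \<alpha> \<in> extensional (Obj C) \<and>
     (\<forall>A \<in> Obj C. \<alpha> A \<in> Hom D (fobj S A) (fobj T A)) \<and>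
     (\<forall>f \<in> Arr C. \<alpha> (Cod C f) \<cdot>\<^bsub>D\<^esub> farr S f = farr T f \<cdot>\<^bsub>D\<^esub> \<alpha> (Dom C f))"

definition functor_cat ::
    "('o, 'a) cat \<Rightarrow> ('p, 'b) cat \<Rightarrow> (('o, 'a, 'p, 'b) fctr, ('o, 'a, 'p, 'b) nat_tr) cat" where
  "functor_cat C D = \<lparr>
     Obj = {T. is_functor C D T},
     Arr = {(S, \<alpha>, T). is_nat_tr C D S \<alpha> T},
     Dom = (\<lambda>(S, \<alpha>, T). S),
     Cod = (\<lambda>(S, \<alpha>, T). T),
     Idn = (\<lambda>T. (T, \<lambda>A \<in> Obj C. Idn D (fobj T A), T)),
     Cmp = (\<lambda>(S', \<beta>, T') (S, \<alpha>, T). (S, \<lambda>A \<in> Obj C. \<beta> A \<cdot>\<^bsub>D\<^esub> \<alpha> A, T'))\<rparr>"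

definition inverse_equivalences ::
    "('o, 'a) cat \<Rightarrow> ('p, 'b) cat \<Rightarrow> ('o, 'a, 'p, 'b) fctr \<Rightarrow> ('p, 'b, 'o, 'a) fctr \<Rightarrow> bool" where
  "inverse_equivalences C D \<Phi> \<Psi> \<longleftrightarrow>
     is_functor C D \<Phi> \<and> is_functor D C \<Psi> \<and>
     isomorphic (functor_cat C C) (functor_comp C \<Psi> \<Phi>) (functor_id C) \<and>
     isomorphic (functor_cat D D) (functor_comp D \<Phi> \<Psi>) (functor_id D)"


section \<open>Coends\<close>

text \<open>A bifunctor \<open>S : C\<^sup>o\<^sup>p \<times> C \<rightarrow> D\<close> acts on pairs of arrows of \<open>C\<close>: for \<open>g : A' \<rightarrow> A\<close> and
  \<open>h : B \<rightarrow> B'\<close>, \<open>farr S (g, h)\<close> goes from \<open>S (A, B)\<close> to \<open>S (A', B')\<close>.\<close>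

definition is_wedge ::
    "('o, 'a) cat \<Rightarrow> ('p, 'b) cat \<Rightarrow> ('o \<times> 'o, 'a \<times> 'a, 'p, 'b) fctr \<Rightarrow> 'p \<Rightarrow> ('o \<Rightarrow> 'b) \<Rightarrow> bool" where
  "is_wedge C D S X \<omega> \<longleftrightarrow>
     X \<in> Obj D \<and>
     (\<forall>A \<in> Obj C. \<omega> A \<in> Hom D (fobj S (A, A)) X) \<and>
     (\<forall>A \<in> Obj C. \<forall>B \<in> Obj C. \<forall>f \<in> Hom C A B.
        \<omega> A \<cdot>\<^bsub>D\<^esub> farr S (f, Idn C A) = \<omega> B \<cdot>\<^bsub>D\<^esub> farr S (Idn C B, f))"

definition is_coend ::
    "('o, 'a) cat \<Rightarrow> ('p, 'b) cat \<Rightarrow> ('o \<times> 'o, 'a \<times> 'a, 'p, 'b) fctr \<Rightarrow> 'p \<times> ('o \<Rightarrow> 'b) \<Rightarrow> bool" where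
  "is_coend C D S = (\<lambda>(X, \<omega>).
     is_wedge C D S X \<omega> \<and>
     (\<forall>Y \<theta>. is_wedge C D S Y \<theta> \<longrightarrow>
        (\<exists>!h. h \<in> Hom D X Y \<and> (\<forall>A \<in> Obj C. h \<cdot>\<^bsub>D\<^esub> \<omega> A = \<theta> A))))"

text \<open>A chosen coend of \<open>S : C\<^sup>o\<^sup>p \<times> C \<rightarrow> D\<close> with its universal wedge, and the arrow between
  coends induced by the diagonal components \<open>\<sigma> A : S (A, A) \<rightarrow> S' (A, A)\<close> of a natural
  transformation.\<close>

definition coend ::
    "('o, 'a) cat \<Rightarrow> ('p, 'b) cat \<Rightarrow> ('o \<times> 'o, 'a \<times> 'a, 'p, 'b) fctr \<Rightarrow> 'p \<times> ('o \<Rightarrow> 'b)" where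
  "coend C D S = (SOME Z. is_coend C D S Z)"

definition coend_map ::
    "('o, 'a) cat \<Rightarrow> ('p, 'b) cat \<Rightarrow> ('o \<times> 'o, 'a \<times> 'a, 'p, 'b) fctr \<Rightarrow>
     ('o \<times> 'o, 'a \<times> 'a, 'p, 'b) fctr \<Rightarrow> ('o \<Rightarrow> 'b) \<Rightarrow> 'b" where
  "coend_map C D S S' \<sigma> = (THE h.
     h \<in> Hom D (fst (coend C D S)) (fst (coend C D S')) \<and>
     (\<forall>A \<in> Obj C. h \<cdot>\<^bsub>D\<^esub> snd (coend C D S) A = snd (coend C D S') A \<cdot>\<^bsub>D\<^esub> \<sigma> A))"


section \<open>Modules\<close>

text \<open>The library record for modules extends the one for rings; its fields \<open>mult\<close> and \<open>one\<close> play
  no role for modules.\<close>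

definition linear_maps ::
    "('r, 's) ring_scheme \<Rightarrow> ('r, 'm) module \<Rightarrow> ('r, 'n) module \<Rightarrow> ('m \<Rightarrow> 'n) set" where
  "linear_maps R M N = {f \<in> carrier M \<rightarrow>\<^sub>E carrier N.
     (\<forall>x \<in> carrier M. \<forall>y \<in> carrier M. f (x \<oplus>\<^bsub>M\<^esub> y) = f x \<oplus>\<^bsub>N\<^esub> f y) \<and>
     (\<forall>a \<in> carrier R. \<forall>x \<in> carrier M. f (a \<odot>\<^bsub>M\<^esub> x) = a \<odot>\<^bsub>N\<^esub> f x)}"

type_synonym ('r, 'u) mod_arr = "('r, 'u) module \<times> ('u \<Rightarrow> 'u) \<times> ('r, 'u) module"

text \<open>The category of \<open>R\<close>-modules whose underlying sets are subsets of the type \<open>'u\<close>.\<close>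

definition mod_cat :: "('r, 's) ring_scheme \<Rightarrow> (('r, 'u) module, ('r, 'u) mod_arr) cat" where
  "mod_cat R = \<lparr>
     Obj = {M. module R M},
     Arr = {(M, f, N). module R M \<and> module R N \<and> f \<in> linear_maps R M N},
     Dom = (\<lambda>(M, f, N). M),
     Cod = (\<lambda>(M, f, N). N),
     Idn = (\<lambda>M. (M, \<lambda>x \<in> carrier M. x, M)),
     Cmp = (\<lambda>(M', g, N') (M, f, N). (M, compose (carrier M) g f, N'))\<rparr>"

definition bilinear_maps ::
    "('r, 's) ring_scheme \<Rightarrow> ('r, 'm) module \<Rightarrow> ('r, 'n) module \<Rightarrow> ('r, 'p) module \<Rightarrow>
     ('m \<Rightarrow> 'n \<Rightarrow> 'p) set" where
  "bilinear_maps R M N P = {t.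
     (\<forall>x \<in> carrier M. \<forall>y \<in> carrier N. t x y \<in> carrier P) \<and>
     (\<forall>x \<in> carrier M. \<forall>x' \<in> carrier M. \<forall>y \<in> carrier N.
        t (x \<oplus>\<^bsub>M\<^esub> x') y = t x y \<oplus>\<^bsub>P\<^esub> t x' y) \<and>
     (\<forall>x \<in> carrier M. \<forall>y \<in> carrier N. \<forall>y' \<in> carrier N.
        t x (y \<oplus>\<^bsub>N\<^esub> y') = t x y \<oplus>\<^bsub>P\<^esub> t x y') \<and>
     (\<forall>a \<in> carrier R. \<forall>x \<in> carrier M. \<forall>y \<in> carrier N.
        t (a \<odot>\<^bsub>M\<^esub> x) y = a \<odot>\<^bsub>P\<^esub> t x y \<and> t x (a \<odot>\<^bsub>N\<^esub> y) = a \<odot>\<^bsub>P\<^esub> t x y)}"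

text \<open>Tensor products are taken in the category of modules carried by \<open>'u\<close>, although the factors
  may be carried by other types.\<close>

definition is_tensor ::
    "('r, 's) ring_scheme \<Rightarrow> ('r, 'm) module \<Rightarrow> ('r, 'n) module \<Rightarrow>
     ('r, 'u) module \<times> ('m \<Rightarrow> 'n \<Rightarrow> 'u) \<Rightarrow> bool" where
  "is_tensor R M N = (\<lambda>(P, t).
     module R P \<and> t \<in> bilinear_maps R M N P \<and>
     (\<forall>(Q :: ('r, 'u) module) s. module R Q \<and> s \<in> bilinear_maps R M N Q \<longrightarrow>
        (\<exists>!h. h \<in> linear_maps R P Q \<and>
           (\<forall>x \<in> carrier M. \<forall>y \<in> carrier N. h (t x y) = s x y))))"

definition tensor ::
    "('r, 's) ring_scheme \<Rightarrow> ('r, 'm) module \<Rightarrow> ('r, 'n) module \<Rightarrow>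
     ('r, 'u) module \<times> ('m \<Rightarrow> 'n \<Rightarrow> 'u)" where
  "tensor R M N = (SOME Z. is_tensor R M N Z)"

definition tensor_arr ::
    "('r, 's) ring_scheme \<Rightarrow> ('r, 'm) mod_arr \<Rightarrow> ('r, 'n) mod_arr \<Rightarrow> ('r, 'u) mod_arr" where
  "tensor_arr R = (\<lambda>(M, f, M') (N, g, N').
     (fst (tensor R M N),
      THE h. h \<in> linear_maps R (fst (tensor R M N)) (fst (tensor R M' N')) \<and>
        (\<forall>x \<in> carrier M. \<forall>y \<in> carrier N.
           h (snd (tensor R M N) x y) = snd (tensor R M' N') (f x) (g y)),
      fst (tensor R M' N')))"

text \<open>The free module \<open>RX\<close>: finitely supported functions vanishing off \<open>X\<close>. In particular
  \<open>RX \<subseteq> RY\<close> literally if \<open>X \<subseteq> Y\<close>.\<close>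

definition free_mod :: "('r, 's) ring_scheme \<Rightarrow> 'x set \<Rightarrow> ('r, 'x \<Rightarrow> 'r) module" where
  "free_mod R X = \<lparr>
     carrier = {u. (\<forall>x. u x \<in> carrier R) \<and> (\<forall>x. x \<notin> X \<longrightarrow> u x = \<zero>\<^bsub>R\<^esub>) \<and>
                   finite {x. u x \<noteq> \<zero>\<^bsub>R\<^esub>}},
     mult = undefined, one = undefined,
     zero = (\<lambda>x. \<zero>\<^bsub>R\<^esub>),
     add = (\<lambda>u v x. u x \<oplus>\<^bsub>R\<^esub> v x),
     smult = (\<lambda>a u x. a \<otimes>\<^bsub>R\<^esub> u x)\<rparr>"

definition free_gen :: "('r, 's) ring_scheme \<Rightarrow> 'x \<Rightarrow> 'x \<Rightarrow> 'r" where
  "free_gen R x = (\<lambda>y. if y = x then \<one>\<^bsub>R\<^esub> else \<zero>\<^bsub>R\<^esub>)"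

text \<open>The linear map \<open>RX \<rightarrow> N\<close> extending \<open>\<phi> : X \<rightarrow> N\<close>.\<close>

definition free_lift ::
    "('r, 's) ring_scheme \<Rightarrow> 'x set \<Rightarrow> ('r, 'n) module \<Rightarrow> ('x \<Rightarrow> 'n) \<Rightarrow> ('x \<Rightarrow> 'r) \<Rightarrow> 'n" where
  "free_lift R X N \<phi> = (\<lambda>u \<in> carrier (free_mod R X).
     finsum N (\<lambda>x. u x \<odot>\<^bsub>N\<^esub> \<phi> x) {x \<in> X. u x \<noteq> \<zero>\<^bsub>R\<^esub>})"


section \<open>The pointwise linear structure on functor categories\<close>

text \<open>The operations below are only meaningful on parallel arrows.\<close>

definition nat_add ::
    "('o, 'a) cat \<Rightarrow> ('o, 'a, ('r, 'u) module, ('r, 'u) mod_arr) nat_tr \<Rightarrow>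
     ('o, 'a, ('r, 'u) module, ('r, 'u) mod_arr) nat_tr \<Rightarrow>
     ('o, 'a, ('r, 'u) module, ('r, 'u) mod_arr) nat_tr" where
  "nat_add C = (\<lambda>(S, \<alpha>, T) (_, \<beta>, _).
     (S, \<lambda>A \<in> Obj C. (fobj S A,
           \<lambda>x \<in> carrier (fobj S A). fst (snd (\<alpha> A)) x \<oplus>\<^bsub>fobj T A\<^esub> fst (snd (\<beta> A)) x,
           fobj T A), T))"

definition nat_smult ::
    "('o, 'a) cat \<Rightarrow> 'r \<Rightarrow> ('o, 'a, ('r, 'u) module, ('r, 'u) mod_arr) nat_tr \<Rightarrow>
     ('o, 'a, ('r, 'u) module, ('r, 'u) mod_arr) nat_tr" where
  "nat_smult C a = (\<lambda>(S, \<alpha>, T).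
     (S, \<lambda>A \<in> Obj C. (fobj S A,
           \<lambda>x \<in> carrier (fobj S A). a \<odot>\<^bsub>fobj T A\<^esub> fst (snd (\<alpha> A)) x,
           fobj T A), T))"

definition is_linear ::
    "('r, 's) ring_scheme \<Rightarrow> ('o, 'a) cat \<Rightarrow> ('p, 'b) cat \<Rightarrow>
     (('o, 'a, ('r, 'u) module, ('r, 'u) mod_arr) fctr,
      ('o, 'a, ('r, 'u) module, ('r, 'u) mod_arr) nat_tr,
      ('p, 'b, ('r, 'u) module, ('r, 'u) mod_arr) fctr,
      ('p, 'b, ('r, 'u) module, ('r, 'u) mod_arr) nat_tr) fctr \<Rightarrow> bool" where
  "is_linear R C D \<Phi> \<longleftrightarrow>
     (\<forall>S T. \<forall>\<alpha> \<in> Hom (functor_cat C (mod_cat R)) S T.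
        (\<forall>\<beta> \<in> Hom (functor_cat C (mod_cat R)) S T.
           farr \<Phi> (nat_add C \<alpha> \<beta>) = nat_add D (farr \<Phi> \<alpha>) (farr \<Phi> \<beta>)) \<and>
        (\<forall>a \<in> carrier R. farr \<Phi> (nat_smult C a \<alpha>) = nat_smult D a (farr \<Phi> \<alpha>)))"


section \<open>The functor \<open>[C, V] \<rightarrow> [D, V]\<close> induced by a kernel\<close>

text \<open>For a functor \<open>K : C\<^sup>o\<^sup>p \<times> D \<rightarrow> V\<close>, the functor sending \<open>T\<close> to
  \<open>B \<mapsto> \<integral>\<^sup>A K (A, B) \<otimes> T A\<close>. First, the bifunctor \<open>(A, A') \<mapsto> K (A, B) \<otimes> T A'\<close>.\<close>

type_synonym ('o, 'a, 'p, 'b, 'r, 'k) kernel =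
  "('o \<times> 'p, 'a \<times> 'b, ('r, 'k) module, ('r, 'k) mod_arr) fctr"

definition kernel_integrand ::
    "('r, 's) ring_scheme \<Rightarrow> ('o, 'a) cat \<Rightarrow> ('p, 'b) cat \<Rightarrow> ('o, 'a, 'p, 'b, 'r, 'k) kernel \<Rightarrow>
     ('o, 'a, ('r, 'u) module, ('r, 'u) mod_arr) fctr \<Rightarrow> 'p \<Rightarrow>
     ('o \<times> 'o, 'a \<times> 'a, ('r, 'u) module, ('r, 'u) mod_arr) fctr" where
  "kernel_integrand R C D K T B = \<lparr>
     fobj = (\<lambda>(A, A') \<in> Obj C \<times> Obj C. fst (tensor R (fobj K (A, B)) (fobj T A'))),
     farr = (\<lambda>(g, h) \<in> Arr C \<times> Arr C. tensor_arr R (farr K (g, Idn D B)) (farr T h))\<rparr>"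

definition kernel_obj ::
    "('r, 's) ring_scheme \<Rightarrow> ('o, 'a) cat \<Rightarrow> ('p, 'b) cat \<Rightarrow> ('o, 'a, 'p, 'b, 'r, 'k) kernel \<Rightarrow>
     ('o, 'a, ('r, 'u) module, ('r, 'u) mod_arr) fctr \<Rightarrow>
     ('p, 'b, ('r, 'u) module, ('r, 'u) mod_arr) fctr" where
  "kernel_obj R C D K T = \<lparr>
     fobj = (\<lambda>B \<in> Obj D. fst (coend C (mod_cat R) (kernel_integrand R C D K T B))),
     farr = (\<lambda>f \<in> Arr D. coend_map C (mod_cat R)
               (kernel_integrand R C D K T (Dom D f)) (kernel_integrand R C D K T (Cod D f))
               (\<lambda>A. tensor_arr R (farr K (Idn C A, f)) (Idn (mod_cat R) (fobj T A))))\<rparr>"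

definition kernel_functor ::
    "('r, 's) ring_scheme \<Rightarrow> ('o, 'a) cat \<Rightarrow> ('p, 'b) cat \<Rightarrow> ('o, 'a, 'p, 'b, 'r, 'k) kernel \<Rightarrow>
     (('o, 'a, ('r, 'u) module, ('r, 'u) mod_arr) fctr,
      ('o, 'a, ('r, 'u) module, ('r, 'u) mod_arr) nat_tr,
      ('p, 'b, ('r, 'u) module, ('r, 'u) mod_arr) fctr,
      ('p, 'b, ('r, 'u) module, ('r, 'u) mod_arr) nat_tr) fctr" where
  "kernel_functor R C D K = \<lparr>
     fobj = (\<lambda>T \<in> Obj (functor_cat C (mod_cat R)). kernel_obj R C D K T),
     farr = (\<lambda>(S, \<alpha>, T) \<in> Arr (functor_cat C (mod_cat R)).
       (kernel_obj R C D K S,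
        \<lambda>B \<in> Obj D. coend_map C (mod_cat R)
          (kernel_integrand R C D K S B) (kernel_integrand R C D K T B)
          (\<lambda>A. tensor_arr R (Idn (mod_cat R) (fobj K (A, B))) (\<alpha> A)),
        kernel_obj R C D K T))\<rparr>"


section \<open>Factorization systems\<close>

locale factorization_system = category C
  for C :: "('o, 'a) cat" (structure) and E M :: "'a set" +
  assumes E_sub: "E \<subseteq> Arr C"
    and M_sub: "M \<subseteq> Arr C"
    and FS0_M: "m \<in> M \<Longrightarrow> invertible C w \<Longrightarrow> Cod C w = Dom C m \<Longrightarrow> m \<cdot> w \<in> M"
    and FS0_E: "e \<in> E \<Longrightarrow> invertible C w \<Longrightarrow> Dom C w = Cod C e \<Longrightarrow> w \<cdot> e \<in> E"
    and FS1: "e \<in> E \<Longrightarrow> m \<in> M \<Longrightarrow> h \<in> Hom C (Dom C e) (Dom C m) \<Longrightarrow>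
      k \<in> Hom C (Cod C e) (Cod C m) \<Longrightarrow> m \<cdot> h = k \<cdot> e \<Longrightarrow>
      \<exists>!l. l \<in> Hom C (Cod C e) (Dom C m) \<and> l \<cdot> e = h \<and> m \<cdot> l = k"
    and FS2: "f \<in> Arr C \<Longrightarrow>
      \<exists>m \<in> M. \<exists>e \<in> E. Dom C e = Dom C f \<and> Cod C e = Dom C m \<and> Cod C m = Cod C f \<and> f = m \<cdot> e"

locale proper_factorization_system = factorization_system +
  assumes E_epi: "e \<in> E \<Longrightarrow> epimorphism C e"
    and M_mono: "m \<in> M \<Longrightarrow> monomorphism C m"

definition fs_groupoid :: "('o, 'a) cat \<Rightarrow> 'a set \<Rightarrow> 'a set \<Rightarrow> ('o, 'a) cat" where
  "fs_groupoid C E M = wide_subcat C (E \<inter> M)"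

text \<open>Composition in \<open>RC\<close> of \<open>v \<in> R(C(A, B))\<close> followed by \<open>u \<in> R(C(B, D))\<close>.\<close>

definition free_comp ::
    "('r, 's) ring_scheme \<Rightarrow> ('o, 'a) cat \<Rightarrow> 'o \<Rightarrow> 'o \<Rightarrow> 'o \<Rightarrow> ('a \<Rightarrow> 'r) \<Rightarrow> ('a \<Rightarrow> 'r) \<Rightarrow> 'a \<Rightarrow> 'r" where
  "free_comp R C A B D u v =
     free_lift R (Hom C B D) (free_mod R (Hom C A D))
       (\<lambda>g. free_lift R (Hom C A B) (free_mod R (Hom C A D)) (\<lambda>f. free_gen R (g \<cdot>\<^bsub>C\<^esub> f)) v) u"

definition idempotent_axiom ::
    "('r, 's) ring_scheme \<Rightarrow> ('o, 'a) cat \<Rightarrow> 'a set \<Rightarrow> 'a set \<Rightarrow> bool" where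
  "idempotent_axiom R C E M \<longleftrightarrow> (\<exists>p.
     (\<forall>A \<in> Obj C. p A \<in> carrier (free_mod R (Hom C A A))) \<and>
     (\<forall>A \<in> Obj C. free_comp R C A A A (p A) (p A) = p A) \<and>
     (\<forall>A \<in> Obj C. \<forall>B \<in> Obj C. \<forall>f \<in> Hom C A B - M.
        free_comp R C A A B (free_gen R f) (p A) = \<zero>\<^bsub>free_mod R (Hom C A B)\<^esub>) \<and>
     (\<forall>A \<in> Obj C. \<forall>B \<in> Obj C. \<forall>f \<in> Hom C A B - E.
        free_comp R C A B B (p B) (free_gen R f) = \<zero>\<^bsub>free_mod R (Hom C A B)\<^esub>) \<and>
     (\<forall>A \<in> Obj C. \<forall>B \<in> Obj C. \<forall>g \<in> Hom C A B \<inter> (E \<inter> M).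
        free_comp R C A A B (free_gen R g) (p A) = free_comp R C A B B (p B) (free_gen R g)) \<and>
     (\<forall>A \<in> Obj C. free_gen R (Idn C A) \<ominus>\<^bsub>free_mod R (Hom C A A)\<^esub> p A
        \<in> carrier (free_mod R (Hom C A A - E - M))))"

text \<open>For subcategories \<open>X\<close>, \<open>Y\<close> of \<open>C\<close> and a set \<open>S\<close> of arrows, the functor
  \<open>X\<^sup>o\<^sup>p \<times> Y \<rightarrow> V\<close> given on objects by \<open>(A, B) \<mapsto> R(S(A, B))\<close>; on arrows, \<open>(x, y)\<close> sends the
  generator \<open>s\<close> to \<open>y \<cdot> s \<cdot> x\<close> if this is in \<open>S\<close> and to \<open>0\<close> otherwise.\<close>

definition truncated_hom ::
    "('r, 's) ring_scheme \<Rightarrow> ('o, 'a) cat \<Rightarrow> 'a set \<Rightarrow> ('o, 'a) cat \<Rightarrow> ('o, 'a) cat \<Rightarrow>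
     ('o, 'a, 'o, 'a, 'r, 'a \<Rightarrow> 'r) kernel" where
  "truncated_hom R C S X Y = \<lparr>
     fobj = (\<lambda>(A, B) \<in> Obj X \<times> Obj Y. free_mod R (S \<inter> Hom C A B)),
     farr = (\<lambda>(x, y) \<in> Arr X \<times> Arr Y.
       (free_mod R (S \<inter> Hom C (Cod C x) (Dom C y)),
        free_lift R (S \<inter> Hom C (Cod C x) (Dom C y)) (free_mod R (S \<inter> Hom C (Dom C x) (Cod C y)))
          (\<lambda>s. if y \<cdot>\<^bsub>C\<^esub> s \<cdot>\<^bsub>C\<^esub> x \<in> S then free_gen R (y \<cdot>\<^bsub>C\<^esub> s \<cdot>\<^bsub>C\<^esub> x)
               else \<zero>\<^bsub>free_mod R (S \<inter> Hom C (Dom C x) (Cod C y))\<^esub>),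
        free_mod R (S \<inter> Hom C (Dom C x) (Cod C y))))\<rparr>"

definition M_hat ::
    "('r, 's) ring_scheme \<Rightarrow> ('o, 'a) cat \<Rightarrow> 'a set \<Rightarrow> 'a set \<Rightarrow>
     (('o, 'a, ('r, 'u) module, ('r, 'u) mod_arr) fctr,
      ('o, 'a, ('r, 'u) module, ('r, 'u) mod_arr) nat_tr,
      ('o, 'a, ('r, 'u) module, ('r, 'u) mod_arr) fctr,
      ('o, 'a, ('r, 'u) module, ('r, 'u) mod_arr) nat_tr) fctr" where
  "M_hat R C E M =
     kernel_functor R (fs_groupoid C E M) C (truncated_hom R C M (fs_groupoid C E M) C)"

definition E_hat ::
    "('r, 's) ring_scheme \<Rightarrow> ('o, 'a) cat \<Rightarrow> 'a set \<Rightarrow> 'a set \<Rightarrow>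
     (('o, 'a, ('r, 'u) module, ('r, 'u) mod_arr) fctr,
      ('o, 'a, ('r, 'u) module, ('r, 'u) mod_arr) nat_tr,
      ('o, 'a, ('r, 'u) module, ('r, 'u) mod_arr) fctr,
      ('o, 'a, ('r, 'u) module, ('r, 'u) mod_arr) nat_tr) fctr" where
  "E_hat R C E M =
     kernel_functor R C (fs_groupoid C E M) (truncated_hom R C E C (fs_groupoid C E M))"

text \<open>The type \<open>'u\<close> plays the role of a universe: it has to be large enough for the coends
  defining \<open>M_hat\<close> and \<open>E_hat\<close> to exist among modules carried by subsets of \<open>'u\<close>.\<close>

definition universe_for ::
    "'u itself \<Rightarrow> ('r, 's) ring_scheme \<Rightarrow> ('o, 'a) cat \<Rightarrow> bool" where
  "universe_for (_ :: 'u itself) R C \<longleftrightarrow>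
     infinite (UNIV :: 'u set) \<and> carrier R \<lesssim> (UNIV :: 'u set) \<and> Arr C \<lesssim> (UNIV :: 'u set)"

end

theory Submission
  imports Defs "HOL-Algebra.Free_Abelian_Groups"
begin

text \<open>The axioms (p2) and (p4) make \<open>e \<mapsto> p\<^sub>A e\<close> a section of the truncation
  \<open>R F(B, A) \<rightarrow> E(B, A)\<close>, natural in \<open>B\<close>, so by the Yoneda lemma \<open>E_hat X A\<close> is the image of \<open>p\<^sub>A\<close> on
  \<open>X A\<close>, while \<open>M_hat T B\<close> is the direct sum of the \<open>T A\<close> over the \<open>M\<close>-subobjects \<open>A \<rightarrow> B\<close>. On
  \<open>M_hat T A\<close> the idempotent \<open>p\<^sub>A\<close> is the projection onto the summand of \<open>1\<^sub>A\<close>, so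
  \<open>E_hat (M_hat T) \<cong> T\<close>.

  For the counit \<open>M_hat (E_hat X) \<rightarrow> X\<close>, note that \<open>1 - p\<^sub>B\<close> is a combination of arrows that factor
  through proper subobjects of \<open>B\<close>. By induction on the number of subobjects, a subfunctor of \<open>X\<close>
  containing all \<open>p\<^sub>B (X B)\<close> is all of \<open>X\<close>, and a subfunctor on which all \<open>p\<^sub>B\<close> vanish is zero.
  This is applied to the image and to the kernel of the counit, respectively.\<close>

text \<open>Coends and tensor products are picked by \<open>SOME\<close> among modules carried by
  subsets of \<open>'u\<close>, so nothing is known about them until one is exhibited inside that
  universe. This obstacle shapes the proof. For \<open>M_hat\<close> a direct sum is encoded in
  \<open>'u\<close>; for \<open>E_hat\<close>, whose coend runs over all objects of F, the image of
  \<open>p\<close> lies inside \<open>X A\<close> and is in the universe already. From then on only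
  the universal property is used, in an elementwise form: a coend is generated by symbols
  \<open>s \<otimes> x\<close> with \<open>s\<close> in \<open>M\<close> or \<open>E\<close>, and
  linear maps out of it are compared on these.

  The remaining axioms enter separately, each read as a statement about the linear action of RF on a
  functor \<open>X\<close>. (p0) makes the elements of \<open>E_hat X A\<close>, seen in
  \<open>X A\<close>, fixed by \<open>p\<close>. (p3) makes this identification compatible with the
  groupoid. (p1) makes the counit natural: \<open>M_hat\<close> sends a symbol to zero when its
  arrow leaves \<open>M\<close>, and (p1) produces the same zero in \<open>X\<close>.

  Both functors come from a hom-set truncated to a class of arrows, so one locale treats them
  together, with the roles of the groupoid and of F exchanged.\<close>

section \<open>Linear maps\<close>

text \<open>In contrast to \<open>linear_maps\<close>, the values of the function off the carrier are arbitrary.\<close>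

definition lin ::
    "('r, 's) ring_scheme \<Rightarrow> ('r, 'm) module \<Rightarrow> ('r, 'n) module \<Rightarrow> ('m \<Rightarrow> 'n) \<Rightarrow> bool" where
  "lin R M N f \<longleftrightarrow> f \<in> carrier M \<rightarrow> carrier N \<and>
     (\<forall>x \<in> carrier M. \<forall>y \<in> carrier M. f (x \<oplus>\<^bsub>M\<^esub> y) = f x \<oplus>\<^bsub>N\<^esub> f y) \<and>
     (\<forall>a \<in> carrier R. \<forall>x \<in> carrier M. f (a \<odot>\<^bsub>M\<^esub> x) = a \<odot>\<^bsub>N\<^esub> f x)"

lemma linI:
  assumes "\<And>x. x \<in> carrier M \<Longrightarrow> f x \<in> carrier N"
    and "\<And>x y. x \<in> carrier M \<Longrightarrow> y \<in> carrier M \<Longrightarrow> f (x \<oplus>\<^bsub>M\<^esub> y) = f x \<oplus>\<^bsub>N\<^esub> f y"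
    and "\<And>a x. a \<in> carrier R \<Longrightarrow> x \<in> carrier M \<Longrightarrow> f (a \<odot>\<^bsub>M\<^esub> x) = a \<odot>\<^bsub>N\<^esub> f x"
  shows "lin R M N f"
  using assms unfolding lin_def by auto

lemma lin_closed: "lin R M N f \<Longrightarrow> x \<in> carrier M \<Longrightarrow> f x \<in> carrier N"
  and lin_add: "lin R M N f \<Longrightarrow> x \<in> carrier M \<Longrightarrow> y \<in> carrier M \<Longrightarrow> f (x \<oplus>\<^bsub>M\<^esub> y) = f x \<oplus>\<^bsub>N\<^esub> f y"
  and lin_smult: "lin R M N f \<Longrightarrow> a \<in> carrier R \<Longrightarrow> x \<in> carrier M \<Longrightarrow> f (a \<odot>\<^bsub>M\<^esub> x) = a \<odot>\<^bsub>N\<^esub> f x"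
  unfolding lin_def by auto

lemma linear_maps_iff: "f \<in> linear_maps R M N \<longleftrightarrow> lin R M N f \<and> f \<in> extensional (carrier M)"
  unfolding linear_maps_def lin_def by (auto simp: PiE_def)

lemma lin_cong:
  assumes "lin R M N f" "module R M" "\<And>x. x \<in> carrier M \<Longrightarrow> f x = g x"
  shows "lin R M N g"
proof -
  interpret module R M by fact
  show ?thesis
    by (intro linI; simp add: assms(3)[symmetric] lin_closed[OF assms(1)] lin_add[OF assms(1)] lin_smult[OF assms(1)])
qed

lemma lin_restrict: "lin R M N f \<Longrightarrow> module R M \<Longrightarrow> restrict f (carrier M) \<in> linear_maps R M N"
  unfolding linear_maps_iff by (auto intro: lin_cong)

lemma lin_id: "lin R M M (\<lambda>x. x)"
  by (auto intro: linI)

lemma lin_comp: "lin R M N f \<Longrightarrow> lin R N P g \<Longrightarrow> lin R M P (\<lambda>x. g (f x))"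
  by (intro linI; simp add: lin_closed lin_add lin_smult)

lemma lin_zero:
  assumes "lin R M N f" "module R M" "module R N"
  shows "f \<zero>\<^bsub>M\<^esub> = \<zero>\<^bsub>N\<^esub>"
proof -
  interpret M: module R M by fact
  interpret N: module R N by fact
  have "f (\<zero>\<^bsub>R\<^esub> \<odot>\<^bsub>M\<^esub> \<zero>\<^bsub>M\<^esub>) = \<zero>\<^bsub>R\<^esub> \<odot>\<^bsub>N\<^esub> f \<zero>\<^bsub>M\<^esub>"
    by (intro lin_smult[OF assms(1)]) auto
  then show ?thesis
    by (simp add: lin_closed[OF assms(1)])
qed

lemma lin_minus:
  assumes "lin R M N f" "module R M" "module R N" "x \<in> carrier M" "y \<in> carrier M"
  shows "f (x \<ominus>\<^bsub>M\<^esub> y) = f x \<ominus>\<^bsub>N\<^esub> f y"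
proof -
  interpret M: module R M by fact
  interpret N: module R N by fact
  have "f (x \<ominus>\<^bsub>M\<^esub> y) \<oplus>\<^bsub>N\<^esub> f y = f x"
    using assms(4,5) lin_add[OF assms(1), of "x \<ominus>\<^bsub>M\<^esub> y" y]
    by (simp add: M.minus_eq M.M.a_assoc M.M.l_neg)
  moreover have "f x \<in> carrier N" "f y \<in> carrier N" "f (x \<ominus>\<^bsub>M\<^esub> y) \<in> carrier N"
    using assms(4,5) by (auto intro: lin_closed[OF assms(1)])
  ultimately show ?thesis
    by (metis N.M.minus_eq N.M.a_assoc N.M.r_neg N.M.a_inv_closed N.M.r_zero)
qed

lemma lin_zero_map: "module R N \<Longrightarrow> lin R M N (\<lambda>x. \<zero>\<^bsub>N\<^esub>)"
proof -
  assume "module R N"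
  then interpret N: module R N .
  show ?thesis by (intro linI) auto
qed

lemma lin_add_map:
  assumes "module R N" "lin R M N f" "lin R M N g"
  shows "lin R M N (\<lambda>x. f x \<oplus>\<^bsub>N\<^esub> g x)"
proof -
  interpret N: module R N by fact
  show ?thesis
    by (intro linI; simp add: lin_closed[OF assms(2)] lin_closed[OF assms(3)] lin_add[OF assms(2)] lin_add[OF assms(3)]
        lin_smult[OF assms(2)] lin_smult[OF assms(3)] N.M.add.m_ac N.smult_r_distr)
qed

lemma lin_smult_map:
  assumes "module R N" "lin R M N f" "a \<in> carrier R"
  shows "lin R M N (\<lambda>x. a \<odot>\<^bsub>N\<^esub> f x)"
proof -
  interpret N: module R N by fact
  show ?thesis
    using assms(3) by (intro linI; simp add: lin_closed[OF assms(2)] lin_add[OF assms(2)]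
        lin_smult[OF assms(2)] N.smult_r_distr N.smult_assoc1[symmetric] N.m_comm)
qed


text \<open>\<open>finsum\<close> over an infinite set is zero by convention, so a finitely
  supported family over an infinite index set has to be summed over its support.\<close>

definition supp_sum :: "('n, 's) ring_scheme \<Rightarrow> ('i \<Rightarrow> 'n) \<Rightarrow> 'i set \<Rightarrow> 'n" where
  "supp_sum N f I = finsum N f {i \<in> I. f i \<noteq> \<zero>\<^bsub>N\<^esub>}"

context module
begin

text \<open>The additional summands are zero. This freedom brings families with different supports
  to a common index set, since the support of a sum or of a multiple may shrink.\<close>

lemma supp_sum_eq:
  assumes "finite Y" "{i \<in> I. f i \<noteq> \<zero>\<^bsub>M\<^esub>} \<subseteq> Y" "Y \<subseteq> I" "\<And>i. i \<in> I \<Longrightarrow> f i \<in> carrier M"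
  shows "supp_sum M f I = finsum M f Y"
  unfolding supp_sum_def
  by (rule M.add.finprod_mono_neutral_cong) (use assms in \<open>auto intro: finite_subset\<close>)

lemma supp_sum_closed:
  assumes "\<And>i. i \<in> I \<Longrightarrow> f i \<in> carrier M"
  shows "supp_sum M f I \<in> carrier M"
  unfolding supp_sum_def using assms by (auto intro!: M.finsum_closed)

lemma supp_sum_add:
  assumes f: "\<And>i. i \<in> I \<Longrightarrow> f i \<in> carrier M" "finite {i \<in> I. f i \<noteq> \<zero>\<^bsub>M\<^esub>}"
    and g: "\<And>i. i \<in> I \<Longrightarrow> g i \<in> carrier M" "finite {i \<in> I. g i \<noteq> \<zero>\<^bsub>M\<^esub>}"
  shows "supp_sum M (\<lambda>i. f i \<oplus>\<^bsub>M\<^esub> g i) I = supp_sum M f I \<oplus>\<^bsub>M\<^esub> supp_sum M g I"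
proof -
  \<comment> \<open>Cancellation may make the support of the sum smaller than either support; the
    union serves for all three sums.\<close>
  let ?Y = "{i \<in> I. f i \<noteq> \<zero>\<^bsub>M\<^esub>} \<union> {i \<in> I. g i \<noteq> \<zero>\<^bsub>M\<^esub>}"
  have "supp_sum M (\<lambda>i. f i \<oplus>\<^bsub>M\<^esub> g i) I = finsum M (\<lambda>i. f i \<oplus>\<^bsub>M\<^esub> g i) ?Y"
    by (rule supp_sum_eq) (use f g in auto)
  also have "\<dots> = finsum M f ?Y \<oplus>\<^bsub>M\<^esub> finsum M g ?Y"
    by (rule M.finsum_addf) (use f g in auto)
  also have "finsum M f ?Y = supp_sum M f I"
    by (rule supp_sum_eq[symmetric]) (use f g in auto)
  also have "finsum M g ?Y = supp_sum M g I"
    by (rule supp_sum_eq[symmetric]) (use f g in auto)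
  finally show ?thesis .
qed

lemma finsum_smult_right:
  assumes "a \<in> carrier R" "finite Y" "\<And>i. i \<in> Y \<Longrightarrow> f i \<in> carrier M"
  shows "finsum M (\<lambda>i. a \<odot>\<^bsub>M\<^esub> f i) Y = a \<odot>\<^bsub>M\<^esub> finsum M f Y"
  using assms(2,3)
proof (induction Y rule: finite_induct)
  case empty
  then show ?case using assms(1) by simp
next
  case (insert x Y)
  then have "finsum M f Y \<in> carrier M" "f x \<in> carrier M"
    by (auto intro!: M.finsum_closed)
  moreover have "finsum M (\<lambda>i. a \<odot>\<^bsub>M\<^esub> f i) (insert x Y) = a \<odot>\<^bsub>M\<^esub> f x \<oplus>\<^bsub>M\<^esub> finsum M (\<lambda>i. a \<odot>\<^bsub>M\<^esub> f i) Y"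
    by (rule M.finsum_insert) (use insert assms(1) in auto)
  moreover have "finsum M f (insert x Y) = f x \<oplus>\<^bsub>M\<^esub> finsum M f Y"
    by (rule M.finsum_insert) (use insert in auto)
  ultimately show ?case
    using insert assms(1) by (simp add: smult_r_distr)
qed

lemma supp_sum_smult:
  assumes f: "\<And>i. i \<in> I \<Longrightarrow> f i \<in> carrier M" "finite {i \<in> I. f i \<noteq> \<zero>\<^bsub>M\<^esub>}" and a: "a \<in> carrier R"
  shows "supp_sum M (\<lambda>i. a \<odot>\<^bsub>M\<^esub> f i) I = a \<odot>\<^bsub>M\<^esub> supp_sum M f I"
proof -
  have "supp_sum M (\<lambda>i. a \<odot>\<^bsub>M\<^esub> f i) I = finsum M (\<lambda>i. a \<odot>\<^bsub>M\<^esub> f i) {i \<in> I. f i \<noteq> \<zero>\<^bsub>M\<^esub>}"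
    by (rule supp_sum_eq) (use f a in auto)
  also have "\<dots> = a \<odot>\<^bsub>M\<^esub> supp_sum M f I"
    unfolding supp_sum_def by (rule finsum_smult_right) (use f a in auto)
  finally show ?thesis .
qed

lemma supp_sum_single:
  assumes "i \<in> I" "f i \<in> carrier M" "\<And>j. j \<in> I \<Longrightarrow> j \<noteq> i \<Longrightarrow> f j = \<zero>\<^bsub>M\<^esub>"
  shows "supp_sum M f I = f i"
proof -
  have "supp_sum M f I = finsum M f {i}"
  proof (rule supp_sum_eq)
    fix j assume "j \<in> I"
    then show "f j \<in> carrier M" using assms(2,3) by (cases "j = i") auto
  qed (use assms in auto)
  then show ?thesis using assms(2) by simp
qed

lemma supp_sum_in:
  assumes "\<zero>\<^bsub>M\<^esub> \<in> H" "\<And>x y. x \<in> H \<Longrightarrow> y \<in> H \<Longrightarrow> x \<oplus>\<^bsub>M\<^esub> y \<in> H" "H \<subseteq> carrier M"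
    and "\<And>i. i \<in> I \<Longrightarrow> f i \<in> H"
  shows "supp_sum M f I \<in> H"
proof -
  have *: "finsum M f Y \<in> H" if "\<And>i. i \<in> Y \<Longrightarrow> f i \<in> H" for Y
  \<comment> \<open>No finiteness of the support is assumed: the sum over an infinite set is zero,
    which lies in \<open>H\<close>.\<close>
  proof (cases "finite Y")
    case True
    then show ?thesis using that
    proof (induction Y rule: finite_induct)
      case (insert x Y)
      have "finsum M f (insert x Y) = f x \<oplus>\<^bsub>M\<^esub> finsum M f Y"
        by (rule M.finsum_insert) (use insert assms(3) in auto)
      then show ?case using insert assms(2) by auto
    qed (use assms in auto)
  qed (use assms in auto)
  show ?thesis unfolding supp_sum_def by (rule *) (use assms(4) in simp)
qed

end


section \<open>Direct sums and free modules\<close>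

text \<open>Elements are total functions that are zero off \<open>I\<close>, so that all operations
  are pointwise. In exchange \<open>N i\<close> has to be a module also for \<open>i\<close> outside
  \<open>I\<close>.\<close>

definition direct_sum :: "'i set \<Rightarrow> ('i \<Rightarrow> ('r, 'n) module) \<Rightarrow> ('r, 'i \<Rightarrow> 'n) module" where
  "direct_sum I N = \<lparr>
     carrier = {u. (\<forall>i. u i \<in> carrier (N i)) \<and> (\<forall>i. i \<notin> I \<longrightarrow> u i = \<zero>\<^bsub>N i\<^esub>) \<and>
                   finite {i. u i \<noteq> \<zero>\<^bsub>N i\<^esub>}},
     monoid.mult = undefined, one = undefined,
     ring.zero = (\<lambda>i. \<zero>\<^bsub>N i\<^esub>),
     ring.add = (\<lambda>u v i. u i \<oplus>\<^bsub>N i\<^esub> v i),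
     smult = (\<lambda>a u i. a \<odot>\<^bsub>N i\<^esub> u i)\<rparr>"

definition direct_sum_inj :: "('i \<Rightarrow> ('r, 'n) module) \<Rightarrow> 'i \<Rightarrow> 'n \<Rightarrow> 'i \<Rightarrow> 'n" where
  "direct_sum_inj N i x = (\<lambda>j. if j = i then x else \<zero>\<^bsub>N j\<^esub>)"

context
  fixes R :: "('r, 's) ring_scheme" and N :: "'i \<Rightarrow> ('r, 'n) module" and I :: "'i set"
  assumes R: "cring R" and N: "\<And>i. module R (N i)"
begin

interpretation R: cring R by (rule R)
interpretation N: module R "N i" for i by (rule N)

lemma module_direct_sum: "module R (direct_sum I N)"
proof (rule moduleI[OF R])
  show "abelian_group (direct_sum I N)"
  proof (rule abelian_groupI)
    fix u v assume u: "u \<in> carrier (direct_sum I N)" and v: "v \<in> carrier (direct_sum I N)"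
    have "{i. u i \<oplus>\<^bsub>N i\<^esub> v i \<noteq> \<zero>\<^bsub>N i\<^esub>} \<subseteq> {i. u i \<noteq> \<zero>\<^bsub>N i\<^esub>} \<union> {i. v i \<noteq> \<zero>\<^bsub>N i\<^esub>}"
      by auto
    then have "finite {i. u i \<oplus>\<^bsub>N i\<^esub> v i \<noteq> \<zero>\<^bsub>N i\<^esub>}"
      by (rule finite_subset) (use u v in \<open>auto simp: direct_sum_def\<close>)
    then show "u \<oplus>\<^bsub>direct_sum I N\<^esub> v \<in> carrier (direct_sum I N)"
      using u v by (simp add: direct_sum_def)
    show "u \<oplus>\<^bsub>direct_sum I N\<^esub> v = v \<oplus>\<^bsub>direct_sum I N\<^esub> u"
      using u v by (simp add: direct_sum_def N.M.a_comm)
    show "\<zero>\<^bsub>direct_sum I N\<^esub> \<oplus>\<^bsub>direct_sum I N\<^esub> u = u"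
      using u by (simp add: direct_sum_def)
    fix w assume w: "w \<in> carrier (direct_sum I N)"
    show "u \<oplus>\<^bsub>direct_sum I N\<^esub> v \<oplus>\<^bsub>direct_sum I N\<^esub> w = u \<oplus>\<^bsub>direct_sum I N\<^esub> (v \<oplus>\<^bsub>direct_sum I N\<^esub> w)"
      using u v w by (simp add: direct_sum_def N.M.a_assoc)
  next
    fix u assume u: "u \<in> carrier (direct_sum I N)"
    let ?w = "\<lambda>i. \<ominus>\<^bsub>N i\<^esub> u i"
    have "{i. ?w i \<noteq> \<zero>\<^bsub>N i\<^esub>} \<subseteq> {i. u i \<noteq> \<zero>\<^bsub>N i\<^esub>}" by auto
    then have "finite {i. ?w i \<noteq> \<zero>\<^bsub>N i\<^esub>}"
      by (rule finite_subset) (use u in \<open>auto simp: direct_sum_def\<close>)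
    then have "?w \<in> carrier (direct_sum I N)"
      using u by (simp add: direct_sum_def)
    moreover have "?w \<oplus>\<^bsub>direct_sum I N\<^esub> u = \<zero>\<^bsub>direct_sum I N\<^esub>"
      using u by (simp add: direct_sum_def N.M.l_neg)
    ultimately show "\<exists>w\<in>carrier (direct_sum I N). w \<oplus>\<^bsub>direct_sum I N\<^esub> u = \<zero>\<^bsub>direct_sum I N\<^esub>" by blast
  qed (simp add: direct_sum_def)
  fix a u assume a: "a \<in> carrier R" and u: "u \<in> carrier (direct_sum I N)"
  have "{i. a \<odot>\<^bsub>N i\<^esub> u i \<noteq> \<zero>\<^bsub>N i\<^esub>} \<subseteq> {i. u i \<noteq> \<zero>\<^bsub>N i\<^esub>}"
    using a by auto
  then have "finite {i. a \<odot>\<^bsub>N i\<^esub> u i \<noteq> \<zero>\<^bsub>N i\<^esub>}"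
    by (rule finite_subset) (use u in \<open>auto simp: direct_sum_def\<close>)
  then show "a \<odot>\<^bsub>direct_sum I N\<^esub> u \<in> carrier (direct_sum I N)"
    using u a by (simp add: direct_sum_def)
qed (simp_all add: direct_sum_def N.smult_l_distr N.smult_r_distr N.smult_assoc1)

lemma lin_direct_sum_inj:
  assumes i: "i \<in> I"
  shows "lin R (N i) (direct_sum I N) (direct_sum_inj N i)"
proof (rule linI)
  fix x assume x: "x \<in> carrier (N i)"
  have "finite {j. direct_sum_inj N i x j \<noteq> \<zero>\<^bsub>N j\<^esub>}"
    by (rule finite_subset[of _ "{i}"]) (auto simp: direct_sum_inj_def)
  then show "direct_sum_inj N i x \<in> carrier (direct_sum I N)"
    using x i by (auto simp: direct_sum_def direct_sum_inj_def)
qed (auto simp: direct_sum_def direct_sum_inj_def)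

text \<open>Induction on a finite set that bounds the support: one coordinate is split off by
  \<open>direct_sum_inj\<close>, and the rest is supported on a smaller set.\<close>

lemma direct_sum_induct:
  assumes u: "u \<in> carrier (direct_sum I N)"
    and zero: "P \<zero>\<^bsub>direct_sum I N\<^esub>"
    and add: "\<And>v i x. v \<in> carrier (direct_sum I N) \<Longrightarrow> P v \<Longrightarrow> i \<in> I \<Longrightarrow> x \<in> carrier (N i) \<Longrightarrow>
      P (direct_sum_inj N i x \<oplus>\<^bsub>direct_sum I N\<^esub> v)"
  shows "P u"
proof -
  have "\<forall>u \<in> carrier (direct_sum I N). {i. u i \<noteq> \<zero>\<^bsub>N i\<^esub>} \<subseteq> Y \<longrightarrow> P u" if "finite Y" for Y
    using that
  proof (induction Y rule: finite_induct)
    case empty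
    have "u = \<zero>\<^bsub>direct_sum I N\<^esub>" if "{i. u i \<noteq> \<zero>\<^bsub>N i\<^esub>} \<subseteq> {}" for u
      using that by (auto simp: direct_sum_def)
    then show ?case using zero by blast
  next
    case (insert i Y)
    show ?case
    proof (intro ballI impI)
      fix u assume u: "u \<in> carrier (direct_sum I N)" and s: "{j. u j \<noteq> \<zero>\<^bsub>N j\<^esub>} \<subseteq> insert i Y"
      show "P u"
      proof (cases "i \<in> I")
        case False
        then have "{j. u j \<noteq> \<zero>\<^bsub>N j\<^esub>} \<subseteq> Y" using s u by (auto simp: direct_sum_def)
        then show ?thesis using insert u by blast
      next
        case True
        let ?v = "u(i := \<zero>\<^bsub>N i\<^esub>)"
        have "finite {j. ?v j \<noteq> \<zero>\<^bsub>N j\<^esub>}"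
          by (rule finite_subset[of _ "{j. u j \<noteq> \<zero>\<^bsub>N j\<^esub>}"]) (use u in \<open>auto simp: direct_sum_def\<close>)
        then have v: "?v \<in> carrier (direct_sum I N)"
          using u by (auto simp: direct_sum_def)
        have "{j. ?v j \<noteq> \<zero>\<^bsub>N j\<^esub>} \<subseteq> Y" using s by auto
        then have "P ?v" using insert v by blast
        moreover have "u i \<in> carrier (N i)" using u by (simp add: direct_sum_def)
        moreover have "u = direct_sum_inj N i (u i) \<oplus>\<^bsub>direct_sum I N\<^esub> ?v"
          using u by (auto simp: direct_sum_def direct_sum_inj_def)
        ultimately show ?thesis using add v True by metis
      qed
    qed
  qed
  moreover have "finite {i. u i \<noteq> \<zero>\<^bsub>N i\<^esub>}" using u by (simp add: direct_sum_def)
  ultimately show ?thesis using u by blast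
qed

text \<open>Linear maps kill zero, so the values \<open>\<phi> i (u i)\<close> are supported where
  \<open>u\<close> is and can be added up.\<close>

lemma direct_sum_lift:
  assumes Q: "module R Q" and \<phi>: "\<And>i. i \<in> I \<Longrightarrow> lin R (N i) Q (\<phi> i)"
  shows "lin R (direct_sum I N) Q (\<lambda>u. supp_sum Q (\<lambda>i. \<phi> i (u i)) I)"
    and "i \<in> I \<Longrightarrow> x \<in> carrier (N i) \<Longrightarrow> supp_sum Q (\<lambda>j. \<phi> j (direct_sum_inj N i x j)) I = \<phi> i x"
proof -
  interpret Q: module R Q by fact
  have z: "\<phi> i \<zero>\<^bsub>N i\<^esub> = \<zero>\<^bsub>Q\<^esub>" if "i \<in> I" for i using lin_zero[OF \<phi>[OF that] N Q] .
  have cl: "\<phi> i (u i) \<in> carrier Q" if "u \<in> carrier (direct_sum I N)" "i \<in> I" for u i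
    using that by (auto simp: direct_sum_def intro!: lin_closed[OF \<phi>])
  have fin: "finite {i \<in> I. \<phi> i (u i) \<noteq> \<zero>\<^bsub>Q\<^esub>}" if u: "u \<in> carrier (direct_sum I N)" for u
    by (rule finite_subset[of _ "{i. u i \<noteq> \<zero>\<^bsub>N i\<^esub>}"]) (use u z in \<open>auto simp: direct_sum_def\<close>)
  show "lin R (direct_sum I N) Q (\<lambda>u. supp_sum Q (\<lambda>i. \<phi> i (u i)) I)"
  proof (rule linI)
    fix u v assume u: "u \<in> carrier (direct_sum I N)" and v: "v \<in> carrier (direct_sum I N)"
    show "supp_sum Q (\<lambda>i. \<phi> i (u i)) I \<in> carrier Q"
      by (rule Q.supp_sum_closed) (use cl u in auto)
    have e: "\<phi> i ((u \<oplus>\<^bsub>direct_sum I N\<^esub> v) i) = \<phi> i (u i) \<oplus>\<^bsub>Q\<^esub> \<phi> i (v i)" if "i \<in> I" for i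
      using u v lin_add[OF \<phi>[OF that]] by (simp add: direct_sum_def)
    have "supp_sum Q (\<lambda>i. \<phi> i ((u \<oplus>\<^bsub>direct_sum I N\<^esub> v) i)) I =
        supp_sum Q (\<lambda>i. \<phi> i (u i) \<oplus>\<^bsub>Q\<^esub> \<phi> i (v i)) I"
      unfolding supp_sum_def by (rule Q.M.add.finprod_cong') (use e cl u v in auto)
    then show "supp_sum Q (\<lambda>i. \<phi> i ((u \<oplus>\<^bsub>direct_sum I N\<^esub> v) i)) I =
        supp_sum Q (\<lambda>i. \<phi> i (u i)) I \<oplus>\<^bsub>Q\<^esub> supp_sum Q (\<lambda>i. \<phi> i (v i)) I"
      using Q.supp_sum_add[of I "\<lambda>i. \<phi> i (u i)" "\<lambda>i. \<phi> i (v i)"] u v cl fin by simp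
    fix a assume a: "a \<in> carrier R"
    have e: "\<phi> i ((a \<odot>\<^bsub>direct_sum I N\<^esub> u) i) = a \<odot>\<^bsub>Q\<^esub> \<phi> i (u i)" if "i \<in> I" for i
      using u a lin_smult[OF \<phi>[OF that]] by (simp add: direct_sum_def)
    have "supp_sum Q (\<lambda>i. \<phi> i ((a \<odot>\<^bsub>direct_sum I N\<^esub> u) i)) I = supp_sum Q (\<lambda>i. a \<odot>\<^bsub>Q\<^esub> \<phi> i (u i)) I"
      unfolding supp_sum_def by (rule Q.M.add.finprod_cong') (use e cl u a in auto)
    then show "supp_sum Q (\<lambda>i. \<phi> i ((a \<odot>\<^bsub>direct_sum I N\<^esub> u) i)) I = a \<odot>\<^bsub>Q\<^esub> supp_sum Q (\<lambda>i. \<phi> i (u i)) I"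
      using Q.supp_sum_smult[of I "\<lambda>i. \<phi> i (u i)" a] u a cl fin by simp
  qed
  assume i: "i \<in> I" "x \<in> carrier (N i)"
  have "supp_sum Q (\<lambda>j. \<phi> j (direct_sum_inj N i x j)) I = \<phi> i (direct_sum_inj N i x i)"
    by (rule Q.supp_sum_single) (use i z in \<open>auto simp: direct_sum_inj_def intro: lin_closed[OF \<phi>]\<close>)
  then show "supp_sum Q (\<lambda>j. \<phi> j (direct_sum_inj N i x j)) I = \<phi> i x"
    by (simp add: direct_sum_inj_def)
qed

lemma direct_sum_ext:
  assumes Q: "module R Q" and h: "lin R (direct_sum I N) Q h" and k: "lin R (direct_sum I N) Q k"
    and eq: "\<And>i x. i \<in> I \<Longrightarrow> x \<in> carrier (N i) \<Longrightarrow> h (direct_sum_inj N i x) = k (direct_sum_inj N i x)"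
    and u: "u \<in> carrier (direct_sum I N)"
  shows "h u = k u"
  using u
proof (rule direct_sum_induct)
  show "h \<zero>\<^bsub>direct_sum I N\<^esub> = k \<zero>\<^bsub>direct_sum I N\<^esub>"
    using lin_zero[OF h module_direct_sum Q] lin_zero[OF k module_direct_sum Q] by simp
  fix v i x assume v: "v \<in> carrier (direct_sum I N)" "h v = k v" and i: "i \<in> I" "x \<in> carrier (N i)"
  have "direct_sum_inj N i x \<in> carrier (direct_sum I N)"
    using lin_direct_sum_inj[OF i(1)] i(2) by (rule lin_closed)
  then show "h (direct_sum_inj N i x \<oplus>\<^bsub>direct_sum I N\<^esub> v) = k (direct_sum_inj N i x \<oplus>\<^bsub>direct_sum I N\<^esub> v)"
    using v i eq lin_add[OF h] lin_add[OF k] by simp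
qed

end

section \<open>Direct sums inside the universe\<close>

definition transport :: "('m \<Rightarrow> 'n) \<Rightarrow> ('r, 'm) module \<Rightarrow> ('r, 'n) module" where
  "transport \<phi> D = (let \<psi> = inv_into (carrier D) \<phi> in \<lparr>
     carrier = \<phi> ` carrier D, monoid.mult = undefined, one = undefined,
     ring.zero = \<phi> \<zero>\<^bsub>D\<^esub>,
     ring.add = (\<lambda>x y. \<phi> (\<psi> x \<oplus>\<^bsub>D\<^esub> \<psi> y)),
     smult = (\<lambda>a x. \<phi> (a \<odot>\<^bsub>D\<^esub> \<psi> x))\<rparr>)"

text \<open>The elements of \<open>direct_sum\<close> are functions, not elements of the universe.
  An injection on the carrier moves the whole structure to another type, and \<open>inv_into\<close>
  undoes it on the image.\<close>

lemma transport:
  assumes D: "module R D" and \<phi>: "inj_on \<phi> (carrier D)"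
  shows "module R (transport \<phi> D)" and "lin R D (transport \<phi> D) \<phi>"
    and "lin R (transport \<phi> D) D (inv_into (carrier D) \<phi>)"
    and "carrier (transport \<phi> D) = \<phi> ` carrier D"
proof -
  interpret D: module R D by fact
  note s = inv_into_f_f[OF \<phi>]
  show "module R (transport \<phi> D)"
  proof (rule moduleI)
    show "abelian_group (transport \<phi> D)"
    proof (rule abelian_groupI)
      fix x assume "x \<in> carrier (transport \<phi> D)"
      then obtain u where u: "u \<in> carrier D" "x = \<phi> u" by (auto simp: transport_def Let_def)
      then have "\<phi> (\<ominus>\<^bsub>D\<^esub> u) \<in> carrier (transport \<phi> D)"
        "\<phi> (\<ominus>\<^bsub>D\<^esub> u) \<oplus>\<^bsub>transport \<phi> D\<^esub> x = \<zero>\<^bsub>transport \<phi> D\<^esub>"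
        by (auto simp: transport_def Let_def s D.M.l_neg)
      then show "\<exists>y\<in>carrier (transport \<phi> D). y \<oplus>\<^bsub>transport \<phi> D\<^esub> x = \<zero>\<^bsub>transport \<phi> D\<^esub>" by blast
    qed (auto simp: transport_def Let_def s D.M.add.m_ac)
  qed (auto simp: transport_def Let_def s D.smult_l_distr D.smult_r_distr D.smult_assoc1 D.cring_axioms)
  show "lin R D (transport \<phi> D) \<phi>"
    by (rule linI) (auto simp: transport_def Let_def s)
  show "lin R (transport \<phi> D) D (inv_into (carrier D) \<phi>)"
    by (rule linI) (auto simp: transport_def Let_def s)
  show "carrier (transport \<phi> D) = \<phi> ` carrier D" by (simp add: transport_def Let_def)
qed

text \<open>The universal property is tested only against modules carried by \<open>'u\<close>.
  Existence and uniqueness are kept apart, and uniqueness means agreement on the carrier, so that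
  maps need not be extensional.\<close>

definition is_direct_sum ::
    "('r, 's) ring_scheme \<Rightarrow> 'i set \<Rightarrow> ('i \<Rightarrow> ('r, 'u) module) \<Rightarrow> ('r, 'u) module \<Rightarrow>
     ('i \<Rightarrow> 'u \<Rightarrow> 'u) \<Rightarrow> bool" where
  "is_direct_sum R I N D j \<longleftrightarrow> module R D \<and> (\<forall>i \<in> I. lin R (N i) D (j i)) \<and>
     (\<forall>(Q :: ('r, 'u) module) \<phi>. module R Q \<longrightarrow> (\<forall>i \<in> I. lin R (N i) Q (\<phi> i)) \<longrightarrow>
        (\<exists>h. lin R D Q h \<and> (\<forall>i \<in> I. \<forall>x \<in> carrier (N i). h (j i x) = \<phi> i x))) \<and>
     (\<forall>(Q :: ('r, 'u) module) h k. module R Q \<longrightarrow> lin R D Q h \<longrightarrow> lin R D Q k \<longrightarrow>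
        (\<forall>i \<in> I. \<forall>x \<in> carrier (N i). h (j i x) = k (j i x)) \<longrightarrow> (\<forall>z \<in> carrier D. h z = k z))"

lemma is_direct_sumD:
  fixes D :: "('r, 'u) module"
  assumes D: "is_direct_sum R I N D j"
  shows is_direct_sum_module: "module R D"
    and is_direct_sum_lin: "\<And>i. i \<in> I \<Longrightarrow> lin R (N i) D (j i)"
    and is_direct_sum_lift: "\<And>(Q :: ('r, 'u) module) \<phi>. module R Q \<Longrightarrow>
      (\<And>i. i \<in> I \<Longrightarrow> lin R (N i) Q (\<phi> i)) \<Longrightarrow>
      \<exists>h. lin R D Q h \<and> (\<forall>i \<in> I. \<forall>x \<in> carrier (N i). h (j i x) = \<phi> i x)"
    and is_direct_sum_ext: "\<And>(Q :: ('r, 'u) module) h k z. module R Q \<Longrightarrow> lin R D Q h \<Longrightarrow> lin R D Q k \<Longrightarrow>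
      (\<And>i x. i \<in> I \<Longrightarrow> x \<in> carrier (N i) \<Longrightarrow> h (j i x) = k (j i x)) \<Longrightarrow> z \<in> carrier D \<Longrightarrow> h z = k z"
  by (fact D[unfolded is_direct_sum_def, THEN conjunct1]
      D[unfolded is_direct_sum_def, THEN conjunct2, THEN conjunct1, rule_format]
      D[unfolded is_direct_sum_def, THEN conjunct2, THEN conjunct2, THEN conjunct1, rule_format]
      D[unfolded is_direct_sum_def, THEN conjunct2, THEN conjunct2, THEN conjunct2, rule_format])+

text \<open>A finitely supported family is encoded in the universe \<open>'u\<close> by its finite graph.\<close>

lemma direct_sum_exists:
  fixes N :: "'i \<Rightarrow> ('r, 'u) module"
  assumes R: "cring R" and N: "\<And>i. module R (N i)"
    and I: "I \<lesssim> (UNIV :: 'u set)" and inf: "infinite (UNIV :: 'u set)"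
  shows "\<exists>D j. is_direct_sum R I N D j"
proof -
  have "carrier (direct_sum I N) \<subseteq> {f. f ` I \<subseteq> UNIV \<and> {x. f x \<noteq> \<zero>\<^bsub>N x\<^esub>} \<subseteq> I \<and> finite {x. f x \<noteq> \<zero>\<^bsub>N x\<^esub>}}"
    by (auto simp: direct_sum_def)
  then have "carrier (direct_sum I N) \<lesssim> Fpow (I \<times> (UNIV :: 'u set))"
    by (rule lepoll_trans[OF subset_imp_lepoll lepoll_restricted_funspace])
  also have "\<dots> \<lesssim> Fpow (UNIV :: 'u set)"
  proof -
    have "I \<times> (UNIV :: 'u set) \<lesssim> (UNIV :: 'u set) \<times> (UNIV :: 'u set)"
      by (rule times_lepoll_mono) (use I in auto)
    also have "\<dots> \<approx> (UNIV :: 'u set)"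
      using card_of_Times_same_infinite[OF inf] by (simp add: eqpoll_iff_card_of_ordIso)
    finally obtain f :: "'i \<times> 'u \<Rightarrow> 'u" where f: "inj_on f (I \<times> UNIV)"
      unfolding lepoll_def by (elim exE conjE)
    have "inj_on ((`) f) (Fpow (I \<times> UNIV))"
      using f by (rule inj_on_image_Fpow)
    moreover have "(`) f ` Fpow (I \<times> UNIV) \<subseteq> Fpow (UNIV :: 'u set)"
      by (rule image_Fpow_mono) simp
    ultimately show ?thesis unfolding lepoll_def by (intro exI conjI)
  qed
  also have "\<dots> \<approx> (UNIV :: 'u set)"
    using inf by (rule eqpoll_Fpow)
  finally obtain \<phi> :: "('i \<Rightarrow> 'u) \<Rightarrow> 'u" where \<phi>: "inj_on \<phi> (carrier (direct_sum I N))"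
    unfolding lepoll_def by (elim exE conjE)
  let ?D = "transport \<phi> (direct_sum I N)"
  let ?\<psi> = "inv_into (carrier (direct_sum I N)) \<phi>"
  note mD = module_direct_sum[OF R N]
  note T = transport[OF mD \<phi>]
  have inj: "lin R (N i) (direct_sum I N) (direct_sum_inj N i)" if "i \<in> I" for i
    using R N that by (rule lin_direct_sum_inj)
  have injc: "direct_sum_inj N i x \<in> carrier (direct_sum I N)" if "i \<in> I" "x \<in> carrier (N i)" for i x
    using lin_closed[OF inj] that by auto
  have "is_direct_sum R I N ?D (\<lambda>i x. \<phi> (direct_sum_inj N i x))"
    unfolding is_direct_sum_def
  proof (intro conjI allI impI ballI)
    show "module R ?D" by (rule T)
    show "lin R (N i) ?D (\<lambda>x. \<phi> (direct_sum_inj N i x))" if "i \<in> I" for i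
      using lin_comp[OF inj T(2)] that by auto
  next
    fix Q :: "('r, 'u) module" and \<theta> assume Q: "module R Q" and \<theta>: "\<forall>i\<in>I. lin R (N i) Q (\<theta> i)"
    note L = direct_sum_lift[OF R N Q \<theta>[rule_format]]
    have "lin R ?D Q (\<lambda>z. supp_sum Q (\<lambda>i. \<theta> i (?\<psi> z i)) I)"
      by (rule lin_comp[OF T(3) L(1)])
    moreover have "supp_sum Q (\<lambda>k. \<theta> k (?\<psi> (\<phi> (direct_sum_inj N i x)) k)) I = \<theta> i x"
      if "i \<in> I" "x \<in> carrier (N i)" for i x
      using L(2) that injc[OF that] by (simp add: inv_into_f_f[OF \<phi>])
    ultimately show "\<exists>h. lin R ?D Q h \<and> (\<forall>i\<in>I. \<forall>x\<in>carrier (N i). h (\<phi> (direct_sum_inj N i x)) = \<theta> i x)"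
      by blast
  next
    fix Q :: "('r, 'u) module" and h k z
    assume Q: "module R Q" and h: "lin R ?D Q h" and k: "lin R ?D Q k"
      and eq: "\<forall>i\<in>I. \<forall>x\<in>carrier (N i). h (\<phi> (direct_sum_inj N i x)) = k (\<phi> (direct_sum_inj N i x))"
      and z: "z \<in> carrier ?D"
    obtain u where u: "u \<in> carrier (direct_sum I N)" "z = \<phi> u" using z T(4) by auto
    show "h z = k z"
      using direct_sum_ext[OF R N Q lin_comp[OF T(2) h] lin_comp[OF T(2) k] _ u(1)] eq u by auto
  qed
  then show ?thesis by blast
qed


section \<open>Free modules as direct sums of copies of the ring\<close>

definition regular_mod :: "('r, 's) ring_scheme \<Rightarrow> ('r, 'r) module" where
  "regular_mod R = \<lparr>carrier = carrier R, monoid.mult = undefined, one = undefined,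
     ring.zero = \<zero>\<^bsub>R\<^esub>, ring.add = add R, smult = monoid.mult R\<rparr>"

text \<open>A literal equality of records: both sides also set \<open>mult\<close> and
  \<open>one\<close> to \<open>undefined\<close>. Free modules thereby inherit everything proved for
  direct sums.\<close>

lemma free_mod_eq_direct_sum: "free_mod R X = direct_sum X (\<lambda>_. regular_mod R)"
  by (auto simp: free_mod_def direct_sum_def regular_mod_def)

lemma free_gen_eq: "free_gen R x = direct_sum_inj (\<lambda>_. regular_mod R) x \<one>\<^bsub>R\<^esub>"
  by (auto simp: free_gen_def direct_sum_inj_def regular_mod_def)

lemma free_mod_mono: "X \<subseteq> Y \<Longrightarrow> u \<in> carrier (free_mod R X) \<Longrightarrow> u \<in> carrier (free_mod R Y)"
  by (auto simp: free_mod_def)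

context
  fixes R :: "('r, 's) ring_scheme"
  assumes R: "cring R"
begin

interpretation R: cring R by (rule R)

lemma module_regular_mod: "module R (regular_mod R)"
proof (rule moduleI[OF R])
  show "abelian_group (regular_mod R)"
    by (rule abelian_groupI) (auto simp: regular_mod_def R.a_ac intro: R.l_neg)
qed (simp_all add: regular_mod_def R.l_distr R.r_distr R.m_assoc)

lemma module_free_mod: "module R (free_mod R X)"
  unfolding free_mod_eq_direct_sum by (rule module_direct_sum[OF R module_regular_mod])

lemma free_gen_closed: "x \<in> X \<Longrightarrow> free_gen R x \<in> carrier (free_mod R X)"
  unfolding free_mod_eq_direct_sum free_gen_eq
  by (rule lin_closed[OF lin_direct_sum_inj[OF R module_regular_mod]]) (simp_all add: regular_mod_def)

text \<open>A family concentrated at \<open>x\<close> with value \<open>a\<close> is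
  \<open>a\<close> times the generator of \<open>x\<close>, so agreement on generators gives
  agreement on each summand.\<close>

lemma free_mod_ext:
  assumes Q: "module R Q" and h: "lin R (free_mod R X) Q h" and k: "lin R (free_mod R X) Q k"
    and eq: "\<And>x. x \<in> X \<Longrightarrow> h (free_gen R x) = k (free_gen R x)" and u: "u \<in> carrier (free_mod R X)"
  shows "h u = k u"
proof (rule direct_sum_ext[OF R module_regular_mod Q h[unfolded free_mod_eq_direct_sum]
      k[unfolded free_mod_eq_direct_sum] _ u[unfolded free_mod_eq_direct_sum]])
  fix x a assume x: "x \<in> X" and "a \<in> carrier (regular_mod R)"
  then have a: "a \<in> carrier R" by (simp add: regular_mod_def)
  then have "direct_sum_inj (\<lambda>_. regular_mod R) x a = a \<odot>\<^bsub>free_mod R X\<^esub> free_gen R x"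
    by (auto simp: direct_sum_inj_def regular_mod_def free_mod_def free_gen_def)
  then show "h (direct_sum_inj (\<lambda>_. regular_mod R) x a) = k (direct_sum_inj (\<lambda>_. regular_mod R) x a)"
    using lin_smult[OF h a free_gen_closed[OF x]] lin_smult[OF k a free_gen_closed[OF x]] eq[OF x] by simp
qed

end

text \<open>\<open>free_lift\<close> sums over the support of the coefficients, which may exceed the
  support of the products \<open>u x \<odot> \<phi> x\<close>; the difference contributes
  zeros.\<close>

lemma free_lift_supp_sum:
  assumes Q: "module R Q" and \<phi>: "\<And>x. x \<in> X \<Longrightarrow> \<phi> x \<in> carrier Q" and u: "u \<in> carrier (free_mod R X)"
  shows "free_lift R X Q \<phi> u = supp_sum Q (\<lambda>x. u x \<odot>\<^bsub>Q\<^esub> \<phi> x) X"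
proof -
  interpret Q: module R Q by fact
  have "finite {x \<in> X. u x \<noteq> \<zero>\<^bsub>R\<^esub>}" using u by (auto simp: free_mod_def)
  then have "supp_sum Q (\<lambda>x. u x \<odot>\<^bsub>Q\<^esub> \<phi> x) X = finsum Q (\<lambda>x. u x \<odot>\<^bsub>Q\<^esub> \<phi> x) {x \<in> X. u x \<noteq> \<zero>\<^bsub>R\<^esub>}"
    by (rule Q.supp_sum_eq) (use \<phi> u in \<open>auto simp: free_mod_def\<close>)
  then show ?thesis using u by (simp add: free_lift_def)
qed

lemma free_lift:
  assumes Q: "module R Q" and \<phi>: "\<And>x. x \<in> X \<Longrightarrow> \<phi> x \<in> carrier Q"
  shows lin_free_lift: "lin R (free_mod R X) Q (free_lift R X Q \<phi>)"
    and free_lift_gen: "x \<in> X \<Longrightarrow> free_lift R X Q \<phi> (free_gen R x) = \<phi> x"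
proof -
  interpret Q: module R Q by fact
  note R = Q.cring_axioms
  have "lin R (regular_mod R) Q (\<lambda>a. a \<odot>\<^bsub>Q\<^esub> \<phi> x)" if "x \<in> X" for x
    using \<phi>[OF that] by (intro linI) (simp_all add: regular_mod_def Q.smult_l_distr Q.smult_assoc1)
  note L = direct_sum_lift[OF R module_regular_mod[OF R] Q this, of X]
  show "lin R (free_mod R X) Q (free_lift R X Q \<phi>)"
    by (rule lin_cong[OF L(1)[folded free_mod_eq_direct_sum] module_free_mod[OF R]])
       (use \<phi> in \<open>simp_all add: free_lift_supp_sum[OF Q]\<close>)
  show "free_lift R X Q \<phi> (free_gen R x) = \<phi> x" if x: "x \<in> X"
    using L(2)[where i = x and x = "\<one>\<^bsub>R\<^esub>"] \<phi> x free_lift_supp_sum[OF Q \<phi> free_gen_closed[OF R x]]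
    by (simp add: free_gen_eq regular_mod_def)
qed

text \<open>Evaluates an otherwise unknown linear map from its values on generators; the rules for
  pushing linear maps through \<open>free_lift\<close> and for replacing its family are
  instances.\<close>

lemma free_lift_unique:
  assumes Q: "module R Q" and h: "lin R (free_mod R X) Q h" and u: "u \<in> carrier (free_mod R X)"
    and eq: "\<And>x. x \<in> X \<Longrightarrow> h (free_gen R x) = \<phi> x"
  shows "h u = free_lift R X Q \<phi> u"
proof -
  have R: "cring R" using Q by (simp add: module_def)
  have \<phi>: "\<phi> x \<in> carrier Q" if "x \<in> X" for x
    using eq[OF that] lin_closed[OF h] free_gen_closed[OF R that] by metis
  show ?thesis
    by (rule free_mod_ext[OF R Q h lin_free_lift[OF Q] _ u]) (use \<phi> eq in \<open>auto simp: free_lift_gen[OF Q]\<close>)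
qed

lemma free_lift_lin:
  assumes Q: "module R Q" and P: "module R P" and \<phi>: "\<And>x. x \<in> X \<Longrightarrow> \<phi> x \<in> carrier Q"
    and h: "lin R Q P h" and u: "u \<in> carrier (free_mod R X)"
  shows "h (free_lift R X Q \<phi> u) = free_lift R X P (\<lambda>x. h (\<phi> x)) u"
  by (rule free_lift_unique[OF P lin_comp[OF lin_free_lift[OF Q] h] u])
     (use \<phi> in \<open>auto simp: free_lift_gen[OF Q]\<close>)

lemma free_lift_cong:
  assumes Q: "module R Q" and \<phi>: "\<And>x. x \<in> X \<Longrightarrow> \<phi> x \<in> carrier Q"
    and eq: "\<And>x. x \<in> X \<Longrightarrow> \<phi> x = \<psi> x" and u: "u \<in> carrier (free_mod R X)"
  shows "free_lift R X Q \<phi> u = free_lift R X Q \<psi> u"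
  by (rule free_lift_unique[OF Q lin_free_lift[OF Q] u]) (use \<phi> eq in \<open>auto simp: free_lift_gen[OF Q]\<close>)

text \<open>Coefficients on the part of \<open>X\<close> outside \<open>Y\<close> are zero, so only
  values in \<open>H\<close> contribute. The intended \<open>u\<close> is \<open>1 - p\<close>,
  which (p4) places in the free module on the arrows outside both \<open>E\<close> and
  \<open>M\<close>.\<close>

lemma free_lift_in:
  assumes Q: "module R Q" and \<phi>: "\<And>x. x \<in> X \<Longrightarrow> \<phi> x \<in> carrier Q" and u: "u \<in> carrier (free_mod R Y)"
    and YX: "Y \<subseteq> X"
    and H: "\<zero>\<^bsub>Q\<^esub> \<in> H" "\<And>x y. x \<in> H \<Longrightarrow> y \<in> H \<Longrightarrow> x \<oplus>\<^bsub>Q\<^esub> y \<in> H" "H \<subseteq> carrier Q"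
    "\<And>a x. a \<in> carrier R \<Longrightarrow> x \<in> H \<Longrightarrow> a \<odot>\<^bsub>Q\<^esub> x \<in> H"
    and in_H: "\<And>x. x \<in> Y \<Longrightarrow> \<phi> x \<in> H"
  shows "free_lift R X Q \<phi> u \<in> H"
proof -
  interpret Q: module R Q by fact
  have uX: "u \<in> carrier (free_mod R X)" using u YX free_mod_mono by blast
  have c: "u x \<in> carrier R" for x using u by (auto simp: free_mod_def)
  have "u x \<odot>\<^bsub>Q\<^esub> \<phi> x \<in> H" if "x \<in> X" for x
  proof (cases "x \<in> Y")
    case True
    then show ?thesis using H(4) c in_H by blast
  next
    case False
    then have "u x = \<zero>\<^bsub>R\<^esub>" using u by (auto simp: free_mod_def)
    then show ?thesis using that \<phi> H(1) by simp
  qed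
  with H(1-3) have "supp_sum Q (\<lambda>x. u x \<odot>\<^bsub>Q\<^esub> \<phi> x) X \<in> H"
    by (rule Q.supp_sum_in)
  then show ?thesis
    using \<phi> uX by (simp add: free_lift_supp_sum[OF Q])
qed

section \<open>Functor categories and categories of modules\<close>

context category
begin

lemma Hom_Obj: "f \<in> Hom C A B \<Longrightarrow> A \<in> Obj C \<and> B \<in> Obj C"
  using Dom_in_Obj Cod_in_Obj by (auto simp: Hom_def)

lemma invertible_inverse:
  assumes "invertible C f"
  obtains g where "g \<in> Hom C (Cod C f) (Dom C f)" "g \<cdot> f = Idn C (Dom C f)" "f \<cdot> g = Idn C (Cod C f)"
    "invertible C g"
proof -
  obtain g where g: "g \<in> Hom C (Cod C f) (Dom C f)" "g \<cdot> f = Idn C (Dom C f)" "f \<cdot> g = Idn C (Cod C f)"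
    and f: "f \<in> Arr C"
    using assms unfolding invertible_def by blast
  moreover have "invertible C g"
    using g f unfolding invertible_def by (intro conjI bexI[of _ f]) (auto simp: Hom_def)
  ultimately show thesis using that by blast
qed

lemma isomorphic_sym: "isomorphic C A B \<Longrightarrow> isomorphic C B A"
  unfolding isomorphic_def
  by (elim bexE, erule invertible_inverse) (auto simp: Hom_def)

end

lemma functor_cat_simps [simp]:
  "Obj (functor_cat C D) = {T. is_functor C D T}"
  "Arr (functor_cat C D) = {(S, \<alpha>, T). is_nat_tr C D S \<alpha> T}"
  "Dom (functor_cat C D) (S, \<alpha>, T) = S"
  "Cod (functor_cat C D) (S, \<alpha>, T) = T"
  "Idn (functor_cat C D) T = (T, \<lambda>A \<in> Obj C. Idn D (fobj T A), T)"
  "(S', \<beta>, T') \<cdot>\<^bsub>functor_cat C D\<^esub> (S, \<alpha>, T) = (S, \<lambda>A \<in> Obj C. \<beta> A \<cdot>\<^bsub>D\<^esub> \<alpha> A, T')"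
  by (simp_all add: functor_cat_def)

lemma Hom_functor_cat: "\<phi> \<in> Hom (functor_cat C D) S T \<longleftrightarrow> (\<exists>\<alpha>. \<phi> = (S, \<alpha>, T) \<and> is_nat_tr C D S \<alpha> T)"
  by (cases \<phi>) (auto simp: Hom_def)

lemma is_nat_tr_id: "category C \<Longrightarrow> category D \<Longrightarrow> is_functor C D T \<Longrightarrow>
    is_nat_tr C D T (\<lambda>A \<in> Obj C. Idn D (fobj T A)) T"
proof -
  assume "category C" "category D" and T: "is_functor C D T"
  interpret C: category C by fact
  interpret D: category D by fact
  have "farr T f \<in> Hom D (fobj T (Dom C f)) (fobj T (Cod C f))" if "f \<in> Arr C" for f
    using T that unfolding is_functor_def Hom_def by auto
  moreover have "fobj T A \<in> Obj D" if "A \<in> Obj C" for A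
    using T that unfolding is_functor_def by auto
  moreover have "Idn D (fobj T (Cod C f)) \<cdot>\<^bsub>D\<^esub> farr T f = farr T f \<cdot>\<^bsub>D\<^esub> Idn D (fobj T (Dom C f))"
    if "f \<in> Arr C" for f
    using calculation(1)[OF that] by (simp add: D.Cmp_Idn_left D.Cmp_Idn_right)
  ultimately show ?thesis
    using T unfolding is_nat_tr_def
    by (auto simp: C.Dom_in_Obj C.Cod_in_Obj D.Idn_in_Hom)
qed

lemma is_nat_tr_comp:
  assumes "category C" "category D" and \<alpha>: "is_nat_tr C D S \<alpha> T" and \<beta>: "is_nat_tr C D T \<beta> P"
  shows "is_nat_tr C D S (\<lambda>A \<in> Obj C. \<beta> A \<cdot>\<^bsub>D\<^esub> \<alpha> A) P"
proof -
  interpret C: category C by fact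
  interpret D: category D by fact
  have Sf: "farr S f \<in> Hom D (fobj S (Dom C f)) (fobj S (Cod C f))"
    and Tf: "farr T f \<in> Hom D (fobj T (Dom C f)) (fobj T (Cod C f))"
    and Pf: "farr P f \<in> Hom D (fobj P (Dom C f)) (fobj P (Cod C f))" if "f \<in> Arr C" for f
    using \<alpha> \<beta> that unfolding is_functor_def is_nat_tr_def Hom_def by auto
  have a: "\<alpha> A \<in> Hom D (fobj S A) (fobj T A)" and b: "\<beta> A \<in> Hom D (fobj T A) (fobj P A)" if "A \<in> Obj C" for A
    using \<alpha> \<beta> that unfolding is_nat_tr_def by auto
  have "(\<beta> (Cod C f) \<cdot>\<^bsub>D\<^esub> \<alpha> (Cod C f)) \<cdot>\<^bsub>D\<^esub> farr S f = farr P f \<cdot>\<^bsub>D\<^esub> \<beta> (Dom C f) \<cdot>\<^bsub>D\<^esub> \<alpha> (Dom C f)"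
    if f: "f \<in> Arr C" for f
  proof -
    note o = C.Dom_in_Obj[OF f] C.Cod_in_Obj[OF f]
    have "(\<beta> (Cod C f) \<cdot>\<^bsub>D\<^esub> \<alpha> (Cod C f)) \<cdot>\<^bsub>D\<^esub> farr S f = \<beta> (Cod C f) \<cdot>\<^bsub>D\<^esub> (\<alpha> (Cod C f) \<cdot>\<^bsub>D\<^esub> farr S f)"
      using D.Cmp_assoc[OF Sf[OF f] a[OF o(2)] b[OF o(2)]] .
    also have "\<dots> = \<beta> (Cod C f) \<cdot>\<^bsub>D\<^esub> (farr T f \<cdot>\<^bsub>D\<^esub> \<alpha> (Dom C f))"
      using \<alpha> f unfolding is_nat_tr_def by auto
    also have "\<dots> = (\<beta> (Cod C f) \<cdot>\<^bsub>D\<^esub> farr T f) \<cdot>\<^bsub>D\<^esub> \<alpha> (Dom C f)"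
      using D.Cmp_assoc[OF a[OF o(1)] Tf[OF f] b[OF o(2)]] by simp
    also have "\<dots> = (farr P f \<cdot>\<^bsub>D\<^esub> \<beta> (Dom C f)) \<cdot>\<^bsub>D\<^esub> \<alpha> (Dom C f)"
      using \<beta> f unfolding is_nat_tr_def by auto
    also have "\<dots> = farr P f \<cdot>\<^bsub>D\<^esub> \<beta> (Dom C f) \<cdot>\<^bsub>D\<^esub> \<alpha> (Dom C f)"
      using D.Cmp_assoc[OF a[OF o(1)] b[OF o(1)] Pf[OF f]] .
    finally show ?thesis .
  qed
  moreover have "\<beta> A \<cdot>\<^bsub>D\<^esub> \<alpha> A \<in> Hom D (fobj S A) (fobj P A)" if "A \<in> Obj C" for A
    using a[OF that] b[OF that] by (rule D.Cmp_in_Hom)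
  ultimately show ?thesis
    using \<alpha> \<beta> unfolding is_nat_tr_def by (auto simp: C.Dom_in_Obj C.Cod_in_Obj)
qed

lemma category_functor_cat:
  assumes C: "category C" and D: "category D"
  shows "category (functor_cat C D)"
proof -
  interpret C: category C by fact
  interpret D: category D by fact
  \<comment> \<open>Components are extensional, so the restriction that composition introduces
    changes nothing and the identity laws are equalities.\<close>
  have restr: "(\<lambda>A \<in> Obj C. \<alpha> A) = \<alpha>" if "is_nat_tr C D S \<alpha> T" for \<alpha> S T
    using that by (auto simp: is_nat_tr_def extensional_def)
  have Hom: "\<alpha> A \<in> Hom D (fobj S A) (fobj T A)" if "is_nat_tr C D S \<alpha> T" "A \<in> Obj C" for \<alpha> S T A
    using that by (auto simp: is_nat_tr_def)
  show ?thesis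
  proof
    fix f assume "f \<in> Arr (functor_cat C D)"
    then obtain S \<alpha> T where "f = (S, \<alpha>, T)" "is_nat_tr C D S \<alpha> T" by auto
    then show "Dom (functor_cat C D) f \<in> Obj (functor_cat C D)" "Cod (functor_cat C D) f \<in> Obj (functor_cat C D)"
      by (auto simp: is_nat_tr_def)
  next
    fix A assume "A \<in> Obj (functor_cat C D)"
    then show "Idn (functor_cat C D) A \<in> Hom (functor_cat C D) A A"
      using is_nat_tr_id[OF C D] by (simp add: Hom_functor_cat)
  next
    fix f g A B P assume "f \<in> Hom (functor_cat C D) A B" "g \<in> Hom (functor_cat C D) B P"
    then show "g \<cdot>\<^bsub>functor_cat C D\<^esub> f \<in> Hom (functor_cat C D) A P"
      using is_nat_tr_comp[OF C D] by (auto simp: Hom_functor_cat)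
  next
    fix f A B assume f: "f \<in> Hom (functor_cat C D) A B"
    then obtain \<alpha> where \<alpha>: "f = (A, \<alpha>, B)" "is_nat_tr C D A \<alpha> B" by (auto simp: Hom_functor_cat)
    show "Idn (functor_cat C D) B \<cdot>\<^bsub>functor_cat C D\<^esub> f = f"
      using \<alpha> restr[OF \<alpha>(2)] D.Cmp_Idn_left[OF Hom[OF \<alpha>(2)]] by (simp cong: restrict_cong)
    show "f \<cdot>\<^bsub>functor_cat C D\<^esub> Idn (functor_cat C D) A = f"
      using \<alpha> restr[OF \<alpha>(2)] D.Cmp_Idn_right[OF Hom[OF \<alpha>(2)]] by (simp cong: restrict_cong)
  next
    fix f g h A B P Q
    assume "f \<in> Hom (functor_cat C D) A B" "g \<in> Hom (functor_cat C D) B P" "h \<in> Hom (functor_cat C D) P Q"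
    then obtain \<alpha> \<beta> \<gamma> where \<alpha>: "f = (A, \<alpha>, B)" "is_nat_tr C D A \<alpha> B" and \<beta>: "g = (B, \<beta>, P)" "is_nat_tr C D B \<beta> P"
      and \<gamma>: "h = (P, \<gamma>, Q)" "is_nat_tr C D P \<gamma> Q" by (auto simp: Hom_functor_cat)
    show "(h \<cdot>\<^bsub>functor_cat C D\<^esub> g) \<cdot>\<^bsub>functor_cat C D\<^esub> f = h \<cdot>\<^bsub>functor_cat C D\<^esub> (g \<cdot>\<^bsub>functor_cat C D\<^esub> f)"
      using \<alpha> \<beta> \<gamma> D.Cmp_assoc[OF Hom[OF \<alpha>(2)] Hom[OF \<beta>(2)] Hom[OF \<gamma>(2)]] by (simp cong: restrict_cong)
  qed
qed

text \<open>Naturality of the pointwise inverses is automatic: insert \<open>\<alpha>\<close> after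
  \<open>\<beta>\<close> at the source, slide the arrow past \<open>\<alpha>\<close>, and cancel
  \<open>\<beta>\<close> after \<open>\<alpha>\<close> at the target.\<close>

lemma invertible_functor_cat:
  assumes "category C" "category D" and \<alpha>: "is_nat_tr C D S \<alpha> T"
    and inv: "\<And>A. A \<in> Obj C \<Longrightarrow> invertible D (\<alpha> A)"
  shows "invertible (functor_cat C D) (S, \<alpha>, T)"
proof -
  interpret C: category C by fact
  interpret D: category D by fact
  have a: "\<alpha> A \<in> Hom D (fobj S A) (fobj T A)" if "A \<in> Obj C" for A
    using \<alpha> that unfolding is_nat_tr_def by auto
  have "\<exists>g. g \<in> Hom D (fobj T A) (fobj S A) \<and> g \<cdot>\<^bsub>D\<^esub> \<alpha> A = Idn D (fobj S A) \<and> \<alpha> A \<cdot>\<^bsub>D\<^esub> g = Idn D (fobj T A)"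
    if "A \<in> Obj C" for A
    using inv[OF that] a[OF that] unfolding invertible_def Hom_def by auto
  then obtain \<beta> where b: "\<And>A. A \<in> Obj C \<Longrightarrow> \<beta> A \<in> Hom D (fobj T A) (fobj S A)"
    and ba: "\<And>A. A \<in> Obj C \<Longrightarrow> \<beta> A \<cdot>\<^bsub>D\<^esub> \<alpha> A = Idn D (fobj S A)"
    and ab: "\<And>A. A \<in> Obj C \<Longrightarrow> \<alpha> A \<cdot>\<^bsub>D\<^esub> \<beta> A = Idn D (fobj T A)" by metis
  have Sf: "farr S f \<in> Hom D (fobj S (Dom C f)) (fobj S (Cod C f))"
    and Tf: "farr T f \<in> Hom D (fobj T (Dom C f)) (fobj T (Cod C f))" if "f \<in> Arr C" for f
    using \<alpha> that unfolding is_functor_def is_nat_tr_def Hom_def by auto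
  have nat: "\<beta> (Cod C f) \<cdot>\<^bsub>D\<^esub> farr T f = farr S f \<cdot>\<^bsub>D\<^esub> \<beta> (Dom C f)" if f: "f \<in> Arr C" for f
  proof -
    note o = C.Dom_in_Obj[OF f] C.Cod_in_Obj[OF f]
    note S = Sf[OF f] and T = Tf[OF f]
    have "\<beta> (Cod C f) \<cdot>\<^bsub>D\<^esub> farr T f = \<beta> (Cod C f) \<cdot>\<^bsub>D\<^esub> (farr T f \<cdot>\<^bsub>D\<^esub> (\<alpha> (Dom C f) \<cdot>\<^bsub>D\<^esub> \<beta> (Dom C f)))"
      using T by (simp add: ab[OF o(1)] D.Cmp_Idn_right)
    also have "\<dots> = \<beta> (Cod C f) \<cdot>\<^bsub>D\<^esub> ((farr T f \<cdot>\<^bsub>D\<^esub> \<alpha> (Dom C f)) \<cdot>\<^bsub>D\<^esub> \<beta> (Dom C f))"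
      using D.Cmp_assoc[OF b[OF o(1)] a[OF o(1)] T] by simp
    also have "\<dots> = \<beta> (Cod C f) \<cdot>\<^bsub>D\<^esub> ((\<alpha> (Cod C f) \<cdot>\<^bsub>D\<^esub> farr S f) \<cdot>\<^bsub>D\<^esub> \<beta> (Dom C f))"
      using \<alpha> f unfolding is_nat_tr_def by simp
    also have "\<dots> = \<beta> (Cod C f) \<cdot>\<^bsub>D\<^esub> (\<alpha> (Cod C f) \<cdot>\<^bsub>D\<^esub> (farr S f \<cdot>\<^bsub>D\<^esub> \<beta> (Dom C f)))"
      using D.Cmp_assoc[OF b[OF o(1)] S a[OF o(2)]] by simp
    also have "\<dots> = (\<beta> (Cod C f) \<cdot>\<^bsub>D\<^esub> \<alpha> (Cod C f)) \<cdot>\<^bsub>D\<^esub> (farr S f \<cdot>\<^bsub>D\<^esub> \<beta> (Dom C f))"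
      using D.Cmp_assoc[OF D.Cmp_in_Hom[OF b[OF o(1)] S] a[OF o(2)] b[OF o(2)]] by simp
    also have "\<dots> = farr S f \<cdot>\<^bsub>D\<^esub> \<beta> (Dom C f)"
      using D.Cmp_Idn_left[OF D.Cmp_in_Hom[OF b[OF o(1)] S]] by (simp add: ba[OF o(2)])
    finally show ?thesis .
  qed
  have "is_nat_tr C D T (\<lambda>A \<in> Obj C. \<beta> A) S"
    using \<alpha> b nat unfolding is_nat_tr_def by (auto simp: C.Dom_in_Obj C.Cod_in_Obj)
  then have "(T, \<lambda>A \<in> Obj C. \<beta> A, S) \<in> Hom (functor_cat C D) T S"
    unfolding Hom_functor_cat by blast
  then show ?thesis
    unfolding invertible_def using \<alpha>
    by (intro conjI bexI[of _ "(T, \<lambda>A \<in> Obj C. \<beta> A, S)"])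
       (auto simp: ab ba restrict_def fun_eq_iff)
qed

lemma is_functor_id: "category C \<Longrightarrow> is_functor C C (functor_id C)"
proof -
  assume "category C"
  then interpret category C .
  have "g \<cdot>\<^bsub>C\<^esub> f \<in> Arr C" if "f \<in> Arr C" "g \<in> Arr C" "Cod C f = Dom C g" for f g
    using Cmp_in_Hom[of f _ _ g "Cod C g"] that by (auto simp: Hom_def)
  then show ?thesis
    using Idn_in_Hom Dom_in_Obj Cod_in_Obj by (auto simp: is_functor_def functor_id_def Hom_def)
qed

lemma is_functor_comp:
  assumes "category C" and T: "is_functor C D T" and S: "is_functor D P S"
  shows "is_functor C P (functor_comp C S T)"
proof -
  interpret category C by fact
  have c: "g \<cdot>\<^bsub>C\<^esub> f \<in> Arr C" if "f \<in> Arr C" "g \<in> Arr C" "Cod C f = Dom C g" for f g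
    using Cmp_in_Hom[of f _ _ g "Cod C g"] that by (auto simp: Hom_def)
  have To: "\<And>A. A \<in> Obj C \<Longrightarrow> fobj T A \<in> Obj D" and Ta: "\<And>f. f \<in> Arr C \<Longrightarrow> farr T f \<in> Arr D"
    using T by (auto simp: is_functor_def)
  have So: "\<And>A. A \<in> Obj D \<Longrightarrow> fobj S A \<in> Obj P" and Sa: "\<And>f. f \<in> Arr D \<Longrightarrow> farr S f \<in> Arr P"
    using S by (auto simp: is_functor_def)
  have "Idn C A \<in> Arr C" if "A \<in> Obj C" for A
    using Idn_in_Hom[OF that] by (auto simp: Hom_def)
  then show ?thesis
    using T S unfolding is_functor_def functor_comp_def
    by (simp add: To Ta So Sa Dom_in_Obj Cod_in_Obj c)
qed

section \<open>The category of modules\<close>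

lemma mod_cat_simps [simp]:
  "Obj (mod_cat R) = {M. module R M}"
  "Arr (mod_cat R) = {(M, f, N). module R M \<and> module R N \<and> f \<in> linear_maps R M N}"
  "Dom (mod_cat R) (M, f, N) = M"
  "Cod (mod_cat R) (M, f, N) = N"
  "Idn (mod_cat R) M = (M, \<lambda>x \<in> carrier M. x, M)"
  "(M', g, N') \<cdot>\<^bsub>mod_cat R\<^esub> (M, f, N) = (M, compose (carrier M) g f, N')"
  by (simp_all add: mod_cat_def)

lemma Hom_mod_cat: "a \<in> Hom (mod_cat R) M N \<longleftrightarrow>
    (\<exists>f. a = (M, f, N) \<and> module R M \<and> module R N \<and> f \<in> linear_maps R M N)"
  by (cases a) (auto simp: Hom_def)

lemma linear_maps_lin: "f \<in> linear_maps R M N \<Longrightarrow> lin R M N f"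
  by (simp add: linear_maps_iff)

lemma linear_maps_eqI:
  assumes "f \<in> linear_maps R M N" "g \<in> linear_maps R M N" "\<And>x. x \<in> carrier M \<Longrightarrow> f x = g x"
  shows "f = g"
  using assms by (intro extensionalityI[of f "carrier M" g]) (auto simp: linear_maps_iff)

lemma linear_maps_id: "module R M \<Longrightarrow> (\<lambda>x \<in> carrier M. x) \<in> linear_maps R M M"
  by (rule lin_restrict[OF lin_id])

lemma linear_maps_compose:
  "module R M \<Longrightarrow> f \<in> linear_maps R M N \<Longrightarrow> g \<in> linear_maps R N P \<Longrightarrow>
   compose (carrier M) g f \<in> linear_maps R M P"
  unfolding compose_def by (intro lin_restrict lin_comp[of R M N f P g]) (auto simp: linear_maps_lin)

lemma category_mod_cat: "category (mod_cat R)"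
proof
  fix f A B assume "f \<in> Hom (mod_cat R) A B"
  then obtain a where a: "f = (A, a, B)" "module R A" "module R B" "a \<in> linear_maps R A B"
    by (auto simp: Hom_mod_cat)
  have "compose (carrier A) (\<lambda>x \<in> carrier B. x) a = a"
    by (rule linear_maps_eqI[OF linear_maps_compose[OF a(2,4) linear_maps_id[OF a(3)]] a(4)])
       (use a in \<open>auto simp: compose_def lin_closed[OF linear_maps_lin]\<close>)
  then show "Idn (mod_cat R) B \<cdot>\<^bsub>mod_cat R\<^esub> f = f" using a by simp
  have "compose (carrier A) a (\<lambda>x \<in> carrier A. x) = a"
    by (rule linear_maps_eqI[OF linear_maps_compose[OF a(2) linear_maps_id[OF a(2)] a(4)] a(4)])
       (use a in \<open>auto simp: compose_def\<close>)
  then show "f \<cdot>\<^bsub>mod_cat R\<^esub> Idn (mod_cat R) A = f" using a by simp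
next
  fix f g h A B D E
  assume "f \<in> Hom (mod_cat R) A B" "g \<in> Hom (mod_cat R) B D" "h \<in> Hom (mod_cat R) D E"
  then show "(h \<cdot>\<^bsub>mod_cat R\<^esub> g) \<cdot>\<^bsub>mod_cat R\<^esub> f = h \<cdot>\<^bsub>mod_cat R\<^esub> (g \<cdot>\<^bsub>mod_cat R\<^esub> f)"
    by (auto simp: Hom_mod_cat compose_def fun_eq_iff restrict_def lin_closed[OF linear_maps_lin])
qed (auto simp: Hom_mod_cat linear_maps_id linear_maps_compose)

lemma invertible_mod_cat:
  assumes M: "module R M" and N: "module R N" and f: "f \<in> linear_maps R M N"
    and bij: "bij_betw f (carrier M) (carrier N)"
  shows "invertible (mod_cat R) (M, f, N)"
proof -
  interpret M: module R M by fact
  note l = linear_maps_lin[OF f]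
  let ?g = "inv_into (carrier M) f"
  have g: "?g y \<in> carrier M" "f (?g y) = y" if "y \<in> carrier N" for y
    using that bij by (auto simp: bij_betw_def f_inv_into_f inv_into_into)
  have gf: "?g (f x) = x" if "x \<in> carrier M" for x
    using that bij by (auto simp: bij_betw_def)
  have "lin R N M ?g"
  proof (rule linI)
    fix x y assume x: "x \<in> carrier N" and y: "y \<in> carrier N"
    have "x \<oplus>\<^bsub>N\<^esub> y = f (?g x \<oplus>\<^bsub>M\<^esub> ?g y)"
      using x y g by (simp add: lin_add[OF l])
    then show "?g (x \<oplus>\<^bsub>N\<^esub> y) = ?g x \<oplus>\<^bsub>M\<^esub> ?g y"
      using x y g by (simp add: gf)
    fix a assume a: "a \<in> carrier R"
    have "a \<odot>\<^bsub>N\<^esub> x = f (a \<odot>\<^bsub>M\<^esub> ?g x)"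
      using x a g by (simp add: lin_smult[OF l])
    then show "?g (a \<odot>\<^bsub>N\<^esub> x) = a \<odot>\<^bsub>M\<^esub> ?g x"
      using x a g by (simp add: gf)
  qed (use g in auto)
  then have "restrict ?g (carrier N) \<in> linear_maps R N M" using N by (rule lin_restrict)
  then have "(N, restrict ?g (carrier N), M) \<in> Hom (mod_cat R) N M"
    unfolding Hom_mod_cat using M N by blast
  then show ?thesis
    unfolding invertible_def using M N f
    by (intro conjI bexI[of _ "(N, restrict ?g (carrier N), M)"])
       (auto simp: compose_def fun_eq_iff restrict_def g gf lin_closed[OF l])
qed

section \<open>Module-valued functors in terms of elements\<close>

type_synonym ('o, 'a, 'r, 'u) mod_fctr = "('o, 'a, ('r, 'u) module, ('r, 'u) mod_arr) fctr"
type_synonym ('o, 'a, 'r, 'u) mod_nat_tr = "('o, 'a, ('r, 'u) module, ('r, 'u) mod_arr) nat_tr"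

definition act :: "('o, 'a, 'r, 'u) mod_fctr \<Rightarrow> 'a \<Rightarrow> 'u \<Rightarrow> 'u" where
  "act T f = fst (snd (farr T f))"

text \<open>Together with its converse \<open>mod_functorI\<close> and the analogues for
  transformations, this trades equations between triples in \<open>mod_cat\<close> for equations
  between elements, the level at which all later arguments take place.\<close>

lemma mod_functorD:
  assumes T: "is_functor C (mod_cat R) T"
  shows mod_functor_module: "\<And>A. A \<in> Obj C \<Longrightarrow> module R (fobj T A)"
    and mod_functor_arr: "\<And>f. f \<in> Arr C \<Longrightarrow> farr T f = (fobj T (Dom C f), act T f, fobj T (Cod C f))"
    and mod_functor_linear: "\<And>f. f \<in> Arr C \<Longrightarrow> act T f \<in> linear_maps R (fobj T (Dom C f)) (fobj T (Cod C f))"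
    and mod_functor_lin: "\<And>f. f \<in> Arr C \<Longrightarrow> lin R (fobj T (Dom C f)) (fobj T (Cod C f)) (act T f)"
    and mod_functor_id: "\<And>A x. A \<in> Obj C \<Longrightarrow> x \<in> carrier (fobj T A) \<Longrightarrow> act T (Idn C A) x = x"
    and mod_functor_comp: "\<And>f g x. f \<in> Arr C \<Longrightarrow> g \<in> Arr C \<Longrightarrow> Cod C f = Dom C g \<Longrightarrow>
      x \<in> carrier (fobj T (Dom C f)) \<Longrightarrow> act T (g \<cdot>\<^bsub>C\<^esub> f) x = act T g (act T f x)"
proof -
  show "module R (fobj T A)" if "A \<in> Obj C" for A
    using T that by (auto simp: is_functor_def)
  have 1: "farr T f = (fobj T (Dom C f), act T f, fobj T (Cod C f)) \<and>
    act T f \<in> linear_maps R (fobj T (Dom C f)) (fobj T (Cod C f))" if f: "f \<in> Arr C" for f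
  proof -
    obtain M u N where u: "farr T f = (M, u, N)" by (cases "farr T f")
    moreover have "farr T f \<in> Arr (mod_cat R)" "Dom (mod_cat R) (farr T f) = fobj T (Dom C f)"
      "Cod (mod_cat R) (farr T f) = fobj T (Cod C f)"
      using T f unfolding is_functor_def by (blast dest: PiE_mem)+
    ultimately show ?thesis by (auto simp: act_def)
  qed
  then show arr: "farr T f = (fobj T (Dom C f), act T f, fobj T (Cod C f))"
    and "act T f \<in> linear_maps R (fobj T (Dom C f)) (fobj T (Cod C f))" if "f \<in> Arr C" for f
    using that by auto
  then show "lin R (fobj T (Dom C f)) (fobj T (Cod C f)) (act T f)" if "f \<in> Arr C" for f
    using that by (auto intro: linear_maps_lin)
  show "act T (Idn C A) x = x" if "A \<in> Obj C" "x \<in> carrier (fobj T A)" for A x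
    using T that unfolding is_functor_def by (auto simp: act_def)
  show "act T (g \<cdot>\<^bsub>C\<^esub> f) x = act T g (act T f x)"
    if "f \<in> Arr C" "g \<in> Arr C" "Cod C f = Dom C g" "x \<in> carrier (fobj T (Dom C f))" for f g x
  proof -
    have "farr T (g \<cdot>\<^bsub>C\<^esub> f) = farr T g \<cdot>\<^bsub>mod_cat R\<^esub> farr T f"
      using T that unfolding is_functor_def by blast
    then have "farr T (g \<cdot>\<^bsub>C\<^esub> f) = (fobj T (Dom C f), compose (carrier (fobj T (Dom C f))) (act T g) (act T f), fobj T (Cod C g))"
      using that by (simp add: arr)
    then have "act T (g \<cdot>\<^bsub>C\<^esub> f) = compose (carrier (fobj T (Dom C f))) (act T g) (act T f)"
      by (simp add: act_def[of T "g \<cdot>\<^bsub>C\<^esub> f"])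
    then show ?thesis using that by (simp add: compose_def)
  qed
qed

lemma mod_functorI:
  assumes "category C" and N: "\<And>A. A \<in> Obj C \<Longrightarrow> module R (N A)"
    and u: "\<And>f. f \<in> Arr C \<Longrightarrow> u f \<in> linear_maps R (N (Dom C f)) (N (Cod C f))"
    and id: "\<And>A x. A \<in> Obj C \<Longrightarrow> x \<in> carrier (N A) \<Longrightarrow> u (Idn C A) x = x"
    and comp: "\<And>f g x. f \<in> Arr C \<Longrightarrow> g \<in> Arr C \<Longrightarrow> Cod C f = Dom C g \<Longrightarrow>
      x \<in> carrier (N (Dom C f)) \<Longrightarrow> u (g \<cdot>\<^bsub>C\<^esub> f) x = u g (u f x)"
  shows "is_functor C (mod_cat R) \<lparr>fobj = (\<lambda>A \<in> Obj C. N A), farr = (\<lambda>f \<in> Arr C. (N (Dom C f), u f, N (Cod C f)))\<rparr>"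
proof -
  interpret category C by fact
  have I: "Idn C A \<in> Arr C" "Dom C (Idn C A) = A" "Cod C (Idn C A) = A" if "A \<in> Obj C" for A
    using Idn_in_Hom[OF that] by (auto simp: Hom_def)
  have c: "g \<cdot>\<^bsub>C\<^esub> f \<in> Arr C" "Dom C (g \<cdot>\<^bsub>C\<^esub> f) = Dom C f" "Cod C (g \<cdot>\<^bsub>C\<^esub> f) = Cod C g"
    if "f \<in> Arr C" "g \<in> Arr C" "Cod C f = Dom C g" for f g
    using Cmp_in_Hom[of f "Dom C f" "Cod C f" g "Cod C g"] that by (auto simp: Hom_def)
  have "u (Idn C A) = (\<lambda>x \<in> carrier (N A). x)" if "A \<in> Obj C" for A
    using u[OF I(1)[OF that]] I[OF that] id[OF that]
    by (intro linear_maps_eqI[OF _ linear_maps_id[OF N[OF that]]]) auto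
  moreover have "u (g \<cdot>\<^bsub>C\<^esub> f) = compose (carrier (N (Dom C f))) (u g) (u f)"
    if "f \<in> Arr C" "g \<in> Arr C" "Cod C f = Dom C g" for f g
  proof (rule linear_maps_eqI)
    show "u (g \<cdot>\<^bsub>C\<^esub> f) \<in> linear_maps R (N (Dom C f)) (N (Cod C g))"
      using u[OF c(1)[OF that]] by (simp add: c[OF that])
    show "compose (carrier (N (Dom C f))) (u g) (u f) \<in> linear_maps R (N (Dom C f)) (N (Cod C g))"
      using linear_maps_compose[OF N u[OF that(1)], of "u g" "N (Cod C g)"] u[OF that(2)] that Dom_in_Obj by simp
  qed (use comp that in \<open>auto simp: compose_def\<close>)
  ultimately show ?thesis
    unfolding is_functor_def
    by (auto simp: Dom_in_Obj Cod_in_Obj N u I c)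
qed

lemma mod_nat_trD:
  assumes \<alpha>: "is_nat_tr C (mod_cat R) S \<alpha> T"
  shows "is_functor C (mod_cat R) S" "is_functor C (mod_cat R) T"
    and mod_nat_tr_arr: "\<And>A. A \<in> Obj C \<Longrightarrow> \<alpha> A = (fobj S A, fst (snd (\<alpha> A)), fobj T A)"
    and mod_nat_tr_linear: "\<And>A. A \<in> Obj C \<Longrightarrow> fst (snd (\<alpha> A)) \<in> linear_maps R (fobj S A) (fobj T A)"
    and mod_nat_tr_natural: "category C \<Longrightarrow> f \<in> Arr C \<Longrightarrow> x \<in> carrier (fobj S (Dom C f)) \<Longrightarrow>
      fst (snd (\<alpha> (Cod C f))) (act S f x) = act T f (fst (snd (\<alpha> (Dom C f))) x)"
proof -
  show S: "is_functor C (mod_cat R) S" and T: "is_functor C (mod_cat R) T"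
    using \<alpha> by (auto simp: is_nat_tr_def)
  show a: "\<alpha> A = (fobj S A, fst (snd (\<alpha> A)), fobj T A)"
    and "fst (snd (\<alpha> A)) \<in> linear_maps R (fobj S A) (fobj T A)" if "A \<in> Obj C" for A
    using \<alpha> that by (auto simp: is_nat_tr_def Hom_mod_cat)
  assume "category C" and f: "f \<in> Arr C" and x: "x \<in> carrier (fobj S (Dom C f))"
  interpret category C by fact
  have "\<alpha> (Cod C f) \<cdot>\<^bsub>mod_cat R\<^esub> farr S f = farr T f \<cdot>\<^bsub>mod_cat R\<^esub> \<alpha> (Dom C f)"
    using \<alpha> f by (auto simp: is_nat_tr_def)
  then have "(fobj S (Cod C f), fst (snd (\<alpha> (Cod C f))), fobj T (Cod C f)) \<cdot>\<^bsub>mod_cat R\<^esub>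
        (fobj S (Dom C f), act S f, fobj S (Cod C f)) =
      (fobj T (Dom C f), act T f, fobj T (Cod C f)) \<cdot>\<^bsub>mod_cat R\<^esub>
        (fobj S (Dom C f), fst (snd (\<alpha> (Dom C f))), fobj T (Dom C f))"
    by (simp only: a[OF Dom_in_Obj[OF f], symmetric] a[OF Cod_in_Obj[OF f], symmetric]
        mod_functor_arr[OF S f, symmetric] mod_functor_arr[OF T f, symmetric])
  then have "compose (carrier (fobj S (Dom C f))) (fst (snd (\<alpha> (Cod C f)))) (act S f) =
      compose (carrier (fobj S (Dom C f))) (act T f) (fst (snd (\<alpha> (Dom C f))))"
    by simp
  from fun_cong[OF this, of x] show "fst (snd (\<alpha> (Cod C f))) (act S f x) = act T f (fst (snd (\<alpha> (Dom C f))) x)"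
    using x by (simp add: compose_def)
qed

lemma mod_nat_trI:
  assumes "category C" and S: "is_functor C (mod_cat R) S" and T: "is_functor C (mod_cat R) T"
    and a: "\<And>A. A \<in> Obj C \<Longrightarrow> a A \<in> linear_maps R (fobj S A) (fobj T A)"
    and nat: "\<And>f x. f \<in> Arr C \<Longrightarrow> x \<in> carrier (fobj S (Dom C f)) \<Longrightarrow>
      a (Cod C f) (act S f x) = act T f (a (Dom C f) x)"
  shows "is_nat_tr C (mod_cat R) S (\<lambda>A \<in> Obj C. (fobj S A, a A, fobj T A)) T"
proof -
  interpret category C by fact
  have "compose (carrier (fobj S (Dom C f))) (a (Cod C f)) (act S f) =
      compose (carrier (fobj S (Dom C f))) (act T f) (a (Dom C f))" if "f \<in> Arr C" for f
    using nat[OF that] by (auto simp: compose_def restrict_def)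
  then show ?thesis
    using S T a unfolding is_nat_tr_def
    by (auto simp: Dom_in_Obj Cod_in_Obj Hom_mod_cat mod_functor_module[OF S] mod_functor_module[OF T]
        mod_functor_arr[OF S] mod_functor_arr[OF T])
qed


section \<open>Tensor products with free modules\<close>

text \<open>Linearity in \<open>u\<close> is built into \<open>free_lift\<close>. For linearity in
  \<open>n\<close>, both sides of each law are linear in \<open>u\<close>, so they are compared on
  generators only.\<close>

lemma free_lift_bilinear:
  assumes Q: "module R Q" and \<phi>: "\<And>x. x \<in> X \<Longrightarrow> lin R N Q (\<phi> x)" and N: "module R N"
  shows "(\<lambda>u n. free_lift R X Q (\<lambda>x. \<phi> x n) u) \<in> bilinear_maps R (free_mod R X) N Q"
proof -
  interpret Q: module R Q by fact
  interpret N: module R N by fact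
  have L: "lin R (free_mod R X) Q (free_lift R X Q (\<lambda>x. \<phi> x n))" if "n \<in> carrier N" for n
    using \<phi> that by (intro lin_free_lift[OF Q]) (auto intro: lin_closed)
  have g: "free_lift R X Q (\<lambda>x. \<phi> x n) (free_gen R x) = \<phi> x n" if "n \<in> carrier N" "x \<in> X" for n x
    using \<phi> that by (intro free_lift_gen[OF Q]) (auto intro: lin_closed)
  have add: "free_lift R X Q (\<lambda>x. \<phi> x (n \<oplus>\<^bsub>N\<^esub> n')) u =
      free_lift R X Q (\<lambda>x. \<phi> x n) u \<oplus>\<^bsub>Q\<^esub> free_lift R X Q (\<lambda>x. \<phi> x n') u"
    if n: "n \<in> carrier N" "n' \<in> carrier N" and u: "u \<in> carrier (free_mod R X)" for n n' u
    by (rule free_mod_ext[OF Q.cring_axioms Q L lin_add_map[OF Q L L] _ u])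
       (use n in \<open>auto simp: g lin_add[OF \<phi>]\<close>)
  have smult: "free_lift R X Q (\<lambda>x. \<phi> x (a \<odot>\<^bsub>N\<^esub> n)) u = a \<odot>\<^bsub>Q\<^esub> free_lift R X Q (\<lambda>x. \<phi> x n) u"
    if n: "n \<in> carrier N" "a \<in> carrier R" and u: "u \<in> carrier (free_mod R X)" for n a u
    by (rule free_mod_ext[OF Q.cring_axioms Q L lin_smult_map[OF Q L] _ u])
       (use n in \<open>auto simp: g lin_smult[OF \<phi>]\<close>)
  show ?thesis
    unfolding bilinear_maps_def using add smult
    by (auto simp: lin_add[OF L] lin_smult[OF L] intro: lin_closed[OF L])
qed

lemma bilinear_lin:
  assumes "t \<in> bilinear_maps R M N P"
  shows "n \<in> carrier N \<Longrightarrow> lin R M P (\<lambda>u. t u n)" and "u \<in> carrier M \<Longrightarrow> lin R N P (t u)"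
  using assms by (auto simp: bilinear_maps_def intro!: linI)

text \<open>The tensor product of \<open>RX\<close> with \<open>N\<close> is a direct sum of copies
  of \<open>N\<close> indexed by \<open>X\<close>. Since \<open>X\<close> embeds into the universe,
  such a sum exists there, and so the \<open>SOME\<close> in \<open>tensor\<close> picks a genuine
  tensor product.\<close>

lemma is_tensor_free:
  fixes N :: "('r, 'u) module"
  assumes R: "cring R" and N: "module R N"
    and X: "X \<lesssim> (UNIV :: 'u set)" and inf: "infinite (UNIV :: 'u set)"
  shows "is_tensor R (free_mod R X) N (tensor R (free_mod R X) N :: ('r, 'u) module \<times> _)"
proof -
  obtain D :: "('r, 'u) module" and j where S: "is_direct_sum R X (\<lambda>_. N) D j"
    using direct_sum_exists[OF R N X inf] by blast
  note D = is_direct_sum_module[OF S] and j = is_direct_sum_lin[OF S]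
    and ex = is_direct_sum_lift[OF S] and un = is_direct_sum_ext[OF S]
  let ?t = "\<lambda>u n. free_lift R X D (\<lambda>x. j x n) u"
  have t: "?t \<in> bilinear_maps R (free_mod R X) N D"
    using D j N by (rule free_lift_bilinear)
  have tg: "?t (free_gen R x) n = j x n" if "x \<in> X" "n \<in> carrier N" for x n
    using that j by (intro free_lift_gen[OF D]) (auto intro: lin_closed)
  have gen: "free_gen R x \<in> carrier (free_mod R X)" if "x \<in> X" for x
    using R that by (rule free_gen_closed)
  have "is_tensor R (free_mod R X) N (D, ?t)"
    unfolding is_tensor_def split
  proof (intro conjI allI impI)
    fix Q :: "('r, 'u) module" and s assume "module R Q \<and> s \<in> bilinear_maps R (free_mod R X) N Q"
    then have Q: "module R Q" and s: "s \<in> bilinear_maps R (free_mod R X) N Q" by auto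
    obtain h where h: "lin R D Q h" "\<And>x n. x \<in> X \<Longrightarrow> n \<in> carrier N \<Longrightarrow> h (j x n) = s (free_gen R x) n"
      using ex[OF Q, of "\<lambda>x. s (free_gen R x)"] bilinear_lin(2)[OF s gen] by blast
    have hs: "h (?t u n) = s u n" if "u \<in> carrier (free_mod R X)" "n \<in> carrier N" for u n
      by (rule free_mod_ext[OF R Q lin_comp[OF bilinear_lin(1)[OF t] h(1)] bilinear_lin(1)[OF s] _ that(1)])
         (use that in \<open>auto simp: tg h(2)\<close>)
    have tc: "?t u n \<in> carrier D" if "u \<in> carrier (free_mod R X)" "n \<in> carrier N" for u n
      using lin_closed[OF bilinear_lin(1)[OF t] that(1)] that by blast
    show "\<exists>!h. h \<in> linear_maps R D Q \<and> (\<forall>u\<in>carrier (free_mod R X). \<forall>n\<in>carrier N. h (?t u n) = s u n)"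
    proof (rule ex1I[of _ "restrict h (carrier D)"])
      show "restrict h (carrier D) \<in> linear_maps R D Q \<and>
          (\<forall>u\<in>carrier (free_mod R X). \<forall>n\<in>carrier N. restrict h (carrier D) (?t u n) = s u n)"
        using lin_restrict[OF h(1) D] hs tc by auto
      fix k assume k: "k \<in> linear_maps R D Q \<and> (\<forall>u\<in>carrier (free_mod R X). \<forall>n\<in>carrier N. k (?t u n) = s u n)"
      show "k = restrict h (carrier D)"
      proof (rule linear_maps_eqI)
        fix z assume z: "z \<in> carrier D"
        have "k z = h z"
        proof (rule un[OF Q _ h(1) _ z])
          show "lin R D Q k" using k by (auto intro: linear_maps_lin)
          fix x n assume xn: "x \<in> X" "n \<in> carrier N"
          then have "k (?t (free_gen R x) n) = s (free_gen R x) n" using k gen by blast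
          then show "k (j x n) = h (j x n)" using xn by (simp add: tg h(2))
        qed
        then show "k z = restrict h (carrier D) z" using z by simp
      qed (use k lin_restrict[OF h(1) D] in auto)
    qed
  qed (use D t in auto)
  then show ?thesis unfolding tensor_def by (rule someI)
qed

context
  fixes R :: "('r, 's) ring_scheme" and U :: "'u itself"
  assumes R: "cring R" and inf: "infinite (UNIV :: 'u set)"
begin

text \<open>After this only symbols \<open>t (free_gen R x) n\<close> have to be considered: maps
  out of the chosen tensor product are constructed from families of linear maps indexed by
  \<open>X\<close> and compared on these symbols.\<close>

lemma tensor_free:
  fixes N :: "('r, 'u) module"
  assumes N: "module R N" and X: "X \<lesssim> (UNIV :: 'u set)"
    and Z: "(tensor R (free_mod R X) N :: ('r, 'u) module \<times> _) = (P, t)"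
  shows tensor_free_module: "module R P"
    and tensor_free_bilinear: "t \<in> bilinear_maps R (free_mod R X) N P"
    and tensor_free_lift: "\<And>Q \<phi>. module R (Q :: ('r, 'u) module) \<Longrightarrow> (\<And>x. x \<in> X \<Longrightarrow> lin R N Q (\<phi> x)) \<Longrightarrow>
      \<exists>h. h \<in> linear_maps R P Q \<and> (\<forall>x \<in> X. \<forall>n \<in> carrier N. h (t (free_gen R x) n) = \<phi> x n)"
    and tensor_free_ext: "\<And>Q h k z. module R (Q :: ('r, 'u) module) \<Longrightarrow> lin R P Q h \<Longrightarrow> lin R P Q k \<Longrightarrow>
      (\<And>x n. x \<in> X \<Longrightarrow> n \<in> carrier N \<Longrightarrow> h (t (free_gen R x) n) = k (t (free_gen R x) n)) \<Longrightarrow>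
      z \<in> carrier P \<Longrightarrow> h z = k z"
proof -
  have T: "is_tensor R (free_mod R X) N (P, t)"
    using is_tensor_free[OF R N X inf] unfolding Z .
  then show P: "module R P" and t: "t \<in> bilinear_maps R (free_mod R X) N P"
    by (auto simp: is_tensor_def)
  have gen: "free_gen R x \<in> carrier (free_mod R X)" if "x \<in> X" for x
    using R that by (rule free_gen_closed)
  fix Q :: "('r, 'u) module" assume Q: "module R Q"
  have U: "\<exists>!h. h \<in> linear_maps R P Q \<and> (\<forall>u\<in>carrier (free_mod R X). \<forall>n\<in>carrier N. h (t u n) = s u n)"
    if "s \<in> bilinear_maps R (free_mod R X) N Q" for s
    using T Q that by (simp add: is_tensor_def)
  show "\<exists>h. h \<in> linear_maps R P Q \<and> (\<forall>x \<in> X. \<forall>n \<in> carrier N. h (t (free_gen R x) n) = \<phi> x n)"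
    if \<phi>: "\<And>x. x \<in> X \<Longrightarrow> lin R N Q (\<phi> x)" for \<phi>
  proof -
    obtain h where h: "h \<in> linear_maps R P Q"
      "\<And>u n. u \<in> carrier (free_mod R X) \<Longrightarrow> n \<in> carrier N \<Longrightarrow> h (t u n) = free_lift R X Q (\<lambda>x. \<phi> x n) u"
      using U[OF free_lift_bilinear[OF Q _ N], of \<phi>] \<phi> by blast
    have "h (t (free_gen R x) n) = \<phi> x n" if "x \<in> X" "n \<in> carrier N" for x n
      using that h(2)[OF gen] free_lift_gen[OF Q, of X "\<lambda>x. \<phi> x n"] by (simp add: lin_closed[OF \<phi>])
    then show ?thesis using h(1) by blast
  qed
  fix h k z assume h: "lin R P Q h" and k: "lin R P Q k" and z: "z \<in> carrier P"
    and eq: "\<And>x n. x \<in> X \<Longrightarrow> n \<in> carrier N \<Longrightarrow> h (t (free_gen R x) n) = k (t (free_gen R x) n)"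
  have tc: "t u n \<in> carrier P" if "u \<in> carrier (free_mod R X)" "n \<in> carrier N" for u n
    using lin_closed[OF bilinear_lin(1)[OF t] that(1)] that by blast
  \<comment> \<open>Uniqueness in \<open>is_tensor\<close> is relative to a bilinear map. Taking
    \<open>h\<close> after \<open>t\<close> as that map, both \<open>h\<close> and \<open>k\<close>
    become its factorization.\<close>
  let ?s = "\<lambda>u n. h (t u n)"
  have s: "?s \<in> bilinear_maps R (free_mod R X) N Q"
    using t lin_closed[OF h] lin_add[OF h] lin_smult[OF h]
    by (simp add: bilinear_maps_def)
  have kh: "k (t u n) = h (t u n)" if "u \<in> carrier (free_mod R X)" "n \<in> carrier N" for u n
    by (rule free_mod_ext[OF R Q lin_comp[OF bilinear_lin(1)[OF t] k] lin_comp[OF bilinear_lin(1)[OF t] h] _ that(1)])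
       (use that eq in auto)
  obtain l where l: "\<forall>m. m \<in> linear_maps R P Q \<and>
      (\<forall>u\<in>carrier (free_mod R X). \<forall>n\<in>carrier N. m (t u n) = ?s u n) \<longrightarrow> m = l"
    using U[OF s] unfolding Ex1_def by blast
  have "restrict h (carrier P) = l"
    using lin_restrict[OF h P] by (intro l[rule_format]) (simp add: tc)
  moreover have "restrict k (carrier P) = l"
    using lin_restrict[OF k P] by (intro l[rule_format]) (simp add: tc kh)
  ultimately show "h z = k z" using z by (metis restrict_apply')
qed

text \<open>Evaluates the \<open>THE\<close> in \<open>tensor_arr\<close>: the map
  \<open>\<lambda>u n. t' (f u) (g n)\<close> is bilinear, so it has exactly one
  factorization.\<close>

lemma tensor_arr_free:
  fixes N N' :: "('r, 'u) module"
  assumes N: "module R N" and X: "X \<lesssim> (UNIV :: 'u set)"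
    and Z: "(tensor R (free_mod R X) N :: ('r, 'u) module \<times> _) = (P, t)"
    and N': "module R N'" and X': "X' \<lesssim> (UNIV :: 'u set)"
    and Z': "(tensor R (free_mod R X') N' :: ('r, 'u) module \<times> _) = (P', t')"
    and f: "f \<in> linear_maps R (free_mod R X) (free_mod R X')" and g: "g \<in> linear_maps R N N'"
  shows "\<exists>h. (tensor_arr R (free_mod R X, f, free_mod R X') (N, g, N') :: ('r, 'u) mod_arr) = (P, h, P') \<and>
    h \<in> linear_maps R P P' \<and> (\<forall>u \<in> carrier (free_mod R X). \<forall>n \<in> carrier N. h (t u n) = t' (f u) (g n))"
proof -
  have T: "is_tensor R (free_mod R X) N (P, t)"
    using is_tensor_free[OF R N X inf] unfolding Z .
  note P' = tensor_free_module[OF N' X' Z'] and t' = tensor_free_bilinear[OF N' X' Z']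
  note lf = linear_maps_lin[OF f] and lg = linear_maps_lin[OF g]
  have s: "(\<lambda>u n. t' (f u) (g n)) \<in> bilinear_maps R (free_mod R X) N P'"
    using t' by (simp add: bilinear_maps_def lin_closed[OF lf] lin_add[OF lf] lin_smult[OF lf]
        lin_closed[OF lg] lin_add[OF lg] lin_smult[OF lg])
  have "\<exists>!h. h \<in> linear_maps R P P' \<and>
      (\<forall>u\<in>carrier (free_mod R X). \<forall>n\<in>carrier N. h (t u n) = t' (f u) (g n))"
    using T s P' by (simp add: is_tensor_def)
  from theI'[OF this] show ?thesis
    by (simp add: tensor_arr_def Z Z')
qed

end

section \<open>Functors induced by truncated kernels\<close>

lemma free_lift_linear_maps:
  assumes Q: "module R Q" and \<phi>: "\<And>x. x \<in> X \<Longrightarrow> \<phi> x \<in> carrier Q"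
  shows "free_lift R X Q \<phi> \<in> linear_maps R (free_mod R X) Q"
  using lin_free_lift[OF Q, of X \<phi>] \<phi> by (simp add: linear_maps_iff) (simp add: free_lift_def)

lemma compose_eqD: "compose A f g = compose A f' g' \<Longrightarrow> x \<in> A \<Longrightarrow> f (g x) = f' (g' x)"
  by (drule fun_cong[of _ _ x]) (simp add: compose_def)

lemma restrict_eqD: "restrict f A = restrict g A \<Longrightarrow> x \<in> A \<Longrightarrow> f x = g x"
  by (drule fun_cong[of _ _ x]) simp

section \<open>Wide subcategories\<close>

lemma wide_subcat_simps [simp]:
  "Obj (wide_subcat C S) = Obj C" "Arr (wide_subcat C S) = S"
  "Dom (wide_subcat C S) = Dom C" "Cod (wide_subcat C S) = Cod C"
  "Idn (wide_subcat C S) = Idn C" "Cmp (wide_subcat C S) = Cmp C"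
  by (simp_all add: wide_subcat_def)

lemma (in category) category_wide_subcat:
  assumes "S \<subseteq> Arr C" "\<And>A. A \<in> Obj C \<Longrightarrow> Idn C A \<in> S"
    and "\<And>f g. f \<in> S \<Longrightarrow> g \<in> S \<Longrightarrow> Cod C f = Dom C g \<Longrightarrow> g \<cdot> f \<in> S"
  shows "category (wide_subcat C S)"
proof -
  have H: "Hom (wide_subcat C S) A B = S \<inter> Hom C A B" for A B
    using assms(1) by (auto simp: Hom_def)
  show ?thesis
  proof
    fix f g A B D assume "f \<in> Hom (wide_subcat C S) A B" "g \<in> Hom (wide_subcat C S) B D"
    then show "g \<cdot>\<^bsub>wide_subcat C S\<^esub> f \<in> Hom (wide_subcat C S) A D"
      using assms(3)[of f g] Cmp_in_Hom[of f A B g D] by (auto simp: H) (auto simp: Hom_def)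
  qed (use assms Dom_in_Obj Cod_in_Obj Idn_in_Hom Cmp_Idn_left Cmp_Idn_right Cmp_assoc in \<open>auto simp: H\<close>)
qed

context category
begin

lemma Idn_simps: "A \<in> Obj C \<Longrightarrow> Idn C A \<in> Arr C \<and> Dom C (Idn C A) = A \<and> Cod C (Idn C A) = A"
  using Idn_in_Hom[of A] by (auto simp: Hom_def)

lemma Cmp_simps: "f \<in> Arr C \<Longrightarrow> g \<in> Arr C \<Longrightarrow> Cod C f = Dom C g \<Longrightarrow>
    g \<cdot> f \<in> Arr C \<and> Dom C (g \<cdot> f) = Dom C f \<and> Cod C (g \<cdot> f) = Cod C g"
  using Cmp_in_Hom[of f "Dom C f" "Cod C f" g "Cod C g"] by (auto simp: Hom_def)

lemma Cmp_assoc': "f \<in> Arr C \<Longrightarrow> g \<in> Arr C \<Longrightarrow> h \<in> Arr C \<Longrightarrow> Cod C f = Dom C g \<Longrightarrow> Cod C g = Dom C h \<Longrightarrow>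
    (h \<cdot> g) \<cdot> f = h \<cdot> (g \<cdot> f)"
  using Cmp_assoc[of f "Dom C f" "Cod C f" g "Cod C g" h "Cod C h"] by (auto simp: Hom_def)

lemma Cmp_Idn_left': "f \<in> Arr C \<Longrightarrow> Cod C f = B \<Longrightarrow> Idn C B \<cdot> f = f"
  using Cmp_Idn_left[of f "Dom C f" B] by (auto simp: Hom_def)

lemma Cmp_Idn_right': "f \<in> Arr C \<Longrightarrow> Dom C f = A \<Longrightarrow> f \<cdot> Idn C A = f"
  using Cmp_Idn_right[of f A "Cod C f"] by (auto simp: Hom_def)

end

text \<open>Covers both functors: \<open>M_hat\<close> is \<open>S = M\<close> with
  \<open>AX = E \<inter> M\<close> and \<open>AY = Arr C\<close>, and \<open>E_hat\<close> is
  \<open>S = E\<close> with \<open>AX\<close> and \<open>AY\<close> exchanged. By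
  \<open>S_left\<close> and \<open>S_both\<close> a composite that has left \<open>S\<close> does
  not return under further composition. This is what makes it consistent to send arrows outside
  \<open>S\<close> to zero.\<close>

locale truncated_kernel = category C + R: cring R
  for R :: "('r, 's) ring_scheme" and C :: "('o, 'a) cat" (structure) +
  fixes S AX AY :: "'a set" and U :: "'u itself"
  assumes infinite_U: "infinite (UNIV :: 'u set)"
    and Arr_le: "Arr C \<lesssim> (UNIV :: 'u set)"
    and S_sub: "S \<subseteq> Arr C" and AX_sub: "AX \<subseteq> Arr C" and AY_sub: "AY \<subseteq> Arr C"
    and AX_id: "A \<in> Obj C \<Longrightarrow> Idn C A \<in> AX" and AY_id: "A \<in> Obj C \<Longrightarrow> Idn C A \<in> AY"
    and AX_comp: "f \<in> AX \<Longrightarrow> g \<in> AX \<Longrightarrow> Cod C f = Dom C g \<Longrightarrow> g \<cdot> f \<in> AX"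
    and AY_comp: "f \<in> AY \<Longrightarrow> g \<in> AY \<Longrightarrow> Cod C f = Dom C g \<Longrightarrow> g \<cdot> f \<in> AY"
    and S_left: "s \<in> S \<Longrightarrow> y \<in> AY \<Longrightarrow> y' \<in> AY \<Longrightarrow> Cod C s = Dom C y \<Longrightarrow> Cod C y = Dom C y' \<Longrightarrow>
      y' \<cdot> (y \<cdot> s) \<in> S \<Longrightarrow> y \<cdot> s \<in> S"
    and S_both: "s \<in> S \<Longrightarrow> x \<in> AX \<Longrightarrow> y \<in> AY \<Longrightarrow> Cod C x = Dom C s \<Longrightarrow> Cod C s = Dom C y \<Longrightarrow>
      y \<cdot> (s \<cdot> x) \<in> S \<Longrightarrow> y \<cdot> s \<in> S \<and> s \<cdot> x \<in> S"
begin

abbreviation X where "X \<equiv> wide_subcat C AX"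
abbreviation Y where "Y \<equiv> wide_subcat C AY"
abbreviation V :: "(('r, 'u) module, ('r, 'u) mod_arr) cat" where "V \<equiv> mod_cat R"
abbreviation K where "K \<equiv> truncated_hom R C S X Y"
abbreviation integrand where "integrand \<equiv> kernel_integrand R X Y K"
abbreviation mfun :: "('o, 'a, 'r, 'u) mod_fctr \<Rightarrow> bool" where
  "mfun T \<equiv> is_functor X V T"

lemma category_X: "category X" and category_Y: "category Y"
  using AX_sub AX_id AX_comp AY_sub AY_id AY_comp by (auto intro!: category_wide_subcat)

lemma S_Arr: "s \<in> S \<Longrightarrow> s \<in> Arr C" and AX_Arr: "x \<in> AX \<Longrightarrow> x \<in> Arr C" and AY_Arr: "y \<in> AY \<Longrightarrow> y \<in> Arr C"
  using S_sub AX_sub AY_sub by auto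

lemma Hom_X: "Hom X A B = AX \<inter> Hom C A B"
  using AX_sub by (auto simp: Hom_def)

abbreviation tmod :: "'o \<Rightarrow> 'o \<Rightarrow> ('r, 'u) module \<Rightarrow> ('r, 'u) module" where
  "tmod A B N \<equiv> fst (tensor R (free_mod R (S \<inter> Hom C A B)) N)"

abbreviation tgen :: "'o \<Rightarrow> 'o \<Rightarrow> ('r, 'u) module \<Rightarrow> 'a \<Rightarrow> 'u \<Rightarrow> 'u" where
  "tgen A B N s x \<equiv> snd (tensor R (free_mod R (S \<inter> Hom C A B)) N) (free_gen R s) x"

lemma S_Hom_le: "S \<inter> Hom C A B \<lesssim> (UNIV :: 'u set)"
proof -
  have "S \<inter> Hom C A B \<subseteq> Arr C" by (auto simp: Hom_def)
  then show ?thesis using Arr_le subset_imp_lepoll lepoll_trans by metis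
qed

lemmas tensor_facts = tensor_free[OF R.cring_axioms infinite_U _ S_Hom_le surjective_pairing]

lemma tmod_module: "module R N \<Longrightarrow> module R (tmod A B N)"
  by (rule tensor_facts(1))

lemma tmod_ext:
  assumes "module R N" "module R (Q :: ('r, 'u) module)" "lin R (tmod A B N) Q h" "lin R (tmod A B N) Q k"
    and "\<And>s x. s \<in> S \<Longrightarrow> s \<in> Hom C A B \<Longrightarrow> x \<in> carrier N \<Longrightarrow> h (tgen A B N s x) = k (tgen A B N s x)"
    and "z \<in> carrier (tmod A B N)"
  shows "h z = k z"
  by (rule tensor_facts(4)[OF assms(1-4) _ assms(6)]) (use assms(5) in auto)

lemma tmod_lift:
  assumes "module R N" "module R (Q :: ('r, 'u) module)" "\<And>s. s \<in> S \<Longrightarrow> s \<in> Hom C A B \<Longrightarrow> lin R N Q (\<phi> s)"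
  shows "\<exists>h. h \<in> linear_maps R (tmod A B N) Q \<and>
    (\<forall>s \<in> S. s \<in> Hom C A B \<longrightarrow> (\<forall>x \<in> carrier N. h (tgen A B N s x) = \<phi> s x))"
  using tensor_facts(3)[OF assms(1,2), of A B \<phi>] assms(3) by auto

lemma tgen_lin:
  assumes "module R N" "s \<in> S" "s \<in> Hom C A B"
  shows "lin R N (tmod A B N) (tgen A B N s)"
  by (rule bilinear_lin(2)[OF tensor_facts(2)[OF assms(1)]]) (use assms in \<open>auto intro: free_gen_closed R.cring_axioms\<close>)

lemma K_arr:
  assumes x: "x \<in> AX" and y: "y \<in> AY"
  shows "\<exists>\<phi>. farr K (x, y) = (free_mod R (S \<inter> Hom C (Cod C x) (Dom C y)), \<phi>,
      free_mod R (S \<inter> Hom C (Dom C x) (Cod C y))) \<and>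
    \<phi> \<in> linear_maps R (free_mod R (S \<inter> Hom C (Cod C x) (Dom C y))) (free_mod R (S \<inter> Hom C (Dom C x) (Cod C y))) \<and>
    (\<forall>s \<in> S. s \<in> Hom C (Cod C x) (Dom C y) \<longrightarrow> \<phi> (free_gen R s) =
       (if y \<cdot> (s \<cdot> x) \<in> S then free_gen R (y \<cdot> (s \<cdot> x)) else \<zero>\<^bsub>free_mod R (S \<inter> Hom C (Dom C x) (Cod C y))\<^esub>))"
proof -
  let ?X = "S \<inter> Hom C (Cod C x) (Dom C y)" and ?Q = "free_mod R (S \<inter> Hom C (Dom C x) (Cod C y))"
  let ?f = "\<lambda>s. if y \<cdot> (s \<cdot> x) \<in> S then free_gen R (y \<cdot> (s \<cdot> x)) else \<zero>\<^bsub>?Q\<^esub>"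
  have Q: "module R ?Q" by (rule module_free_mod[OF R.cring_axioms])
  then interpret Q: module R ?Q .
  have f: "?f s \<in> carrier ?Q" if "s \<in> ?X" for s
  proof -
    have "y \<cdot> (s \<cdot> x) \<in> Hom C (Dom C x) (Cod C y)"
      using that AX_Arr[OF x] AY_Arr[OF y] by (auto simp: Hom_def Cmp_simps)
    then show ?thesis by (auto intro: free_gen_closed[OF R.cring_axioms])
  qed
  show ?thesis
    using x y free_lift_linear_maps[OF Q, of ?X ?f] free_lift_gen[OF Q, of ?X ?f] f
    by (simp add: truncated_hom_def)
qed

lemma integrand_obj: "A \<in> Obj C \<Longrightarrow> A' \<in> Obj C \<Longrightarrow> B \<in> Obj C \<Longrightarrow>
    fobj (integrand T B) (A, A') = tmod A B (fobj T A')"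
  by (simp add: kernel_integrand_def truncated_hom_def)

lemma mfun_module: "mfun T \<Longrightarrow> A \<in> Obj C \<Longrightarrow> module R (fobj T A)"
  and mfun_id: "mfun T \<Longrightarrow> A \<in> Obj C \<Longrightarrow> x \<in> carrier (fobj T A) \<Longrightarrow> act T (Idn C A) x = x"
  and mfun_lin: "mfun T \<Longrightarrow> g \<in> AX \<Longrightarrow> lin R (fobj T (Dom C g)) (fobj T (Cod C g)) (act T g)"
  using mod_functor_module[of X R T A] mod_functor_id[of X R T A x] mod_functor_lin[of X R T g] by auto

text \<open>Carries the truncation through the tensor product: where the kernel yields zero, the
  induced map on tensor products does too.\<close>

lemma tgen_zero:
  assumes "module R N" "x \<in> carrier N"
  shows "snd (tensor R (free_mod R (S \<inter> Hom C A B)) N) \<zero>\<^bsub>free_mod R (S \<inter> Hom C A B)\<^esub> x = \<zero>\<^bsub>tmod A B N\<^esub>"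
  using lin_zero[OF bilinear_lin(1)[OF tensor_facts(2)[OF assms(1)] assms(2)]
      module_free_mod[OF R.cring_axioms] tmod_module[OF assms(1)]] .

lemma tensor_arr_K:
  assumes x: "x \<in> AX" and y: "y \<in> AY" and N: "module R N" "module R N'" and g: "g \<in> linear_maps R N N'"
  shows "\<exists>h. tensor_arr R (farr K (x, y)) (N, g, N') = (tmod (Cod C x) (Dom C y) N, h, tmod (Dom C x) (Cod C y) N') \<and>
    h \<in> linear_maps R (tmod (Cod C x) (Dom C y) N) (tmod (Dom C x) (Cod C y) N') \<and>
    (\<forall>s \<in> S. s \<in> Hom C (Cod C x) (Dom C y) \<longrightarrow> (\<forall>n \<in> carrier N.
      h (tgen (Cod C x) (Dom C y) N s n) =
        (if y \<cdot> (s \<cdot> x) \<in> S then tgen (Dom C x) (Cod C y) N' (y \<cdot> (s \<cdot> x)) (g n) else \<zero>\<^bsub>tmod (Dom C x) (Cod C y) N'\<^esub>)))"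
proof -
  obtain \<phi> where \<phi>: "farr K (x, y) = (free_mod R (S \<inter> Hom C (Cod C x) (Dom C y)), \<phi>,
      free_mod R (S \<inter> Hom C (Dom C x) (Cod C y)))"
    "\<phi> \<in> linear_maps R (free_mod R (S \<inter> Hom C (Cod C x) (Dom C y))) (free_mod R (S \<inter> Hom C (Dom C x) (Cod C y)))"
    "\<And>s. s \<in> S \<Longrightarrow> s \<in> Hom C (Cod C x) (Dom C y) \<Longrightarrow> \<phi> (free_gen R s) =
       (if y \<cdot> (s \<cdot> x) \<in> S then free_gen R (y \<cdot> (s \<cdot> x)) else \<zero>\<^bsub>free_mod R (S \<inter> Hom C (Dom C x) (Cod C y))\<^esub>)"
    using K_arr[OF x y] by blast
  have gc: "g n \<in> carrier N'" if "n \<in> carrier N" for n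
    using lin_closed[OF linear_maps_lin[OF g] that] .
  obtain h where h: "tensor_arr R (farr K (x, y)) (N, g, N') = (tmod (Cod C x) (Dom C y) N, h, tmod (Dom C x) (Cod C y) N')"
    "h \<in> linear_maps R (tmod (Cod C x) (Dom C y) N) (tmod (Dom C x) (Cod C y) N')"
    "\<And>u n. u \<in> carrier (free_mod R (S \<inter> Hom C (Cod C x) (Dom C y))) \<Longrightarrow> n \<in> carrier N \<Longrightarrow>
      h (snd (tensor R (free_mod R (S \<inter> Hom C (Cod C x) (Dom C y))) N) u n) =
      snd (tensor R (free_mod R (S \<inter> Hom C (Dom C x) (Cod C y))) N') (\<phi> u) (g n)"
    using tensor_arr_free[OF R.cring_axioms infinite_U N(1) S_Hom_le surjective_pairing N(2) S_Hom_le surjective_pairing \<phi>(2) g]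
    unfolding \<phi>(1) by blast
  have "h (tgen (Cod C x) (Dom C y) N s n) =
      (if y \<cdot> (s \<cdot> x) \<in> S then tgen (Dom C x) (Cod C y) N' (y \<cdot> (s \<cdot> x)) (g n) else \<zero>\<^bsub>tmod (Dom C x) (Cod C y) N'\<^esub>)"
    if s: "s \<in> S" "s \<in> Hom C (Cod C x) (Dom C y)" and n: "n \<in> carrier N" for s n
    using s n h(3)[of "free_gen R s" n] free_gen_closed[OF R.cring_axioms, of s "S \<inter> Hom C (Cod C x) (Dom C y)"]
      tgen_zero[OF N(2) gc[OF n]] \<phi>(3)[OF s] by simp
  then show ?thesis using h(1,2) by blast
qed

lemma integrand_arr:
  assumes T: "mfun T" and B: "B \<in> Obj C" and g: "g \<in> AX" and h: "h \<in> AX"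
  shows "\<exists>u. farr (integrand T B) (g, h) = (tmod (Cod C g) B (fobj T (Dom C h)), u, tmod (Dom C g) B (fobj T (Cod C h))) \<and>
    u \<in> linear_maps R (tmod (Cod C g) B (fobj T (Dom C h))) (tmod (Dom C g) B (fobj T (Cod C h))) \<and>
    (\<forall>s \<in> S. s \<in> Hom C (Cod C g) B \<longrightarrow> (\<forall>n \<in> carrier (fobj T (Dom C h)).
      u (tgen (Cod C g) B (fobj T (Dom C h)) s n) =
        (if s \<cdot> g \<in> S then tgen (Dom C g) B (fobj T (Cod C h)) (s \<cdot> g) (act T h n)
         else \<zero>\<^bsub>tmod (Dom C g) B (fobj T (Cod C h))\<^esub>)))"
proof -
  have "h \<in> Arr C" using h AX_Arr by auto
  then have N: "module R (fobj T (Dom C h))" "module R (fobj T (Cod C h))"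
    using mod_functor_module[OF T] Dom_in_Obj Cod_in_Obj by auto
  have l: "act T h \<in> linear_maps R (fobj T (Dom C h)) (fobj T (Cod C h))"
    using mod_functor_linear[OF T] h by auto
  have "farr (integrand T B) (g, h) = tensor_arr R (farr K (g, Idn C B)) (fobj T (Dom C h), act T h, fobj T (Cod C h))"
    using mod_functor_arr[OF T, of h] g h by (simp add: kernel_integrand_def)
  moreover have "Idn C B \<cdot> (s \<cdot> g) = s \<cdot> g" if "s \<in> Hom C (Cod C g) B" for s
    using that AX_Arr[OF g] by (intro Cmp_Idn_left') (auto simp: Hom_def Cmp_simps)
  ultimately show ?thesis
    using tensor_arr_K[OF g AY_id[OF B] N l] Idn_simps[OF B] by auto
qed

text \<open>By the universal properties of tensor products and free modules, wedges out of the integrand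
  are families of linear maps indexed by the arrows \<open>s \<in> S\<close> into \<open>B\<close>.\<close>

definition cone :: "('o, 'a, 'r, 'u) mod_fctr \<Rightarrow> 'o \<Rightarrow> ('r, 'u) module \<Rightarrow>
    ('a \<Rightarrow> 'u \<Rightarrow> 'u) \<Rightarrow> bool" where
  "cone T B Q \<beta> \<longleftrightarrow>
     (\<forall>s \<in> S. Cod C s = B \<longrightarrow> lin R (fobj T (Dom C s)) Q (\<beta> s)) \<and>
     (\<forall>g \<in> AX. \<forall>s \<in> S. Cod C s = B \<longrightarrow> Dom C s = Cod C g \<longrightarrow> (\<forall>x \<in> carrier (fobj T (Dom C g)).
        \<beta> s (act T g x) = (if s \<cdot> g \<in> S then \<beta> (s \<cdot> g) x else \<zero>\<^bsub>Q\<^esub>)))"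

lemma cone_lin: "cone T B Q \<beta> \<Longrightarrow> s \<in> S \<Longrightarrow> Cod C s = B \<Longrightarrow> lin R (fobj T (Dom C s)) Q (\<beta> s)"
  and cone_act: "cone T B Q \<beta> \<Longrightarrow> g \<in> AX \<Longrightarrow> s \<in> S \<Longrightarrow> Cod C s = B \<Longrightarrow> Dom C s = Cod C g \<Longrightarrow>
    x \<in> carrier (fobj T (Dom C g)) \<Longrightarrow> \<beta> s (act T g x) = (if s \<cdot> g \<in> S then \<beta> (s \<cdot> g) x else \<zero>\<^bsub>Q\<^esub>)"
  by (auto simp: cone_def)

text \<open>The coend described by cones: the initial cone among modules carried by
  \<open>'u\<close>. Existence and uniqueness are separated and uniqueness ignores values off the
  carrier, as in \<open>is_direct_sum\<close>.\<close>

definition universal :: "('o, 'a, 'r, 'u) mod_fctr \<Rightarrow> 'o \<Rightarrow> ('r, 'u) module \<Rightarrow>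
    ('a \<Rightarrow> 'u \<Rightarrow> 'u) \<Rightarrow> bool" where
  "universal T B Z \<zeta> \<longleftrightarrow> module R Z \<and> cone T B Z \<zeta> \<and>
     (\<forall>Q \<beta>. module R Q \<longrightarrow> cone T B Q \<beta> \<longrightarrow> (\<exists>h. lin R Z Q h \<and>
        (\<forall>s \<in> S. Cod C s = B \<longrightarrow> (\<forall>x \<in> carrier (fobj T (Dom C s)). h (\<zeta> s x) = \<beta> s x)))) \<and>
     (\<forall>Q h k. module R (Q :: ('r, 'u) module) \<longrightarrow> lin R Z Q h \<longrightarrow> lin R Z Q k \<longrightarrow>
        (\<forall>s \<in> S. Cod C s = B \<longrightarrow> (\<forall>x \<in> carrier (fobj T (Dom C s)). h (\<zeta> s x) = k (\<zeta> s x))) \<longrightarrow>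
        (\<forall>z \<in> carrier Z. h z = k z))"

definition wedge_cone :: "('o, 'a, 'r, 'u) mod_fctr \<Rightarrow> 'o \<Rightarrow>
    ('o \<Rightarrow> ('r, 'u) mod_arr) \<Rightarrow> 'a \<Rightarrow> 'u \<Rightarrow> 'u" where
  "wedge_cone T B \<omega> s x = fst (snd (\<omega> (Dom C s))) (tgen (Dom C s) B (fobj T (Dom C s)) s x)"

lemma wedge_arr:
  assumes "is_wedge X V (integrand T B) Q \<omega>" "A \<in> Obj C" "B \<in> Obj C"
  shows "\<omega> A = (tmod A B (fobj T A), fst (snd (\<omega> A)), Q)"
    and "fst (snd (\<omega> A)) \<in> linear_maps R (tmod A B (fobj T A)) Q" and "module R Q"
  using assms by (auto simp: is_wedge_def Hom_mod_cat integrand_obj)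

text \<open>Evaluate the wedge equation for \<open>g\<close> at the symbol
  \<open>s \<otimes> x\<close> with \<open>x\<close> over the domain of \<open>g\<close>. One side
  moves \<open>g\<close> into the kernel and gives \<open>(s \<cdot> g) \<otimes> x\<close>, or zero
  if \<open>s \<cdot> g\<close> leaves \<open>S\<close>; the other gives
  \<open>s \<otimes> g x\<close>.\<close>

lemma cone_of_wedge:
  assumes T: "mfun T" and B: "B \<in> Obj C" and w: "is_wedge X V (integrand T B) Q \<omega>"
  shows "cone T B Q (wedge_cone T B \<omega>)"
  unfolding cone_def
proof (intro conjI ballI impI)
  fix s assume s: "s \<in> S" "Cod C s = B"
  then have A: "Dom C s \<in> Obj C" and sH: "s \<in> Hom C (Dom C s) B"
    using S_Arr Dom_in_Obj by (auto simp: Hom_def)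
  have N: "module R (fobj T (Dom C s))" using mod_functor_module[OF T] A by simp
  show "lin R (fobj T (Dom C s)) Q (wedge_cone T B \<omega> s)"
    unfolding wedge_cone_def
    using lin_comp[OF tgen_lin[OF N s(1) sH] linear_maps_lin[OF wedge_arr(2)[OF w A B]]] .
next
  fix g s x assume g: "g \<in> AX" and s: "s \<in> S" "Cod C s = B" "Dom C s = Cod C g"
    and x: "x \<in> carrier (fobj T (Dom C g))"
  let ?A = "Dom C g" and ?A' = "Cod C g"
  have A: "?A \<in> Obj C" "?A' \<in> Obj C" using AX_Arr[OF g] Dom_in_Obj Cod_in_Obj by auto
  have sH: "s \<in> Hom C ?A' B" using s S_Arr by (auto simp: Hom_def)
  note I = Idn_simps[OF A(1)] Idn_simps[OF A(2)]
  have N: "module R (fobj T ?A)" "module R (fobj T ?A')" using mod_functor_module[OF T] A by auto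
  obtain u where u: "farr (integrand T B) (g, Idn C ?A) = (tmod ?A' B (fobj T ?A), u, tmod ?A B (fobj T ?A))"
    "u (tgen ?A' B (fobj T ?A) s x) = (if s \<cdot> g \<in> S then tgen ?A B (fobj T ?A) (s \<cdot> g) (act T (Idn C ?A) x)
       else \<zero>\<^bsub>tmod ?A B (fobj T ?A)\<^esub>)"
    using integrand_arr[OF T B g AX_id[OF A(1)]] I s sH x by auto
  obtain v where v: "farr (integrand T B) (Idn C ?A', g) = (tmod ?A' B (fobj T ?A), v, tmod ?A' B (fobj T ?A'))"
    "v (tgen ?A' B (fobj T ?A) s x) = tgen ?A' B (fobj T ?A') s (act T g x)"
    using integrand_arr[OF T B AX_id[OF A(2)] g] I s sH x Cmp_Idn_right[OF sH] by auto
  note l = wedge_arr(2)[OF w A(1) B, THEN linear_maps_lin]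
  have "\<omega> ?A \<cdot>\<^bsub>V\<^esub> farr (integrand T B) (g, Idn C ?A) = \<omega> ?A' \<cdot>\<^bsub>V\<^esub> farr (integrand T B) (Idn C ?A', g)"
    using w A g AX_Arr[OF g] by (auto simp: is_wedge_def Hom_X Hom_def)
  then have "compose (carrier (tmod ?A' B (fobj T ?A))) (fst (snd (\<omega> ?A))) u =
      compose (carrier (tmod ?A' B (fobj T ?A))) (fst (snd (\<omega> ?A'))) v"
    unfolding u(1) v(1) by (subst (asm) wedge_arr(1)[OF w A(1) B], subst (asm) wedge_arr(1)[OF w A(2) B]) simp
  moreover have "tgen ?A' B (fobj T ?A) s x \<in> carrier (tmod ?A' B (fobj T ?A))"
    using lin_closed[OF tgen_lin[OF N(1) s(1) sH] x] .
  ultimately have "fst (snd (\<omega> ?A)) (u (tgen ?A' B (fobj T ?A) s x)) = fst (snd (\<omega> ?A')) (v (tgen ?A' B (fobj T ?A) s x))"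
    by (rule compose_eqD)
  then show "wedge_cone T B \<omega> s (act T g x) = (if s \<cdot> g \<in> S then wedge_cone T B \<omega> (s \<cdot> g) x else \<zero>\<^bsub>Q\<^esub>)"
    using s S_Arr AX_Arr[OF g] lin_zero[OF l tmod_module[OF N(1)] wedge_arr(3)[OF w A(1) B]]
    by (auto simp: wedge_cone_def u v Cmp_simps mfun_id[OF T] A x)
qed

lemma tmod_arr_eqI:
  assumes N: "module R N" and Q: "module R (Q :: ('r, 'u) module)" and h: "lin R (tmod A B N) Q h" and k: "lin R (tmod A B N) Q k"
    and eq: "\<And>s x. s \<in> S \<Longrightarrow> s \<in> Hom C A B \<Longrightarrow> x \<in> carrier N \<Longrightarrow> h (tgen A B N s x) = k (tgen A B N s x)"
  shows "restrict h (carrier (tmod A B N)) = restrict k (carrier (tmod A B N))"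
  using tmod_ext[OF N Q h k eq] by auto

text \<open>The members of the cone with domain \<open>A\<close> assemble to a map out of the tensor
  product at \<open>A\<close>. The wedge equations are equations between linear maps on tensor
  products, so the cone equations on generators suffice.\<close>

lemma wedge_of_cone:
  assumes T: "mfun T" and B: "B \<in> Obj C" and Q: "module R Q" and c: "cone T B Q \<beta>"
  shows "\<exists>\<omega>. is_wedge X V (integrand T B) Q \<omega> \<and>
    (\<forall>s \<in> S. Cod C s = B \<longrightarrow> (\<forall>x \<in> carrier (fobj T (Dom C s)). wedge_cone T B \<omega> s x = \<beta> s x))"
proof -
  have N: "module R (fobj T A)" if "A \<in> Obj C" for A using mod_functor_module[OF T] that by simp
  have "\<exists>h. h \<in> linear_maps R (tmod A B (fobj T A)) Q \<and>
    (\<forall>s \<in> S. s \<in> Hom C A B \<longrightarrow> (\<forall>x \<in> carrier (fobj T A). h (tgen A B (fobj T A) s x) = \<beta> s x))" if "A \<in> Obj C" for A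
    by (rule tmod_lift[OF N[OF that] Q]) (use cone_lin[OF c] in \<open>auto simp: Hom_def\<close>)
  then obtain h where h: "\<And>A. A \<in> Obj C \<Longrightarrow> h A \<in> linear_maps R (tmod A B (fobj T A)) Q"
    "\<And>A s x. A \<in> Obj C \<Longrightarrow> s \<in> S \<Longrightarrow> s \<in> Hom C A B \<Longrightarrow> x \<in> carrier (fobj T A) \<Longrightarrow> h A (tgen A B (fobj T A) s x) = \<beta> s x"
    by metis
  note hl = linear_maps_lin[OF h(1)]
  let ?\<omega> = "\<lambda>A. (tmod A B (fobj T A), h A, Q)"
  have "is_wedge X V (integrand T B) Q ?\<omega>"
    unfolding is_wedge_def
  proof (intro conjI ballI)
    show "Q \<in> Obj V" using Q by simp
    show "?\<omega> A \<in> Hom V (fobj (integrand T B) (A, A)) Q" if "A \<in> Obj X" for A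
      using that h(1) Q tmod_module[OF N] B by (simp add: Hom_mod_cat integrand_obj)
    fix A A' g assume "A \<in> Obj X" "A' \<in> Obj X" "g \<in> Hom X A A'"
    then have A: "A \<in> Obj C" "A' \<in> Obj C" and g: "g \<in> AX" "Dom C g = A" "Cod C g = A'"
      by (auto simp: Hom_def)
    note I = Idn_simps[OF A(1)] Idn_simps[OF A(2)]
    obtain u where u: "farr (integrand T B) (g, Idn C A) = (tmod A' B (fobj T A), u, tmod A B (fobj T A))"
      "u \<in> linear_maps R (tmod A' B (fobj T A)) (tmod A B (fobj T A))"
      "\<And>s x. s \<in> S \<Longrightarrow> s \<in> Hom C A' B \<Longrightarrow> x \<in> carrier (fobj T A) \<Longrightarrow>
         u (tgen A' B (fobj T A) s x) = (if s \<cdot> g \<in> S then tgen A B (fobj T A) (s \<cdot> g) (act T (Idn C A) x)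
           else \<zero>\<^bsub>tmod A B (fobj T A)\<^esub>)"
      using integrand_arr[OF T B g(1) AX_id[OF A(1)]] I unfolding g by auto
    obtain v where v: "farr (integrand T B) (Idn C A', g) = (tmod A' B (fobj T A), v, tmod A' B (fobj T A'))"
      "v \<in> linear_maps R (tmod A' B (fobj T A)) (tmod A' B (fobj T A'))"
      "\<And>s x. s \<in> S \<Longrightarrow> s \<in> Hom C A' B \<Longrightarrow> x \<in> carrier (fobj T A) \<Longrightarrow>
        v (tgen A' B (fobj T A) s x) = (if s \<cdot> Idn C A' \<in> S then tgen A' B (fobj T A') (s \<cdot> Idn C A') (act T g x)
           else \<zero>\<^bsub>tmod A' B (fobj T A')\<^esub>)"
      using integrand_arr[OF T B AX_id[OF A(2)] g(1)] I unfolding g by auto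
    have "compose (carrier (tmod A' B (fobj T A))) (h A) u = compose (carrier (tmod A' B (fobj T A))) (h A') v"
      unfolding compose_def
    proof (rule tmod_arr_eqI[OF N[OF A(1)] Q lin_comp[OF linear_maps_lin[OF u(2)] hl[OF A(1)]]
          lin_comp[OF linear_maps_lin[OF v(2)] hl[OF A(2)]]])
      fix s x assume s: "s \<in> S" "s \<in> Hom C A' B" and x: "x \<in> carrier (fobj T A)"
      have sg: "s \<cdot> g \<in> Hom C A B" using s g AX_Arr[OF g(1)] by (auto simp: Hom_def Cmp_simps)
      have gx: "act T g x \<in> carrier (fobj T A')"
        using lin_closed[OF mod_functor_lin[OF T], of g x] g x by simp
      have "h A (u (tgen A' B (fobj T A) s x)) = (if s \<cdot> g \<in> S then \<beta> (s \<cdot> g) x else \<zero>\<^bsub>Q\<^esub>)"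
        using sg A s x h(2) lin_zero[OF hl[OF A(1)] tmod_module[OF N[OF A(1)]] Q]
        by (simp add: u mfun_id[OF T])
      also have "\<dots> = \<beta> s (act T g x)"
        using cone_act[OF c g(1) s(1)] s g x by (auto simp: Hom_def)
      also have "\<dots> = h A' (v (tgen A' B (fobj T A) s x))"
        using A s x gx h(2) by (simp add: v Cmp_Idn_right[OF s(2)])
      finally show "h A (u (tgen A' B (fobj T A) s x)) = h A' (v (tgen A' B (fobj T A) s x))" .
    qed
    then show "?\<omega> A \<cdot>\<^bsub>V\<^esub> farr (integrand T B) (g, Idn X A) = ?\<omega> A' \<cdot>\<^bsub>V\<^esub> farr (integrand T B) (Idn X A', g)"
      by (simp add: u v)
  qed
  moreover have "wedge_cone T B ?\<omega> s x = \<beta> s x" if "s \<in> S" "Cod C s = B" "x \<in> carrier (fobj T (Dom C s))" for s x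
    using that h(2)[of "Dom C s" s x] S_Arr[OF that(1)] Dom_in_Obj by (auto simp: wedge_cone_def Hom_def)
  ultimately show ?thesis by blast
qed

text \<open>Factoring one wedge through another is a matter of generators. This lets the universal
  property be transferred between wedges and cones in both directions.\<close>

lemma wedge_factor_iff:
  assumes T: "mfun T" and B: "B \<in> Obj C"
    and w: "is_wedge X V (integrand T B) Z \<omega>" and t: "is_wedge X V (integrand T B) Q \<theta>"
    and Z: "module R Z" and Q: "module R Q" and h: "lin R Z Q h"
  shows "(\<forall>A \<in> Obj C. (Z, restrict h (carrier Z), Q) \<cdot>\<^bsub>V\<^esub> \<omega> A = \<theta> A) \<longleftrightarrow>
    (\<forall>s \<in> S. Cod C s = B \<longrightarrow> (\<forall>x \<in> carrier (fobj T (Dom C s)). h (wedge_cone T B \<omega> s x) = wedge_cone T B \<theta> s x))"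
proof -
  have N: "module R (fobj T A)" if "A \<in> Obj C" for A using mod_functor_module[OF T] that by simp
  have e: "(Z, restrict h (carrier Z), Q) \<cdot>\<^bsub>V\<^esub> \<omega> A = \<theta> A \<longleftrightarrow>
      (\<forall>z \<in> carrier (tmod A B (fobj T A)). h (fst (snd (\<omega> A)) z) = fst (snd (\<theta> A)) z)" (is "?l \<longleftrightarrow> ?r") if A: "A \<in> Obj C" for A
  proof -
    note \<omega> = wedge_arr[OF w A B] and \<theta> = wedge_arr[OF t A B]
    have "?l \<longleftrightarrow> compose (carrier (tmod A B (fobj T A))) (restrict h (carrier Z)) (fst (snd (\<omega> A))) = fst (snd (\<theta> A))"
    proof -
      obtain a b where "\<omega> A = (tmod A B (fobj T A), a, Z)" "\<theta> A = (tmod A B (fobj T A), b, Q)"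
        using \<omega>(1) \<theta>(1) by blast
      then show ?thesis by simp
    qed
    also have "\<dots> \<longleftrightarrow> ?r"
    proof
      assume r: ?r
      show "compose (carrier (tmod A B (fobj T A))) (restrict h (carrier Z)) (fst (snd (\<omega> A))) = fst (snd (\<theta> A))"
        by (rule linear_maps_eqI[OF linear_maps_compose[OF tmod_module[OF N[OF A]] \<omega>(2) lin_restrict[OF h Z]] \<theta>(2)])
           (use r lin_closed[OF linear_maps_lin[OF \<omega>(2)]] in \<open>auto simp: compose_def\<close>)
    next
      assume "compose (carrier (tmod A B (fobj T A))) (restrict h (carrier Z)) (fst (snd (\<omega> A))) = fst (snd (\<theta> A))"
      from fun_cong[OF this] show ?r
        using lin_closed[OF linear_maps_lin[OF \<omega>(2)]] by (simp add: compose_def restrict_def) metis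
    qed
    finally show ?thesis .
  qed
  show ?thesis (is "?L \<longleftrightarrow> ?R")
  proof
    assume L: ?L
    show ?R
    proof (intro ballI impI)
      fix s x assume s: "s \<in> S" "Cod C s = B" and x: "x \<in> carrier (fobj T (Dom C s))"
      have A: "Dom C s \<in> Obj C" and sH: "s \<in> Hom C (Dom C s) B" using s S_Arr Dom_in_Obj by (auto simp: Hom_def)
      have "tgen (Dom C s) B (fobj T (Dom C s)) s x \<in> carrier (tmod (Dom C s) B (fobj T (Dom C s)))"
        using lin_closed[OF tgen_lin[OF N[OF A] s(1) sH] x] .
      then show "h (wedge_cone T B \<omega> s x) = wedge_cone T B \<theta> s x"
        using L e[OF A] A unfolding wedge_cone_def by blast
    qed
  next
    assume r: ?R
    show ?L
    proof
      fix A assume A: "A \<in> Obj C"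
      show "(Z, restrict h (carrier Z), Q) \<cdot>\<^bsub>V\<^esub> \<omega> A = \<theta> A"
        unfolding e[OF A]
      proof
        fix z assume z: "z \<in> carrier (tmod A B (fobj T A))"
        show "h (fst (snd (\<omega> A)) z) = fst (snd (\<theta> A)) z"
          by (rule tmod_ext[OF N[OF A] Q lin_comp[OF linear_maps_lin[OF wedge_arr(2)[OF w A B]] h] linear_maps_lin[OF wedge_arr(2)[OF t A B]] _ z])
             (use r in \<open>auto simp: wedge_cone_def Hom_def\<close>)
      qed
    qed
  qed
qed

lemma universal_module: "universal T B Z \<zeta> \<Longrightarrow> module R Z"
  and universal_cone: "universal T B Z \<zeta> \<Longrightarrow> cone T B Z \<zeta>"
  by (auto simp: universal_def)

lemma universal_lift: "universal T B Z \<zeta> \<Longrightarrow> module R Q \<Longrightarrow> cone T B Q \<beta> \<Longrightarrow>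
    \<exists>h. lin R Z Q h \<and> (\<forall>s \<in> S. Cod C s = B \<longrightarrow> (\<forall>x \<in> carrier (fobj T (Dom C s)). h (\<zeta> s x) = \<beta> s x))"
  unfolding universal_def by simp

lemma universal_ext:
  assumes "universal T B Z \<zeta>" "module R (Q :: ('r, 'u) module)" "lin R Z Q h" "lin R Z Q k"
    and "\<And>s x. s \<in> S \<Longrightarrow> Cod C s = B \<Longrightarrow> x \<in> carrier (fobj T (Dom C s)) \<Longrightarrow> h (\<zeta> s x) = k (\<zeta> s x)"
    and "z \<in> carrier Z"
  shows "h z = k z"
  using assms(1)[unfolded universal_def, THEN conjunct2, THEN conjunct2, THEN conjunct2, rule_format, OF assms(2-4) _ assms(6)]
    assms(5) by simp

lemma coend_of_universal:
  assumes T: "mfun T" and B: "B \<in> Obj C" and u: "universal T B Z \<zeta>"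
  shows "\<exists>\<omega>. is_coend X V (integrand T B) (Z, \<omega>)"
proof -
  note Z = universal_module[OF u]
  obtain \<omega> where w: "is_wedge X V (integrand T B) Z \<omega>"
    and \<omega>: "\<And>s x. s \<in> S \<Longrightarrow> Cod C s = B \<Longrightarrow> x \<in> carrier (fobj T (Dom C s)) \<Longrightarrow> wedge_cone T B \<omega> s x = \<zeta> s x"
    using wedge_of_cone[OF T B Z universal_cone[OF u]] by blast
  have "is_coend X V (integrand T B) (Z, \<omega>)"
    unfolding is_coend_def split
  proof (intro conjI allI impI)
    fix Q \<theta> assume t: "is_wedge X V (integrand T B) Q \<theta>"
    then have Q: "module R Q" by (simp add: is_wedge_def)
    obtain h where h: "lin R Z Q h"
      "\<And>s x. s \<in> S \<Longrightarrow> Cod C s = B \<Longrightarrow> x \<in> carrier (fobj T (Dom C s)) \<Longrightarrow> h (\<zeta> s x) = wedge_cone T B \<theta> s x"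
      using universal_lift[OF u Q cone_of_wedge[OF T B t]] by blast
    show "\<exists>!h. h \<in> Hom V Z Q \<and> (\<forall>A\<in>Obj X. h \<cdot>\<^bsub>V\<^esub> \<omega> A = \<theta> A)"
    proof (rule ex1I[of _ "(Z, restrict h (carrier Z), Q)"])
      show "(Z, restrict h (carrier Z), Q) \<in> Hom V Z Q \<and> (\<forall>A\<in>Obj X. (Z, restrict h (carrier Z), Q) \<cdot>\<^bsub>V\<^esub> \<omega> A = \<theta> A)"
        using lin_restrict[OF h(1) Z] Z Q wedge_factor_iff[OF T B w t Z Q h(1)] h(2) \<omega> by (simp add: Hom_mod_cat)
      fix k' assume k': "k' \<in> Hom V Z Q \<and> (\<forall>A\<in>Obj X. k' \<cdot>\<^bsub>V\<^esub> \<omega> A = \<theta> A)"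
      then obtain k where k: "k' = (Z, k, Q)" "k \<in> linear_maps R Z Q" by (auto simp: Hom_mod_cat)
      have kr: "restrict k (carrier Z) = k" using k(2) by (simp add: linear_maps_iff extensional_restrict)
      have "k (\<zeta> s x) = h (\<zeta> s x)" if "s \<in> S" "Cod C s = B" "x \<in> carrier (fobj T (Dom C s))" for s x
        using wedge_factor_iff[OF T B w t Z Q linear_maps_lin[OF k(2)]] k' k(1) kr that h(2) \<omega> by simp
      then have "k z = h z" if "z \<in> carrier Z" for z
        using universal_ext[OF u Q linear_maps_lin[OF k(2)] h(1)] that by blast
      then have "k = restrict h (carrier Z)"
        by (intro linear_maps_eqI[OF k(2) lin_restrict[OF h(1) Z]]) auto
      then show "k' = (Z, restrict h (carrier Z), Q)" using k(1) by simp
    qed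
  qed (rule w)
  then show ?thesis by blast
qed

text \<open>The coend that \<open>SOME\<close> selects need not be the one that was constructed, so
  the elementwise universal property has to be recovered from the abstract one for an arbitrary
  coend.\<close>

lemma universal_of_coend:
  assumes T: "mfun T" and B: "B \<in> Obj C" and c: "is_coend X V (integrand T B) (Z, \<omega>)"
  shows "universal T B Z (wedge_cone T B \<omega>)"
proof -
  have w: "is_wedge X V (integrand T B) Z \<omega>" using c by (simp add: is_coend_def)
  then have Z: "module R Z" by (simp add: is_wedge_def)
  have cu: "\<exists>!h. h \<in> Hom V Z Q \<and> (\<forall>A\<in>Obj C. h \<cdot>\<^bsub>V\<^esub> \<omega> A = \<theta> A)"
    if "is_wedge X V (integrand T B) Q \<theta>" for Q \<theta>
    using c that by (simp add: is_coend_def)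
  have wc: "wedge_cone T B \<omega> s x \<in> carrier Z" if "s \<in> S" "Cod C s = B" "x \<in> carrier (fobj T (Dom C s))" for s x
    using lin_closed[OF cone_lin[OF cone_of_wedge[OF T B w]]] that by blast
  show ?thesis
    unfolding universal_def
  proof (intro conjI allI impI)
    show "module R Z" by (rule Z)
    show "cone T B Z (wedge_cone T B \<omega>)" by (rule cone_of_wedge[OF T B w])
  next
    fix Q \<beta> assume Q: "module R Q" and b: "cone T B Q \<beta>"
    obtain \<theta> where t: "is_wedge X V (integrand T B) Q \<theta>"
      and \<theta>: "\<And>s x. s \<in> S \<Longrightarrow> Cod C s = B \<Longrightarrow> x \<in> carrier (fobj T (Dom C s)) \<Longrightarrow> wedge_cone T B \<theta> s x = \<beta> s x"
      using wedge_of_cone[OF T B Q b] by blast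
    obtain h where h: "h \<in> linear_maps R Z Q" "\<forall>A\<in>Obj C. (Z, h, Q) \<cdot>\<^bsub>V\<^esub> \<omega> A = \<theta> A"
      using cu[OF t] by (auto simp: Hom_mod_cat)
    have hr: "restrict h (carrier Z) = h" using h(1) by (simp add: linear_maps_iff extensional_restrict)
    show "\<exists>h. lin R Z Q h \<and> (\<forall>s\<in>S. Cod C s = B \<longrightarrow> (\<forall>x\<in>carrier (fobj T (Dom C s)). h (wedge_cone T B \<omega> s x) = \<beta> s x))"
      using wedge_factor_iff[OF T B w t Z Q linear_maps_lin[OF h(1)]] h \<theta> hr
      by (intro exI[of _ h]) (auto simp: linear_maps_lin)
  next
    fix Q :: "('r, 'u) module" and h k assume Q: "module R Q" and h: "lin R Z Q h" and k: "lin R Z Q k"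
      and eq: "\<forall>s\<in>S. Cod C s = B \<longrightarrow> (\<forall>x\<in>carrier (fobj T (Dom C s)). h (wedge_cone T B \<omega> s x) = k (wedge_cone T B \<omega> s x))"
    \<comment> \<open>For uniqueness, \<open>h\<close> applied to the universal cone is itself a
      cone. Its wedge \<open>\<theta>\<close> is factored by both \<open>h\<close> and
      \<open>k\<close>, and \<open>\<exists>!\<close> identifies them.\<close>
    have "cone T B Q (\<lambda>s x. h (wedge_cone T B \<omega> s x))"
      using lin_comp[OF cone_lin[OF cone_of_wedge[OF T B w]] h] cone_act[OF cone_of_wedge[OF T B w]] lin_zero[OF h Z Q]
      unfolding cone_def by simp
    from wedge_of_cone[OF T B Q this]
    obtain \<theta> where t: "is_wedge X V (integrand T B) Q \<theta>"
      and \<theta>: "\<And>s x. s \<in> S \<Longrightarrow> Cod C s = B \<Longrightarrow> x \<in> carrier (fobj T (Dom C s)) \<Longrightarrow>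
        wedge_cone T B \<theta> s x = h (wedge_cone T B \<omega> s x)" by blast
    have a: "(Z, restrict h (carrier Z), Q) \<in> Hom V Z Q \<and> (\<forall>A\<in>Obj C. (Z, restrict h (carrier Z), Q) \<cdot>\<^bsub>V\<^esub> \<omega> A = \<theta> A)"
      using lin_restrict[OF h Z] wedge_factor_iff[OF T B w t Z Q h] \<theta> Z Q by (simp add: Hom_mod_cat)
    have b: "(Z, restrict k (carrier Z), Q) \<in> Hom V Z Q \<and> (\<forall>A\<in>Obj C. (Z, restrict k (carrier Z), Q) \<cdot>\<^bsub>V\<^esub> \<omega> A = \<theta> A)"
      using lin_restrict[OF k Z] wedge_factor_iff[OF T B w t Z Q k] \<theta> Z Q eq by (simp add: Hom_mod_cat)
    have "restrict h (carrier Z) = restrict k (carrier Z)"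
      using ex1E[OF cu[OF t]] a b by blast
    then show "\<forall>z\<in>carrier Z. h z = k z" by (auto dest: restrict_eqD)
  qed
qed

end

text \<open>Existence is an assumption here because the two instances obtain it in different ways:
  \<open>M_hat\<close> by a direct sum, \<open>E_hat\<close> by the image of an idempotent.\<close>

locale truncated_kernel_coends = truncated_kernel R C S AX AY U
  for R :: "('r, 's) ring_scheme" and C :: "('o, 'a) cat" (structure)
    and S AX AY :: "'a set" and U :: "'u itself" +
  assumes universal_exists: "mfun T \<Longrightarrow> B \<in> Obj C \<Longrightarrow> \<exists>Z \<zeta>. universal T B Z \<zeta>"
begin

definition coend_obj :: "('o, 'a, 'r, 'u) mod_fctr \<Rightarrow> 'o \<Rightarrow> ('r, 'u) module" where
  "coend_obj T B = fst (coend X V (integrand T B))"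

definition \<iota> :: "('o, 'a, 'r, 'u) mod_fctr \<Rightarrow> 'o \<Rightarrow> 'a \<Rightarrow> 'u \<Rightarrow> 'u" where
  "\<iota> T B = wedge_cone T B (snd (coend X V (integrand T B)))"

lemma is_coend_coend:
  assumes "mfun T" "B \<in> Obj C"
  shows "is_coend X V (integrand T B) (coend_obj T B, snd (coend X V (integrand T B)))"
proof -
  obtain Z \<omega> where "is_coend X V (integrand T B) (Z, \<omega>)"
    using universal_exists[OF assms] coend_of_universal[OF assms] by blast
  then show ?thesis
    unfolding coend_obj_def coend_def prod.collapse by (rule someI)
qed

lemma universal_coend: "mfun T \<Longrightarrow> B \<in> Obj C \<Longrightarrow> universal T B (coend_obj T B) (\<iota> T B)"
  unfolding \<iota>_def by (rule universal_of_coend[OF _ _ is_coend_coend])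

lemmas coend_module = universal_module[OF universal_coend]
lemmas coend_ext = universal_ext[OF universal_coend]
lemmas coend_lift = universal_lift[OF universal_coend]

lemma \<iota>_lin: "mfun T \<Longrightarrow> s \<in> S \<Longrightarrow> Cod C s = B \<Longrightarrow> lin R (fobj T (Dom C s)) (coend_obj T B) (\<iota> T B s)"
  using cone_lin[OF universal_cone[OF universal_coend]] Cod_in_Obj[OF S_Arr] by auto

lemma \<iota>_closed: "mfun T \<Longrightarrow> s \<in> S \<Longrightarrow> Cod C s = B \<Longrightarrow> x \<in> carrier (fobj T (Dom C s)) \<Longrightarrow> \<iota> T B s x \<in> carrier (coend_obj T B)"
  by (rule lin_closed[OF \<iota>_lin])

lemma \<iota>_act: "mfun T \<Longrightarrow> g \<in> AX \<Longrightarrow> s \<in> S \<Longrightarrow> Cod C s = B \<Longrightarrow> Dom C s = Cod C g \<Longrightarrow>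
    x \<in> carrier (fobj T (Dom C g)) \<Longrightarrow>
    \<iota> T B s (act T g x) = (if s \<cdot> g \<in> S then \<iota> T B (s \<cdot> g) x else \<zero>\<^bsub>coend_obj T B\<^esub>)"
  using cone_act[OF universal_cone[OF universal_coend]] Cod_in_Obj[OF S_Arr] by auto

text \<open>Evaluates the \<open>THE\<close> in \<open>coend_map\<close> for any \<open>h\<close>
  with the right values on generators. Source and target may differ in the functor as well as in the
  object, so the lemma serves the action on arrows and on transformations alike.\<close>

lemma coend_map_eq:
  assumes T: "mfun T" and T': "mfun T'" and B: "B \<in> Obj C" "B' \<in> Obj C"
    and \<sigma>: "\<And>A. A \<in> Obj C \<Longrightarrow> \<sigma> A = (tmod A B (fobj T A), \<tau> A, tmod A B' (fobj T' A))"
    and \<tau>: "\<And>A. A \<in> Obj C \<Longrightarrow> \<tau> A \<in> linear_maps R (tmod A B (fobj T A)) (tmod A B' (fobj T' A))"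
    and h: "lin R (coend_obj T B) (coend_obj T' B') h"
    and eq: "\<And>s x. s \<in> S \<Longrightarrow> Cod C s = B \<Longrightarrow> x \<in> carrier (fobj T (Dom C s)) \<Longrightarrow>
      h (\<iota> T B s x) = fst (snd (snd (coend X V (integrand T' B')) (Dom C s)))
        (\<tau> (Dom C s) (tgen (Dom C s) B (fobj T (Dom C s)) s x))"
  shows "coend_map X V (integrand T B) (integrand T' B') \<sigma> =
    (coend_obj T B, restrict h (carrier (coend_obj T B)), coend_obj T' B')"
proof -
  let ?Z = "coend_obj T B" and ?Z' = "coend_obj T' B'"
  let ?\<omega> = "snd (coend X V (integrand T B))" and ?\<omega>' = "snd (coend X V (integrand T' B'))"
  note c = is_coend_coend[OF T B(1)] and c' = is_coend_coend[OF T' B(2)]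
  have w: "is_wedge X V (integrand T B) ?Z ?\<omega>" and w': "is_wedge X V (integrand T' B') ?Z' ?\<omega>'"
    using c c' by (auto simp: is_coend_def)
  note Z = coend_module[OF T B(1)] and Z' = coend_module[OF T' B(2)]
  have N: "module R (fobj T A)" if "A \<in> Obj C" for A using mfun_module[OF T that] .
  let ?\<theta> = "\<lambda>A. ?\<omega>' A \<cdot>\<^bsub>V\<^esub> \<sigma> A"
  have \<theta>: "?\<theta> A = (tmod A B (fobj T A), compose (carrier (tmod A B (fobj T A))) (fst (snd (?\<omega>' A))) (\<tau> A), ?Z')"
    if A: "A \<in> Obj C" for A
  proof -
    obtain a where "?\<omega>' A = (tmod A B' (fobj T' A), a, ?Z')" using wedge_arr(1)[OF w' A B(2)] by blast
    then show ?thesis using \<sigma>[OF A] by simp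
  qed
  have factor: "(\<forall>A\<in>Obj C. (?Z, restrict k (carrier ?Z), ?Z') \<cdot>\<^bsub>V\<^esub> ?\<omega> A = ?\<theta> A) \<longleftrightarrow>
      (\<forall>s\<in>S. Cod C s = B \<longrightarrow> (\<forall>x\<in>carrier (fobj T (Dom C s)). k (\<iota> T B s x) = h (\<iota> T B s x)))" (is "?l \<longleftrightarrow> ?r")
    if k: "lin R ?Z ?Z' k" for k
  proof
    assume l: ?l
    show ?r
    proof (intro ballI impI)
      fix s x assume s: "s \<in> S" "Cod C s = B" and x: "x \<in> carrier (fobj T (Dom C s))"
      have A: "Dom C s \<in> Obj C" and sH: "s \<in> Hom C (Dom C s) B" using s S_Arr Dom_in_Obj by (auto simp: Hom_def)
      let ?t = "tgen (Dom C s) B (fobj T (Dom C s)) s x"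
      have t: "?t \<in> carrier (tmod (Dom C s) B (fobj T (Dom C s)))"
        by (rule lin_closed[OF tgen_lin[OF N[OF A] s(1) sH] x])
      obtain a where a: "?\<omega> (Dom C s) = (tmod (Dom C s) B (fobj T (Dom C s)), a, ?Z)" using wedge_arr(1)[OF w A B(1)] by blast
      have "(?Z, restrict k (carrier ?Z), ?Z') \<cdot>\<^bsub>V\<^esub> ?\<omega> (Dom C s) = ?\<theta> (Dom C s)" using l A by blast
      then have "restrict k (carrier ?Z) (a ?t) = fst (snd (?\<omega>' (Dom C s))) (\<tau> (Dom C s) ?t)"
        unfolding \<theta>[OF A] using a t by (auto dest: compose_eqD)
      moreover have "a ?t = \<iota> T B s x" by (simp add: \<iota>_def wedge_cone_def a)
      ultimately show "k (\<iota> T B s x) = h (\<iota> T B s x)"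
        using eq[OF s x] \<iota>_closed[OF T s x] by simp
    qed
  next
    assume r: ?r
    show ?l
    proof
      fix A assume A: "A \<in> Obj C"
      note l1 = wedge_arr(2)[OF w A B(1), THEN linear_maps_lin] and l2 = wedge_arr(2)[OF w' A B(2), THEN linear_maps_lin]
      obtain a where a: "?\<omega> A = (tmod A B (fobj T A), a, ?Z)" using wedge_arr(1)[OF w A B(1)] by blast
      have "compose (carrier (tmod A B (fobj T A))) (restrict k (carrier ?Z)) (fst (snd (?\<omega> A))) =
          compose (carrier (tmod A B (fobj T A))) (fst (snd (?\<omega>' A))) (\<tau> A)"
        unfolding compose_def
      proof (rule tmod_arr_eqI[OF N[OF A] Z' lin_comp[OF l1 linear_maps_lin[OF lin_restrict[OF k Z]]]
            lin_comp[OF linear_maps_lin[OF \<tau>[OF A]] l2]])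
        fix s x assume s: "s \<in> S" "s \<in> Hom C A B" and x: "x \<in> carrier (fobj T A)"
        then have d: "Dom C s = A" "Cod C s = B" by (auto simp: Hom_def)
        have "fst (snd (?\<omega> A)) (tgen A B (fobj T A) s x) = \<iota> T B s x" by (simp add: \<iota>_def wedge_cone_def d)
        then show "restrict k (carrier ?Z) (fst (snd (?\<omega> A)) (tgen A B (fobj T A) s x)) =
            fst (snd (?\<omega>' A)) (\<tau> A (tgen A B (fobj T A) s x))"
          using r s(1) x eq[OF s(1) d(2)] d \<iota>_closed[OF T s(1) d(2)] by simp
      qed
      then show "(?Z, restrict k (carrier ?Z), ?Z') \<cdot>\<^bsub>V\<^esub> ?\<omega> A = ?\<theta> A"
        unfolding \<theta>[OF A] using a by simp
    qed
  qed
  show ?thesis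
    unfolding coend_map_def coend_obj_def[symmetric]
  proof (rule the_equality)
    show "(?Z, restrict h (carrier ?Z), ?Z') \<in> Hom V ?Z ?Z' \<and>
        (\<forall>A\<in>Obj X. (?Z, restrict h (carrier ?Z), ?Z') \<cdot>\<^bsub>V\<^esub> ?\<omega> A = ?\<theta> A)"
      using factor[OF h] lin_restrict[OF h Z] Z Z' by (simp add: Hom_mod_cat)
    fix k' assume k': "k' \<in> Hom V ?Z ?Z' \<and> (\<forall>A\<in>Obj X. k' \<cdot>\<^bsub>V\<^esub> ?\<omega> A = ?\<theta> A)"
    then obtain k where k: "k' = (?Z, k, ?Z')" "k \<in> linear_maps R ?Z ?Z'" by (auto simp: Hom_mod_cat)
    have kr: "restrict k (carrier ?Z) = k" using k(2) by (simp add: linear_maps_iff extensional_restrict)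
    have "k z = h z" if "z \<in> carrier ?Z" for z
      by (rule coend_ext[OF T B(1) Z' linear_maps_lin[OF k(2)] h _ that])
         (use factor[OF linear_maps_lin[OF k(2)]] k' k(1) kr in auto)
    then have "k = restrict h (carrier ?Z)"
      by (intro linear_maps_eqI[OF k(2) lin_restrict[OF h Z]]) auto
    then show "k' = (?Z, restrict h (carrier ?Z), ?Z')" using k(1) by simp
  qed
qed

section \<open>The induced functor on objects, arrows and transformations\<close>

abbreviation ind :: "('o, 'a, 'r, 'u) mod_fctr \<Rightarrow> ('o, 'a, 'r, 'u) mod_fctr" where
  "ind \<equiv> kernel_obj R X Y K"

lemma ind_obj: "B \<in> Obj C \<Longrightarrow> fobj (ind T) B = coend_obj T B"
  by (simp add: kernel_obj_def coend_obj_def)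

text \<open>The arrow \<open>f\<close> composes with the index \<open>s\<close>, and the symbol dies
  if \<open>f \<cdot> s\<close> leaves \<open>S\<close>. That these values form a cone is the point
  of \<open>S_both\<close>.\<close>

lemma ind_arr_exists:
  assumes T: "mfun T" and f: "f \<in> AY"
  shows "\<exists>h. farr (ind T) f = (coend_obj T (Dom C f), h, coend_obj T (Cod C f)) \<and>
    h \<in> linear_maps R (coend_obj T (Dom C f)) (coend_obj T (Cod C f)) \<and>
    (\<forall>s \<in> S. Cod C s = Dom C f \<longrightarrow> (\<forall>x \<in> carrier (fobj T (Dom C s)). h (\<iota> T (Dom C f) s x) =
      (if f \<cdot> s \<in> S then \<iota> T (Cod C f) (f \<cdot> s) x else \<zero>\<^bsub>coend_obj T (Cod C f)\<^esub>)))"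
proof -
  let ?B = "Dom C f" and ?B' = "Cod C f"
  have B: "?B \<in> Obj C" "?B' \<in> Obj C" using AY_Arr[OF f] Dom_in_Obj Cod_in_Obj by auto
  note Z = coend_module[OF T B(1)] and Z' = coend_module[OF T B(2)]
  interpret Z': module R "coend_obj T ?B'" by (rule Z')
  let ?\<beta> = "\<lambda>s x. if f \<cdot> s \<in> S then \<iota> T ?B' (f \<cdot> s) x else \<zero>\<^bsub>coend_obj T ?B'\<^esub>"
  have "cone T ?B (coend_obj T ?B') ?\<beta>"
    unfolding cone_def
  proof (intro conjI ballI impI)
    fix s assume s: "s \<in> S" "Cod C s = ?B"
    have "lin R (fobj T (Dom C s)) (coend_obj T ?B') (\<iota> T ?B' (f \<cdot> s))" if "f \<cdot> s \<in> S"
      using \<iota>_lin[OF T that, of ?B'] Cmp_simps[OF S_Arr[OF s(1)] AY_Arr[OF f] s(2)] by simp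
    then show "lin R (fobj T (Dom C s)) (coend_obj T ?B') (?\<beta> s)"
      by (cases "f \<cdot> s \<in> S") (auto simp: lin_zero_map[OF Z'])
  next
    fix g s x assume g: "g \<in> AX" and s: "s \<in> S" "Cod C s = ?B" "Dom C s = Cod C g" and x: "x \<in> carrier (fobj T (Dom C g))"
    note fs = Cmp_simps[OF S_Arr[OF s(1)] AY_Arr[OF f] s(2)]
    have a: "(f \<cdot> s) \<cdot> g = f \<cdot> (s \<cdot> g)"
      using s g f S_Arr AX_Arr AY_Arr by (intro Cmp_assoc') auto
    \<comment> \<open>If \<open>f \<cdot> (s \<cdot> g)\<close> lies in \<open>S\<close>, then so do
      \<open>f \<cdot> s\<close> and \<open>s \<cdot> g\<close>, and both sides are the same symbol.
      Otherwise both sides are zero, wherever along the way \<open>S\<close> was left.\<close>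
    show "?\<beta> s (act T g x) = (if s \<cdot> g \<in> S then ?\<beta> (s \<cdot> g) x else \<zero>\<^bsub>coend_obj T ?B'\<^esub>)"
      using \<iota>_act[OF T g _ _ _ x, of "f \<cdot> s" ?B'] S_both[OF s(1) g f] s fs a by auto
  qed
  from coend_lift[OF T B(1) Z' this] obtain h where h: "lin R (coend_obj T ?B) (coend_obj T ?B') h"
    "\<And>s x. s \<in> S \<Longrightarrow> Cod C s = ?B \<Longrightarrow> x \<in> carrier (fobj T (Dom C s)) \<Longrightarrow> h (\<iota> T ?B s x) = ?\<beta> s x"
    by blast
  define \<sigma> where "\<sigma> = (\<lambda>A. tensor_arr R (farr K (Idn C A, f)) (Idn V (fobj T A)) :: ('r, 'u) mod_arr)"
  have "\<exists>k. \<sigma> A = (tmod A ?B (fobj T A), k, tmod A ?B' (fobj T A)) \<and>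
      k \<in> linear_maps R (tmod A ?B (fobj T A)) (tmod A ?B' (fobj T A)) \<and>
      (\<forall>s \<in> S. s \<in> Hom C A ?B \<longrightarrow> (\<forall>n \<in> carrier (fobj T A). k (tgen A ?B (fobj T A) s n) =
        (if f \<cdot> s \<in> S then tgen A ?B' (fobj T A) (f \<cdot> s) n else \<zero>\<^bsub>tmod A ?B' (fobj T A)\<^esub>)))"
    if A: "A \<in> Obj C" for A
    using tensor_arr_K[OF AX_id[OF A] f mfun_module[OF T A] mfun_module[OF T A] linear_maps_id[OF mfun_module[OF T A]]]
    by (auto simp: Idn_simps[OF A] Cmp_Idn_right \<sigma>_def)
  then obtain \<tau> where \<sigma>: "\<And>A. A \<in> Obj C \<Longrightarrow> \<sigma> A = (tmod A ?B (fobj T A), \<tau> A, tmod A ?B' (fobj T A))"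
    and \<tau>: "\<And>A. A \<in> Obj C \<Longrightarrow> \<tau> A \<in> linear_maps R (tmod A ?B (fobj T A)) (tmod A ?B' (fobj T A))"
    and \<tau>g: "\<And>A s n. A \<in> Obj C \<Longrightarrow> s \<in> S \<Longrightarrow> s \<in> Hom C A ?B \<Longrightarrow> n \<in> carrier (fobj T A) \<Longrightarrow> \<tau> A (tgen A ?B (fobj T A) s n) =
        (if f \<cdot> s \<in> S then tgen A ?B' (fobj T A) (f \<cdot> s) n else \<zero>\<^bsub>tmod A ?B' (fobj T A)\<^esub>)"
    by metis
  have w': "is_wedge X V (integrand T ?B') (coend_obj T ?B') (snd (coend X V (integrand T ?B')))"
    using is_coend_coend[OF T B(2)] by (auto simp: is_coend_def)
  have "coend_map X V (integrand T ?B) (integrand T ?B') \<sigma> =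
      (coend_obj T ?B, restrict h (carrier (coend_obj T ?B)), coend_obj T ?B')"
  proof (rule coend_map_eq[OF T T B \<sigma> \<tau> h(1)])
    fix s x assume s: "s \<in> S" "Cod C s = ?B" and x: "x \<in> carrier (fobj T (Dom C s))"
    then have A: "Dom C s \<in> Obj C" and sH: "s \<in> Hom C (Dom C s) ?B" using S_Arr Dom_in_Obj by (auto simp: Hom_def)
    note fs = Cmp_simps[OF S_Arr[OF s(1)] AY_Arr[OF f] s(2)]
    show "h (\<iota> T ?B s x) = fst (snd (snd (coend X V (integrand T ?B')) (Dom C s)))
        (\<tau> (Dom C s) (tgen (Dom C s) ?B (fobj T (Dom C s)) s x))"
      unfolding \<tau>g[OF A s(1) sH x] h(2)[OF s x]
      using lin_zero[OF linear_maps_lin[OF wedge_arr(2)[OF w' A B(2)]] tmod_module[OF mfun_module[OF T A]] Z'] fs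
      by (auto simp: \<iota>_def wedge_cone_def)
  qed
  moreover have "farr (ind T) f = coend_map X V (integrand T ?B) (integrand T ?B') \<sigma>"
    using f by (simp add: kernel_obj_def \<sigma>_def)
  ultimately show ?thesis
    using lin_restrict[OF h(1) Z] h(2) \<iota>_closed[OF T] by simp
qed

lemma ind_arr:
  assumes T: "mfun T" and f: "f \<in> AY"
  shows "farr (ind T) f = (coend_obj T (Dom C f), act (ind T) f, coend_obj T (Cod C f))"
    and "act (ind T) f \<in> linear_maps R (coend_obj T (Dom C f)) (coend_obj T (Cod C f))"
    and "\<And>s x. s \<in> S \<Longrightarrow> Cod C s = Dom C f \<Longrightarrow> x \<in> carrier (fobj T (Dom C s)) \<Longrightarrow>
      act (ind T) f (\<iota> T (Dom C f) s x) =
      (if f \<cdot> s \<in> S then \<iota> T (Cod C f) (f \<cdot> s) x else \<zero>\<^bsub>coend_obj T (Cod C f)\<^esub>)"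
  using ind_arr_exists[OF T f] by (auto simp: act_def)

lemma ind_functor:
  assumes T: "mfun T"
  shows "is_functor Y V (ind T)"
proof -
  note l = ind_arr(2)[OF T, THEN linear_maps_lin]
  \<comment> \<open>\<open>mod_functorI\<close> yields functors of this restricted form; off
    \<open>AY\<close> both action maps are \<open>undefined\<close>, so the records are
    equal.\<close>
  have "ind T = \<lparr>fobj = (\<lambda>B \<in> Obj Y. coend_obj T B),
      farr = (\<lambda>f \<in> Arr Y. (coend_obj T (Dom Y f), act (ind T) f, coend_obj T (Cod Y f)))\<rparr>" (is "_ = ?F")
  proof -
    have "fobj (ind T) = (\<lambda>B \<in> Obj Y. coend_obj T B)" by (simp add: kernel_obj_def coend_obj_def)
    moreover have "farr (ind T) = (\<lambda>f \<in> Arr Y. (coend_obj T (Dom Y f), act (ind T) f, coend_obj T (Cod Y f)))"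
    proof
      fix f
      show "farr (ind T) f = (\<lambda>f \<in> Arr Y. (coend_obj T (Dom Y f), act (ind T) f, coend_obj T (Cod Y f))) f"
        using ind_arr(1)[OF T, of f] by (cases "f \<in> AY") (auto simp: kernel_obj_def)
    qed
    ultimately show ?thesis by simp
  qed
  moreover have "is_functor Y V ?F"
  proof (rule mod_functorI[OF category_Y])
    show "module R (coend_obj T A)" if "A \<in> Obj Y" for A using coend_module[OF T] that by simp
    show "act (ind T) f \<in> linear_maps R (coend_obj T (Dom Y f)) (coend_obj T (Cod Y f))" if "f \<in> Arr Y" for f
      using ind_arr(2)[OF T] that by simp
  next
    fix B z assume "B \<in> Obj Y" and z: "z \<in> carrier (coend_obj T B)"
    then have B: "B \<in> Obj C" by simp
    note I = Idn_simps[OF B]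
    have "act (ind T) (Idn C B) z = z"
    proof (rule coend_ext[OF T B coend_module[OF T B] _ lin_id _ z])
      show "lin R (coend_obj T B) (coend_obj T B) (act (ind T) (Idn C B))"
        using l[OF AY_id[OF B]] I by simp
      fix s x assume s: "s \<in> S" "Cod C s = B" and x: "x \<in> carrier (fobj T (Dom C s))"
      show "act (ind T) (Idn C B) (\<iota> T B s x) = \<iota> T B s x"
        using ind_arr(3)[OF T AY_id[OF B] s(1) _ x] I s Cmp_Idn_left'[OF S_Arr[OF s(1)] s(2)] by simp
    qed
    then show "act (ind T) (Idn Y B) z = z" by simp
  next
    fix f g z assume "f \<in> Arr Y" "g \<in> Arr Y" "Cod Y f = Dom Y g" "z \<in> carrier (coend_obj T (Dom Y f))"
    then have f: "f \<in> AY" "f \<in> Arr C" and g: "g \<in> AY" "g \<in> Arr C" and c: "Cod C f = Dom C g"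
      and z: "z \<in> carrier (coend_obj T (Dom C f))" using AY_Arr by auto
    note gf = Cmp_simps[OF f(2) g(2) c] and gfY = AY_comp[OF f(1) g(1) c]
    have B: "Dom C f \<in> Obj C" "Cod C g \<in> Obj C" "Cod C f \<in> Obj C" using f g Dom_in_Obj Cod_in_Obj by auto
    have "act (ind T) (g \<cdot> f) z = act (ind T) g (act (ind T) f z)"
    proof (rule coend_ext[OF T B(1) coend_module[OF T B(2)] _ lin_comp[OF l[OF f(1)]] _ z])
      show "lin R (coend_obj T (Dom C f)) (coend_obj T (Cod C g)) (act (ind T) (g \<cdot> f))"
        using l[OF gfY] gf by simp
      show "lin R (coend_obj T (Cod C f)) (coend_obj T (Cod C g)) (act (ind T) g)"
        using l[OF g(1)] c by simp
      fix s x assume s: "s \<in> S" "Cod C s = Dom C f" and x: "x \<in> carrier (fobj T (Dom C s))"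
      note fs = Cmp_simps[OF S_Arr[OF s(1)] f(2) s(2)]
      have a: "(g \<cdot> f) \<cdot> s = g \<cdot> (f \<cdot> s)"
        using s f g c S_Arr by (intro Cmp_assoc') auto
      have z: "act (ind T) g \<zero>\<^bsub>coend_obj T (Dom C g)\<^esub> = \<zero>\<^bsub>coend_obj T (Cod C g)\<^esub>"
        using lin_zero[OF l[OF g(1)]] coend_module[OF T] B c by simp
      have L: "act (ind T) (g \<cdot> f) (\<iota> T (Dom C f) s x) =
          (if g \<cdot> (f \<cdot> s) \<in> S then \<iota> T (Cod C g) (g \<cdot> (f \<cdot> s)) x else \<zero>\<^bsub>coend_obj T (Cod C g)\<^esub>)"
        using ind_arr(3)[OF T gfY s(1) _ x] gf s a by simp
      show "act (ind T) (g \<cdot> f) (\<iota> T (Dom C f) s x) = act (ind T) g (act (ind T) f (\<iota> T (Dom C f) s x))"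
      proof (cases "f \<cdot> s \<in> S")
        case True
        then show ?thesis
          using L ind_arr(3)[OF T f(1) s x] ind_arr(3)[OF T g(1) True] fs c x by simp
      next
        case False
        \<comment> \<open>Here \<open>S_left\<close> is needed: a symbol that \<open>f\<close> has
          already killed must not survive under the composite arrow.\<close>
        then have "g \<cdot> (f \<cdot> s) \<notin> S" using S_left[OF s(1) f(1) g(1) s(2) c] by blast
        then show ?thesis using False L ind_arr(3)[OF T f(1) s x] z c by simp
      qed
    qed
    then show "act (ind T) (g \<cdot>\<^bsub>Y\<^esub> f) z = act (ind T) g (act (ind T) f z)" by simp
  qed
  ultimately show ?thesis by simp
qed

abbreviation ind_functor_cat where "ind_functor_cat \<equiv> kernel_functor R X Y K ::
  (('o, 'a, 'r, 'u) mod_fctr, ('o, 'a, 'r, 'u) mod_nat_tr,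
   ('o, 'a, 'r, 'u) mod_fctr, ('o, 'a, 'r, 'u) mod_nat_tr) fctr"

definition ind_map :: "('o, 'a, 'r, 'u) mod_nat_tr \<Rightarrow> 'o \<Rightarrow> 'u \<Rightarrow> 'u" where
  "ind_map \<phi> B = fst (snd (fst (snd (farr ind_functor_cat \<phi>)) B))"

text \<open>The transformation acts on the second tensor factor, and its naturality along
  \<open>AX\<close> is the cone condition.\<close>

lemma ind_map_exists:
  assumes \<alpha>: "is_nat_tr X V P \<alpha> T" and B: "B \<in> Obj C"
  shows "\<exists>h. coend_map X V (integrand P B) (integrand T B)
      (\<lambda>A. tensor_arr R (Idn (mod_cat R) (fobj K (A, B))) (\<alpha> A)) = (coend_obj P B, h, coend_obj T B) \<and>
    h \<in> linear_maps R (coend_obj P B) (coend_obj T B) \<and>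
    (\<forall>s \<in> S. Cod C s = B \<longrightarrow> (\<forall>x \<in> carrier (fobj P (Dom C s)).
      h (\<iota> P B s x) = \<iota> T B s (fst (snd (\<alpha> (Dom C s))) x)))"
proof -
  note P = mod_nat_trD(1)[OF \<alpha>] and T = mod_nat_trD(2)[OF \<alpha>]
  note Z = coend_module[OF P B] and Z' = coend_module[OF T B]
  let ?a = "\<lambda>A. fst (snd (\<alpha> A))"
  have a: "?a A \<in> linear_maps R (fobj P A) (fobj T A)" if "A \<in> Obj C" for A
    using mod_nat_tr_linear[OF \<alpha>] that by simp
  have nat: "?a (Cod C g) (act P g x) = act T g (?a (Dom C g) x)" if "g \<in> AX" "x \<in> carrier (fobj P (Dom C g))" for g x
    using mod_nat_tr_natural[OF \<alpha> category_X] that by simp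
  have "cone P B (coend_obj T B) (\<lambda>s x. \<iota> T B s (?a (Dom C s) x))"
    unfolding cone_def
  proof (intro conjI ballI impI)
    fix s assume s: "s \<in> S" "Cod C s = B"
    then show "lin R (fobj P (Dom C s)) (coend_obj T B) (\<lambda>x. \<iota> T B s (?a (Dom C s) x))"
      using lin_comp[OF linear_maps_lin[OF a] \<iota>_lin[OF T]] Dom_in_Obj[OF S_Arr] by blast
  next
    fix g s x assume g: "g \<in> AX" and s: "s \<in> S" "Cod C s = B" "Dom C s = Cod C g" and x: "x \<in> carrier (fobj P (Dom C g))"
    have "?a (Dom C g) x \<in> carrier (fobj T (Dom C g))"
      using lin_closed[OF linear_maps_lin[OF a] x] Dom_in_Obj[OF AX_Arr[OF g]] by simp
    then show "\<iota> T B s (?a (Dom C s) (act P g x)) =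
        (if s \<cdot> g \<in> S then \<iota> T B (s \<cdot> g) (?a (Dom C (s \<cdot> g)) x) else \<zero>\<^bsub>coend_obj T B\<^esub>)"
      using \<iota>_act[OF T g s] nat[OF g x] s(3) Cmp_simps[OF AX_Arr[OF g] S_Arr[OF s(1)]] by simp
  qed
  from coend_lift[OF P B Z' this] obtain h where h: "lin R (coend_obj P B) (coend_obj T B) h"
    "\<And>s x. s \<in> S \<Longrightarrow> Cod C s = B \<Longrightarrow> x \<in> carrier (fobj P (Dom C s)) \<Longrightarrow> h (\<iota> P B s x) = \<iota> T B s (?a (Dom C s) x)"
    by blast
  define \<sigma> where "\<sigma> = (\<lambda>A. tensor_arr R (Idn (mod_cat R) (fobj K (A, B))) (\<alpha> A) :: ('r, 'u) mod_arr)"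
  have "\<exists>k. tensor_arr R (Idn (mod_cat R) (fobj K (A, B))) (\<alpha> A) = (tmod A B (fobj P A), k, tmod A B (fobj T A)) \<and>
      k \<in> linear_maps R (tmod A B (fobj P A)) (tmod A B (fobj T A)) \<and>
      (\<forall>s \<in> S. s \<in> Hom C A B \<longrightarrow> (\<forall>n \<in> carrier (fobj P A). k (tgen A B (fobj P A) s n) = tgen A B (fobj T A) s (?a A n)))"
    if A: "A \<in> Obj C" for A
  proof -
    note N = mfun_module[OF P A] mfun_module[OF T A]
    let ?F = "free_mod R (S \<inter> Hom C A B)"
    have F: "module R ?F" by (rule module_free_mod[OF R.cring_axioms])
    have e: "Idn (mod_cat R) (fobj K (A, B)) = (?F, \<lambda>u \<in> carrier ?F. u, ?F)"
      using A B by (simp add: truncated_hom_def)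
    have \<alpha>A: "\<alpha> A = (fobj P A, ?a A, fobj T A)" using mod_nat_tr_arr[OF \<alpha>] A by simp
    obtain k where k: "tensor_arr R (?F, \<lambda>u \<in> carrier ?F. u, ?F) (fobj P A, ?a A, fobj T A) = (tmod A B (fobj P A), k, tmod A B (fobj T A))"
      "k \<in> linear_maps R (tmod A B (fobj P A)) (tmod A B (fobj T A))"
      "\<And>u n. u \<in> carrier ?F \<Longrightarrow> n \<in> carrier (fobj P A) \<Longrightarrow>
        k (snd (tensor R ?F (fobj P A)) u n) = snd (tensor R ?F (fobj T A)) ((\<lambda>u \<in> carrier ?F. u) u) (?a A n)"
      using tensor_arr_free[OF R.cring_axioms infinite_U N(1) S_Hom_le surjective_pairing N(2) S_Hom_le surjective_pairing
          linear_maps_id[OF F] a[OF A]] by blast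
    have "k (tgen A B (fobj P A) s n) = tgen A B (fobj T A) s (?a A n)"
      if "s \<in> S" "s \<in> Hom C A B" "n \<in> carrier (fobj P A)" for s n
      using k(3)[of "free_gen R s" n] free_gen_closed[OF R.cring_axioms, of s "S \<inter> Hom C A B"] that by simp
    then show ?thesis unfolding e using k(1,2) \<alpha>A by metis
  qed
  then obtain \<tau> where \<sigma>: "\<And>A. A \<in> Obj C \<Longrightarrow> \<sigma> A = (tmod A B (fobj P A), \<tau> A, tmod A B (fobj T A))"
    and \<tau>: "\<And>A. A \<in> Obj C \<Longrightarrow> \<tau> A \<in> linear_maps R (tmod A B (fobj P A)) (tmod A B (fobj T A))"
    and \<tau>g: "\<And>A s n. A \<in> Obj C \<Longrightarrow> s \<in> S \<Longrightarrow> s \<in> Hom C A B \<Longrightarrow> n \<in> carrier (fobj P A) \<Longrightarrow>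
      \<tau> A (tgen A B (fobj P A) s n) = tgen A B (fobj T A) s (?a A n)"
    unfolding \<sigma>_def by metis
  have "coend_map X V (integrand P B) (integrand T B) \<sigma> =
      (coend_obj P B, restrict h (carrier (coend_obj P B)), coend_obj T B)"
  proof (rule coend_map_eq[OF P T B B \<sigma> \<tau> h(1)])
    fix s x assume s: "s \<in> S" "Cod C s = B" and x: "x \<in> carrier (fobj P (Dom C s))"
    then have A: "Dom C s \<in> Obj C" and sH: "s \<in> Hom C (Dom C s) B" using S_Arr Dom_in_Obj by (auto simp: Hom_def)
    show "h (\<iota> P B s x) = fst (snd (snd (coend X V (integrand T B)) (Dom C s)))
        (\<tau> (Dom C s) (tgen (Dom C s) B (fobj P (Dom C s)) s x))"
      unfolding \<tau>g[OF A s(1) sH x] h(2)[OF s x] by (simp add: \<iota>_def wedge_cone_def)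
  qed
  then show ?thesis
    using lin_restrict[OF h(1) Z] h(2) \<iota>_closed[OF P] unfolding \<sigma>_def by simp
qed

lemma ind_map:
  assumes \<alpha>: "is_nat_tr X V P \<alpha> T"
  shows "farr ind_functor_cat (P, \<alpha>, T) = (ind P, \<lambda>B \<in> Obj C. (coend_obj P B, ind_map (P, \<alpha>, T) B, coend_obj T B), ind T)"
    and "\<And>B. B \<in> Obj C \<Longrightarrow> ind_map (P, \<alpha>, T) B \<in> linear_maps R (coend_obj P B) (coend_obj T B)"
    and "\<And>B s x. s \<in> S \<Longrightarrow> Cod C s = B \<Longrightarrow> x \<in> carrier (fobj P (Dom C s)) \<Longrightarrow>
      ind_map (P, \<alpha>, T) B (\<iota> P B s x) = \<iota> T B s (fst (snd (\<alpha> (Dom C s))) x)"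
proof -
  have e: "farr ind_functor_cat (P, \<alpha>, T) = (ind P, \<lambda>B \<in> Obj C. coend_map X V (integrand P B) (integrand T B)
      (\<lambda>A. tensor_arr R (Idn (mod_cat R) (fobj K (A, B))) (\<alpha> A)), ind T)"
    using \<alpha> unfolding kernel_functor_def by simp
  have "coend_map X V (integrand P B) (integrand T B) (\<lambda>A. tensor_arr R (Idn (mod_cat R) (fobj K (A, B))) (\<alpha> A)) =
      (coend_obj P B, ind_map (P, \<alpha>, T) B, coend_obj T B) \<and>
    ind_map (P, \<alpha>, T) B \<in> linear_maps R (coend_obj P B) (coend_obj T B) \<and>
    (\<forall>s \<in> S. Cod C s = B \<longrightarrow> (\<forall>x \<in> carrier (fobj P (Dom C s)).
      ind_map (P, \<alpha>, T) B (\<iota> P B s x) = \<iota> T B s (fst (snd (\<alpha> (Dom C s))) x)))"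
    if B: "B \<in> Obj C" for B
    using ind_map_exists[OF \<alpha> B] B unfolding ind_map_def e by auto
  note * = this
  show "farr ind_functor_cat (P, \<alpha>, T) = (ind P, \<lambda>B \<in> Obj C. (coend_obj P B, ind_map (P, \<alpha>, T) B, coend_obj T B), ind T)"
    unfolding e using * by (simp cong: restrict_cong)
  show "ind_map (P, \<alpha>, T) B \<in> linear_maps R (coend_obj P B) (coend_obj T B)" if "B \<in> Obj C" for B
    using * that by blast
  show "ind_map (P, \<alpha>, T) B (\<iota> P B s x) = \<iota> T B s (fst (snd (\<alpha> (Dom C s))) x)"
    if "s \<in> S" "Cod C s = B" "x \<in> carrier (fobj P (Dom C s))" for B s x
    using * that Cod_in_Obj[OF S_Arr] by blast
qed

lemma ind_map_natural:
  assumes \<alpha>: "is_nat_tr X V P \<alpha> T"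
  shows "is_nat_tr Y V (ind P) (\<lambda>B \<in> Obj C. (coend_obj P B, ind_map (P, \<alpha>, T) B, coend_obj T B)) (ind T)"
proof -
  note P = mod_nat_trD(1)[OF \<alpha>] and T = mod_nat_trD(2)[OF \<alpha>]
  let ?a = "\<lambda>A. fst (snd (\<alpha> A))"
  have a: "?a A \<in> linear_maps R (fobj P A) (fobj T A)" if "A \<in> Obj C" for A
    using mod_nat_tr_linear[OF \<alpha>] that by simp
  have "is_nat_tr Y V (ind P) (\<lambda>B \<in> Obj Y. (fobj (ind P) B, ind_map (P, \<alpha>, T) B, fobj (ind T) B)) (ind T)"
  proof (rule mod_nat_trI[OF category_Y ind_functor[OF P] ind_functor[OF T]])
    show "ind_map (P, \<alpha>, T) B \<in> linear_maps R (fobj (ind P) B) (fobj (ind T) B)" if "B \<in> Obj Y" for B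
      using ind_map(2)[OF \<alpha>] that by (simp add: ind_obj)
    fix f z assume "f \<in> Arr Y" "z \<in> carrier (fobj (ind P) (Dom Y f))"
    then have f: "f \<in> AY" and fC: "f \<in> Arr C" and B: "Dom C f \<in> Obj C" "Cod C f \<in> Obj C" and z: "z \<in> carrier (coend_obj P (Dom C f))"
      using AY_Arr Dom_in_Obj Cod_in_Obj by (auto simp: ind_obj)
    have "ind_map (P, \<alpha>, T) (Cod C f) (act (ind P) f z) = act (ind T) f (ind_map (P, \<alpha>, T) (Dom C f) z)"
    proof (rule coend_ext[OF P B(1) coend_module[OF T B(2)] lin_comp[OF ind_arr(2)[OF P f, THEN linear_maps_lin]
            ind_map(2)[OF \<alpha> B(2), THEN linear_maps_lin]]
          lin_comp[OF ind_map(2)[OF \<alpha> B(1), THEN linear_maps_lin] ind_arr(2)[OF T f, THEN linear_maps_lin]] _ z])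
      fix s x assume s: "s \<in> S" "Cod C s = Dom C f" and x: "x \<in> carrier (fobj P (Dom C s))"
      note fs = Cmp_simps[OF S_Arr[OF s(1)] fC s(2)]
      have "?a (Dom C s) x \<in> carrier (fobj T (Dom C s))"
        using lin_closed[OF linear_maps_lin[OF a] x] Dom_in_Obj[OF S_Arr[OF s(1)]] by simp
      then show "ind_map (P, \<alpha>, T) (Cod C f) (act (ind P) f (\<iota> P (Dom C f) s x)) =
          act (ind T) f (ind_map (P, \<alpha>, T) (Dom C f) (\<iota> P (Dom C f) s x))"
        using ind_arr(3)[OF P f s x] ind_arr(3)[OF T f s] ind_map(3)[OF \<alpha> s x]
          ind_map(3)[OF \<alpha>, of "f \<cdot> s" "Cod C f" x] fs x
          lin_zero[OF ind_map(2)[OF \<alpha> B(2), THEN linear_maps_lin] coend_module[OF P B(2)] coend_module[OF T B(2)]]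
        by auto
    qed
    then show "ind_map (P, \<alpha>, T) (Cod Y f) (act (ind P) f z) = act (ind T) f (ind_map (P, \<alpha>, T) (Dom Y f) z)"
      by simp
  qed
  then show ?thesis by (simp add: ind_obj cong: restrict_cong)
qed

text \<open>Preservation of identities, composites, sums and scalar multiples by the induced functor
  all reduce to comparing values on the symbols \<open>\<iota> P B s x\<close>.\<close>

lemma ind_map_eqI:
  assumes \<alpha>: "is_nat_tr X V P \<alpha> T" and B: "B \<in> Obj C" and h: "h \<in> linear_maps R (coend_obj P B) (coend_obj T B)"
    and eq: "\<And>s x. s \<in> S \<Longrightarrow> Cod C s = B \<Longrightarrow> x \<in> carrier (fobj P (Dom C s)) \<Longrightarrow>
      h (\<iota> P B s x) = \<iota> T B s (fst (snd (\<alpha> (Dom C s))) x)"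
  shows "ind_map (P, \<alpha>, T) B = h"
proof -
  note P = mod_nat_trD(1)[OF \<alpha>] and T = mod_nat_trD(2)[OF \<alpha>]
  show ?thesis
  proof (rule linear_maps_eqI[OF ind_map(2)[OF \<alpha> B] h])
    fix z assume z: "z \<in> carrier (coend_obj P B)"
    show "ind_map (P, \<alpha>, T) B z = h z"
      by (rule coend_ext[OF P B coend_module[OF T B] ind_map(2)[OF \<alpha> B, THEN linear_maps_lin] linear_maps_lin[OF h] _ z])
         (use ind_map(3)[OF \<alpha>] eq in auto)
  qed
qed

lemma ind_functor_cat_functor: "is_functor (functor_cat X V) (functor_cat Y V) ind_functor_cat"
proof -
  have obj: "fobj ind_functor_cat = (\<lambda>T \<in> {T. mfun T}. ind T)" by (simp add: kernel_functor_def)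
  have arr: "farr ind_functor_cat \<in> extensional (Arr (functor_cat X V))"
    by (auto simp: kernel_functor_def)
  have id: "farr ind_functor_cat (Idn (functor_cat X V) T) = Idn (functor_cat Y V) (ind T)" if T: "mfun T" for T
  proof -
    let ?i = "\<lambda>A \<in> Obj C. Idn V (fobj T A)"
    have i: "is_nat_tr X V T ?i T" using is_nat_tr_id[OF category_X category_mod_cat T] by simp
    have "ind_map (T, ?i, T) B = (\<lambda>z \<in> carrier (coend_obj T B). z)" if B: "B \<in> Obj C" for B
      by (rule ind_map_eqI[OF i B linear_maps_id[OF coend_module[OF T B]]])
         (use \<iota>_closed[OF T] Dom_in_Obj[OF S_Arr] in auto)
    then show ?thesis using ind_map(1)[OF i] by (simp add: ind_obj cong: restrict_cong)
  qed
  have comp: "farr ind_functor_cat (\<psi> \<cdot>\<^bsub>functor_cat X V\<^esub> \<phi>) =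
      farr ind_functor_cat \<psi> \<cdot>\<^bsub>functor_cat Y V\<^esub> farr ind_functor_cat \<phi>"
    if arrs: "\<phi> \<in> Arr (functor_cat X V)" "\<psi> \<in> Arr (functor_cat X V)" "Cod (functor_cat X V) \<phi> = Dom (functor_cat X V) \<psi>" for \<phi> \<psi>
  proof -
    obtain P \<alpha> T where \<phi>: "\<phi> = (P, \<alpha>, T)" and \<alpha>: "is_nat_tr X V P \<alpha> T"
      using arrs(1) by auto
    obtain \<beta> Q where \<psi>: "\<psi> = (T, \<beta>, Q)" and \<beta>: "is_nat_tr X V T \<beta> Q"
      using arrs(2,3) \<phi> by auto
    note P = mod_nat_trD(1)[OF \<alpha>] and T = mod_nat_trD(2)[OF \<alpha>] and Q = mod_nat_trD(2)[OF \<beta>]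
    let ?c = "\<lambda>A \<in> Obj C. \<beta> A \<cdot>\<^bsub>V\<^esub> \<alpha> A"
    have c: "is_nat_tr X V P ?c Q" using is_nat_tr_comp[OF category_X category_mod_cat \<alpha> \<beta>] by simp
    have a: "\<alpha> A = (fobj P A, fst (snd (\<alpha> A)), fobj T A)" "fst (snd (\<alpha> A)) \<in> linear_maps R (fobj P A) (fobj T A)"
      if "A \<in> Obj C" for A using mod_nat_tr_arr[OF \<alpha>, of A] mod_nat_tr_linear[OF \<alpha>, of A] that by simp_all
    have b: "\<beta> A = (fobj T A, fst (snd (\<beta> A)), fobj Q A)" if "A \<in> Obj C" for A using mod_nat_tr_arr[OF \<beta>, of A] that by simp
    have ba: "fst (snd (\<beta> A \<cdot>\<^bsub>V\<^esub> \<alpha> A)) = compose (carrier (fobj P A)) (fst (snd (\<beta> A))) (fst (snd (\<alpha> A)))" if A: "A \<in> Obj C" for A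
    proof -
      obtain a' b' where "\<alpha> A = (fobj P A, a', fobj T A)" "\<beta> A = (fobj T A, b', fobj Q A)" using a(1)[OF A] b[OF A] by blast
      then show ?thesis by simp
    qed
    have "ind_map (P, ?c, Q) B = compose (carrier (coend_obj P B)) (ind_map (T, \<beta>, Q) B) (ind_map (P, \<alpha>, T) B)"
      if B: "B \<in> Obj C" for B
    proof (rule ind_map_eqI[OF c B linear_maps_compose[OF coend_module[OF P B] ind_map(2)[OF \<alpha> B] ind_map(2)[OF \<beta> B]]])
      fix s x assume s: "s \<in> S" "Cod C s = B" and x: "x \<in> carrier (fobj P (Dom C s))"
      have A: "Dom C s \<in> Obj C" using Dom_in_Obj[OF S_Arr[OF s(1)]] .
      have "fst (snd (\<alpha> (Dom C s))) x \<in> carrier (fobj T (Dom C s))"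
        using lin_closed[OF linear_maps_lin[OF a(2)[OF A]] x] .
      then show "compose (carrier (coend_obj P B)) (ind_map (T, \<beta>, Q) B) (ind_map (P, \<alpha>, T) B) (\<iota> P B s x) =
          \<iota> Q B s (fst (snd (?c (Dom C s))) x)"
        using ind_map(3)[OF \<alpha> s x] ind_map(3)[OF \<beta> s] \<iota>_closed[OF P s x] A x by (simp add: ba) (simp add: compose_def)
    qed
    then show ?thesis
      unfolding \<phi> \<psi> using ind_map(1)[OF \<alpha>] ind_map(1)[OF \<beta>] ind_map(1)[OF c]
      by (simp cong: restrict_cong)
  qed
  have A: "farr ind_functor_cat \<phi> \<in> Arr (functor_cat Y V) \<and>
      Dom (functor_cat Y V) (farr ind_functor_cat \<phi>) = fobj ind_functor_cat (Dom (functor_cat X V) \<phi>) \<and>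
      Cod (functor_cat Y V) (farr ind_functor_cat \<phi>) = fobj ind_functor_cat (Cod (functor_cat X V) \<phi>)"
    if \<phi>: "\<phi> \<in> Arr (functor_cat X V)" for \<phi>
  proof -
    obtain P \<alpha> T where e: "\<phi> = (P, \<alpha>, T)" and \<alpha>: "is_nat_tr X V P \<alpha> T" using \<phi> by auto
    show ?thesis
      using ind_map(1)[OF \<alpha>] ind_map_natural[OF \<alpha>] mod_nat_trD(1,2)[OF \<alpha>] unfolding e by (simp add: obj)
  qed
  show ?thesis
    unfolding is_functor_def
    using A id comp arr ind_functor by (auto simp: obj PiE_def)
qed

lemma ind_functor_cat_linear: "is_linear R X Y ind_functor_cat"
  unfolding is_linear_def
proof (intro allI ballI conjI)
  fix P T \<phi> assume "\<phi> \<in> Hom (functor_cat X V) P T"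
  then obtain \<alpha> where \<phi>: "\<phi> = (P, \<alpha>, T)" and \<alpha>: "is_nat_tr X V P \<alpha> T" by (auto simp: Hom_functor_cat)
  note P = mod_nat_trD(1)[OF \<alpha>] and T = mod_nat_trD(2)[OF \<alpha>]
  let ?a = "\<lambda>A. fst (snd (\<alpha> A))"
  have a: "lin R (fobj P A) (fobj T A) (?a A)" if "A \<in> Obj C" for A
    using mod_nat_tr_linear[OF \<alpha>] that by (simp add: linear_maps_lin)
  have na: "?a (Cod C g) (act P g x) = act T g (?a (Dom C g) x)" if "g \<in> AX" "x \<in> carrier (fobj P (Dom C g))" for g x
    using mod_nat_tr_natural[OF \<alpha> category_X] that by simp
  note la = ind_map(2)[OF \<alpha>, THEN linear_maps_lin]
  {
    fix \<psi> assume "\<psi> \<in> Hom (functor_cat X V) P T"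
    then obtain \<beta> where \<psi>: "\<psi> = (P, \<beta>, T)" and \<beta>: "is_nat_tr X V P \<beta> T" by (auto simp: Hom_functor_cat)
    let ?b = "\<lambda>A. fst (snd (\<beta> A))"
    have b: "lin R (fobj P A) (fobj T A) (?b A)" if "A \<in> Obj C" for A
      using mod_nat_tr_linear[OF \<beta>] that by (simp add: linear_maps_lin)
    have nb: "?b (Cod C g) (act P g x) = act T g (?b (Dom C g) x)" if "g \<in> AX" "x \<in> carrier (fobj P (Dom C g))" for g x
      using mod_nat_tr_natural[OF \<beta> category_X] that by simp
    note lb = ind_map(2)[OF \<beta>, THEN linear_maps_lin]
    let ?g = "\<lambda>A \<in> Obj C. (fobj P A, \<lambda>x \<in> carrier (fobj P A). ?a A x \<oplus>\<^bsub>fobj T A\<^esub> ?b A x, fobj T A)"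
    have g: "is_nat_tr X V P ?g T"
    proof -
      have "is_nat_tr X V P (\<lambda>A \<in> Obj X. (fobj P A, \<lambda>x \<in> carrier (fobj P A). ?a A x \<oplus>\<^bsub>fobj T A\<^esub> ?b A x, fobj T A)) T"
      proof (rule mod_nat_trI[OF category_X P T])
        show "(\<lambda>x \<in> carrier (fobj P A). ?a A x \<oplus>\<^bsub>fobj T A\<^esub> ?b A x) \<in> linear_maps R (fobj P A) (fobj T A)" if "A \<in> Obj X" for A
          using that by (intro lin_restrict lin_add_map mfun_module P T a b) auto
        fix f x assume "f \<in> Arr X" "x \<in> carrier (fobj P (Dom X f))"
        then have f: "f \<in> AX" and x: "x \<in> carrier (fobj P (Dom C f))" by auto
        have o: "Dom C f \<in> Obj C" "Cod C f \<in> Obj C" using AX_Arr[OF f] Dom_in_Obj Cod_in_Obj by auto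
        show "(\<lambda>x \<in> carrier (fobj P (Cod X f)). ?a (Cod X f) x \<oplus>\<^bsub>fobj T (Cod X f)\<^esub> ?b (Cod X f) x) (act P f x) =
            act T f ((\<lambda>x \<in> carrier (fobj P (Dom X f)). ?a (Dom X f) x \<oplus>\<^bsub>fobj T (Dom X f)\<^esub> ?b (Dom X f) x) x)"
          using x na[OF f x] nb[OF f x] lin_closed[OF mfun_lin[OF P f] x]
            lin_closed[OF a[OF o(1)] x] lin_closed[OF b[OF o(1)] x] by (simp add: lin_add[OF mfun_lin[OF T f]])
      qed
      then show ?thesis by simp
    qed
    have "ind_map (P, ?g, T) B = (\<lambda>z \<in> carrier (coend_obj P B). ind_map \<phi> B z \<oplus>\<^bsub>coend_obj T B\<^esub> ind_map \<psi> B z)"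
      if B: "B \<in> Obj C" for B unfolding \<phi> \<psi>
    proof (rule ind_map_eqI[OF g B lin_restrict[OF lin_add_map[OF coend_module[OF T B] la[OF B] lb[OF B]] coend_module[OF P B]]])
      fix s x assume s: "s \<in> S" "Cod C s = B" and x: "x \<in> carrier (fobj P (Dom C s))"
      have A: "Dom C s \<in> Obj C" using Dom_in_Obj[OF S_Arr[OF s(1)]] .
      show "(\<lambda>z \<in> carrier (coend_obj P B). ind_map (P, \<alpha>, T) B z \<oplus>\<^bsub>coend_obj T B\<^esub> ind_map (P, \<beta>, T) B z) (\<iota> P B s x) =
          \<iota> T B s (fst (snd (?g (Dom C s))) x)"
        using ind_map(3)[OF \<alpha> s x] ind_map(3)[OF \<beta> s x] \<iota>_closed[OF P s x] A x
          lin_add[OF \<iota>_lin[OF T s] lin_closed[OF a[OF A] x] lin_closed[OF b[OF A] x]] by simp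
    qed
    then show "farr ind_functor_cat (nat_add X \<phi> \<psi>) = nat_add Y (farr ind_functor_cat \<phi>) (farr ind_functor_cat \<psi>)"
      using ind_map(1)[OF \<alpha>] ind_map(1)[OF \<beta>] ind_map(1)[OF g]
      by (simp add: \<phi> \<psi> nat_add_def ind_obj cong: restrict_cong)
  }
  fix r assume r: "r \<in> carrier R"
  let ?g = "\<lambda>A \<in> Obj C. (fobj P A, \<lambda>x \<in> carrier (fobj P A). r \<odot>\<^bsub>fobj T A\<^esub> ?a A x, fobj T A)"
  have g: "is_nat_tr X V P ?g T"
  proof -
    have "is_nat_tr X V P (\<lambda>A \<in> Obj X. (fobj P A, \<lambda>x \<in> carrier (fobj P A). r \<odot>\<^bsub>fobj T A\<^esub> ?a A x, fobj T A)) T"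
    proof (rule mod_nat_trI[OF category_X P T])
      show "(\<lambda>x \<in> carrier (fobj P A). r \<odot>\<^bsub>fobj T A\<^esub> ?a A x) \<in> linear_maps R (fobj P A) (fobj T A)" if "A \<in> Obj X" for A
        using that by (intro lin_restrict lin_smult_map mfun_module P T a r) auto
      fix f x assume "f \<in> Arr X" "x \<in> carrier (fobj P (Dom X f))"
      then have f: "f \<in> AX" and x: "x \<in> carrier (fobj P (Dom C f))" by auto
      have o: "Dom C f \<in> Obj C" using AX_Arr[OF f] Dom_in_Obj by auto
      show "(\<lambda>x \<in> carrier (fobj P (Cod X f)). r \<odot>\<^bsub>fobj T (Cod X f)\<^esub> ?a (Cod X f) x) (act P f x) =
          act T f ((\<lambda>x \<in> carrier (fobj P (Dom X f)). r \<odot>\<^bsub>fobj T (Dom X f)\<^esub> ?a (Dom X f) x) x)"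
        using x na[OF f x] lin_closed[OF mfun_lin[OF P f] x] r
          lin_closed[OF a[OF o] x] by (simp add: lin_smult[OF mfun_lin[OF T f]])
    qed
    then show ?thesis by simp
  qed
  have "ind_map (P, ?g, T) B = (\<lambda>z \<in> carrier (coend_obj P B). r \<odot>\<^bsub>coend_obj T B\<^esub> ind_map \<phi> B z)"
    if B: "B \<in> Obj C" for B unfolding \<phi>
  proof (rule ind_map_eqI[OF g B lin_restrict[OF lin_smult_map[OF coend_module[OF T B] la[OF B] r] coend_module[OF P B]]])
    fix s x assume s: "s \<in> S" "Cod C s = B" and x: "x \<in> carrier (fobj P (Dom C s))"
    have A: "Dom C s \<in> Obj C" using Dom_in_Obj[OF S_Arr[OF s(1)]] .
    show "(\<lambda>z \<in> carrier (coend_obj P B). r \<odot>\<^bsub>coend_obj T B\<^esub> ind_map (P, \<alpha>, T) B z) (\<iota> P B s x) =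
        \<iota> T B s (fst (snd (?g (Dom C s))) x)"
      using ind_map(3)[OF \<alpha> s x] \<iota>_closed[OF P s x] A x
        lin_smult[OF \<iota>_lin[OF T s] r lin_closed[OF a[OF A] x]] by simp
  qed
  then show "farr ind_functor_cat (nat_smult X r \<phi>) = nat_smult Y r (farr ind_functor_cat \<phi>)"
    using ind_map(1)[OF \<alpha>] ind_map(1)[OF g]
    by (simp add: \<phi> nat_smult_def ind_obj cong: restrict_cong)
qed

end

text \<open>Isomorphism of endofunctors of \<open>[D, V]\<close> is a condition two levels up. Given
  maps \<open>h T A\<close> on elements, it amounts to four checks: linearity, bijectivity,
  naturality in the object \<open>A\<close>, and naturality in the functor \<open>T\<close>.\<close>

lemma isomorphic_functorsI:
  fixes R :: "('r, 's) ring_scheme" and D :: "('o, 'a) cat"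
    and \<Phi> \<Psi> :: "(('o, 'a, 'r, 'u) mod_fctr, ('o, 'a, 'r, 'u) mod_nat_tr,
      ('o, 'a, 'r, 'u) mod_fctr, ('o, 'a, 'r, 'u) mod_nat_tr) fctr"
  assumes D: "category D"
    and \<Phi>: "is_functor (functor_cat D (mod_cat R)) (functor_cat D (mod_cat R)) \<Phi>"
    and \<Psi>: "is_functor (functor_cat D (mod_cat R)) (functor_cat D (mod_cat R)) \<Psi>"
    and lin: "\<And>T A. is_functor D (mod_cat R) T \<Longrightarrow> A \<in> Obj D \<Longrightarrow>
      lin R (fobj (fobj \<Phi> T) A) (fobj (fobj \<Psi> T) A) (h T A)"
    and bij: "\<And>T A. is_functor D (mod_cat R) T \<Longrightarrow> A \<in> Obj D \<Longrightarrow>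
      bij_betw (h T A) (carrier (fobj (fobj \<Phi> T) A)) (carrier (fobj (fobj \<Psi> T) A))"
    and nat: "\<And>T f x. is_functor D (mod_cat R) T \<Longrightarrow> f \<in> Arr D \<Longrightarrow> x \<in> carrier (fobj (fobj \<Phi> T) (Dom D f)) \<Longrightarrow>
      h T (Cod D f) (act (fobj \<Phi> T) f x) = act (fobj \<Psi> T) f (h T (Dom D f) x)"
    and nat': "\<And>P \<alpha> T A x. is_nat_tr D (mod_cat R) P \<alpha> T \<Longrightarrow> A \<in> Obj D \<Longrightarrow> x \<in> carrier (fobj (fobj \<Phi> P) A) \<Longrightarrow>
      h T A (fst (snd (fst (snd (farr \<Phi> (P, \<alpha>, T))) A)) x) = fst (snd (fst (snd (farr \<Psi> (P, \<alpha>, T))) A)) (h P A x)"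
  shows "isomorphic (functor_cat (functor_cat D (mod_cat R)) (functor_cat D (mod_cat R))) \<Phi> \<Psi>"
proof -
  interpret D: category D by fact
  let ?V = "mod_cat R :: (('r, 'u) module, ('r, 'u) mod_arr) cat" and ?W = "functor_cat D (mod_cat R :: (('r, 'u) module, ('r, 'u) mod_arr) cat)"
  have W: "category ?W" by (rule category_functor_cat[OF D category_mod_cat])
  have f\<Phi>: "is_functor D ?V (fobj \<Phi> T)" and f\<Psi>: "is_functor D ?V (fobj \<Psi> T)" if "is_functor D ?V T" for T
    using \<Phi> \<Psi> that by (auto simp: is_functor_def[of ?W])
  let ?h = "\<lambda>T A. restrict (h T A) (carrier (fobj (fobj \<Phi> T) A))"
  let ?n = "\<lambda>T. \<lambda>A \<in> Obj D. (fobj (fobj \<Phi> T) A, ?h T A, fobj (fobj \<Psi> T) A)"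
  have hl: "?h T A \<in> linear_maps R (fobj (fobj \<Phi> T) A) (fobj (fobj \<Psi> T) A)"
    if "is_functor D ?V T" "A \<in> Obj D" for T A
    by (rule lin_restrict[OF lin[OF that] mod_functor_module[OF f\<Phi>[OF that(1)] that(2)]])
  have n: "is_nat_tr D ?V (fobj \<Phi> T) (?n T) (fobj \<Psi> T)" if T: "is_functor D ?V T" for T
  proof (rule mod_nat_trI[OF D f\<Phi>[OF T] f\<Psi>[OF T]])
    show "?h T A \<in> linear_maps R (fobj (fobj \<Phi> T) A) (fobj (fobj \<Psi> T) A)" if "A \<in> Obj D" for A
      using hl[OF T that] .
    show "?h T (Cod D f) (act (fobj \<Phi> T) f x) = act (fobj \<Psi> T) f (?h T (Dom D f) x)"
      if "f \<in> Arr D" "x \<in> carrier (fobj (fobj \<Phi> T) (Dom D f))" for f x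
      using nat[OF T that] that lin_closed[OF mod_functor_lin[OF f\<Phi>[OF T] that(1)] that(2)] by simp
  qed
  have ninv: "invertible ?W (fobj \<Phi> T, ?n T, fobj \<Psi> T)" if T: "is_functor D ?V T" for T
  proof (rule invertible_functor_cat[OF D category_mod_cat n[OF T]])
    fix A assume A: "A \<in> Obj D"
    have "bij_betw (?h T A) (carrier (fobj (fobj \<Phi> T) A)) (carrier (fobj (fobj \<Psi> T) A))"
      using bij[OF T A] by (simp cong: bij_betw_cong)
    then show "invertible ?V (?n T A)"
      using A invertible_mod_cat[OF mod_functor_module[OF f\<Phi>[OF T] A] mod_functor_module[OF f\<Psi>[OF T] A] hl[OF T A]] by simp
  qed
  let ?N = "\<lambda>T \<in> Obj ?W. (fobj \<Phi> T, ?n T, fobj \<Psi> T)"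
  have "is_nat_tr ?W ?W \<Phi> ?N \<Psi>"
    unfolding is_nat_tr_def
  proof (intro conjI ballI)
    show "?N T \<in> Hom ?W (fobj \<Phi> T) (fobj \<Psi> T)" if "T \<in> Obj ?W" for T
      using that n by (simp add: Hom_functor_cat)
    fix \<phi> assume "\<phi> \<in> Arr ?W"
    then obtain P \<alpha> T where \<phi>: "\<phi> = (P, \<alpha>, T)" and \<alpha>: "is_nat_tr D ?V P \<alpha> T" by auto
    note P = mod_nat_trD(1)[OF \<alpha>] and T = mod_nat_trD(2)[OF \<alpha>]
    have fa: "\<exists>\<beta>. farr \<Xi> \<phi> = (fobj \<Xi> P, \<beta>, fobj \<Xi> T) \<and> is_nat_tr D ?V (fobj \<Xi> P) \<beta> (fobj \<Xi> T)"
      if \<Xi>: "is_functor ?W ?W \<Xi>" for \<Xi>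
    proof -
      have \<phi>': "\<phi> \<in> Arr ?W" using \<phi> \<alpha> by simp
      have "farr \<Xi> \<phi> \<in> Arr ?W"
        using \<Xi>[unfolded is_functor_def, THEN conjunct2, THEN conjunct1] \<phi>' by (rule PiE_mem)
      moreover have "Dom ?W (farr \<Xi> \<phi>) = fobj \<Xi> P" "Cod ?W (farr \<Xi> \<phi>) = fobj \<Xi> T"
        using \<Xi>[unfolded is_functor_def, THEN conjunct2, THEN conjunct2, THEN conjunct1, rule_format, OF \<phi>'] \<phi> by auto
      ultimately show ?thesis by (cases "farr \<Xi> \<phi>") auto
    qed
    obtain \<beta> where \<beta>: "farr \<Phi> \<phi> = (fobj \<Phi> P, \<beta>, fobj \<Phi> T)" "is_nat_tr D ?V (fobj \<Phi> P) \<beta> (fobj \<Phi> T)"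
      using fa[OF \<Phi>] by blast
    obtain \<gamma> where \<gamma>: "farr \<Psi> \<phi> = (fobj \<Psi> P, \<gamma>, fobj \<Psi> T)" "is_nat_tr D ?V (fobj \<Psi> P) \<gamma> (fobj \<Psi> T)"
      using fa[OF \<Psi>] by blast
    have "?n T A \<cdot>\<^bsub>?V\<^esub> \<beta> A = \<gamma> A \<cdot>\<^bsub>?V\<^esub> ?n P A" if A: "A \<in> Obj D" for A
    proof -
      obtain b where b: "\<beta> A = (fobj (fobj \<Phi> P) A, b, fobj (fobj \<Phi> T) A)" "b \<in> linear_maps R (fobj (fobj \<Phi> P) A) (fobj (fobj \<Phi> T) A)"
        using mod_nat_tr_arr[OF \<beta>(2) A] mod_nat_tr_linear[OF \<beta>(2) A] by metis
      obtain c where c: "\<gamma> A = (fobj (fobj \<Psi> P) A, c, fobj (fobj \<Psi> T) A)"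
        using mod_nat_tr_arr[OF \<gamma>(2) A] by metis
      have "?h T A (b x) = c (?h P A x)" if x: "x \<in> carrier (fobj (fobj \<Phi> P) A)" for x
        using nat'[OF \<alpha> A x] x lin_closed[OF linear_maps_lin[OF b(2)] x] \<beta>(1) \<gamma>(1) \<phi> b(1) c by simp
      then have "compose (carrier (fobj (fobj \<Phi> P) A)) (?h T A) b = compose (carrier (fobj (fobj \<Phi> P) A)) c (?h P A)"
        by (simp add: compose_def cong: restrict_cong)
      then show ?thesis using A b c by simp
    qed
    then show "?N (Cod ?W \<phi>) \<cdot>\<^bsub>?W\<^esub> farr \<Phi> \<phi> = farr \<Psi> \<phi> \<cdot>\<^bsub>?W\<^esub> ?N (Dom ?W \<phi>)"
      using P T by (simp add: \<phi> \<beta>(1)[unfolded \<phi>] \<gamma>(1)[unfolded \<phi>] cong: restrict_cong)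
  qed (use \<Phi> \<Psi> in auto)
  \<comment> \<open>\<open>invertible_functor_cat\<close> is applied a second time, one level up;
    its first use gave the invertibility of each \<open>?n T\<close>.\<close>
  moreover from this have "invertible (functor_cat ?W ?W) (\<Phi>, ?N, \<Psi>)"
    by (rule invertible_functor_cat[OF W W]) (use ninv in simp)
  ultimately show ?thesis
    unfolding isomorphic_def by (intro bexI[of _ "(\<Phi>, ?N, \<Psi>)"]) (auto simp only: Hom_functor_cat)
qed


section \<open>Proper factorization systems\<close>

context category
begin

lemma invertible_Arr: "invertible C f \<Longrightarrow> f \<in> Arr C"
  by (simp add: invertible_def)

lemma invertible_Idn: "A \<in> Obj C \<Longrightarrow> invertible C (Idn C A)"
  unfolding invertible_def using Idn_simps[of A] Idn_in_Hom[of A]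
  by (auto intro!: bexI[of _ "Idn C A"] simp: Cmp_Idn_left')

lemma invertible_Cmp:
  assumes f: "invertible C f" and g: "invertible C g" and c: "Cod C f = Dom C g"
  shows "invertible C (g \<cdot> f)"
proof -
  obtain f' where f': "f' \<in> Hom C (Cod C f) (Dom C f)" "f' \<cdot> f = Idn C (Dom C f)" "f \<cdot> f' = Idn C (Cod C f)"
    using f by (rule invertible_inverse)
  obtain g' where g': "g' \<in> Hom C (Cod C g) (Dom C g)" "g' \<cdot> g = Idn C (Dom C g)" "g \<cdot> g' = Idn C (Cod C g)"
    using g by (rule invertible_inverse)
  have a: "f \<in> Hom C (Dom C f) (Cod C f)" "g \<in> Hom C (Cod C f) (Cod C g)"
    using f g c by (auto simp: Hom_def invertible_Arr)
  have g'': "g' \<in> Hom C (Cod C g) (Cod C f)" using g' c by simp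
  have "(f' \<cdot> g') \<cdot> (g \<cdot> f) = f' \<cdot> ((g' \<cdot> g) \<cdot> f)"
    using Cmp_assoc[OF Cmp_in_Hom[OF a] g'' f'(1)] Cmp_assoc[OF a g''] by simp
  also have "\<dots> = Idn C (Dom C f)" using f' g' c Cmp_Idn_left[OF a(1)] by simp
  finally have 1: "(f' \<cdot> g') \<cdot> (g \<cdot> f) = Idn C (Dom C f)" .
  have "(g \<cdot> f) \<cdot> (f' \<cdot> g') = g \<cdot> ((f \<cdot> f') \<cdot> g')"
    using Cmp_assoc[OF Cmp_in_Hom[OF g'' f'(1)] a] Cmp_assoc[OF g'' f'(1) a(1)] by simp
  also have "\<dots> = Idn C (Cod C g)" using f' g' c Cmp_Idn_left[OF g''] by simp
  finally have 2: "(g \<cdot> f) \<cdot> (f' \<cdot> g') = Idn C (Cod C g)" .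
  show ?thesis
    unfolding invertible_def using Cmp_in_Hom[OF a] Cmp_in_Hom[OF g'' f'(1)] 1 2
    by (auto simp: Hom_def)
qed

end

context proper_factorization_system
begin

lemma E_Arr: "e \<in> E \<Longrightarrow> e \<in> Arr C" and M_Arr: "m \<in> M \<Longrightarrow> m \<in> Arr C"
  using E_sub M_sub by auto

lemma M_cancel_left: "m \<in> M \<Longrightarrow> f \<in> Hom C A (Dom C m) \<Longrightarrow> g \<in> Hom C A (Dom C m) \<Longrightarrow> m \<cdot> f = m \<cdot> g \<Longrightarrow> f = g"
  using M_mono unfolding monomorphism_def by blast

lemma E_cancel_right: "e \<in> E \<Longrightarrow> f \<in> Hom C (Cod C e) B \<Longrightarrow> g \<in> Hom C (Cod C e) B \<Longrightarrow> f \<cdot> e = g \<cdot> e \<Longrightarrow> f = g"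
  using E_epi unfolding epimorphism_def by blast

text \<open>Cancelling the monomorphism \<open>m\<close> in
  \<open>m \<cdot> (s \<cdot> m) = m\<close> turns the one-sided inverse into a two-sided
  one.\<close>

lemma M_split_invertible:
  assumes m: "m \<in> M" and s: "s \<in> Hom C (Cod C m) (Dom C m)" "m \<cdot> s = Idn C (Cod C m)"
  shows "invertible C m"
proof -
  have h: "m \<in> Hom C (Dom C m) (Cod C m)" using M_Arr[OF m] by (simp add: Hom_def)
  have "m \<cdot> (s \<cdot> m) = m \<cdot> Idn C (Dom C m)"
    using Cmp_assoc[OF h s(1) h] s(2) Cmp_Idn_left[OF h] Cmp_Idn_right[OF h] by simp
  then have "s \<cdot> m = Idn C (Dom C m)"
    using M_cancel_left[OF m Cmp_in_Hom[OF h s(1)]] Idn_in_Hom Dom_in_Obj[OF M_Arr[OF m]] by blast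
  then show ?thesis
    unfolding invertible_def using M_Arr[OF m] s by blast
qed

lemma E_split_invertible:
  assumes e: "e \<in> E" and s: "s \<in> Hom C (Cod C e) (Dom C e)" "s \<cdot> e = Idn C (Dom C e)"
  shows "invertible C e"
proof -
  have h: "e \<in> Hom C (Dom C e) (Cod C e)" using E_Arr[OF e] by (simp add: Hom_def)
  have "(e \<cdot> s) \<cdot> e = Idn C (Cod C e) \<cdot> e"
    using Cmp_assoc[OF h s(1) h] s(2) Cmp_Idn_left[OF h] Cmp_Idn_right[OF h] by simp
  then have "e \<cdot> s = Idn C (Cod C e)"
    using E_cancel_right[OF e Cmp_in_Hom[OF s(1) h]] Idn_in_Hom Cod_in_Obj[OF E_Arr[OF e]] by blast
  then show ?thesis
    unfolding invertible_def using E_Arr[OF e] s by blast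
qed

lemma factorize:
  assumes "f \<in> Arr C"
  obtains m e where "m \<in> M" "e \<in> E" "Dom C e = Dom C f" "Cod C e = Dom C m" "Cod C m = Cod C f" "f = m \<cdot> e"
  using FS2[OF assms] by blast

text \<open>That identities lie in \<open>M\<close> is not an axiom. Factor an identity as
  \<open>m \<cdot> e\<close>: then \<open>m\<close> is split, hence invertible, and
  \<open>w = m \<cdot> (m' \<cdot> w)\<close>, with \<open>m'\<close> the inverse of
  \<open>m\<close>, lies in \<open>M\<close> by \<open>FS0_M\<close>.\<close>

lemma invertible_M: assumes w: "invertible C w" shows "w \<in> M"
proof -
  let ?B = "Cod C w"
  have B: "?B \<in> Obj C" using w by (simp add: invertible_Arr Cod_in_Obj)
  note I = Idn_simps[OF B]
  obtain m e where me: "m \<in> M" "e \<in> E" "Dom C e = ?B" "Cod C e = Dom C m" "Cod C m = ?B" "Idn C ?B = m \<cdot> e"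
    using factorize[of "Idn C ?B"] I by metis
  have "e \<in> Hom C (Cod C m) (Dom C m)" using me E_Arr by (simp add: Hom_def)
  then have "invertible C m" using M_split_invertible[OF me(1)] me(5,6) by simp
  then obtain m' where m': "m' \<in> Hom C (Cod C m) (Dom C m)" "m \<cdot> m' = Idn C (Cod C m)" "invertible C m'"
    by (rule invertible_inverse)
  have w': "w \<in> Hom C (Dom C w) (Cod C m)" using w me(5) by (simp add: Hom_def invertible_Arr)
  have m'h: "Dom C m' = Cod C m" "Cod C m' = Dom C m" using m'(1) by (auto simp: Hom_def)
  have "invertible C (m' \<cdot> w)" using invertible_Cmp[OF w m'(3)] m'h me(5) by simp
  moreover have "Cod C (m' \<cdot> w) = Dom C m" using Cmp_in_Hom[OF w' m'(1)] by (simp add: Hom_def)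
  ultimately have "m \<cdot> (m' \<cdot> w) \<in> M" using FS0_M[OF me(1)] by blast
  moreover have mh: "m \<in> Hom C (Dom C m) (Cod C m)" using M_Arr[OF me(1)] by (simp add: Hom_def)
  have "m \<cdot> (m' \<cdot> w) = w"
    using Cmp_assoc[OF w' m'(1) mh] m'(2) Cmp_Idn_left[OF w'] by simp
  ultimately show ?thesis by simp
qed

lemma invertible_E: assumes w: "invertible C w" shows "w \<in> E"
proof -
  let ?B = "Dom C w"
  have B: "?B \<in> Obj C" using w by (simp add: invertible_Arr Dom_in_Obj)
  note I = Idn_simps[OF B]
  obtain m e where me: "m \<in> M" "e \<in> E" "Dom C e = ?B" "Cod C e = Dom C m" "Cod C m = ?B" "Idn C ?B = m \<cdot> e"
    using factorize[of "Idn C ?B"] I by metis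
  have "m \<in> Hom C (Cod C e) (Dom C e)" using me M_Arr by (simp add: Hom_def)
  then have "invertible C e" using E_split_invertible[OF me(2)] me(3,6) by simp
  then obtain e' where e': "e' \<in> Hom C (Cod C e) (Dom C e)" "e' \<cdot> e = Idn C (Dom C e)" "invertible C e'"
    by (rule invertible_inverse)
  have w': "w \<in> Hom C (Dom C e) (Cod C w)" using w me(3) by (simp add: Hom_def invertible_Arr)
  have e'h: "Dom C e' = Cod C e" "Cod C e' = Dom C e" using e'(1) by (auto simp: Hom_def)
  have "invertible C (w \<cdot> e')" using invertible_Cmp[OF e'(3) w] e'h me(3) by simp
  moreover have "Dom C (w \<cdot> e') = Cod C e" using Cmp_in_Hom[OF e'(1) w'] by (simp add: Hom_def)
  ultimately have "(w \<cdot> e') \<cdot> e \<in> E" using FS0_E[OF me(2)] by blast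
  moreover have eh: "e \<in> Hom C (Dom C e) (Cod C e)" using E_Arr[OF me(2)] by (simp add: Hom_def)
  have "(w \<cdot> e') \<cdot> e = w"
    using Cmp_assoc[OF eh e'(1) w'] e'(2) Cmp_Idn_right[OF w'] by simp
  ultimately show ?thesis by simp
qed

text \<open>The diagonal of the square formed by \<open>f\<close> on two sides and identities on the
  others is an inverse of \<open>f\<close>.\<close>

lemma EM_invertible: assumes "f \<in> E" "f \<in> M" shows "invertible C f"
proof -
  have f: "f \<in> Arr C" using assms E_Arr by simp
  have h: "f \<in> Hom C (Dom C f) (Cod C f)" using f by (simp add: Hom_def)
  note i = Idn_in_Hom[OF Dom_in_Obj[OF f]] Idn_in_Hom[OF Cod_in_Obj[OF f]]
  obtain l where "l \<in> Hom C (Cod C f) (Dom C f)" "l \<cdot> f = Idn C (Dom C f)" "f \<cdot> l = Idn C (Cod C f)"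
    using FS1[OF assms i] Cmp_Idn_left[OF h] Cmp_Idn_right[OF h] by auto
  then show ?thesis unfolding invertible_def using f by blast
qed

lemma EM_iff: "f \<in> E \<inter> M \<longleftrightarrow> invertible C f"
  using EM_invertible invertible_E invertible_M by blast

text \<open>Factor \<open>m \<cdot> n = k \<cdot> e\<close>. A first diagonal writes
  \<open>n\<close> as \<open>l \<cdot> e\<close>, a second one splits \<open>e\<close> against
  \<open>n\<close>. So \<open>e\<close> is invertible and \<open>k \<cdot> e\<close> stays in
  \<open>M\<close>.\<close>

lemma M_Cmp:
  assumes n: "n \<in> M" and m: "m \<in> M" and c: "Cod C n = Dom C m"
  shows "m \<cdot> n \<in> M"
proof -
  note mn = Cmp_simps[OF M_Arr[OF n] M_Arr[OF m] c]
  obtain k e where ke: "k \<in> M" "e \<in> E" "Dom C e = Dom C n" "Cod C e = Dom C k" "Cod C k = Cod C m" "m \<cdot> n = k \<cdot> e"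
    using factorize[of "m \<cdot> n"] mn by metis
  have nh: "n \<in> Hom C (Dom C e) (Dom C m)" using n c ke M_Arr by (simp add: Hom_def)
  have kh: "k \<in> Hom C (Cod C e) (Cod C m)" using ke M_Arr by (simp add: Hom_def)
  obtain l where l: "l \<in> Hom C (Cod C e) (Dom C m)" "l \<cdot> e = n" "m \<cdot> l = k"
    using FS1[OF ke(2) m nh kh ke(6)] by blast
  have eO: "Dom C e \<in> Obj C" using Dom_in_Obj[OF E_Arr[OF ke(2)]] .
  have i: "Idn C (Dom C e) \<in> Hom C (Dom C e) (Dom C n)" using Idn_in_Hom[OF eO] ke(3) by simp
  have l': "l \<in> Hom C (Cod C e) (Cod C n)" using l c by simp
  have "n \<cdot> Idn C (Dom C e) = l \<cdot> e" using Cmp_Idn_right[OF nh] l(2) by simp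
  then obtain s where "s \<in> Hom C (Cod C e) (Dom C n)" "s \<cdot> e = Idn C (Dom C e)"
    using FS1[OF ke(2) n i l'] by blast
  then have "invertible C e" using E_split_invertible[OF ke(2)] ke(3) by simp
  then show ?thesis using FS0_M[OF ke(1)] ke by simp
qed

text \<open>Factor \<open>f = m \<cdot> e\<close>. The diagonal of the square from \<open>e\<close>
  to \<open>g \<cdot> f\<close> splits \<open>e\<close>, which is therefore invertible. It makes the
  truncation to \<open>M\<close> consistent under arbitrary arrows on the left.\<close>

lemma M_cancel:
  assumes f: "f \<in> Arr C" and g: "g \<in> Arr C" and c: "Cod C f = Dom C g" and gf: "g \<cdot> f \<in> M"
  shows "f \<in> M"
proof -
  note h = Cmp_simps[OF f g c]
  obtain m e where me: "m \<in> M" "e \<in> E" "Dom C e = Dom C f" "Cod C e = Dom C m" "Cod C m = Cod C f" "f = m \<cdot> e"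
    using f by (rule factorize)
  have eh: "e \<in> Hom C (Dom C f) (Dom C m)" and mh: "m \<in> Hom C (Dom C m) (Cod C f)" and gh: "g \<in> Hom C (Cod C f) (Cod C g)"
    using me E_Arr M_Arr g c by (auto simp: Hom_def)
  have i: "Idn C (Dom C f) \<in> Hom C (Dom C e) (Dom C (g \<cdot> f))" using Idn_in_Hom[OF Dom_in_Obj[OF f]] h me(3) by simp
  have k: "g \<cdot> m \<in> Hom C (Cod C e) (Cod C (g \<cdot> f))" using Cmp_in_Hom[OF mh gh] h me(4) by simp
  have "(g \<cdot> f) \<cdot> Idn C (Dom C f) = (g \<cdot> m) \<cdot> e"
    using Cmp_assoc[OF eh mh gh] me(6) Cmp_Idn_right'[of "g \<cdot> f" "Dom C f"] h by simp
  then obtain s where "s \<in> Hom C (Cod C e) (Dom C (g \<cdot> f))" "s \<cdot> e = Idn C (Dom C f)"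
    using FS1[OF me(2) gf i k] by blast
  then have "invertible C e" using E_split_invertible[OF me(2)] me(3) h by simp
  then show ?thesis using FS0_M[OF me(1)] me by simp
qed

text \<open>Dual to \<open>M_cancel\<close>: the diagonal from \<open>g \<cdot> f\<close> to the
  \<open>M\<close>-part of \<open>g\<close> splits that part.\<close>

lemma E_cancel:
  assumes f: "f \<in> Arr C" and g: "g \<in> Arr C" and c: "Cod C f = Dom C g" and gf: "g \<cdot> f \<in> E"
  shows "g \<in> E"
proof -
  note h = Cmp_simps[OF f g c]
  obtain m e where me: "m \<in> M" "e \<in> E" "Dom C e = Dom C g" "Cod C e = Dom C m" "Cod C m = Cod C g" "g = m \<cdot> e"
    using g by (rule factorize)
  have fh: "f \<in> Hom C (Dom C f) (Dom C e)" and mh: "m \<in> Hom C (Dom C m) (Cod C g)" and eh: "e \<in> Hom C (Dom C e) (Dom C m)"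
    using me E_Arr M_Arr f c by (auto simp: Hom_def)
  have i: "Idn C (Cod C g) \<in> Hom C (Cod C (g \<cdot> f)) (Cod C m)" using Idn_in_Hom[OF Cod_in_Obj[OF g]] h me(5) by simp
  have k: "e \<cdot> f \<in> Hom C (Dom C (g \<cdot> f)) (Dom C m)" using Cmp_in_Hom[OF fh eh] h by simp
  have "m \<cdot> (e \<cdot> f) = Idn C (Cod C g) \<cdot> (g \<cdot> f)"
    using Cmp_assoc[OF fh eh mh] me(6) Cmp_Idn_left'[of "g \<cdot> f" "Cod C g"] h by simp
  then obtain s where "s \<in> Hom C (Cod C (g \<cdot> f)) (Dom C m)" "m \<cdot> s = Idn C (Cod C g)"
    using FS1[OF gf me(1) k i] by blast
  then have "invertible C m" using M_split_invertible[OF me(1)] me(5) h by simp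
  then show ?thesis using FS0_E[OF me(2)] me by simp
qed

section \<open>Subobjects\<close>

definition sub_eq :: "'b \<Rightarrow> 'b \<Rightarrow> bool" where
  "sub_eq m n \<longleftrightarrow> m \<in> M \<and> n \<in> M \<and> Cod C m = Cod C n \<and>
    (\<exists>w. invertible C w \<and> w \<in> Hom C (Dom C m) (Dom C n) \<and> n \<cdot> w = m)"

lemma sub_eq_refl: "m \<in> M \<Longrightarrow> sub_eq m m"
  unfolding sub_eq_def
  using invertible_Idn[OF Dom_in_Obj[OF M_Arr]] Idn_in_Hom[OF Dom_in_Obj[OF M_Arr]] Cmp_Idn_right'[OF M_Arr] by blast

lemma sub_eq_sym: assumes "sub_eq m n" shows "sub_eq n m"
proof -
  obtain w where w: "invertible C w" "w \<in> Hom C (Dom C m) (Dom C n)" "n \<cdot> w = m" and mn: "m \<in> M" "n \<in> M" "Cod C m = Cod C n"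
    using assms by (auto simp: sub_eq_def)
  obtain v where v: "v \<in> Hom C (Cod C w) (Dom C w)" "w \<cdot> v = Idn C (Cod C w)" "invertible C v"
    using w(1) by (rule invertible_inverse)
  have v': "v \<in> Hom C (Dom C n) (Dom C m)" using v w by (simp add: Hom_def)
  have nh: "n \<in> Hom C (Dom C n) (Cod C n)" using mn M_Arr by (simp add: Hom_def)
  have "m \<cdot> v = n" using Cmp_assoc[OF v' w(2) nh] w v(2) Cmp_Idn_right[OF nh] by (simp add: Hom_def)
  then show ?thesis using v(3) v' mn by (auto simp: sub_eq_def)
qed

lemma sub_eq_trans: assumes "sub_eq l m" "sub_eq m n" shows "sub_eq l n"
proof -
  obtain w where w: "invertible C w" "w \<in> Hom C (Dom C l) (Dom C m)" "m \<cdot> w = l"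
    using assms(1) by (auto simp: sub_eq_def)
  obtain v where v: "invertible C v" "v \<in> Hom C (Dom C m) (Dom C n)" "n \<cdot> v = m"
    using assms(2) by (auto simp: sub_eq_def)
  have mn: "l \<in> M" "n \<in> M" "Cod C l = Cod C n" using assms by (auto simp: sub_eq_def)
  have nh: "n \<in> Hom C (Dom C n) (Cod C n)" using mn M_Arr by (simp add: Hom_def)
  have "n \<cdot> (v \<cdot> w) = l" using Cmp_assoc[OF w(2) v(2) nh] w v by simp
  moreover have "invertible C (v \<cdot> w)" using invertible_Cmp[OF w(1) v(1)] w(2) v(2) by (simp add: Hom_def)
  ultimately show ?thesis using mn Cmp_in_Hom[OF w(2) v(2)] by (auto simp: sub_eq_def)
qed

definition sub_class :: "'b \<Rightarrow> 'b set" where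
  "sub_class m = {n. sub_eq m n}"

lemma sub_class_eq_iff: "m \<in> M \<Longrightarrow> n \<in> M \<Longrightarrow> sub_class m = sub_class n \<longleftrightarrow> sub_eq m n"
  unfolding sub_class_def using sub_eq_refl sub_eq_sym sub_eq_trans by blast

text \<open>Invertible arrows belong to \<open>M\<close>, so isomorphism inside the slice of the
  subcategory \<open>M\<close> is the same as comparison by an invertible arrow of
  \<open>C\<close>.\<close>

lemma isomorphic_slice_iff:
  "m \<in> Obj (slice_cat (wide_subcat C M) B) \<Longrightarrow> n \<in> Obj (slice_cat (wide_subcat C M) B) \<Longrightarrow>
   isomorphic (slice_cat (wide_subcat C M) B) m n \<longleftrightarrow> sub_eq m n"
proof -
  let ?L = "slice_cat (wide_subcat C M) B"
  assume "m \<in> Obj ?L" "n \<in> Obj ?L"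
  then have m: "m \<in> M" "Cod C m = B" and n: "n \<in> M" "Cod C n = B" by (auto simp: slice_cat_def)
  show ?thesis
  proof
    assume "isomorphic ?L m n"
    then obtain f where f: "f \<in> Hom ?L m n" "invertible ?L f" by (auto simp: isomorphic_def)
    obtain w where w: "f = (m, w, n)" "w \<in> M" "Dom C w = Dom C m" "Cod C w = Dom C n" "n \<cdot> w = m"
      using f(1) by (auto simp: Hom_def slice_cat_def)
    obtain g where g: "g \<in> Hom ?L n m" "g \<cdot>\<^bsub>?L\<^esub> f = Idn ?L m" "f \<cdot>\<^bsub>?L\<^esub> g = Idn ?L n"
      using f(2) w(1) by (auto simp: invertible_def slice_cat_def)
    obtain v where v: "g = (n, v, m)" "v \<in> M" "Dom C v = Dom C n" "Cod C v = Dom C m"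
      using g(1) by (auto simp: Hom_def slice_cat_def)
    have "v \<cdot> w = Idn C (Dom C m)" "w \<cdot> v = Idn C (Dom C n)"
      using g(2,3) w(1) v(1) by (auto simp: slice_cat_def)
    then have "invertible C w" unfolding invertible_def using w v M_Arr by (auto simp: Hom_def)
    then show "sub_eq m n" using w m n M_Arr by (auto simp: sub_eq_def Hom_def)
  next
    assume "sub_eq m n"
    then obtain w where w: "invertible C w" "w \<in> Hom C (Dom C m) (Dom C n)" "n \<cdot> w = m" by (auto simp: sub_eq_def)
    obtain v where v: "v \<in> Hom C (Cod C w) (Dom C w)" "v \<cdot> w = Idn C (Dom C w)" "w \<cdot> v = Idn C (Cod C w)" "invertible C v"
      using w(1) by (rule invertible_inverse)
    have v': "v \<in> Hom C (Dom C n) (Dom C m)" using v w by (simp add: Hom_def)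
    have nh: "n \<in> Hom C (Dom C n) (Cod C n)" using n M_Arr by (simp add: Hom_def)
    have "m \<cdot> v = n" using Cmp_assoc[OF v' w(2) nh] w v(3) Cmp_Idn_right[OF nh] by (simp add: Hom_def)
    then have "(n, v, m) \<in> Hom ?L n m" "(m, w, n) \<in> Hom ?L m n"
      using w v v' m n invertible_M by (auto simp: Hom_def slice_cat_def)
    moreover have "(n, v, m) \<cdot>\<^bsub>?L\<^esub> (m, w, n) = Idn ?L m" "(m, w, n) \<cdot>\<^bsub>?L\<^esub> (n, v, m) = Idn ?L n"
      using v w by (auto simp: slice_cat_def Hom_def)
    ultimately show "isomorphic ?L m n"
      unfolding isomorphic_def invertible_def by (intro bexI[of _ "(m, w, n)"]) (auto simp: Hom_def)
  qed
qed

lemma iso_classes_slice: "iso_classes (slice_cat (wide_subcat C M) B) = sub_class ` {m \<in> M. Cod C m = B}"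
proof -
  let ?L = "slice_cat (wide_subcat C M) B"
  have O: "Obj ?L = {m \<in> M. Cod C m = B}" by (auto simp: slice_cat_def)
  have "{(m, n). m \<in> Obj ?L \<and> n \<in> Obj ?L \<and> isomorphic ?L m n} `` {m} = sub_class m" if "m \<in> Obj ?L" for m
    using that isomorphic_slice_iff[OF that] by (auto simp: sub_class_def O) (auto simp: sub_eq_def)
  then show ?thesis unfolding iso_classes_def quotient_def O[symmetric] by auto
qed

text \<open>Composition with the monomorphism \<open>m\<close> embeds the subobjects of its domain
  into those of \<open>B\<close>, and it misses the improper subobject because \<open>m\<close> is
  not invertible. This is the descent for the induction on subobjects.\<close>

lemma card_iso_classes_less:
  assumes m: "m \<in> M" "Cod C m = B" and fin: "finite (iso_classes (slice_cat (wide_subcat C M) B))" and ninv: "\<not> invertible C m"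
  shows "card (iso_classes (slice_cat (wide_subcat C M) (Dom C m))) < card (iso_classes (slice_cat (wide_subcat C M) B))"
proof -
  let ?A = "{n \<in> M. Cod C n = Dom C m}" and ?B = "{n \<in> M. Cod C n = B}"
  have mn: "m \<cdot> n \<in> ?B" if "n \<in> ?A" for n
    using that M_Cmp[of n m] m Cmp_simps[of n m] M_Arr by auto
  have eq: "sub_class (m \<cdot> n) = sub_class (m \<cdot> n') \<longleftrightarrow> sub_class n = sub_class n'" if n: "n \<in> ?A" "n' \<in> ?A" for n n'
  proof -
    have h: "m \<in> Hom C (Dom C m) B" "n' \<in> Hom C (Dom C n') (Dom C m)" "n \<in> Hom C (Dom C n) (Dom C m)"
      using n m M_Arr by (auto simp: Hom_def)
    have d: "Dom C (m \<cdot> n) = Dom C n" "Dom C (m \<cdot> n') = Dom C n'" "Cod C (m \<cdot> n) = Cod C (m \<cdot> n')"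
      using Cmp_in_Hom[OF h(3,1)] Cmp_in_Hom[OF h(2,1)] by (auto simp: Hom_def)
    have "(m \<cdot> n') \<cdot> w = m \<cdot> n \<longleftrightarrow> n' \<cdot> w = n" if w: "w \<in> Hom C (Dom C n) (Dom C n')" for w
      using Cmp_assoc[OF w h(2,1)] M_cancel_left[OF m(1) Cmp_in_Hom[OF w h(2)] h(3)] by auto
    then have "sub_eq (m \<cdot> n) (m \<cdot> n') \<longleftrightarrow> sub_eq n n'"
      using mn[OF n(1)] mn[OF n(2)] n unfolding sub_eq_def d by auto
    then show ?thesis using mn[OF n(1)] mn[OF n(2)] n by (simp add: sub_class_eq_iff)
  qed
  \<comment> \<open>Composition with \<open>m\<close> on classes, by way of a representative;
    \<open>eq\<close> gives both that the choice is immaterial and that the map is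
    injective.\<close>
  let ?f = "\<lambda>c. sub_class (m \<cdot> (SOME n. n \<in> ?A \<and> sub_class n = c))"
  have "inj_on ?f (sub_class ` ?A)" and "?f ` (sub_class ` ?A) \<subseteq> sub_class ` ?B - {sub_class (Idn C B)}"
  proof -
    have s: "(SOME n'. n' \<in> ?A \<and> sub_class n' = sub_class n) \<in> ?A \<and>
        sub_class (SOME n'. n' \<in> ?A \<and> sub_class n' = sub_class n) = sub_class n" if "n \<in> ?A" for n
      by (rule someI[of _ n]) (use that in auto)
    have f: "?f (sub_class n) = sub_class (m \<cdot> n)" if "n \<in> ?A" for n
      using eq[OF _ that] s[OF that] by blast
    show "inj_on ?f (sub_class ` ?A)"
    proof (rule inj_onI)
      fix c d assume "c \<in> sub_class ` ?A" "d \<in> sub_class ` ?A" and fe: "?f c = ?f d"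
      then obtain n n' where n: "n \<in> ?A" "c = sub_class n" and n': "n' \<in> ?A" "d = sub_class n'" by blast
      have "sub_class (m \<cdot> n) = sub_class (m \<cdot> n')" using fe f[OF n(1)] f[OF n'(1)] n(2) n'(2) by metis
      then show "c = d" using eq[OF n(1) n'(1)] n(2) n'(2) by simp
    qed
    show "?f ` (sub_class ` ?A) \<subseteq> sub_class ` ?B - {sub_class (Idn C B)}"
    proof
      fix d assume "d \<in> ?f ` (sub_class ` ?A)"
      then obtain n where n: "n \<in> ?A" "d = ?f (sub_class n)" by blast
      then have d: "d = sub_class (m \<cdot> n)" using f by simp
      have B: "B \<in> Obj C" using m Cod_in_Obj M_Arr by blast
      \<comment> \<open>An equivalence of \<open>m \<cdot> n\<close> with the identity would provide
        a right inverse of \<open>m\<close> and so make it invertible.\<close>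
      have "\<not> sub_eq (Idn C B) (m \<cdot> n)"
      proof
        assume "sub_eq (Idn C B) (m \<cdot> n)"
        then obtain w where w: "w \<in> Hom C B (Dom C (m \<cdot> n))" "(m \<cdot> n) \<cdot> w = Idn C B"
          using Idn_simps[OF B] by (auto simp: sub_eq_def)
        have h: "m \<in> Hom C (Dom C m) B" "n \<in> Hom C (Dom C n) (Dom C m)" using n m M_Arr by (auto simp: Hom_def)
        have w': "w \<in> Hom C B (Dom C n)" using w(1) Cmp_in_Hom[OF h(2,1)] by (simp add: Hom_def)
        have "m \<cdot> (n \<cdot> w) = Idn C B" using Cmp_assoc[OF w' h(2,1)] w(2) by simp
        then show False using M_split_invertible[OF m(1)] Cmp_in_Hom[OF w' h(2)] m(2) ninv by simp
      qed
      moreover have "Idn C B \<in> M" using invertible_M[OF invertible_Idn[OF B]] .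
      ultimately have "sub_class (m \<cdot> n) \<noteq> sub_class (Idn C B)"
        using sub_class_eq_iff[of "Idn C B" "m \<cdot> n"] mn[OF n(1)] by auto
      then show "d \<in> sub_class ` ?B - {sub_class (Idn C B)}" using d mn[OF n(1)] by blast
    qed
  qed
  moreover have "finite (sub_class ` ?B - {sub_class (Idn C B)})"
    using fin unfolding iso_classes_slice by (rule finite_Diff)
  ultimately have "card (sub_class ` ?A) \<le> card (sub_class ` ?B - {sub_class (Idn C B)})"
    by (rule card_inj_on_le)
  also have "\<dots> < card (sub_class ` ?B)"
  proof (rule card_Diff1_less)
    have B: "B \<in> Obj C" using m Cod_in_Obj M_Arr by blast
    then have "Idn C B \<in> ?B" using invertible_M[OF invertible_Idn[OF B]] Idn_simps[OF B] by simp
    then show "sub_class (Idn C B) \<in> sub_class ` ?B" by (rule imageI)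
  qed (use fin in \<open>simp only: iso_classes_slice\<close>)
  finally show ?thesis unfolding iso_classes_slice .
qed

text \<open>Members of \<open>M\<close> are monic, so precomposition with invertible arrows acts
  freely on them. A coend over the groupoid therefore reduces to a sum with one summand per orbit,
  and this is the chosen point of the orbit.\<close>

definition sub_rep :: "'b \<Rightarrow> 'b" where
  "sub_rep m = (SOME n. n \<in> sub_class m)"

definition sub_iso :: "'b \<Rightarrow> 'b" where
  "sub_iso m = (SOME w. invertible C w \<and> w \<in> Hom C (Dom C m) (Dom C (sub_rep m)) \<and> sub_rep m \<cdot> w = m)"

lemma sub_rep:
  assumes m: "m \<in> M"
  shows "sub_eq m (sub_rep m)" and "sub_rep m \<in> M" and "Cod C (sub_rep m) = Cod C m"
    and "invertible C (sub_iso m)" and "sub_iso m \<in> Hom C (Dom C m) (Dom C (sub_rep m))"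
    and "sub_rep m \<cdot> sub_iso m = m"
proof -
  have "m \<in> sub_class m" using sub_eq_refl[OF m] by (simp add: sub_class_def)
  then have "sub_rep m \<in> sub_class m" unfolding sub_rep_def by (rule someI)
  then show s: "sub_eq m (sub_rep m)" by (simp add: sub_class_def)
  then show "sub_rep m \<in> M" and "Cod C (sub_rep m) = Cod C m" by (auto simp: sub_eq_def)
  have "\<exists>w. invertible C w \<and> w \<in> Hom C (Dom C m) (Dom C (sub_rep m)) \<and> sub_rep m \<cdot> w = m"
    using s by (simp add: sub_eq_def)
  from someI_ex[OF this] show "invertible C (sub_iso m)" and "sub_iso m \<in> Hom C (Dom C m) (Dom C (sub_rep m))"
    and "sub_rep m \<cdot> sub_iso m = m" unfolding sub_iso_def by auto
qed

lemma sub_rep_eq: "sub_eq m n \<Longrightarrow> sub_rep m = sub_rep n"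
  using sub_class_eq_iff[of m n] by (auto simp: sub_rep_def sub_eq_def)

text \<open>The representative is monic, so its defining equation determines the comparison arrow,
  whatever \<open>SOME\<close> picks.\<close>

lemma sub_iso_eqI:
  "m \<in> M \<Longrightarrow> w \<in> Hom C (Dom C m) (Dom C (sub_rep m)) \<Longrightarrow> sub_rep m \<cdot> w = m \<Longrightarrow> sub_iso m = w"
  using M_cancel_left[of "sub_rep m" "sub_iso m" "Dom C m" w] sub_rep[of m] by simp

end

section \<open>The equivalence for a factorization system with idempotents\<close>

text \<open>Lets \<open>F\<close> itself occur as one of the two subcategories of the shared locale;
  facts from there are specialized by unfolding with this equation.\<close>

lemma wide_subcat_self: "wide_subcat C (Arr C) = C"
  by (simp add: wide_subcat_def)

text \<open>Only the carrier changes and the operations are inherited, so the image stays in the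
  same universe and its elements remain elements of \<open>N\<close>.\<close>

lemma module_image:
  assumes N: "module R N" and h: "lin R N N h"
  shows "module R (N\<lparr>carrier := h ` carrier N\<rparr>)"
proof -
  let ?I = "N\<lparr>carrier := h ` carrier N\<rparr>"
  interpret N: module R N by fact
  have sub: "h ` carrier N \<subseteq> carrier N" using lin_closed[OF h] by blast
  show ?thesis
  proof (rule moduleI[OF N.cring_axioms])
    show "abelian_group (?I)"
    proof (rule abelian_groupI)
      show "x \<oplus>\<^bsub>?I\<^esub> y \<in> carrier (?I)"
        if "x \<in> carrier (?I)" "y \<in> carrier (?I)" for x y
        using that lin_add[OF h, symmetric] by auto
      show "\<zero>\<^bsub>?I\<^esub> \<in> carrier (?I)"
        using lin_zero[OF h N N] by (auto intro!: image_eqI[of _ h "\<zero>\<^bsub>N\<^esub>"])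
      fix x assume "x \<in> carrier (?I)"
      then obtain y where y: "y \<in> carrier N" "x = h y" by auto
      have "h (\<ominus>\<^bsub>N\<^esub> y) \<oplus>\<^bsub>N\<^esub> h y = \<zero>\<^bsub>N\<^esub>"
        using y lin_add[OF h, of "\<ominus>\<^bsub>N\<^esub> y" y] lin_zero[OF h N N] by (simp add: N.M.l_neg)
      then show "\<exists>z\<in>carrier (?I). z \<oplus>\<^bsub>?I\<^esub> x = \<zero>\<^bsub>?I\<^esub>"
        using y by auto
      have x: "x \<in> carrier N" using y lin_closed[OF h] by simp
      then show "\<zero>\<^bsub>?I\<^esub> \<oplus>\<^bsub>?I\<^esub> x = x" by simp
      fix z assume "z \<in> carrier (?I)"
      then have z: "z \<in> carrier N" using lin_closed[OF h] by auto
      show "x \<oplus>\<^bsub>?I\<^esub> z = z \<oplus>\<^bsub>?I\<^esub> x"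
        using N.M.a_comm[OF x z] by simp
      fix w assume "w \<in> carrier (?I)"
      then have w: "w \<in> carrier N" using lin_closed[OF h] by auto
      show "x \<oplus>\<^bsub>?I\<^esub> z \<oplus>\<^bsub>?I\<^esub> w =
          x \<oplus>\<^bsub>?I\<^esub> (z \<oplus>\<^bsub>?I\<^esub> w)"
        using N.M.a_assoc[OF x z w] by simp
    qed
    show "a \<odot>\<^bsub>?I\<^esub> x \<in> carrier (?I)"
      if "a \<in> carrier R" "x \<in> carrier (?I)" for a x
      using that lin_smult[OF h, symmetric] by auto
  qed (simp_all add: N.smult_l_distr N.smult_r_distr N.smult_assoc1 subsetD[OF sub])
qed

locale idempotent_factorization = proper_factorization_system C E M + R: cring R
  for C :: "('o, 'a) cat" (structure) and E M :: "'a set" and R :: "('r, 's) ring_scheme" +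
  fixes p :: "'o \<Rightarrow> 'a \<Rightarrow> 'r" and U :: "'u itself"
  assumes infinite_U: "infinite (UNIV :: 'u set)"
    and Arr_le: "Arr C \<lesssim> (UNIV :: 'u set)"
    and p_closed: "A \<in> Obj C \<Longrightarrow> p A \<in> carrier (free_mod R (Hom C A A))"
    and p0: "A \<in> Obj C \<Longrightarrow> free_comp R C A A A (p A) (p A) = p A"
    and p1: "A \<in> Obj C \<Longrightarrow> B \<in> Obj C \<Longrightarrow> f \<in> Hom C A B - M \<Longrightarrow>
      free_comp R C A A B (free_gen R f) (p A) = \<zero>\<^bsub>free_mod R (Hom C A B)\<^esub>"
    and p2: "A \<in> Obj C \<Longrightarrow> B \<in> Obj C \<Longrightarrow> f \<in> Hom C A B - E \<Longrightarrow>
      free_comp R C A B B (p B) (free_gen R f) = \<zero>\<^bsub>free_mod R (Hom C A B)\<^esub>"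
    and p3: "A \<in> Obj C \<Longrightarrow> B \<in> Obj C \<Longrightarrow> g \<in> Hom C A B \<inter> (E \<inter> M) \<Longrightarrow>
      free_comp R C A A B (free_gen R g) (p A) = free_comp R C A B B (p B) (free_gen R g)"
    and p4: "A \<in> Obj C \<Longrightarrow> free_gen R (Idn C A) \<ominus>\<^bsub>free_mod R (Hom C A A)\<^esub> p A
      \<in> carrier (free_mod R (Hom C A A - E - M))"
    and finite_subobjects: "A \<in> Obj C \<Longrightarrow> finite (iso_classes (slice_cat (wide_subcat C M) A))"
begin

abbreviation G where "G \<equiv> wide_subcat C (E \<inter> M)"
abbreviation V :: "(('r, 'u) module, ('r, 'u) mod_arr) cat" where "V \<equiv> mod_cat R"
abbreviation Mh where "Mh \<equiv> kernel_obj R G C (truncated_hom R C M G C)"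
abbreviation Eh where "Eh \<equiv> kernel_obj R C G (truncated_hom R C E C G)"

lemma Idn_EM: "A \<in> Obj C \<Longrightarrow> Idn C A \<in> E" "A \<in> Obj C \<Longrightarrow> Idn C A \<in> M"
  using invertible_Idn invertible_E invertible_M by auto

lemma G_Cmp: "f \<in> E \<inter> M \<Longrightarrow> g \<in> E \<inter> M \<Longrightarrow> Cod C f = Dom C g \<Longrightarrow> g \<cdot> f \<in> E \<inter> M"
  unfolding EM_iff by (rule invertible_Cmp)

lemma M_Cmp_G_iff:
  assumes s: "s \<in> Arr C" and x: "x \<in> E \<inter> M" and c: "Cod C x = Dom C s"
  shows "s \<cdot> x \<in> M \<longleftrightarrow> s \<in> M"
proof
  have inv: "invertible C x" using x EM_iff by blast
  show "s \<in> M \<Longrightarrow> s \<cdot> x \<in> M" using FS0_M[OF _ inv c] .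
  assume sx: "s \<cdot> x \<in> M"
  obtain y where y: "y \<in> Hom C (Cod C x) (Dom C x)" "x \<cdot> y = Idn C (Cod C x)" "invertible C y"
    using inv by (rule invertible_inverse)
  have h: "x \<in> Hom C (Dom C x) (Cod C x)" "s \<in> Hom C (Cod C x) (Cod C s)"
    using s c inv by (auto simp: Hom_def invertible_Arr)
  have "Cod C y = Dom C (s \<cdot> x)" using y(1) Cmp_in_Hom[OF h] by (simp add: Hom_def)
  then have "(s \<cdot> x) \<cdot> y \<in> M" using FS0_M[OF sx y(3)] by blast
  moreover have "(s \<cdot> x) \<cdot> y = s" using Cmp_assoc[OF y(1) h] y(2) Cmp_Idn_right[OF h(2)] by simp
  ultimately show "s \<in> M" by simp
qed

lemma E_G_Cmp_iff:
  assumes s: "s \<in> Arr C" and x: "x \<in> E \<inter> M" and c: "Cod C s = Dom C x"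
  shows "x \<cdot> s \<in> E \<longleftrightarrow> s \<in> E"
proof
  have inv: "invertible C x" using x EM_iff by blast
  show "s \<in> E \<Longrightarrow> x \<cdot> s \<in> E" using FS0_E[OF _ inv] c by simp
  assume xs: "x \<cdot> s \<in> E"
  obtain y where y: "y \<in> Hom C (Cod C x) (Dom C x)" "y \<cdot> x = Idn C (Dom C x)" "invertible C y"
    using inv by (rule invertible_inverse)
  have h: "s \<in> Hom C (Dom C s) (Dom C x)" "x \<in> Hom C (Dom C x) (Cod C x)"
    using s c inv by (auto simp: Hom_def invertible_Arr)
  have "Dom C y = Cod C (x \<cdot> s)" using y(1) Cmp_in_Hom[OF h] by (simp add: Hom_def)
  then have "y \<cdot> (x \<cdot> s) \<in> E" using FS0_E[OF xs y(3)] by blast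
  moreover have "y \<cdot> (x \<cdot> s) = s" using Cmp_assoc[OF h y(1)] y(2) Cmp_Idn_left[OF h(1)] by simp
  ultimately show "s \<in> E" by simp
qed

text \<open>Leaving \<open>M\<close> by composing on the left is irreversible by
  \<open>M_cancel\<close>, and composition with groupoid arrows on the right neither enters nor
  leaves \<open>M\<close>.\<close>

sublocale KM: truncated_kernel R C M "E \<inter> M" "Arr C" U
proof
  show "m \<in> M \<Longrightarrow> y \<in> Arr C \<Longrightarrow> y' \<in> Arr C \<Longrightarrow> Cod C m = Dom C y \<Longrightarrow> Cod C y = Dom C y' \<Longrightarrow>
      y' \<cdot> (y \<cdot> m) \<in> M \<Longrightarrow> y \<cdot> m \<in> M" for m y y'
    using M_cancel[of "y \<cdot> m" y'] Cmp_simps[of m y] M_Arr by auto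
  fix m x y assume a: "m \<in> M" "x \<in> E \<inter> M" "y \<in> Arr C" "Cod C x = Dom C m" "Cod C m = Dom C y" "y \<cdot> (m \<cdot> x) \<in> M"
  have "(y \<cdot> m) \<cdot> x \<in> M" using a Cmp_assoc'[of x m y] M_Arr by auto
  then show "y \<cdot> m \<in> M \<and> m \<cdot> x \<in> M"
    using a M_Cmp_G_iff[of "y \<cdot> m" x] M_Cmp_G_iff[of m x] Cmp_simps[of m y] M_Arr by auto
qed (use infinite_U Arr_le M_Arr E_Arr Idn_EM Idn_simps G_Cmp Cmp_simps in auto)

text \<open>Groupoid arrows on the left neither enter nor leave \<open>E\<close>; both truncation
  conditions follow from that.\<close>

sublocale KE: truncated_kernel R C E "Arr C" "E \<inter> M" U
proof
  show "e \<in> E \<Longrightarrow> y \<in> E \<inter> M \<Longrightarrow> y' \<in> E \<inter> M \<Longrightarrow> Cod C e = Dom C y \<Longrightarrow> Cod C y = Dom C y' \<Longrightarrow>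
      y' \<cdot> (y \<cdot> e) \<in> E \<Longrightarrow> y \<cdot> e \<in> E" for e y y'
    using E_G_Cmp_iff[of e y] E_Arr by auto
  fix e x y assume a: "e \<in> E" "x \<in> Arr C" "y \<in> E \<inter> M" "Cod C x = Dom C e" "Cod C e = Dom C y" "y \<cdot> (e \<cdot> x) \<in> E"
  then show "y \<cdot> e \<in> E \<and> e \<cdot> x \<in> E"
    using E_G_Cmp_iff[of e y] E_G_Cmp_iff[of "e \<cdot> x" y] Cmp_simps[of x e] E_Arr by auto
qed (use infinite_U Arr_le M_Arr E_Arr Idn_EM Idn_simps G_Cmp Cmp_simps in auto)

subsection \<open>The action of the idempotents\<close>

lemma act_lin: "is_functor C V X \<Longrightarrow> f \<in> Hom C A B \<Longrightarrow> lin R (fobj X A) (fobj X B) (act X f)"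
  using mod_functor_lin[of C R X f] by (auto simp: Hom_def)

lemma act_closed: "is_functor C V X \<Longrightarrow> f \<in> Hom C A B \<Longrightarrow> x \<in> carrier (fobj X A) \<Longrightarrow> act X f x \<in> carrier (fobj X B)"
  by (rule lin_closed[OF act_lin])

lemma act_comp: "is_functor C V X \<Longrightarrow> f \<in> Hom C A B \<Longrightarrow> g \<in> Hom C B D \<Longrightarrow> x \<in> carrier (fobj X A) \<Longrightarrow>
    act X (g \<cdot> f) x = act X g (act X f x)"
  using mod_functor_comp[of C R X f g x] by (auto simp: Hom_def)

text \<open>The value of the R-linear functor on \<open>RC\<close> that corresponds to
  \<open>X\<close>, on the combination \<open>u\<close> of arrows from \<open>A\<close> to
  \<open>B\<close>.\<close>

definition lact :: "('o, 'a, 'r, 'u) mod_fctr \<Rightarrow> 'o \<Rightarrow> 'o \<Rightarrow> ('a \<Rightarrow> 'r) \<Rightarrow> 'u \<Rightarrow> 'u" where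
  "lact X A B u x = free_lift R (Hom C A B) (fobj X B) (\<lambda>f. act X f x) u"

abbreviation pact :: "('o, 'a, 'r, 'u) mod_fctr \<Rightarrow> 'o \<Rightarrow> 'u \<Rightarrow> 'u" where
  "pact X A \<equiv> lact X A A (p A)"

context
  fixes X :: "('o, 'a, 'r, 'u) mod_fctr"
  assumes X: "is_functor C V X"
begin

lemma X_module: "A \<in> Obj C \<Longrightarrow> module R (fobj X A)"
  by (rule mod_functor_module[OF X])

lemma lact_lin:
  assumes "A \<in> Obj C" "B \<in> Obj C" "u \<in> carrier (free_mod R (Hom C A B))"
  shows "lin R (fobj X A) (fobj X B) (lact X A B u)"
  unfolding lact_def
  by (rule bilinear_lin(2)[OF free_lift_bilinear[OF X_module[OF assms(2)] act_lin[OF X] X_module[OF assms(1)]] assms(3)])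

lemma lact_gen: "f \<in> Hom C A B \<Longrightarrow> x \<in> carrier (fobj X A) \<Longrightarrow> lact X A B (free_gen R f) x = act X f x"
  unfolding lact_def using Hom_Obj[of f A B] by (intro free_lift_gen X_module) (auto intro: act_closed[OF X])

lemma lact_zero:
  assumes "A \<in> Obj C" "B \<in> Obj C" "x \<in> carrier (fobj X A)"
  shows "lact X A B \<zero>\<^bsub>free_mod R (Hom C A B)\<^esub> x = \<zero>\<^bsub>fobj X B\<^esub>"
  unfolding lact_def
  by (rule lin_zero[OF lin_free_lift module_free_mod[OF R.cring_axioms]])
     (use assms X_module in \<open>auto intro: act_closed[OF X]\<close>)

text \<open>\<open>free_comp\<close> and the two-step action are both linear in \<open>u\<close> and
  in \<open>v\<close>, so everything reduces to functoriality of \<open>X\<close> on single arrows,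
  by pushing linear maps through the two nested free lifts.\<close>

lemma lact_comp:
  assumes O: "A \<in> Obj C" "B \<in> Obj C" "D \<in> Obj C" and u: "u \<in> carrier (free_mod R (Hom C B D))"
    and v: "v \<in> carrier (free_mod R (Hom C A B))" and x: "x \<in> carrier (fobj X A)"
  shows "lact X A D (free_comp R C A B D u v) x = lact X B D u (lact X A B v x)"
proof -
  note XB = X_module[OF O(2)] and XD = X_module[OF O(3)]
  let ?F = "free_mod R (Hom C A D)"
  have F: "module R ?F" by (rule module_free_mod[OF R.cring_axioms])
  have gf: "free_gen R (g \<cdot> f) \<in> carrier ?F" if "g \<in> Hom C B D" "f \<in> Hom C A B" for g f
    using free_gen_closed[OF R.cring_axioms Cmp_in_Hom[OF that(2,1)]] .
  let ?L = "free_lift R (Hom C A D) (fobj X D) (\<lambda>h. act X h x)"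
  let ?g = "\<lambda>g. free_lift R (Hom C A B) ?F (\<lambda>f. free_gen R (g \<cdot> f)) v"
  have L: "lin R ?F (fobj X D) ?L"
    using x by (intro lin_free_lift[OF XD]) (auto intro: act_closed[OF X])
  have gc: "?g g \<in> carrier ?F" if "g \<in> Hom C B D" for g
    by (rule lin_closed[OF lin_free_lift[OF F gf[OF that]] v])
  have g: "?L (?g g) = act X g (lact X A B v x)" if g: "g \<in> Hom C B D" for g
  proof -
    have "?L (?g g) = free_lift R (Hom C A B) (fobj X D) (\<lambda>f. ?L (free_gen R (g \<cdot> f))) v"
      by (rule free_lift_lin[OF F XD gf[OF g] L v])
    also have "\<dots> = free_lift R (Hom C A B) (fobj X D) (\<lambda>f. act X g (act X f x)) v"
    proof (rule free_lift_cong[OF XD _ _ v])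
      fix f assume f: "f \<in> Hom C A B"
      show "?L (free_gen R (g \<cdot> f)) \<in> carrier (fobj X D)" using lin_closed[OF L gf[OF g f]] .
      show "?L (free_gen R (g \<cdot> f)) = act X g (act X f x)"
        using lact_gen[OF Cmp_in_Hom[OF f g] x] act_comp[OF X f g x] by (simp add: lact_def)
    qed
    also have "\<dots> = act X g (lact X A B v x)"
      unfolding lact_def using x by (intro free_lift_lin[OF XB XD _ act_lin[OF X g] v, symmetric]) (auto intro: act_closed[OF X])
    finally show ?thesis .
  qed
  have "lact X A D (free_comp R C A B D u v) x = ?L (free_lift R (Hom C B D) ?F ?g u)"
    by (simp add: lact_def free_comp_def)
  also have "\<dots> = free_lift R (Hom C B D) (fobj X D) (\<lambda>g. ?L (?g g)) u"
    by (rule free_lift_lin[OF F XD gc L u])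
  also have "\<dots> = lact X B D u (lact X A B v x)"
    unfolding lact_def[of X B D]
    by (rule free_lift_cong[OF XD _ _ u], rule lin_closed[OF L gc], assumption, rule g, assumption)
  finally show ?thesis .
qed

lemma pact_lin: "A \<in> Obj C \<Longrightarrow> lin R (fobj X A) (fobj X A) (pact X A)"
  by (rule lact_lin) (auto intro: p_closed)

lemma pact_closed: "A \<in> Obj C \<Longrightarrow> x \<in> carrier (fobj X A) \<Longrightarrow> pact X A x \<in> carrier (fobj X A)"
  by (rule lin_closed[OF pact_lin])

lemma pact_idem: "A \<in> Obj C \<Longrightarrow> x \<in> carrier (fobj X A) \<Longrightarrow> pact X A (pact X A x) = pact X A x"
  using lact_comp[of A A A "p A" "p A" x] p_closed p0 by simp

text \<open>Gathers an arrow and \<open>p\<close> into a single element of \<open>RC\<close>, the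
  form in which (p1), (p2) and (p3) are stated.\<close>

lemma act_pact:
  assumes f: "f \<in> Hom C A B" and x: "x \<in> carrier (fobj X A)"
  shows "act X f (pact X A x) = lact X A B (free_comp R C A A B (free_gen R f) (p A)) x"
    and "pact X B (act X f x) = lact X A B (free_comp R C A B B (p B) (free_gen R f)) x"
proof -
  have O: "A \<in> Obj C" "B \<in> Obj C" using Hom_Obj[OF f] by auto
  note g = free_gen_closed[OF R.cring_axioms f]
  show "act X f (pact X A x) = lact X A B (free_comp R C A A B (free_gen R f) (p A)) x"
    using lact_comp[OF O(1,1,2) g p_closed[OF O(1)] x] lact_gen[OF f pact_closed[OF O(1) x]] by simp
  show "pact X B (act X f x) = lact X A B (free_comp R C A B B (p B) (free_gen R f)) x"
    using lact_comp[OF O(1,2,2) p_closed[OF O(2)] g x] lact_gen[OF f x] by simp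
qed

lemma act_pact_not_M: "f \<in> Hom C A B \<Longrightarrow> f \<notin> M \<Longrightarrow> x \<in> carrier (fobj X A) \<Longrightarrow> act X f (pact X A x) = \<zero>\<^bsub>fobj X B\<^esub>"
  using act_pact(1)[of f A B x] p1[of A B f] lact_zero[of A B x] Hom_Obj[of f A B] by simp

lemma pact_act_not_E: "f \<in> Hom C A B \<Longrightarrow> f \<notin> E \<Longrightarrow> x \<in> carrier (fobj X A) \<Longrightarrow> pact X B (act X f x) = \<zero>\<^bsub>fobj X B\<^esub>"
  using act_pact(2)[of f A B x] p2[of A B f] lact_zero[of A B x] Hom_Obj[of f A B] by simp

lemma pact_act_G: "f \<in> Hom C A B \<Longrightarrow> f \<in> E \<inter> M \<Longrightarrow> x \<in> carrier (fobj X A) \<Longrightarrow> pact X B (act X f x) = act X f (pact X A x)"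
  using act_pact[of f A B x] p3[of A B f] Hom_Obj[of f A B] by simp

end

text \<open>\<open>p\<close> acts as a linear combination of endomorphisms of \<open>A\<close>.
  Commutation with these at one element is enough, so the lemma also applies to maps that are not
  packaged as natural transformations.\<close>

lemma pact_natural:
  assumes X: "is_functor C V X" and X': "is_functor C V X'" and A: "A \<in> Obj C"
    and h: "lin R (fobj X A) (fobj X' A) h" and x: "x \<in> carrier (fobj X A)"
    and nat: "\<And>f. f \<in> Hom C A A \<Longrightarrow> h (act X f x) = act X' f (h x)"
  shows "h (pact X A x) = pact X' A (h x)"
proof -
  have "h (pact X A x) = free_lift R (Hom C A A) (fobj X' A) (\<lambda>f. h (act X f x)) (p A)"
    unfolding lact_def by (rule free_lift_lin[OF X_module[OF X A] X_module[OF X' A] act_closed[OF X _ x] h p_closed[OF A]])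
  also have "\<dots> = pact X' A (h x)"
    unfolding lact_def
    by (rule free_lift_cong[OF X_module[OF X' A] _ nat p_closed[OF A]]) (use lin_closed[OF h act_closed[OF X _ x]] in auto)
  finally show ?thesis .
qed

text \<open>(p4) in its working form: apply the linear extension of \<open>\<phi>\<close> to
  \<open>1 - p\<close>, a combination of arrows outside \<open>E\<close> and \<open>M\<close>, all
  of which go into the submodule \<open>H\<close>.\<close>

lemma free_lift_p_in:
  assumes A: "A \<in> Obj C" and Q: "module R Q" and \<phi>: "\<And>f. f \<in> Hom C A A \<Longrightarrow> \<phi> f \<in> carrier Q"
    and H: "\<zero>\<^bsub>Q\<^esub> \<in> H" "\<And>x y. x \<in> H \<Longrightarrow> y \<in> H \<Longrightarrow> x \<oplus>\<^bsub>Q\<^esub> y \<in> H" "H \<subseteq> carrier Q"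
    "\<And>a x. a \<in> carrier R \<Longrightarrow> x \<in> H \<Longrightarrow> a \<odot>\<^bsub>Q\<^esub> x \<in> H"
    and in_H: "\<And>f. f \<in> Hom C A A \<Longrightarrow> f \<notin> E \<Longrightarrow> f \<notin> M \<Longrightarrow> \<phi> f \<in> H"
  shows "\<phi> (Idn C A) \<ominus>\<^bsub>Q\<^esub> free_lift R (Hom C A A) Q \<phi> (p A) \<in> H"
proof -
  let ?L = "free_lift R (Hom C A A) Q \<phi>"
  note F = module_free_mod[OF R.cring_axioms, of "Hom C A A"]
  have L: "lin R (free_mod R (Hom C A A)) Q ?L" using \<phi> by (rule lin_free_lift[OF Q])
  have I: "Idn C A \<in> Hom C A A" using A by (rule Idn_in_Hom)
  have "?L (free_gen R (Idn C A) \<ominus>\<^bsub>free_mod R (Hom C A A)\<^esub> p A) = \<phi> (Idn C A) \<ominus>\<^bsub>Q\<^esub> ?L (p A)"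
    using lin_minus[OF L F Q free_gen_closed[OF R.cring_axioms I] p_closed[OF A]] free_lift_gen[OF Q \<phi> I] by simp
  moreover have "?L (free_gen R (Idn C A) \<ominus>\<^bsub>free_mod R (Hom C A A)\<^esub> p A) \<in> H"
    by (rule free_lift_in[OF Q \<phi> p4[OF A] _ H]) (use in_H in auto)
  ultimately show ?thesis by simp
qed

text \<open>The case \<open>H = {0}\<close>: a linear function that vanishes on arrows outside both
  classes cannot distinguish \<open>p\<close> from the identity. It is used with functions vanishing
  outside \<open>E\<close> for \<open>E_hat\<close> and outside \<open>M\<close> for
  \<open>M_hat\<close>.\<close>

lemma free_lift_p:
  assumes A: "A \<in> Obj C" and Q: "module R Q" and \<phi>: "\<And>f. f \<in> Hom C A A \<Longrightarrow> \<phi> f \<in> carrier Q"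
    and zero: "\<And>f. f \<in> Hom C A A \<Longrightarrow> f \<notin> E \<Longrightarrow> f \<notin> M \<Longrightarrow> \<phi> f = \<zero>\<^bsub>Q\<^esub>"
  shows "free_lift R (Hom C A A) Q \<phi> (p A) = \<phi> (Idn C A)"
proof -
  interpret Q: module R Q by fact
  have "\<phi> (Idn C A) \<ominus>\<^bsub>Q\<^esub> free_lift R (Hom C A A) Q \<phi> (p A) \<in> {\<zero>\<^bsub>Q\<^esub>}"
    by (rule free_lift_p_in[OF A Q \<phi>]) (use zero in auto)
  moreover have "free_lift R (Hom C A A) Q \<phi> (p A) \<in> carrier Q"
    by (rule lin_closed[OF lin_free_lift[OF Q \<phi>] p_closed[OF A]])
  ultimately show ?thesis
    using \<phi>[OF Idn_in_Hom[OF A]] Q.M.minus_equality[of "\<phi> (Idn C A)" "\<ominus>\<^bsub>Q\<^esub> free_lift R (Hom C A A) Q \<phi> (p A)"]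
    by (simp add: Q.M.minus_eq)
qed

text \<open>Since \<open>1 - p\<close> is a combination of arrows that factor through proper subobjects, the idempotents
  detect inclusions between subfunctors, by induction on the number of subobjects.\<close>

lemma subfunctor_induct:
  assumes X: "is_functor C V X" and L: "\<And>B. L B \<subseteq> carrier (fobj X B)"
    and L_act: "\<And>A B f x. f \<in> Hom C A B \<Longrightarrow> x \<in> L A \<Longrightarrow> act X f x \<in> L B"
    and N: "\<And>B. B \<in> Obj C \<Longrightarrow> \<zero>\<^bsub>fobj X B\<^esub> \<in> N B" "\<And>B. B \<in> Obj C \<Longrightarrow> N B \<subseteq> carrier (fobj X B)"
    "\<And>B x y. B \<in> Obj C \<Longrightarrow> x \<in> N B \<Longrightarrow> y \<in> N B \<Longrightarrow> x \<oplus>\<^bsub>fobj X B\<^esub> y \<in> N B"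
    "\<And>B a x. B \<in> Obj C \<Longrightarrow> a \<in> carrier R \<Longrightarrow> x \<in> N B \<Longrightarrow> a \<odot>\<^bsub>fobj X B\<^esub> x \<in> N B"
    and N_act: "\<And>A B m x. m \<in> M \<Longrightarrow> m \<in> Hom C A B \<Longrightarrow> x \<in> N A \<Longrightarrow> act X m x \<in> N B"
    and pL: "\<And>B x. B \<in> Obj C \<Longrightarrow> x \<in> L B \<Longrightarrow> pact X B x \<in> N B"
    and B: "B \<in> Obj C"
  shows "L B \<subseteq> N B"
  using B
proof (induction "card (iso_classes (slice_cat (wide_subcat C M) B))" arbitrary: B rule: less_induct)
  case less
  note B = less.prems
  interpret Q: module R "fobj X B" by (rule X_module[OF X B])
  show ?case
  proof
    fix x assume x: "x \<in> L B"
    then have xc: "x \<in> carrier (fobj X B)" using L by blast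
    have f: "act X f x \<in> N B" if f: "f \<in> Hom C B B" "f \<notin> E" for f
    proof -
      have "f \<in> Arr C" using f by (simp add: Hom_def)
      then obtain m e where me: "m \<in> M" "e \<in> E" "Dom C e = Dom C f" "Cod C e = Dom C m" "Cod C m = Cod C f" "f = m \<cdot> e"
        by (rule factorize)
      have eh: "e \<in> Hom C B (Dom C m)" and mh: "m \<in> Hom C (Dom C m) B"
        using me f E_Arr M_Arr by (auto simp: Hom_def)
      \<comment> \<open>If \<open>m\<close> were invertible, \<open>f = m \<cdot> e\<close> would
        lie in \<open>E\<close>. So \<open>m\<close> is a proper subobject of \<open>B\<close>, and
        the induction hypothesis applies to its domain.\<close>
      have "\<not> invertible C m" using FS0_E[OF me(2), of m] me(4,6) f(2) by auto
      then have "card (iso_classes (slice_cat (wide_subcat C M) (Dom C m))) < card (iso_classes (slice_cat (wide_subcat C M) B))"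
        using card_iso_classes_less[OF me(1) _ finite_subobjects[OF B]] mh by (simp add: Hom_def)
      then have "L (Dom C m) \<subseteq> N (Dom C m)"
        using less.hyps[of "Dom C m"] Dom_in_Obj[OF M_Arr[OF me(1)]] by blast
      then have "act X m (act X e x) \<in> N B" using N_act[OF me(1) mh] L_act[OF eh x] by blast
      then show ?thesis using act_comp[OF X eh mh xc] me(6) by simp
    qed
    have I: "act X (Idn C B) x = x" using mod_functor_id[OF X B xc] .
    have "act X (Idn C B) x \<ominus>\<^bsub>fobj X B\<^esub> free_lift R (Hom C B B) (fobj X B) (\<lambda>f. act X f x) (p B) \<in> N B"
    proof (rule free_lift_p_in[OF B X_module[OF X B]])
      show "act X f x \<in> carrier (fobj X B)" if "f \<in> Hom C B B" for f using act_closed[OF X that xc] .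
      show "act X f x \<in> N B" if "f \<in> Hom C B B" "f \<notin> E" for f by (rule f[OF that])
    qed (use N B in auto)
    \<comment> \<open>Split \<open>x\<close> into \<open>x - p x\<close>, which comes from proper
      subobjects, and \<open>p x\<close>, which lies in \<open>N B\<close> by assumption.\<close>
    then have "(x \<ominus>\<^bsub>fobj X B\<^esub> pact X B x) \<oplus>\<^bsub>fobj X B\<^esub> pact X B x \<in> N B"
      using pL[OF B x] N(3)[OF B] I by (simp add: lact_def)
    moreover have "(x \<ominus>\<^bsub>fobj X B\<^esub> pact X B x) \<oplus>\<^bsub>fobj X B\<^esub> pact X B x = x"
      using xc pact_closed[OF X B xc] by (simp add: Q.M.minus_eq Q.M.a_assoc Q.M.l_neg)
    ultimately show "x \<in> N B" by simp
  qed
qed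

subsection \<open>Existence of the coends\<close>

text \<open>The Yoneda argument: the cone condition at the identity shows that
  \<open>\<beta> (Idn C A)\<close> determines all of \<open>\<beta>\<close> and vanishes after
  arrows outside \<open>E\<close>. By \<open>free_lift_p\<close>, inserting \<open>p\<close> has no
  effect.\<close>

lemma cone_pact:
  assumes X: "is_functor C V X" and Q: "module R Q" and c: "KE.cone X A Q \<beta>"
    and e: "e \<in> E" "Cod C e = A" and x: "x \<in> carrier (fobj X (Dom C e))"
  shows "\<beta> (Idn C A) (pact X A (act X e x)) = \<beta> e x"
proof -
  have A: "A \<in> Obj C" and eh: "e \<in> Hom C (Dom C e) A" using e E_Arr Cod_in_Obj by (auto simp: Hom_def)
  note I = Idn_simps[OF A]
  have ex: "act X e x \<in> carrier (fobj X A)" using act_closed[OF X eh x] .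
  have b: "lin R (fobj X A) Q (\<beta> (Idn C A))" using KE.cone_lin[OF c Idn_EM(1)[OF A]] I by simp
  have act: "\<beta> (Idn C A) (act X f y) = (if f \<in> E then \<beta> f y else \<zero>\<^bsub>Q\<^esub>)" if "f \<in> Hom C D A" "y \<in> carrier (fobj X D)" for f D y
    using KE.cone_act[OF c _ Idn_EM(1)[OF A], of f y] I that Cmp_Idn_left[OF that(1)] by (simp add: Hom_def)
  have "\<beta> (Idn C A) (pact X A (act X e x)) =
      free_lift R (Hom C A A) Q (\<lambda>f. \<beta> (Idn C A) (act X f (act X e x))) (p A)"
    unfolding lact_def by (rule free_lift_lin[OF X_module[OF X A] Q act_closed[OF X _ ex] b p_closed[OF A]])
  also have "\<dots> = \<beta> (Idn C A) (act X (Idn C A) (act X e x))"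
    by (rule free_lift_p[OF A Q]) (use act ex lin_closed[OF b act_closed[OF X _ ex]] in auto)
  also have "\<dots> = \<beta> e x"
    using mod_functor_id[OF X A ex] act[OF eh x] e by simp
  finally show ?thesis .
qed

text \<open>The zero clause of the cone condition is (p2). Only the operations of \<open>Q\<close>
  are prescribed, so \<open>Q\<close> may be the image of \<open>p\<close> as well as all of
  \<open>X A\<close>; the first gives the coend, the second the map \<open>\<kappa>\<close>.\<close>

lemma cone_E_pact:
  assumes X: "is_functor C V X" and A: "A \<in> Obj C"
    and Q: "\<And>x. x \<in> carrier (fobj X A) \<Longrightarrow> pact X A x \<in> carrier Q" "\<zero>\<^bsub>Q\<^esub> = \<zero>\<^bsub>fobj X A\<^esub>"
    "\<And>x y. x \<oplus>\<^bsub>Q\<^esub> y = x \<oplus>\<^bsub>fobj X A\<^esub> y" "\<And>a x. a \<odot>\<^bsub>Q\<^esub> x = a \<odot>\<^bsub>fobj X A\<^esub> x"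
  shows "KE.cone X A Q (\<lambda>e x. pact X A (act X e x))"
  unfolding KE.cone_def
proof (intro conjI ballI impI)
  fix e assume e: "e \<in> E" "Cod C e = A"
  then have eh: "e \<in> Hom C (Dom C e) A" using E_Arr by (simp add: Hom_def)
  have l: "lin R (fobj X (Dom C e)) (fobj X A) (\<lambda>x. pact X A (act X e x))"
    by (rule lin_comp[OF act_lin[OF X eh] pact_lin[OF X A]])
  show "lin R (fobj X (Dom C e)) Q (\<lambda>x. pact X A (act X e x))"
    by (rule linI) (use Q act_closed[OF X eh] lin_add[OF l] lin_smult[OF l] in auto)
next
  fix f e x assume f: "f \<in> Arr C" and e: "e \<in> E" "Cod C e = A" "Dom C e = Cod C f" and x: "x \<in> carrier (fobj X (Dom C f))"
  have fh: "f \<in> Hom C (Dom C f) (Dom C e)" and eh: "e \<in> Hom C (Dom C e) A" using f e E_Arr by (auto simp: Hom_def)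
  show "pact X A (act X e (act X f x)) = (if e \<cdot> f \<in> E then pact X A (act X (e \<cdot> f) x) else \<zero>\<^bsub>Q\<^esub>)"
    using act_comp[OF X fh eh x] pact_act_not_E[OF X Cmp_in_Hom[OF fh eh] _ x] Q(2) by auto
qed

text \<open>A cone factors through its own member at the identity, by \<open>cone_pact\<close>.
  Uniqueness holds because every element of the image already occurs as a value at the identity
  index.\<close>

lemma universal_E:
  assumes X: "is_functor C V X" and A: "A \<in> Obj C"
  shows "KE.universal X A (fobj X A\<lparr>carrier := pact X A ` carrier (fobj X A)\<rparr>) (\<lambda>e x. pact X A (act X e x))"
proof -
  let ?Z = "fobj X A\<lparr>carrier := pact X A ` carrier (fobj X A)\<rparr>"
  have Z: "module R ?Z" by (rule module_image[OF X_module[OF X A] pact_lin[OF X A]])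
  have c: "KE.cone X A ?Z (\<lambda>e x. pact X A (act X e x))" by (rule cone_E_pact[OF X A]) auto
  have sub: "pact X A ` carrier (fobj X A) \<subseteq> carrier (fobj X A)" using pact_closed[OF X A] by blast
  note I = Idn_simps[OF A]
  show ?thesis
    unfolding KE.universal_def
  proof (intro conjI allI impI)
    fix Q \<beta> assume Q: "module R Q" and b: "KE.cone X A Q \<beta>"
    have l: "lin R (fobj X A) Q (\<beta> (Idn C A))" using KE.cone_lin[OF b Idn_EM(1)[OF A]] I by simp
    have "lin R ?Z Q (\<beta> (Idn C A))"
      by (rule linI) (simp_all add: lin_closed[OF l] lin_add[OF l] lin_smult[OF l] subsetD[OF sub])
    then show "\<exists>h. lin R ?Z Q h \<and> (\<forall>s\<in>E. Cod C s = A \<longrightarrow> (\<forall>x\<in>carrier (fobj X (Dom C s)). h (pact X A (act X s x)) = \<beta> s x))"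
      using cone_pact[OF X Q b] by blast
  next
    fix Q :: "('r, 'u) module" and h k
    assume eq: "\<forall>s\<in>E. Cod C s = A \<longrightarrow> (\<forall>x\<in>carrier (fobj X (Dom C s)). h (pact X A (act X s x)) = k (pact X A (act X s x)))"
    have "h (pact X A x) = k (pact X A x)" if "x \<in> carrier (fobj X A)" for x
      using eq[rule_format, OF Idn_EM(1)[OF A], of x] that mod_functor_id[OF X A] I by simp
    then show "\<forall>z\<in>carrier ?Z. h z = k z" by auto
  qed (rule Z, rule c)
qed

text \<open>A member of the groupoid coend can be moved along the comparison arrow of its index to
  the representative of its subobject. What remains is a direct sum over representatives, without
  relations.\<close>

lemma universal_M:
  assumes T: "is_functor G V T" and B: "B \<in> Obj C"
  shows "\<exists>Z \<zeta>. KM.universal T B Z \<zeta>"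
proof -
  let ?I = "sub_rep ` {m \<in> M. Cod C m = B}"
  have I: "i \<in> M \<and> Cod C i = B" if "i \<in> ?I" for i using that sub_rep by auto
  \<comment> \<open>\<open>direct_sum_exists\<close> asks for a module at every index; off the
    representatives the object \<open>B\<close> serves as a default.\<close>
  have N: "module R (fobj T (if i \<in> ?I then Dom C i else B))" for i
    using mod_functor_module[OF T] I[of i] Dom_in_Obj[of i] M_Arr[of i] B by simp
  have "?I \<subseteq> Arr C" using I M_Arr by blast
  then have "?I \<lesssim> (UNIV :: 'u set)" using Arr_le by (rule lepoll_trans[OF subset_imp_lepoll])
  then obtain D :: "('r, 'u) module" and j where "is_direct_sum R ?I (\<lambda>i. fobj T (if i \<in> ?I then Dom C i else B)) D j"
    using direct_sum_exists[where N = "\<lambda>i. fobj T (if i \<in> ?I then Dom C i else B)", OF R.cring_axioms N _ infinite_U] by blast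
  then have S: "is_direct_sum R ?I (\<lambda>i. fobj T (Dom C i)) D j"
    unfolding is_direct_sum_def by (simp cong: ball_cong)
  let ?\<zeta> = "\<lambda>m t. j (sub_rep m) (act T (sub_iso m) t)"
  have G: "sub_iso m \<in> E \<inter> M" "Dom C (sub_iso m) = Dom C m" "Cod C (sub_iso m) = Dom C (sub_rep m)" if "m \<in> M" for m
    using sub_rep(4,5)[OF that] EM_iff by (auto simp: Hom_def)
  have lG: "lin R (fobj T (Dom C m)) (fobj T (Dom C (sub_rep m))) (act T (sub_iso m))" if "m \<in> M" for m
    using KM.mfun_lin[OF T G(1)[OF that]] G[OF that] by simp
  have c: "KM.cone T B D ?\<zeta>"
    unfolding KM.cone_def
  proof (intro conjI ballI impI)
    fix m assume "m \<in> M" "Cod C m = B"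
    then show "lin R (fobj T (Dom C m)) D (?\<zeta> m)" by (intro lin_comp[OF lG is_direct_sum_lin[OF S]]) auto
  next
    fix g m t assume g: "g \<in> E \<inter> M" and m: "m \<in> M" "Cod C m = B" "Dom C m = Cod C g" and t: "t \<in> carrier (fobj T (Dom C g))"
    have gA: "g \<in> Arr C" using g E_Arr by auto
    have mg: "m \<cdot> g \<in> M" using M_Cmp_G_iff[OF M_Arr[OF m(1)] g] m by simp
    have h: "g \<in> Hom C (Dom C g) (Dom C m)" "sub_iso m \<in> Hom C (Dom C m) (Dom C (sub_rep m))"
      "sub_rep m \<in> Hom C (Dom C (sub_rep m)) B"
      using gA m sub_rep[OF m(1)] M_Arr by (auto simp: Hom_def)
    have mgh: "Dom C (m \<cdot> g) = Dom C g" "Cod C (m \<cdot> g) = B" using Cmp_simps[OF gA M_Arr[OF m(1)]] m by auto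
    have "sub_eq (m \<cdot> g) m" using mg m mgh h(1) g EM_iff[of g] unfolding sub_eq_def by metis
    then have r: "sub_rep (m \<cdot> g) = sub_rep m" by (rule sub_rep_eq)
    \<comment> \<open>Freeness of the groupoid action: the representative is the same for
      \<open>m\<close> and \<open>m \<cdot> g\<close>, and it is monic. The cone condition becomes
      functoriality of \<open>T\<close>.\<close>
    have "sub_iso (m \<cdot> g) = sub_iso m \<cdot> g"
      by (rule sub_iso_eqI[OF mg]) (use r mgh Cmp_in_Hom[OF h(1,2)] Cmp_assoc[OF h] sub_rep(6)[OF m(1)] in auto)
    moreover have "act T (sub_iso m \<cdot> g) t = act T (sub_iso m) (act T g t)"
      using mod_functor_comp[OF T, of g "sub_iso m" t] g G[OF m(1)] m t by simp
    ultimately show "?\<zeta> m (act T g t) = (if m \<cdot> g \<in> M then ?\<zeta> (m \<cdot> g) t else \<zero>\<^bsub>D\<^esub>)"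
      using mg r by simp
  qed
  \<comment> \<open>A representative is its own representative, with the identity as comparison, so
    the cone contains the inclusions of all summands.\<close>
  have rep: "?\<zeta> i t = j i t" if i: "i \<in> ?I" and t: "t \<in> carrier (fobj T (Dom C i))" for i t
  proof -
    obtain m where m: "m \<in> M" "i = sub_rep m" using i by blast
    have r: "sub_rep i = i" using sub_rep_eq[OF sub_rep(1)[OF m(1)]] m by simp
    have iA: "i \<in> M" using I[OF i] by blast
    have "sub_iso i = Idn C (Dom C i)"
      by (rule sub_iso_eqI[OF iA]) (use r Idn_in_Hom[OF Dom_in_Obj[OF M_Arr[OF iA]]] Cmp_Idn_right'[OF M_Arr[OF iA]] in auto)
    then show ?thesis using r KM.mfun_id[OF T Dom_in_Obj[OF M_Arr[OF iA]] t] by simp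
  qed
  have "KM.universal T B D ?\<zeta>"
    unfolding KM.universal_def
  proof (intro conjI allI impI)
    fix Q \<beta> assume Q: "module R Q" and b: "KM.cone T B Q \<beta>"
    have "lin R (fobj T (Dom C i)) Q (\<beta> i)" if "i \<in> ?I" for i using KM.cone_lin[OF b] I[OF that] by blast
    from is_direct_sum_lift[OF S Q this] obtain h where h: "lin R D Q h"
      "\<And>i t. i \<in> ?I \<Longrightarrow> t \<in> carrier (fobj T (Dom C i)) \<Longrightarrow> h (j i t) = \<beta> i t" by blast
    have "h (?\<zeta> m t) = \<beta> m t" if m: "m \<in> M" "Cod C m = B" and t: "t \<in> carrier (fobj T (Dom C m))" for m t
    proof -
      have "h (?\<zeta> m t) = \<beta> (sub_rep m) (act T (sub_iso m) t)"
        by (rule h(2)) (use m lin_closed[OF lG[OF m(1)] t] in auto)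
      also have "\<dots> = \<beta> m t"
        using KM.cone_act[OF b G(1)[OF m(1)] sub_rep(2)[OF m(1)], of t] sub_rep(3,6)[OF m(1)] G[OF m(1)] m t by simp
      finally show ?thesis .
    qed
    then show "\<exists>h. lin R D Q h \<and> (\<forall>s\<in>M. Cod C s = B \<longrightarrow> (\<forall>x\<in>carrier (fobj T (Dom C s)). h (?\<zeta> s x) = \<beta> s x))"
      using h(1) by blast
  next
    fix Q :: "('r, 'u) module" and h k assume Q: "module R Q" and h: "lin R D Q h" and k: "lin R D Q k"
      and eq: "\<forall>s\<in>M. Cod C s = B \<longrightarrow> (\<forall>x\<in>carrier (fobj T (Dom C s)). h (?\<zeta> s x) = k (?\<zeta> s x))"
    have "h (j i t) = k (j i t)" if i: "i \<in> ?I" "t \<in> carrier (fobj T (Dom C i))" for i t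
      using eq rep[OF i] I[OF i(1)] i(2) by metis
    then show "\<forall>z\<in>carrier D. h z = k z" using is_direct_sum_ext[OF S Q h k] by blast
  qed (rule is_direct_sum_module[OF S], rule c)
  then show ?thesis by blast
qed

sublocale KM: truncated_kernel_coends R C M "E \<inter> M" "Arr C" U
  by unfold_locales (rule universal_M)

sublocale KE: truncated_kernel_coends R C E "Arr C" "E \<inter> M" U
  by unfold_locales (use universal_E in \<open>auto simp: wide_subcat_self\<close>)

lemmas M_ind_obj = KM.ind_obj[unfolded wide_subcat_self]
  and M_ind_functor = KM.ind_functor[unfolded wide_subcat_self]
  and M_ind_arr = KM.ind_arr[unfolded wide_subcat_self]
  and M_ind_map = KM.ind_map[unfolded wide_subcat_self]
  and E_ind_obj = KE.ind_obj[unfolded wide_subcat_self]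
  and E_ind_functor = KE.ind_functor[unfolded wide_subcat_self]
  and E_ind_arr = KE.ind_arr[unfolded wide_subcat_self]
  and E_ind_map = KE.ind_map[unfolded wide_subcat_self]
  and E_universal = KE.universal_coend[unfolded wide_subcat_self]
  and E_module = KE.coend_module[unfolded wide_subcat_self]
  and E_ext = KE.coend_ext[unfolded wide_subcat_self]
  and E_lift = KE.coend_lift[unfolded wide_subcat_self]
  and \<iota>E_lin = KE.\<iota>_lin[unfolded wide_subcat_self]


abbreviation "\<iota>M \<equiv> KM.\<iota>"
abbreviation "\<iota>E \<equiv> KE.\<iota>"

lemma M_Hom: "m \<in> M \<Longrightarrow> m \<in> Hom C (Dom C m) (Cod C m)" and E_Hom: "e \<in> E \<Longrightarrow> e \<in> Hom C (Dom C e) (Cod C e)"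
  using M_Arr E_Arr by (auto simp: Hom_def)

lemma \<iota>E_Idn_lin:
  assumes "is_functor C V X" "A \<in> Obj C"
  shows "lin R (fobj X A) (KE.coend_obj X A) (\<iota>E X A (Idn C A))"
  using \<iota>E_lin[OF assms(1) Idn_EM(1)[OF assms(2)]] Idn_simps[OF assms(2)] by simp

lemma \<iota>M_Idn_lin:
  assumes "is_functor G V T" "A \<in> Obj C"
  shows "lin R (fobj T A) (KM.coend_obj T A) (\<iota>M T A (Idn C A))"
  using KM.\<iota>_lin[OF assms(1) Idn_EM(2)[OF assms(2)]] Idn_simps[OF assms(2)] by simp

text \<open>\<open>\<kappa>\<close> identifies the coend \<open>E_hat X A\<close> with the image of the idempotent \<open>p\<close> on \<open>X A\<close>.\<close>

definition \<kappa> :: "('o, 'a, 'r, 'u) mod_fctr \<Rightarrow> 'o \<Rightarrow> 'u \<Rightarrow> 'u" where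
  "\<kappa> X A = (SOME k. lin R (KE.coend_obj X A) (fobj X A) k \<and>
     (\<forall>e \<in> E. Cod C e = A \<longrightarrow> (\<forall>x \<in> carrier (fobj X (Dom C e)). k (\<iota>E X A e x) = pact X A (act X e x))))"

context
  fixes X :: "('o, 'a, 'r, 'u) mod_fctr" and A
  assumes X: "is_functor C V X" and A: "A \<in> Obj C"
begin

lemma \<kappa>: "lin R (KE.coend_obj X A) (fobj X A) (\<kappa> X A)"
    "e \<in> E \<Longrightarrow> Cod C e = A \<Longrightarrow> x \<in> carrier (fobj X (Dom C e)) \<Longrightarrow> \<kappa> X A (\<iota>E X A e x) = pact X A (act X e x)"
proof -
  have "KE.cone X A (fobj X A) (\<lambda>e x. pact X A (act X e x))"
    by (rule cone_E_pact[OF X A]) (auto intro: pact_closed[OF X A])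
  from someI_ex[OF E_lift[OF X A X_module[OF X A] this]]
  show "lin R (KE.coend_obj X A) (fobj X A) (\<kappa> X A)"
    "e \<in> E \<Longrightarrow> Cod C e = A \<Longrightarrow> x \<in> carrier (fobj X (Dom C e)) \<Longrightarrow> \<kappa> X A (\<iota>E X A e x) = pact X A (act X e x)"
    unfolding \<kappa>_def by blast+
qed

lemma \<kappa>_closed: "k \<in> carrier (KE.coend_obj X A) \<Longrightarrow> \<kappa> X A k \<in> carrier (fobj X A)"
  by (rule lin_closed[OF \<kappa>(1)])

text \<open>\<open>cone_pact\<close> for the universal cone itself. Together with
  \<open>\<kappa>_\<iota>E\<close> it exhibits the coend as the splitting of \<open>p\<close>: one
  composite is the identity, the other is \<open>p\<close>.\<close>

lemma \<iota>E_\<kappa>: "k \<in> carrier (KE.coend_obj X A) \<Longrightarrow> \<iota>E X A (Idn C A) (\<kappa> X A k) = k"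
  by (rule E_ext[OF X A E_module[OF X A] lin_comp[OF \<kappa>(1) \<iota>E_Idn_lin[OF X A]] lin_id])
     (auto simp: \<kappa>(2) cone_pact[OF X E_module[OF X A] KE.universal_cone[OF E_universal[OF X A]]])

text \<open>The values of \<open>\<kappa>\<close> on generators have the form
  \<open>p (e x)\<close>, so this is (p0).\<close>

lemma pact_\<kappa>:
  assumes k: "k \<in> carrier (KE.coend_obj X A)"
  shows "pact X A (\<kappa> X A k) = \<kappa> X A k"
proof (rule E_ext[OF X A X_module[OF X A] lin_comp[OF \<kappa>(1) pact_lin[OF X A]] \<kappa>(1) _ k])
  fix e x assume e: "e \<in> E" "Cod C e = A" and x: "x \<in> carrier (fobj X (Dom C e))"
  have "e \<in> Hom C (Dom C e) A" using E_Hom[OF e(1)] e(2) by simp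
  then show "pact X A (\<kappa> X A (\<iota>E X A e x)) = \<kappa> X A (\<iota>E X A e x)"
    using \<kappa>(2)[OF e x] pact_idem[OF X A act_closed[OF X _ x]] by simp
qed

lemma \<kappa>_\<iota>E: "x \<in> carrier (fobj X A) \<Longrightarrow> \<kappa> X A (\<iota>E X A (Idn C A) x) = pact X A x"
  using \<kappa>(2)[OF Idn_EM(1)[OF A], of x] Idn_simps[OF A] mod_functor_id[OF X A] by simp

end

text \<open>On a generator both sides are \<open>g\<close> applied to \<open>p (e x)\<close>, once
  (p3) has moved \<open>p\<close> past the groupoid arrow.\<close>

lemma \<kappa>_act:
  assumes X: "is_functor C V X" and g: "g \<in> E \<inter> M" and k: "k \<in> carrier (KE.coend_obj X (Dom C g))"
  shows "\<kappa> X (Cod C g) (act (Eh X) g k) = act X g (\<kappa> X (Dom C g) k)"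
proof -
  have gh: "g \<in> Hom C (Dom C g) (Cod C g)" using g E_Hom by blast
  have O: "Dom C g \<in> Obj C" "Cod C g \<in> Obj C" using Hom_Obj[OF gh] by auto
  show ?thesis
  proof (rule E_ext[OF X O(1) X_module[OF X O(2)] lin_comp[OF E_ind_arr(2)[OF X g, THEN linear_maps_lin] \<kappa>(1)[OF X O(2)]]
        lin_comp[OF \<kappa>(1)[OF X O(1)] act_lin[OF X gh]] _ k])
    fix e x assume e: "e \<in> E" "Cod C e = Dom C g" and x: "x \<in> carrier (fobj X (Dom C e))"
    have eh: "e \<in> Hom C (Dom C e) (Dom C g)" using E_Hom[OF e(1)] e(2) by simp
    have ge: "g \<cdot> e \<in> E" "Dom C (g \<cdot> e) = Dom C e" "Cod C (g \<cdot> e) = Cod C g"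
      using E_G_Cmp_iff[OF E_Arr[OF e(1)] g e(2)] e(1) Cmp_in_Hom[OF eh gh] by (auto simp: Hom_def)
    have "\<kappa> X (Cod C g) (act (Eh X) g (\<iota>E X (Dom C g) e x)) = pact X (Cod C g) (act X (g \<cdot> e) x)"
      using E_ind_arr(3)[OF X g e x] \<kappa>(2)[OF X O(2) ge(1,3)] ge x by simp
    also have "\<dots> = act X g (pact X (Dom C g) (act X e x))"
      using act_comp[OF X eh gh x] pact_act_G[OF X gh g act_closed[OF X eh x]] by simp
    finally show "\<kappa> X (Cod C g) (act (Eh X) g (\<iota>E X (Dom C g) e x)) = act X g (\<kappa> X (Dom C g) (\<iota>E X (Dom C g) e x))"
      using \<kappa>(2)[OF X O(1) e x] by simp
  qed
qed

lemma \<kappa>_natural: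
  assumes \<alpha>: "is_nat_tr C V P \<alpha> T" and A: "A \<in> Obj C" and k: "k \<in> carrier (KE.coend_obj P A)"
  shows "\<kappa> T A (KE.ind_map (P, \<alpha>, T) A k) = fst (snd (\<alpha> A)) (\<kappa> P A k)"
proof -
  note P = mod_nat_trD(1)[OF \<alpha>] and T = mod_nat_trD(2)[OF \<alpha>]
  note a = mod_nat_tr_linear[OF \<alpha>, THEN linear_maps_lin]
  have nat: "fst (snd (\<alpha> B)) (act P f x) = act T f (fst (snd (\<alpha> D)) x)" if "f \<in> Hom C D B" "x \<in> carrier (fobj P D)" for f D B x
    using mod_nat_tr_natural[OF \<alpha> category_axioms, of f x] that by (auto simp: Hom_def)
  show ?thesis
  proof (rule E_ext[OF P A X_module[OF T A] lin_comp[OF E_ind_map(2)[OF \<alpha> A, THEN linear_maps_lin] \<kappa>(1)[OF T A]]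
        lin_comp[OF \<kappa>(1)[OF P A] a[OF A]] _ k])
    fix e x assume e: "e \<in> E" "Cod C e = A" and x: "x \<in> carrier (fobj P (Dom C e))"
    have eh: "e \<in> Hom C (Dom C e) A" using E_Hom[OF e(1)] e(2) by simp
    note ex = act_closed[OF P eh x]
    have "\<kappa> T A (KE.ind_map (P, \<alpha>, T) A (\<iota>E P A e x)) = pact T A (act T e (fst (snd (\<alpha> (Dom C e))) x))"
      using E_ind_map(3)[OF \<alpha> e x] \<kappa>(2)[OF T A e] lin_closed[OF a x] Hom_Obj[OF eh] by simp
    also have "\<dots> = fst (snd (\<alpha> A)) (pact P A (act P e x))"
      using nat[OF eh x] pact_natural[OF P T A a[OF A] ex nat[OF _ ex]] by simp
    finally show "\<kappa> T A (KE.ind_map (P, \<alpha>, T) A (\<iota>E P A e x)) = fst (snd (\<alpha> A)) (\<kappa> P A (\<iota>E P A e x))"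
      using \<kappa>(2)[OF P A e x] by simp
  qed
qed

lemma Mh_functor: "is_functor G V T \<Longrightarrow> is_functor C V (Mh T)"
  by (rule M_ind_functor)

text \<open>\<open>\<pi>\<close> projects the direct sum \<open>M_hat T A\<close> onto the summand of the improper subobject; it agrees
  with the action of \<open>p\<close>.\<close>

definition \<pi> :: "('o, 'a, 'r, 'u) mod_fctr \<Rightarrow> 'o \<Rightarrow> 'u \<Rightarrow> 'u" where
  "\<pi> T A = (SOME h. lin R (KM.coend_obj T A) (fobj T A) h \<and>
     (\<forall>m \<in> M. Cod C m = A \<longrightarrow> (\<forall>t \<in> carrier (fobj T (Dom C m)).
       h (\<iota>M T A m t) = (if m \<in> E then act T m t else \<zero>\<^bsub>fobj T A\<^esub>))))"

context
  fixes T :: "('o, 'a, 'r, 'u) mod_fctr" and A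
  assumes T: "is_functor G V T" and A: "A \<in> Obj C"
begin

lemma \<pi>: "lin R (KM.coend_obj T A) (fobj T A) (\<pi> T A)"
    "m \<in> M \<Longrightarrow> Cod C m = A \<Longrightarrow> t \<in> carrier (fobj T (Dom C m)) \<Longrightarrow>
      \<pi> T A (\<iota>M T A m t) = (if m \<in> E then act T m t else \<zero>\<^bsub>fobj T A\<^esub>)"
proof -
  have "KM.cone T A (fobj T A) (\<lambda>m t. if m \<in> E then act T m t else \<zero>\<^bsub>fobj T A\<^esub>)"
    unfolding KM.cone_def
  proof (intro conjI ballI impI)
    fix m assume m: "m \<in> M" "Cod C m = A"
    show "lin R (fobj T (Dom C m)) (fobj T A) (\<lambda>t. if m \<in> E then act T m t else \<zero>\<^bsub>fobj T A\<^esub>)"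
      using KM.mfun_lin[OF T, of m] lin_zero_map[OF KM.mfun_module[OF T A]] m by (cases "m \<in> E") auto
  next
    fix g m t assume g: "g \<in> E \<inter> M" and m: "m \<in> M" "Cod C m = A" "Dom C m = Cod C g" and t: "t \<in> carrier (fobj T (Dom C g))"
    have mg: "m \<cdot> g \<in> M" using M_Cmp_G_iff[OF M_Arr[OF m(1)] g] m by simp
    \<comment> \<open>The zero clause must not depend on the representative of the orbit.
      \<open>E_cancel\<close> gives one direction, closure of the groupoid under composition the
      other.\<close>
    have E: "m \<cdot> g \<in> E \<longleftrightarrow> m \<in> E"
      using E_cancel[of g m] G_Cmp[OF g, of m] mg m g E_Arr M_Arr by auto
    have "act T (m \<cdot> g) t = act T m (act T g t)" if "m \<in> E"
      using mod_functor_comp[OF T, of g m t] g m t that by simp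
    then show "(if m \<in> E then act T m (act T g t) else \<zero>\<^bsub>fobj T A\<^esub>) =
        (if m \<cdot> g \<in> M then if m \<cdot> g \<in> E then act T (m \<cdot> g) t else \<zero>\<^bsub>fobj T A\<^esub> else \<zero>\<^bsub>fobj T A\<^esub>)"
      using mg E by simp
  qed
  from someI_ex[OF KM.coend_lift[OF T A KM.mfun_module[OF T A] this]]
  show "lin R (KM.coend_obj T A) (fobj T A) (\<pi> T A)"
    "m \<in> M \<Longrightarrow> Cod C m = A \<Longrightarrow> t \<in> carrier (fobj T (Dom C m)) \<Longrightarrow>
      \<pi> T A (\<iota>M T A m t) = (if m \<in> E then act T m t else \<zero>\<^bsub>fobj T A\<^esub>)"
    unfolding \<pi>_def by blast+
qed

lemma \<pi>_closed: "z \<in> carrier (KM.coend_obj T A) \<Longrightarrow> \<pi> T A z \<in> carrier (fobj T A)"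
  by (rule lin_closed[OF \<pi>(1)])

lemma \<pi>_\<iota>M: "t \<in> carrier (fobj T A) \<Longrightarrow> \<pi> T A (\<iota>M T A (Idn C A) t) = t"
  using \<pi>(2)[OF Idn_EM(2)[OF A], of t] Idn_simps[OF A] Idn_EM(1)[OF A] KM.mfun_id[OF T A] by simp


text \<open>The identity summands generate \<open>Mh T\<close>: for \<open>m\<close> in
  \<open>M\<close>, the symbol at index \<open>m\<close> is the image under \<open>m\<close> of the
  symbol at the identity.\<close>

lemma act_\<iota>M_Idn:
  assumes f: "f \<in> Hom C A B" and t: "t \<in> carrier (fobj T A)"
  shows "act (Mh T) f (\<iota>M T A (Idn C A) t) = (if f \<in> M then \<iota>M T B f t else \<zero>\<^bsub>KM.coend_obj T B\<^esub>)"
  using M_ind_arr(3)[OF T, of f "Idn C A" t] f t Idn_EM(2)[OF A] Idn_simps[OF A] Cmp_Idn_right[OF f]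
  by (simp add: Hom_def)

text \<open>Arrows outside \<open>M\<close> kill symbols at the identity index, so
  \<open>free_lift_p\<close> replaces \<open>p\<close> by the identity there.\<close>

lemma pact_\<iota>M_Idn: "t \<in> carrier (fobj T A) \<Longrightarrow> pact (Mh T) A (\<iota>M T A (Idn C A) t) = \<iota>M T A (Idn C A) t"
proof -
  assume t: "t \<in> carrier (fobj T A)"
  have z: "\<iota>M T A (Idn C A) t \<in> carrier (fobj (Mh T) A)"
    using lin_closed[OF \<iota>M_Idn_lin[OF T A] t] A by (simp add: M_ind_obj)
  have "pact (Mh T) A (\<iota>M T A (Idn C A) t) = act (Mh T) (Idn C A) (\<iota>M T A (Idn C A) t)"
    unfolding lact_def
    by (rule free_lift_p[OF A X_module[OF Mh_functor[OF T] A]], rule act_closed[OF Mh_functor[OF T] _ z], assumption)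
       (use act_\<iota>M_Idn[OF _ t] A in \<open>simp add: M_ind_obj\<close>)
  then show ?thesis using mod_functor_id[OF Mh_functor[OF T] A z] by simp
qed

end

text \<open>A symbol at index \<open>m\<close> is the image under \<open>m\<close> of an identity
  symbol. If \<open>m\<close> is outside \<open>E\<close>, then \<open>p\<close> kills it by (p2),
  as does \<open>\<pi>\<close>.\<close>

lemma pact_Mh:
  assumes T: "is_functor G V T" and A: "A \<in> Obj C" and z: "z \<in> carrier (KM.coend_obj T A)"
  shows "pact (Mh T) A z = \<iota>M T A (Idn C A) (\<pi> T A z)"
proof -
  note Mh = Mh_functor[OF T]
  have obj: "fobj (Mh T) B = KM.coend_obj T B" if "B \<in> Obj C" for B using that by (rule M_ind_obj)
  show ?thesis
  proof (rule KM.coend_ext[OF T A KM.coend_module[OF T A] _ lin_comp[OF \<pi>(1)[OF T A] \<iota>M_Idn_lin[OF T A]] _ z])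
    show "lin R (KM.coend_obj T A) (KM.coend_obj T A) (pact (Mh T) A)"
      using pact_lin[OF Mh A] obj[OF A] by simp
    fix m t assume m: "m \<in> M" "Cod C m = A" and t: "t \<in> carrier (fobj T (Dom C m))"
    have D: "Dom C m \<in> Obj C" and mh: "m \<in> Hom C (Dom C m) A" using m M_Hom[OF m(1)] Dom_in_Obj M_Arr by auto
    let ?y = "\<iota>M T (Dom C m) (Idn C (Dom C m)) t"
    have y: "?y \<in> carrier (fobj (Mh T) (Dom C m))"
      using lin_closed[OF \<iota>M_Idn_lin[OF T D] t] obj[OF D] by simp
    have my: "\<iota>M T A m t = act (Mh T) m ?y" using act_\<iota>M_Idn[OF T D mh t] m(1) by simp
    show "pact (Mh T) A (\<iota>M T A m t) = \<iota>M T A (Idn C A) (\<pi> T A (\<iota>M T A m t))"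
    proof (cases "m \<in> E")
      case False
      then show ?thesis
        using pact_act_not_E[OF Mh mh False y] my \<pi>(2)[OF T A m t] obj[OF A]
          lin_zero[OF \<iota>M_Idn_lin[OF T A] KM.mfun_module[OF T A] KM.coend_module[OF T A]] by simp
    next
      case True
      then have mG: "m \<in> E \<inter> M" using m by simp
      have mt: "act T m t \<in> carrier (fobj T A)" using lin_closed[OF KM.mfun_lin[OF T mG] t] m by simp
      \<comment> \<open>Now \<open>m\<close> is invertible, so the coend relation moves it from the
        index to the element, and the symbol lies in the identity summand, which \<open>p\<close>
        fixes.\<close>
      have "\<iota>M T A m t = \<iota>M T A (Idn C A) (act T m t)"
        using KM.\<iota>_act[OF T mG Idn_EM(2)[OF A], of A t] Idn_simps[OF A] m t Cmp_Idn_left[OF mh] by simp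
      then show ?thesis
        using pact_\<iota>M_Idn[OF T A mt] \<pi>(2)[OF T A m t] True by simp
    qed
  qed
qed

subsection \<open>The unit\<close>

definition \<eta> :: "('o, 'a, 'r, 'u) mod_fctr \<Rightarrow> 'o \<Rightarrow> 'u \<Rightarrow> 'u" where
  "\<eta> T A t = \<iota>E (Mh T) A (Idn C A) (\<iota>M T A (Idn C A) t)"

context
  fixes T :: "('o, 'a, 'r, 'u) mod_fctr"
  assumes T: "is_functor G V T"
begin

lemma \<eta>_lin: "A \<in> Obj C \<Longrightarrow> lin R (fobj T A) (KE.coend_obj (Mh T) A) (\<eta> T A)"
  unfolding \<eta>_def
  by (rule lin_comp[OF _ \<iota>E_Idn_lin[OF Mh_functor[OF T]]]) (use \<iota>M_Idn_lin[OF T] in \<open>simp_all add: M_ind_obj\<close>)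

text \<open>The inverse is \<open>\<pi>\<close> after \<open>\<kappa>\<close>. The values of
  \<open>\<kappa>\<close> are fixed by \<open>p\<close>, and on \<open>Mh T\<close> the idempotent
  is \<open>\<pi>\<close> followed by inclusion of the identity summand, so both round trips
  collapse.\<close>

lemma \<eta>_bij: "A \<in> Obj C \<Longrightarrow> bij_betw (\<eta> T A) (carrier (fobj T A)) (carrier (KE.coend_obj (Mh T) A))"
proof (rule bij_betw_byWitness[where f' = "\<lambda>k. \<pi> T A (\<kappa> (Mh T) A k)"])
  assume A: "A \<in> Obj C"
  note Mh = Mh_functor[OF T]
  have \<kappa>c: "\<kappa> (Mh T) A k \<in> carrier (KM.coend_obj T A)" if "k \<in> carrier (KE.coend_obj (Mh T) A)" for k
    using \<kappa>_closed[OF Mh A that] A by (simp add: M_ind_obj)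
  have c: "\<iota>M T A (Idn C A) t \<in> carrier (fobj (Mh T) A)" if "t \<in> carrier (fobj T A)" for t
    using lin_closed[OF \<iota>M_Idn_lin[OF T A] that] A by (simp add: M_ind_obj)
  show "\<forall>t\<in>carrier (fobj T A). \<pi> T A (\<kappa> (Mh T) A (\<eta> T A t)) = t"
    using \<kappa>_\<iota>E[OF Mh A c] pact_\<iota>M_Idn[OF T A] \<pi>_\<iota>M[OF T A] by (simp add: \<eta>_def)
  show "\<forall>k\<in>carrier (KE.coend_obj (Mh T) A). \<eta> T A (\<pi> T A (\<kappa> (Mh T) A k)) = k"
    using pact_\<kappa>[OF Mh A] pact_Mh[OF T A \<kappa>c] \<iota>E_\<kappa>[OF Mh A] by (simp add: \<eta>_def)
  show "\<eta> T A ` carrier (fobj T A) \<subseteq> carrier (KE.coend_obj (Mh T) A)"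
    using lin_closed[OF \<eta>_lin[OF A]] by blast
  show "(\<lambda>k. \<pi> T A (\<kappa> (Mh T) A k)) ` carrier (KE.coend_obj (Mh T) A) \<subseteq> carrier (fobj T A)"
    using \<pi>_closed[OF T A] \<kappa>c by blast
qed

text \<open>The arrow \<open>g\<close> crosses two coend relations: from the index in
  \<open>Eh\<close> to an action on \<open>Mh T\<close>, where it becomes an index, and from there
  to an action on \<open>T\<close>.\<close>

lemma \<eta>_act:
  assumes g: "g \<in> E \<inter> M" and t: "t \<in> carrier (fobj T (Dom C g))"
  shows "\<eta> T (Cod C g) (act T g t) = act (Eh (Mh T)) g (\<eta> T (Dom C g) t)"
proof -
  note Mh = Mh_functor[OF T]
  have gh: "g \<in> Hom C (Dom C g) (Cod C g)" and gE: "g \<in> E" and gM: "g \<in> M" and gA: "g \<in> Arr C" using g E_Hom E_Arr by auto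
  have O: "Dom C g \<in> Obj C" "Cod C g \<in> Obj C" using Hom_Obj[OF gh] by auto
  note I = Idn_simps[OF O(1)] Idn_simps[OF O(2)]
  let ?z = "\<iota>M T (Dom C g) (Idn C (Dom C g)) t"
  have z: "?z \<in> carrier (fobj (Mh T) (Dom C g))"
    using lin_closed[OF \<iota>M_Idn_lin[OF T O(1)] t] O by (simp add: M_ind_obj)
  have "act (Eh (Mh T)) g (\<eta> T (Dom C g) t) = \<iota>E (Mh T) (Cod C g) g ?z"
    using E_ind_arr(3)[OF Mh g Idn_EM(1)[OF O(1)], of ?z] I z gE Cmp_Idn_right[OF gh] by (simp add: \<eta>_def)
  also have "\<dots> = \<iota>E (Mh T) (Cod C g) (Idn C (Cod C g)) (act (Mh T) g ?z)"
    using KE.cone_act[OF KE.universal_cone[OF E_universal[OF Mh O(2)]] gA Idn_EM(1)[OF O(2)], of ?z]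
      I z gE Cmp_Idn_left[OF gh] by simp
  also have "act (Mh T) g ?z = \<iota>M T (Cod C g) g t" using act_\<iota>M_Idn[OF T O(1) gh t] gM by simp
  also have "\<dots> = \<iota>M T (Cod C g) (Idn C (Cod C g)) (act T g t)"
    using KM.\<iota>_act[OF T g Idn_EM(2)[OF O(2)], of "Cod C g" t] I gM t Cmp_Idn_left[OF gh] by simp
  finally show ?thesis by (simp add: \<eta>_def)
qed

end

text \<open>Applying \<open>M_hat\<close> to \<open>\<alpha>\<close> gives a restricted family of
  triples. Only the underlying functions matter, hence an arbitrary \<open>\<beta>\<close> with
  those functions.\<close>

lemma \<eta>_natural:
  assumes \<alpha>: "is_nat_tr G V P \<alpha> T" and \<beta>: "is_nat_tr C V (Mh P) \<beta> (Mh T)"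
    and \<beta>_eq: "\<forall>B \<in> Obj C. fst (snd (\<beta> B)) = KM.ind_map (P, \<alpha>, T) B"
    and A: "A \<in> Obj C" and t: "t \<in> carrier (fobj P A)"
  shows "\<eta> T A (fst (snd (\<alpha> A)) t) = KE.ind_map (Mh P, \<beta>, Mh T) A (\<eta> P A t)"
proof -
  note P = mod_nat_trD(1)[OF \<alpha>]
  note I = Idn_simps[OF A]
  let ?z = "\<iota>M P A (Idn C A) t"
  have z: "?z \<in> carrier (fobj (Mh P) A)"
    using lin_closed[OF \<iota>M_Idn_lin[OF P A] t] A by (simp add: M_ind_obj)
  have "KE.ind_map (Mh P, \<beta>, Mh T) A (\<eta> P A t) = \<iota>E (Mh T) A (Idn C A) (KM.ind_map (P, \<alpha>, T) A ?z)"
    using E_ind_map(3)[OF \<beta> Idn_EM(1)[OF A], of A ?z] I z bspec[OF \<beta>_eq A] by (simp add: \<eta>_def)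
  also have "KM.ind_map (P, \<alpha>, T) A ?z = \<iota>M T A (Idn C A) (fst (snd (\<alpha> A)) t)"
    using KM.ind_map(3)[OF \<alpha> Idn_EM(2)[OF A], of A t] I t by simp
  finally show ?thesis by (simp add: \<eta>_def)
qed

subsection \<open>The counit\<close>

definition \<epsilon> :: "('o, 'a, 'r, 'u) mod_fctr \<Rightarrow> 'o \<Rightarrow> 'u \<Rightarrow> 'u" where
  "\<epsilon> X B = (SOME h. lin R (KM.coend_obj (Eh X) B) (fobj X B) h \<and>
     (\<forall>m \<in> M. Cod C m = B \<longrightarrow> (\<forall>k \<in> carrier (fobj (Eh X) (Dom C m)).
       h (\<iota>M (Eh X) B m k) = act X m (\<kappa> X (Dom C m) k))))"

context
  fixes X :: "('o, 'a, 'r, 'u) mod_fctr"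
  assumes X: "is_functor C V X"
begin

lemma Eh_functor: "is_functor G V (Eh X)"
  by (rule E_ind_functor[OF X])

lemma Eh_obj: "A \<in> Obj C \<Longrightarrow> fobj (Eh X) A = KE.coend_obj X A"
  by (rule E_ind_obj)

text \<open>The values form a cone because \<open>\<kappa>\<close> commutes with groupoid arrows, so
  \<open>g\<close> may be moved from the coend element into the arrow acting on
  \<open>X\<close>.\<close>

lemma \<epsilon>: 
  assumes B: "B \<in> Obj C"
  shows "lin R (KM.coend_obj (Eh X) B) (fobj X B) (\<epsilon> X B)"
    "m \<in> M \<Longrightarrow> Cod C m = B \<Longrightarrow> k \<in> carrier (KE.coend_obj X (Dom C m)) \<Longrightarrow>
      \<epsilon> X B (\<iota>M (Eh X) B m k) = act X m (\<kappa> X (Dom C m) k)"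
proof -
  have "KM.cone (Eh X) B (fobj X B) (\<lambda>m k. act X m (\<kappa> X (Dom C m) k))"
    unfolding KM.cone_def
  proof (intro conjI ballI impI)
    fix m assume m: "m \<in> M" "Cod C m = B"
    have D: "Dom C m \<in> Obj C" and mh: "m \<in> Hom C (Dom C m) B" using m M_Hom[OF m(1)] Dom_in_Obj M_Arr by auto
    show "lin R (fobj (Eh X) (Dom C m)) (fobj X B) (\<lambda>k. act X m (\<kappa> X (Dom C m) k))"
      using lin_comp[OF \<kappa>(1)[OF X D] act_lin[OF X mh]] Eh_obj[OF D] by simp
  next
    fix g m k assume g: "g \<in> E \<inter> M" and m: "m \<in> M" "Cod C m = B" "Dom C m = Cod C g" and k: "k \<in> carrier (fobj (Eh X) (Dom C g))"
    have gh: "g \<in> Hom C (Dom C g) (Dom C m)" using g E_Hom[of g] m by simp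
    have mh: "m \<in> Hom C (Dom C m) B" using m M_Hom[OF m(1)] by simp
    have k': "k \<in> carrier (KE.coend_obj X (Dom C g))" using k Eh_obj Hom_Obj[OF gh] by simp
    have "Dom C (m \<cdot> g) = Dom C g" using Cmp_in_Hom[OF gh mh] by (simp add: Hom_def)
    moreover have "m \<cdot> g \<in> M" using M_Cmp_G_iff[OF M_Arr[OF m(1)] g] m by simp
    ultimately show "act X m (\<kappa> X (Dom C m) (act (Eh X) g k)) =
        (if m \<cdot> g \<in> M then act X (m \<cdot> g) (\<kappa> X (Dom C (m \<cdot> g)) k) else \<zero>\<^bsub>fobj X B\<^esub>)"
      using \<kappa>_act[OF X g k'] m(3) act_comp[OF X gh mh \<kappa>_closed[OF X _ k']] Hom_Obj[OF gh] by simp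
  qed
  from someI_ex[OF KM.coend_lift[OF Eh_functor B X_module[OF X B] this]]
  show "lin R (KM.coend_obj (Eh X) B) (fobj X B) (\<epsilon> X B)"
    "m \<in> M \<Longrightarrow> Cod C m = B \<Longrightarrow> k \<in> carrier (KE.coend_obj X (Dom C m)) \<Longrightarrow>
      \<epsilon> X B (\<iota>M (Eh X) B m k) = act X m (\<kappa> X (Dom C m) k)"
    unfolding \<epsilon>_def using Eh_obj Dom_in_Obj[OF M_Arr] by auto
qed

lemma \<epsilon>_closed: "B \<in> Obj C \<Longrightarrow> z \<in> carrier (KM.coend_obj (Eh X) B) \<Longrightarrow> \<epsilon> X B z \<in> carrier (fobj X B)"
  by (rule lin_closed[OF \<epsilon>(1)])

text \<open>The delicate case is \<open>f \<cdot> m\<close> outside \<open>M\<close>, where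
  \<open>Mh\<close> returns zero. There \<open>\<kappa>\<close> takes values fixed by
  \<open>p\<close>, and (p1) kills them under \<open>f \<cdot> m\<close>.\<close>

lemma \<epsilon>_act:
  assumes f: "f \<in> Hom C A B" and z: "z \<in> carrier (KM.coend_obj (Eh X) A)"
  shows "\<epsilon> X B (act (Mh (Eh X)) f z) = act X f (\<epsilon> X A z)"
proof -
  have O: "A \<in> Obj C" "B \<in> Obj C" using Hom_Obj[OF f] by auto
  have fA: "f \<in> Arr C" "Dom C f = A" "Cod C f = B" using f by (auto simp: Hom_def)
  note al = M_ind_arr(2)[OF Eh_functor fA(1), THEN linear_maps_lin, unfolded fA(2,3)]
  show ?thesis
  proof (rule KM.coend_ext[OF Eh_functor O(1) X_module[OF X O(2)] lin_comp[OF al \<epsilon>(1)[OF O(2)]]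
        lin_comp[OF \<epsilon>(1)[OF O(1)] act_lin[OF X f]] _ z])
    fix m k assume m: "m \<in> M" "Cod C m = A" and k: "k \<in> carrier (fobj (Eh X) (Dom C m))"
    have D: "Dom C m \<in> Obj C" and mh: "m \<in> Hom C (Dom C m) A" using m M_Hom[OF m(1)] Dom_in_Obj M_Arr by auto
    have k': "k \<in> carrier (KE.coend_obj X (Dom C m))" using k Eh_obj[OF D] by simp
    have fm: "f \<cdot> m \<in> Hom C (Dom C m) B" using Cmp_in_Hom[OF mh f] .
    then have fm': "Dom C (f \<cdot> m) = Dom C m" "Cod C (f \<cdot> m) = B" by (auto simp: Hom_def)
    note \<kappa>c = \<kappa>_closed[OF X D k']
    have "\<epsilon> X B (act (Mh (Eh X)) f (\<iota>M (Eh X) A m k)) = act X (f \<cdot> m) (\<kappa> X (Dom C m) k)"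
    proof (cases "f \<cdot> m \<in> M")
      case True
      then show ?thesis
        using M_ind_arr(3)[OF Eh_functor fA(1) m(1), of k] m fA k \<epsilon>(2)[OF O(2) True] fm' k' by simp
    next
      case False
      then have "act X (f \<cdot> m) (pact X (Dom C m) (\<kappa> X (Dom C m) k)) = \<zero>\<^bsub>fobj X B\<^esub>"
        using act_pact_not_M[OF X fm _ \<kappa>c] by simp
      then show ?thesis
        using M_ind_arr(3)[OF Eh_functor fA(1) m(1), of k] m fA k False pact_\<kappa>[OF X D k']
          lin_zero[OF \<epsilon>(1)[OF O(2)] KM.coend_module[OF Eh_functor O(2)] X_module[OF X O(2)]] by simp
    qed
    also have "\<dots> = act X f (act X m (\<kappa> X (Dom C m) k))" using act_comp[OF X mh f \<kappa>c] .
    finally show "\<epsilon> X B (act (Mh (Eh X)) f (\<iota>M (Eh X) A m k)) = act X f (\<epsilon> X A (\<iota>M (Eh X) A m k))"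
      using \<epsilon>(2)[OF O(1) m k'] by simp
  qed
qed

lemma \<epsilon>_bij:
  assumes B: "B \<in> Obj C"
  shows "bij_betw (\<epsilon> X B) (carrier (KM.coend_obj (Eh X) B)) (carrier (fobj X B))"
proof -
  let ?Y = "Mh (Eh X)" and ?K = "KM.coend_obj (Eh X)"
  let ?O = "\<lambda>A. {\<zero>\<^bsub>fobj ?Y A\<^esub>}" and ?L = "\<lambda>A. {z \<in> carrier (fobj ?Y A). A \<in> Obj C \<and> \<epsilon> X A z = \<zero>\<^bsub>fobj X A\<^esub>}"
  note T = Eh_functor and MhT = Mh_functor[OF Eh_functor]
  have obj: "fobj ?Y A = ?K A" if "A \<in> Obj C" for A using that by (rule M_ind_obj)
  \<comment> \<open>On the identity summand the counit is the inclusion \<open>\<kappa>\<close> of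
    the image of \<open>p\<close>, hence injective with values covering that image.\<close>
  have \<epsilon>_Idn: "\<epsilon> X A (\<iota>M (Eh X) A (Idn C A) k) = \<kappa> X A k" if "A \<in> Obj C" "k \<in> carrier (KE.coend_obj X A)" for A k
    using \<epsilon>(2)[OF that(1) Idn_EM(2)[OF that(1)], of k] that Idn_simps[OF that(1)]
      mod_functor_id[OF X that(1) \<kappa>_closed[OF X that]] by simp
  have zero: "\<epsilon> X A \<zero>\<^bsub>?K A\<^esub> = \<zero>\<^bsub>fobj X A\<^esub>" if "A \<in> Obj C" for A
    by (rule lin_zero[OF \<epsilon>(1)[OF that] KM.coend_module[OF T that] X_module[OF X that]])
  have "carrier (fobj X B) \<subseteq> \<epsilon> X B ` carrier (?K B)"
  proof (rule subfunctor_induct[OF X, where L = "\<lambda>A. carrier (fobj X A)"])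
    fix A assume A: "A \<in> Obj C"
    interpret Z: module R "?K A" by (rule KM.coend_module[OF T A])
    show "\<zero>\<^bsub>fobj X A\<^esub> \<in> \<epsilon> X A ` carrier (?K A)"
      using zero[OF A] by (intro image_eqI[of _ _ "\<zero>\<^bsub>?K A\<^esub>"]) simp_all
    show "\<epsilon> X A ` carrier (?K A) \<subseteq> carrier (fobj X A)" using \<epsilon>_closed[OF A] by blast
    show "x \<oplus>\<^bsub>fobj X A\<^esub> y \<in> \<epsilon> X A ` carrier (?K A)"
      if "x \<in> \<epsilon> X A ` carrier (?K A)" "y \<in> \<epsilon> X A ` carrier (?K A)" for x y
      using that lin_add[OF \<epsilon>(1)[OF A], symmetric] by auto
    show "a \<odot>\<^bsub>fobj X A\<^esub> x \<in> \<epsilon> X A ` carrier (?K A)"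
      if "a \<in> carrier R" "x \<in> \<epsilon> X A ` carrier (?K A)" for a x
      using that lin_smult[OF \<epsilon>(1)[OF A], symmetric] by auto
    fix x assume x: "x \<in> carrier (fobj X A)"
    let ?k = "\<iota>E X A (Idn C A) x"
    have k: "?k \<in> carrier (KE.coend_obj X A)" by (rule lin_closed[OF \<iota>E_Idn_lin[OF X A] x])
    have "\<iota>M (Eh X) A (Idn C A) ?k \<in> carrier (?K A)"
      using lin_closed[OF \<iota>M_Idn_lin[OF T A]] k Eh_obj[OF A] by simp
    moreover have "pact X A x = \<epsilon> X A (\<iota>M (Eh X) A (Idn C A) ?k)" using \<epsilon>_Idn[OF A k] \<kappa>_\<iota>E[OF X A x] by simp
    ultimately show "pact X A x \<in> \<epsilon> X A ` carrier (?K A)" by (rule rev_image_eqI)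
  next
    fix A B m x assume m: "m \<in> Hom C A B" and "x \<in> \<epsilon> X A ` carrier (?K A)"
    then obtain z where z: "z \<in> carrier (?K A)" "x = \<epsilon> X A z" by blast
    have "A \<in> Obj C" "B \<in> Obj C" using Hom_Obj[OF m] by auto
    then have "act ?Y m z \<in> carrier (?K B)"
      using act_closed[OF MhT m] z(1) by (simp add: obj)
    then show "act X m x \<in> \<epsilon> X B ` carrier (?K B)"
      using \<epsilon>_act[OF m z(1)] z(2) by (intro image_eqI[of _ _ "act ?Y m z"]) simp_all
  qed (use B act_closed[OF X] in auto)
  moreover have "{z \<in> carrier (fobj ?Y B). \<epsilon> X B z = \<zero>\<^bsub>fobj X B\<^esub>} \<subseteq> ?O B"
  proof (rule subfunctor_induct[OF MhT, where L = ?L, THEN order_trans[rotated]])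
    fix A assume A: "A \<in> Obj C"
    interpret Z: module R "fobj ?Y A" by (rule X_module[OF MhT A])
    show "\<zero>\<^bsub>fobj ?Y A\<^esub> \<in> ?O A" by simp
    show "?O A \<subseteq> carrier (fobj ?Y A)" by simp
    show "x \<oplus>\<^bsub>fobj ?Y A\<^esub> y \<in> ?O A"
      if "x \<in> ?O A" "y \<in> ?O A" for x y using that by simp
    show "a \<odot>\<^bsub>fobj ?Y A\<^esub> x \<in> ?O A"
      if "a \<in> carrier R" "x \<in> ?O A" for a x using that by simp
    fix z assume "z \<in> ?L A"
    then have z: "z \<in> carrier (?K A)" and \<epsilon>z: "\<epsilon> X A z = \<zero>\<^bsub>fobj X A\<^esub>" using obj[OF A] by auto
    have lE: "lin R (fobj ?Y A) (fobj X A) (\<epsilon> X A)" using \<epsilon>(1)[OF A] obj[OF A] by simp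
    have \<pi>z: "\<pi> (Eh X) A z \<in> carrier (KE.coend_obj X A)" using \<pi>_closed[OF T A z] Eh_obj[OF A] by simp
    \<comment> \<open>The counit commutes with all arrows and therefore with \<open>p\<close>, so
      the kernel element \<open>z\<close> gives \<open>p z\<close> in the kernel as well.\<close>
    have "\<epsilon> X A (pact ?Y A z) = pact X A (\<epsilon> X A z)"
      by (rule pact_natural[OF MhT X A lE]) (use z obj[OF A] \<epsilon>_act in auto)
    also have "\<dots> = \<zero>\<^bsub>fobj X A\<^esub>"
      using \<epsilon>z lin_zero[OF pact_lin[OF X A] X_module[OF X A] X_module[OF X A]] by simp
    finally have "\<kappa> X A (\<pi> (Eh X) A z) = \<zero>\<^bsub>fobj X A\<^esub>"
      using pact_Mh[OF T A z] \<epsilon>_Idn[OF A \<pi>z] by simp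
    \<comment> \<open>\<open>p z\<close> lies in the identity summand, with coordinate
      \<open>\<pi> z\<close>, and there the counit is \<open>\<kappa>\<close>, which has the left
      inverse \<open>\<iota>E X A (Idn C A)\<close>.\<close>
    then have "\<pi> (Eh X) A z = \<zero>\<^bsub>KE.coend_obj X A\<^esub>"
      using \<iota>E_\<kappa>[OF X A \<pi>z] lin_zero[OF \<iota>E_Idn_lin[OF X A] X_module[OF X A] E_module[OF X A]] by simp
    then show "pact ?Y A z \<in> ?O A"
      using pact_Mh[OF T A z] lin_zero[OF \<iota>M_Idn_lin[OF T A] KM.mfun_module[OF T A] KM.coend_module[OF T A]]
        obj[OF A] Eh_obj[OF A] by simp
  next
    fix A B f z assume f: "f \<in> Hom C A B" and z: "z \<in> ?L A"
    have O: "A \<in> Obj C" "B \<in> Obj C" using Hom_Obj[OF f] by auto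
    show "act ?Y f z \<in> ?L B"
      using act_closed[OF MhT f] \<epsilon>_act[OF f] z O obj
        lin_zero[OF act_lin[OF X f] X_module[OF X O(1)] X_module[OF X O(2)]] by simp
  next
    fix A B m x assume m: "m \<in> Hom C A B" and x: "x \<in> ?O A"
    then show "act ?Y m x \<in> ?O B"
      using lin_zero[OF act_lin[OF MhT m]] X_module[OF MhT] Hom_Obj[OF m] by simp
  qed (use B in auto)
  then have "inj_on (\<epsilon> X B) (carrier (?K B))"
  proof (intro inj_onI)
    fix x y assume k: "{z \<in> carrier (fobj ?Y B). \<epsilon> X B z = \<zero>\<^bsub>fobj X B\<^esub>} \<subseteq> ?O B"
      and x: "x \<in> carrier (?K B)" and y: "y \<in> carrier (?K B)"
      and eq: "\<epsilon> X B x = \<epsilon> X B y"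
    interpret Z: module R "?K B" by (rule KM.coend_module[OF T B])
    interpret Q: module R "fobj X B" by (rule X_module[OF X B])
    have "\<epsilon> X B (x \<ominus>\<^bsub>?K B\<^esub> y) = \<zero>\<^bsub>fobj X B\<^esub>"
      using lin_minus[OF \<epsilon>(1)[OF B] KM.coend_module[OF T B] X_module[OF X B] x y] eq \<epsilon>_closed[OF B y]
      by (simp add: Q.M.minus_eq Q.M.r_neg)
    then have "x \<ominus>\<^bsub>?K B\<^esub> y = \<zero>\<^bsub>?K B\<^esub>" using k x y obj[OF B] by auto
    then show "x = y"
      using x y Z.M.minus_equality[of x "\<ominus>\<^bsub>?K B\<^esub> y"] by (simp add: Z.M.minus_eq)
  qed
  ultimately show ?thesis unfolding bij_betw_def using \<epsilon>_closed[OF B] by blast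
qed

end

text \<open>On a symbol at index \<open>m\<close> this combines naturality of
  \<open>\<kappa>\<close> in the functor with naturality of \<open>\<alpha>\<close> at
  \<open>m\<close>.\<close>

lemma \<epsilon>_natural:
  assumes \<alpha>: "is_nat_tr C V P \<alpha> X" and \<beta>: "is_nat_tr G V (Eh P) \<beta> (Eh X)"
    and \<beta>_eq: "\<forall>B \<in> Obj C. fst (snd (\<beta> B)) = KE.ind_map (P, \<alpha>, X) B"
    and B: "B \<in> Obj C" and z: "z \<in> carrier (KM.coend_obj (Eh P) B)"
  shows "\<epsilon> X B (KM.ind_map (Eh P, \<beta>, Eh X) B z) = fst (snd (\<alpha> B)) (\<epsilon> P B z)"
proof -
  note P = mod_nat_trD(1)[OF \<alpha>] and X = mod_nat_trD(2)[OF \<alpha>]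
  note a = mod_nat_tr_linear[OF \<alpha>, THEN linear_maps_lin]
  show ?thesis
  proof (rule KM.coend_ext[OF Eh_functor[OF P] B X_module[OF X B] lin_comp[OF KM.ind_map(2)[OF \<beta> B, THEN linear_maps_lin] \<epsilon>(1)[OF X B]]
        lin_comp[OF \<epsilon>(1)[OF P B] a[OF B]] _ z])
    fix m k assume m: "m \<in> M" "Cod C m = B" and k: "k \<in> carrier (fobj (Eh P) (Dom C m))"
    have D: "Dom C m \<in> Obj C" and mA: "m \<in> Arr C" using m M_Arr Dom_in_Obj by auto
    have k': "k \<in> carrier (KE.coend_obj P (Dom C m))" using k Eh_obj[OF P D] by simp
    have "KE.ind_map (P, \<alpha>, X) (Dom C m) k \<in> carrier (KE.coend_obj X (Dom C m))"
      using lin_closed[OF E_ind_map(2)[OF \<alpha> D, THEN linear_maps_lin] k'] .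
    then have "\<epsilon> X B (KM.ind_map (Eh P, \<beta>, Eh X) B (\<iota>M (Eh P) B m k)) =
        act X m (\<kappa> X (Dom C m) (KE.ind_map (P, \<alpha>, X) (Dom C m) k))"
      using KM.ind_map(3)[OF \<beta> m k] \<epsilon>(2)[OF X B m] bspec[OF \<beta>_eq D] by simp
    also have "\<dots> = fst (snd (\<alpha> B)) (act P m (\<kappa> P (Dom C m) k))"
      using \<kappa>_natural[OF \<alpha> D k'] mod_nat_tr_natural[OF \<alpha> category_axioms mA] \<kappa>_closed[OF P D k'] m by simp
    finally show "\<epsilon> X B (KM.ind_map (Eh P, \<beta>, Eh X) B (\<iota>M (Eh P) B m k)) = fst (snd (\<alpha> B)) (\<epsilon> P B (\<iota>M (Eh P) B m k))"
      using \<epsilon>(2)[OF P B m k'] by simp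
  qed
qed

subsection \<open>The equivalence\<close>

abbreviation "M_fun \<equiv> M_hat R C E M ::
  (('o, 'a, 'r, 'u) mod_fctr, ('o, 'a, 'r, 'u) mod_nat_tr,
   ('o, 'a, 'r, 'u) mod_fctr, ('o, 'a, 'r, 'u) mod_nat_tr) fctr"
abbreviation "E_fun \<equiv> E_hat R C E M ::
  (('o, 'a, 'r, 'u) mod_fctr, ('o, 'a, 'r, 'u) mod_nat_tr,
   ('o, 'a, 'r, 'u) mod_fctr, ('o, 'a, 'r, 'u) mod_nat_tr) fctr"

lemma M_fun: "M_fun = kernel_functor R G C (truncated_hom R C M G C)"
  and E_fun: "E_fun = kernel_functor R C G (truncated_hom R C E C G)"
  by (simp_all add: M_hat_def E_hat_def fs_groupoid_def)

lemma M_fun_functor: "is_functor (functor_cat G V) (functor_cat C V) M_fun"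
  and E_fun_functor: "is_functor (functor_cat C V) (functor_cat G V) E_fun"
  and M_fun_linear: "is_linear R G C M_fun"
  and E_fun_linear: "is_linear R C G E_fun"
  unfolding M_fun E_fun
  using KM.ind_functor_cat_functor KE.ind_functor_cat_functor KM.ind_functor_cat_linear KE.ind_functor_cat_linear
  by (simp_all only: wide_subcat_self)

lemma M_fun_obj: "is_functor G V T \<Longrightarrow> fobj M_fun T = Mh T"
  and E_fun_obj: "is_functor C V X \<Longrightarrow> fobj E_fun X = Eh X"
  by (simp_all add: M_fun E_fun kernel_functor_def)

lemma M_fun_arr:
  assumes \<alpha>: "is_nat_tr G V P \<alpha> T"
  obtains \<beta> where "farr M_fun (P, \<alpha>, T) = (Mh P, \<beta>, Mh T)" "is_nat_tr C V (Mh P) \<beta> (Mh T)"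
    "\<forall>B \<in> Obj C. fst (snd (\<beta> B)) = KM.ind_map (P, \<alpha>, T) B"
proof (rule that)
  show "farr M_fun (P, \<alpha>, T) = (Mh P, \<lambda>B \<in> Obj C. (KM.coend_obj P B, KM.ind_map (P, \<alpha>, T) B, KM.coend_obj T B), Mh T)"
    unfolding M_fun by (rule M_ind_map(1)[OF \<alpha>])
  show "is_nat_tr C V (Mh P) (\<lambda>B \<in> Obj C. (KM.coend_obj P B, KM.ind_map (P, \<alpha>, T) B, KM.coend_obj T B)) (Mh T)"
    by (rule KM.ind_map_natural[OF \<alpha>, unfolded wide_subcat_self])
qed simp

lemma E_fun_arr:
  assumes \<alpha>: "is_nat_tr C V P \<alpha> T"
  obtains \<beta> where "farr E_fun (P, \<alpha>, T) = (Eh P, \<beta>, Eh T)" "is_nat_tr G V (Eh P) \<beta> (Eh T)"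
    "\<forall>B \<in> Obj C. fst (snd (\<beta> B)) = KE.ind_map (P, \<alpha>, T) B"
proof (rule that)
  show "farr E_fun (P, \<alpha>, T) = (Eh P, \<lambda>B \<in> Obj C. (KE.coend_obj P B, KE.ind_map (P, \<alpha>, T) B, KE.coend_obj T B), Eh T)"
    unfolding E_fun by (rule E_ind_map(1)[OF \<alpha>])
  show "is_nat_tr G V (Eh P) (\<lambda>B \<in> Obj C. (KE.coend_obj P B, KE.ind_map (P, \<alpha>, T) B, KE.coend_obj T B)) (Eh T)"
    by (rule KE.ind_map_natural[unfolded wide_subcat_self, OF \<alpha>])
qed simp

text \<open>Stated from the identity to the composite, the direction in which \<open>\<eta>\<close>
  is explicit; the orientation required by \<open>inverse_equivalences\<close> follows by symmetry
  of isomorphism.\<close>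

lemma isomorphic_unit:
  "isomorphic (functor_cat (functor_cat G V) (functor_cat G V)) (functor_id (functor_cat G V))
    (functor_comp (functor_cat G V) E_fun M_fun)"
  (is "isomorphic _ ?I ?\<Phi>")
proof (rule isomorphic_functorsI[where h = \<eta>])
  show G: "category G" by (rule KM.category_X)
  have W: "category (functor_cat G V)" by (rule category_functor_cat[OF G category_mod_cat])
  show "is_functor (functor_cat G V) (functor_cat G V) ?I" by (rule is_functor_id[OF W])
  show "is_functor (functor_cat G V) (functor_cat G V) ?\<Phi>"
    by (rule is_functor_comp[OF W M_fun_functor E_fun_functor])
  have 1: "fobj ?I T = T" "fobj ?\<Phi> T = Eh (Mh T)"
    if "is_functor G V T" for T
    using that E_fun_obj[OF Mh_functor[OF that]] by (simp_all add: functor_id_def functor_comp_def M_fun_obj)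
  note obj = Eh_obj[OF Mh_functor]
  fix T A assume T: "is_functor G V T" and "A \<in> Obj G"
  then have A: "A \<in> Obj C" by simp
  show "lin R (fobj (fobj ?I T) A) (fobj (fobj ?\<Phi> T) A) (\<eta> T A)"
    and "bij_betw (\<eta> T A) (carrier (fobj (fobj ?I T) A))
      (carrier (fobj (fobj ?\<Phi> T) A))"
    using \<eta>_lin[OF T A] \<eta>_bij[OF T A] by (simp_all add: 1[OF T] obj[OF T A])
next
  fix T f x assume T: "is_functor G V T" and f: "f \<in> Arr G"
    and x: "x \<in> carrier (fobj (fobj ?I T) (Dom G f))"
  have "fobj ?I T = T" "fobj ?\<Phi> T = Eh (Mh T)"
    using T E_fun_obj[OF Mh_functor[OF T]] by (simp_all add: functor_id_def functor_comp_def M_fun_obj)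
  then show "\<eta> T (Cod G f) (act (fobj ?I T) f x) =
      act (fobj ?\<Phi> T) f (\<eta> T (Dom G f) x)"
    using \<eta>_act[OF T, of f x] f x by simp
next
  fix P \<alpha> T A x assume \<alpha>: "is_nat_tr G V P \<alpha> T" and "A \<in> Obj G"
    and x: "x \<in> carrier (fobj (fobj ?I P) A)"
  then have A: "A \<in> Obj C" by simp
  obtain \<beta> where \<beta>: "farr M_fun (P, \<alpha>, T) = (Mh P, \<beta>, Mh T)" "is_nat_tr C V (Mh P) \<beta> (Mh T)"
    "\<forall>B \<in> Obj C. fst (snd (\<beta> B)) = KM.ind_map (P, \<alpha>, T) B"
    using \<alpha> by (rule M_fun_arr)
  obtain \<gamma> where \<gamma>: "farr E_fun (Mh P, \<beta>, Mh T) = (Eh (Mh P), \<gamma>, Eh (Mh T))"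
    "\<forall>B \<in> Obj C. fst (snd (\<gamma> B)) = KE.ind_map (Mh P, \<beta>, Mh T) B"
    using \<beta>(2) by (rule E_fun_arr)
  have "x \<in> carrier (fobj P A)" using x mod_nat_trD(1)[OF \<alpha>] by (simp add: functor_id_def)
  then show "\<eta> T A (fst (snd (fst (snd (farr ?I (P, \<alpha>, T))) A)) x) =
      fst (snd (fst (snd (farr ?\<Phi> (P, \<alpha>, T))) A)) (\<eta> P A x)"
    using \<eta>_natural[OF \<alpha> \<beta>(2,3) A] \<alpha> \<beta>(1) \<gamma>(1) bspec[OF \<gamma>(2) A] by (simp add: functor_id_def functor_comp_def)
qed

lemma isomorphic_counit:
  "isomorphic (functor_cat (functor_cat C V) (functor_cat C V)) (functor_comp (functor_cat C V) M_fun E_fun)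
    (functor_id (functor_cat C V))"
  (is "isomorphic _ ?\<Phi> ?I")
proof (rule isomorphic_functorsI[where h = \<epsilon>])
  show "category C" by (rule category_axioms)
  have W: "category (functor_cat C V)" by (rule category_functor_cat[OF category_axioms category_mod_cat])
  show "is_functor (functor_cat C V) (functor_cat C V) ?I" by (rule is_functor_id[OF W])
  show "is_functor (functor_cat C V) (functor_cat C V) ?\<Phi>"
    by (rule is_functor_comp[OF W E_fun_functor M_fun_functor])
  have 1: "fobj ?I X = X" "fobj ?\<Phi> X = Mh (Eh X)"
    if "is_functor C V X" for X
    using that M_fun_obj[OF Eh_functor[OF that]] by (simp_all add: functor_id_def functor_comp_def E_fun_obj)
  fix X A assume X: "is_functor C V X" and A: "A \<in> Obj C"
  show "lin R (fobj (fobj ?\<Phi> X) A) (fobj (fobj ?I X) A) (\<epsilon> X A)"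
    and "bij_betw (\<epsilon> X A) (carrier (fobj (fobj ?\<Phi> X) A))
      (carrier (fobj (fobj ?I X) A))"
    using \<epsilon>(1)[OF X A] \<epsilon>_bij[OF X A] by (simp_all add: 1[OF X] M_ind_obj[OF A])
next
  fix X f x assume X: "is_functor C V X" and f: "f \<in> Arr C"
    and x: "x \<in> carrier (fobj (fobj ?\<Phi> X) (Dom C f))"
  have 1: "fobj ?I X = X" "fobj ?\<Phi> X = Mh (Eh X)"
    using X M_fun_obj[OF Eh_functor[OF X]] by (simp_all add: functor_id_def functor_comp_def E_fun_obj)
  have fh: "f \<in> Hom C (Dom C f) (Cod C f)" using f by (simp add: Hom_def)
  show "\<epsilon> X (Cod C f) (act (fobj ?\<Phi> X) f x) =
      act (fobj ?I X) f (\<epsilon> X (Dom C f) x)"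
    using \<epsilon>_act[OF X fh, of x] x by (simp add: 1 M_ind_obj[OF Dom_in_Obj[OF f]])
next
  fix P \<alpha> T A x assume \<alpha>: "is_nat_tr C V P \<alpha> T" and A: "A \<in> Obj C"
    and x: "x \<in> carrier (fobj (fobj ?\<Phi> P) A)"
  note P = mod_nat_trD(1)[OF \<alpha>]
  obtain \<beta> where \<beta>: "farr E_fun (P, \<alpha>, T) = (Eh P, \<beta>, Eh T)" "is_nat_tr G V (Eh P) \<beta> (Eh T)"
    "\<forall>B \<in> Obj C. fst (snd (\<beta> B)) = KE.ind_map (P, \<alpha>, T) B"
    using \<alpha> by (rule E_fun_arr)
  obtain \<gamma> where \<gamma>: "farr M_fun (Eh P, \<beta>, Eh T) = (Mh (Eh P), \<gamma>, Mh (Eh T))"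
    "\<forall>B \<in> Obj C. fst (snd (\<gamma> B)) = KM.ind_map (Eh P, \<beta>, Eh T) B"
    using \<beta>(2) by (rule M_fun_arr)
  have "fobj ?\<Phi> P = Mh (Eh P)"
    using P M_fun_obj[OF Eh_functor[OF P]] by (simp add: functor_comp_def E_fun_obj)
  then have "x \<in> carrier (KM.coend_obj (Eh P) A)" using x by (simp add: M_ind_obj[OF A])
  then show "\<epsilon> T A (fst (snd (fst (snd (farr ?\<Phi> (P, \<alpha>, T))) A)) x) =
      fst (snd (fst (snd (farr ?I (P, \<alpha>, T))) A)) (\<epsilon> P A x)"
    using \<epsilon>_natural[OF \<alpha> \<beta>(2,3) A] \<alpha> \<beta>(1) \<gamma>(1) bspec[OF \<gamma>(2) A] by (simp add: functor_id_def functor_comp_def)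
qed

lemma M_fun_E_fun_inverse: "inverse_equivalences (functor_cat G V) (functor_cat C V) M_fun E_fun"
proof -
  have W: "category (functor_cat G V)" by (rule category_functor_cat[OF KM.category_X category_mod_cat])
  interpret W2: category "functor_cat (functor_cat G V) (functor_cat G V)" by (rule category_functor_cat[OF W W])
  show ?thesis
    unfolding inverse_equivalences_def
    using M_fun_functor E_fun_functor W2.isomorphic_sym[OF isomorphic_unit] isomorphic_counit by blast
qed

end

theorem corollary3p11:
  fixes R :: "('r, 's) ring_scheme"
    and F :: "('o, 'a) cat"
    and E M :: "'a set"
  assumes "cring R"
    and "proper_factorization_system F E M"
    and "idempotent_axiom R F E M"
    and "\<And>A. A \<in> Obj F \<Longrightarrow> finite (iso_classes (slice_cat (wide_subcat F M) A))"
    and "universe_for TYPE('u) R F"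
  shows "inverse_equivalences
      (functor_cat (fs_groupoid F E M) (mod_cat R :: (('r, 'u) module, ('r, 'u) mod_arr) cat))
      (functor_cat F (mod_cat R))
      (M_hat R F E M) (E_hat R F E M) \<and>
    is_linear R (fs_groupoid F E M) F
      (M_hat R F E M :: (_, ('o, 'a, ('r, 'u) module, ('r, 'u) mod_arr) nat_tr, _, _) fctr) \<and>
    is_linear R F (fs_groupoid F E M)
      (E_hat R F E M :: (_, ('o, 'a, ('r, 'u) module, ('r, 'u) mod_arr) nat_tr, _, _) fctr)"
proof -
  interpret F: proper_factorization_system F E M by fact
  \<comment> \<open>One family of idempotents is fixed for all objects, so that it can become a
    parameter of the locale.\<close>
  obtain p where p:
    "\<forall>A \<in> Obj F. p A \<in> carrier (free_mod R (Hom F A A))"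
    "\<forall>A \<in> Obj F. free_comp R F A A A (p A) (p A) = p A"
    "\<forall>A \<in> Obj F. \<forall>B \<in> Obj F. \<forall>f \<in> Hom F A B - M.
        free_comp R F A A B (free_gen R f) (p A) = \<zero>\<^bsub>free_mod R (Hom F A B)\<^esub>"
    "\<forall>A \<in> Obj F. \<forall>B \<in> Obj F. \<forall>f \<in> Hom F A B - E.
        free_comp R F A B B (p B) (free_gen R f) = \<zero>\<^bsub>free_mod R (Hom F A B)\<^esub>"
    "\<forall>A \<in> Obj F. \<forall>B \<in> Obj F. \<forall>g \<in> Hom F A B \<inter> (E \<inter> M).
        free_comp R F A A B (free_gen R g) (p A) = free_comp R F A B B (p B) (free_gen R g)"
    "\<forall>A \<in> Obj F. free_gen R (Idn F A) \<ominus>\<^bsub>free_mod R (Hom F A A)\<^esub> p A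
        \<in> carrier (free_mod R (Hom F A A - E - M))"
    using assms(3) unfolding idempotent_axiom_def by (elim exE conjE)
  interpret idempotent_factorization F E M R p "TYPE('u)"
  proof (rule idempotent_factorization.intro[OF assms(2,1) idempotent_factorization_axioms.intro])
    show "infinite (UNIV :: 'u set)" "Arr F \<lesssim> (UNIV :: 'u set)"
      using assms(5) by (simp_all add: universe_for_def)
  qed (use p assms(4) in \<open>simp_all\<close>)
  show ?thesis
    using M_fun_E_fun_inverse M_fun_linear E_fun_linear by (simp add: fs_groupoid_def)
qed

end
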